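(* Let $M^3$ be an indefinite improper affine hypersphere of $\mathbb{R}^4$ which admits a pointwise $\mathbb{Z}_3$-symmetry or a pointwise $SO(2)$-symmetry. Let $a_{22}^2=a_4^2$ on $M^3$. Then $M^3$ is affine equivalent with either $$\varphi:I\times N^2\to\mathbb{R}^4,\quad (t,v,w)\mapsto(tv,\ tw,\ tf(v,w)-ct^4,\ t)\qquad(a_{22}=a_4),$$ or $$\varphi:I\times N^2\to\mathbb{R}^4,\quad (t,v,w)\mapsto(v,\ w,\ f(v,w)+ct^3,\ t^4)\qquad(-a_{22}=a_4),$$ where $\psi:N^2\to\mathbb{R}^3$, $(v,w)\mapsto(v,w,f(v,w))$, is a positive definite improper affine sphere with affine normal $(0,0,1)$ and $c,t\in\mathbb{R}^+$. Moreover, if $M^3$ admits a pointwise $SO(2)$-symmetry, then $N^2$ is an elliptic paraboloid.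
   Context: Affine hyperspheres. $D$ is the flat connection and $\det$ the volume form of $\mathbb{R}^{n+1}$; $M^n$ is connected and oriented. For a nondegenerate immersed hypersurface $\varphi:M^n\to\mathbb{R}^{n+1}$ the affine (Blaschke) normal $\xi$ is the transverse vector field, unique up to sign, such that (identifying tangent vectors with their images under $\varphi_*$) $D_XY=\nabla_XY+h(X,Y)\xi$, $D_X\xi=-SX$ with $SX$ tangential, and the volume form $\det(\varphi_*X_1,\dots,\varphi_*X_n,\xi)$ equals the volume form $|\det h|^{1/2}$ of $h$. $\nabla$ is the induced connection, $h$ the affine metric, $S$ the shape operator, $\widehat\nabla$ the Levi-Civita connection of $h$, and $K(X,Y)=\nabla_XY-\widehat\nabla_XY$ the difference tensor. $\varphi$ is an affine (hyper)sphere if $S=H\,\mathrm{Id}$ with $H$ constant; it is proper if $H\ne0$ and improper if $H=0$; it is positive definite / indefinite if $h$ is. For $n=3$ and $h$ indefinite, the sign of $\xi$ is fixed so that $h$ has exactly one negative direction. Pointwise symmetry. $M^3$ admits a pointwise $SO(2)$-symmetry (resp. $\mathbb{Z}_3$-symmetry) if at each $p\in M^3$ there is a basis $\{T,V,W\}$ of $T_pM$, orthonormal for $h$ with $h(T,T)=-1$, $h(V,V)=h(W,W)=1$, such that $K(T,T)=-2a_4T$, $K(T,V)=a_4V$, $K(T,W)=a_4W$, $K(V,V)=-a_4T+a_6V$, $K(V,W)=-a_6W$, $K(W,W)=-a_4T-a_6V$, with $a_4>0$ and $a_6=0$ (resp. $a_4>0$ and $a_6>0$). (This is the canonical form of $K$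 when its stabilizer in the isometry group $SO(1,2)$ of $(T_pM,h)$ is $SO(2)$, resp. $\mathbb{Z}_3$.) The vector field $T$ and the function $a_4$ are then globally defined and smooth, and $a_{22}:=h(\widehat\nabla_VT,V)$, which does not depend on the choice of the unit vector $V\perp T$. Affine equivalent means equal up to an affine transformation of $\mathbb{R}^4$ and reparametrization; $I\subset\mathbb{R}^+$ is an interval and $N^2$ is a surface with coordinates $(v,w)$. The statement that $N^2$ is a paraboloid refers to its immersion $\psi$.
   Formalization: "Affine equivalent" is local: one affine map, one c and one alternative serve all of M, but the reparametrization by I×N (with I, N, f) is only near each point; globally the claim fails, e.g. for a connected open non-product part of a model. *)

theory Defs
  imports "HOL-Analysis.Analysis"
begin

subsection \<open>Smooth maps and smooth manifolds\<close>

text \<open>\<open>Ck_on\<close> and \<open>smooth_on\<close> are meant for open subsets of a Euclidean space.\<close>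

primrec Ck_on :: "nat \<Rightarrow> 'a::real_normed_vector set \<Rightarrow> ('a \<Rightarrow> 'b::real_normed_vector) \<Rightarrow> bool" where
  "Ck_on 0 S f \<longleftrightarrow> continuous_on S f"
| "Ck_on (Suc k) S f \<longleftrightarrow>
     (\<forall>x\<in>S. f differentiable (at x)) \<and>
     (\<forall>v. Ck_on k S (\<lambda>x. frechet_derivative f (at x) v))"

definition smooth_on :: "'a::real_normed_vector set \<Rightarrow> ('a \<Rightarrow> 'b::real_normed_vector) \<Rightarrow> bool" where
  "smooth_on S f \<longleftrightarrow> (\<forall>k. Ck_on k S f)"

text \<open>A chart is given by its inverse: a parametrization \<open>x\<close> of an open set \<open>x ` U\<close> of the
  manifold by an open set \<open>U\<close> of Euclidean space.\<close>

type_synonym ('n, 'a) chart = "(real ^ 'n) set \<times> (real ^ 'n \<Rightarrow> 'a)"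

definition local_parametrization ::
    "'a topology \<Rightarrow> (real ^ 'n::finite) set \<Rightarrow> (real ^ 'n \<Rightarrow> 'a) \<Rightarrow> bool" where
  "local_parametrization M U x \<longleftrightarrow>
     open U \<and> openin M (x ` U) \<and>
     homeomorphic_map (top_of_set U) (subtopology M (x ` U)) x"

definition smooth_transition ::
    "(real ^ 'n::finite) set \<Rightarrow> (real ^ 'n \<Rightarrow> 'a) \<Rightarrow> (real ^ 'n) set \<Rightarrow> (real ^ 'n \<Rightarrow> 'a) \<Rightarrow> bool" where
  "smooth_transition U x V y \<longleftrightarrow> smooth_on (U \<inter> x -` (y ` V)) (inv_into V y \<circ> x)"

definition connected_oriented_manifold :: "'a topology \<Rightarrow> ('n::finite, 'a) chart set \<Rightarrow> bool" where
  "connected_oriented_manifold M A \<longleftrightarrow>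
     Hausdorff_space M \<and> second_countable M \<and> connected_space M \<and>
     (\<forall>(U, x)\<in>A. local_parametrization M U x) \<and>
     (\<Union>(U, x)\<in>A. x ` U) = topspace M \<and>
     (\<forall>(U, x)\<in>A. \<forall>(V, y)\<in>A. smooth_transition U x V y \<and>
        (\<forall>u \<in> U \<inter> x -` (y ` V).
           det (matrix (frechet_derivative (inv_into V y \<circ> x) (at u))) > 0))"

definition smooth_map_on ::
    "('n::finite, 'a) chart set \<Rightarrow> 'a set \<Rightarrow> ('a \<Rightarrow> 'b::real_normed_vector) \<Rightarrow> bool" where
  "smooth_map_on A W f \<longleftrightarrow> (\<forall>(U, x)\<in>A. smooth_on (U \<inter> x -` W) (f \<circ> x))"

text \<open>A diffeomorphism from an open set \<open>U\<close> of Euclidean space onto an open set of \<open>M\<close>.\<close>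

definition diffeo_onto_open ::
    "'a topology \<Rightarrow> ('n::finite, 'a) chart set \<Rightarrow> (real ^ 'n) set \<Rightarrow> (real ^ 'n \<Rightarrow> 'a) \<Rightarrow> bool" where
  "diffeo_onto_open M A U F \<longleftrightarrow>
     local_parametrization M U F \<and>
     (\<forall>(V, y)\<in>A. smooth_transition U F V y \<and> smooth_transition V y U F)"

subsection \<open>Immersed hypersurfaces\<close>

definition immersion ::
    "'a topology \<Rightarrow> ('n::finite, 'a) chart set \<Rightarrow> ('a \<Rightarrow> real ^ 'm::finite) \<Rightarrow> bool" where
  "immersion M A \<phi> \<longleftrightarrow>
     smooth_map_on A (topspace M) \<phi> \<and>
     (\<forall>(U, x)\<in>A. \<forall>u\<in>U. inj (frechet_derivative (\<phi> \<circ> x) (at u)))"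

text \<open>Throughout, tangent vectors are identified with their images under the differential of the
  immersion \<open>\<phi>\<close>, so the tangent space at \<open>p\<close> is a linear subspace of the ambient space and a
  vector field is a map from \<open>M\<close> to the ambient space.\<close>

definition tangent_space ::
    "('n::finite, 'a) chart set \<Rightarrow> ('a \<Rightarrow> real ^ 'm::finite) \<Rightarrow> 'a \<Rightarrow> (real ^ 'm) set" where
  "tangent_space A \<phi> p =
     {X. \<exists>(U, x)\<in>A. \<exists>u\<in>U. x u = p \<and> (\<exists>\<zeta>. X = frechet_derivative (\<phi> \<circ> x) (at u) \<zeta>)}"

text \<open>A smooth tangent vector field on the open set \<open>W\<close>; the values outside \<open>W\<close> are irrelevant.\<close>

definition tangent_field ::
    "'a topology \<Rightarrow> ('n::finite, 'a) chart set \<Rightarrow> ('a \<Rightarrow> real ^ 'm::finite) \<Rightarrow>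
     'a set \<Rightarrow> ('a \<Rightarrow> real ^ 'm) \<Rightarrow> bool" where
  "tangent_field M A \<phi> W Y \<longleftrightarrow>
     openin M W \<and> smooth_map_on A W Y \<and> (\<forall>q\<in>W. Y q \<in> tangent_space A \<phi> q)"

text \<open>The derivative at \<open>p\<close> of a function \<open>f\<close> on \<open>M\<close> (smooth near \<open>p\<close>) in the direction of the
  tangent vector \<open>X\<close> at \<open>p\<close>. For real-valued \<open>f\<close> this is \<open>X f\<close>; for a vector field \<open>f\<close> along the
  immersion it is \<open>D\<^sub>X f\<close>, with \<open>D\<close> the flat connection of the ambient space. By the chain rule
  the value does not depend on the chart.\<close>

definition deriv_along ::
    "('n::finite, 'a) chart set \<Rightarrow> ('a \<Rightarrow> real ^ 'm::finite) \<Rightarrow>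
     ('a \<Rightarrow> 'b::real_normed_vector) \<Rightarrow> 'a \<Rightarrow> real ^ 'm \<Rightarrow> 'b" where
  "deriv_along A \<phi> f p X =
     (THE d. \<exists>(U, x)\<in>A. \<exists>u\<in>U. x u = p \<and>
        (\<exists>\<zeta>. X = frechet_derivative (\<phi> \<circ> x) (at u) \<zeta> \<and>
             d = frechet_derivative (f \<circ> x) (at u) \<zeta>))"

subsection \<open>Affine normal, affine metric, affine spheres\<close>

text \<open>\<open>\<phi>\<close> is a nondegenerate immersed hypersurface with affine (Blaschke) normal \<open>\<xi>\<close>, induced
  connection \<open>nab\<close> (\<open>nab p X Y\<close> is the derivative at \<open>p\<close> of the vector field \<open>Y\<close> in the direction
  of the tangent vector \<open>X\<close> at \<open>p\<close>), affine metric \<open>h\<close> and shape operator \<open>S\<close>. The bijection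
  \<open>\<sigma>\<close> says that the ambient dimension is \<open>n + 1\<close> and only fixes the order of the arguments of the
  determinant, which does not affect its absolute value. The volume condition is stated with
  absolute values because \<open>\<xi>\<close> is determined only up to sign.\<close>

definition blaschke_hypersurface ::
    "'a topology \<Rightarrow> ('n::finite, 'a) chart set \<Rightarrow> ('a \<Rightarrow> real ^ 'm::finite) \<Rightarrow> ('a \<Rightarrow> real ^ 'm) \<Rightarrow>
     ('a \<Rightarrow> real ^ 'm \<Rightarrow> ('a \<Rightarrow> real ^ 'm) \<Rightarrow> real ^ 'm) \<Rightarrow>
     ('a \<Rightarrow> real ^ 'm \<Rightarrow> real ^ 'm \<Rightarrow> real) \<Rightarrow>
     ('a \<Rightarrow> real ^ 'm \<Rightarrow> real ^ 'm) \<Rightarrow> bool" where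
  "blaschke_hypersurface M A \<phi> \<xi> nab h S \<longleftrightarrow>
     connected_oriented_manifold M A \<and> immersion M A \<phi> \<and>
     smooth_map_on A (topspace M) \<xi> \<and>
     (\<forall>p\<in>topspace M. \<xi> p \<notin> tangent_space A \<phi> p) \<and>
     (\<forall>W Y p X. tangent_field M A \<phi> W Y \<longrightarrow> p \<in> W \<longrightarrow> X \<in> tangent_space A \<phi> p \<longrightarrow>
        nab p X Y \<in> tangent_space A \<phi> p \<and>
        deriv_along A \<phi> Y p X = nab p X Y + h p X (Y p) *\<^sub>R \<xi> p) \<and>
     (\<forall>p\<in>topspace M. \<forall>X\<in>tangent_space A \<phi> p.
        S p X \<in> tangent_space A \<phi> p \<and> deriv_along A \<phi> \<xi> p X = - S p X) \<and>
     (\<forall>p\<in>topspace M. \<forall>X\<in>tangent_space A \<phi> p. X \<noteq> 0 \<longrightarrow>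
        (\<exists>Y\<in>tangent_space A \<phi> p. h p X Y \<noteq> 0)) \<and>
     (\<exists>\<sigma> :: 'm \<Rightarrow> 'n option. bij \<sigma> \<and>
        (\<forall>p\<in>topspace M. \<forall>X :: 'n \<Rightarrow> real ^ 'm. (\<forall>i. X i \<in> tangent_space A \<phi> p) \<longrightarrow>
           \<bar>det (\<chi> j. case \<sigma> j of Some i \<Rightarrow> X i | None \<Rightarrow> \<xi> p)\<bar> =
           sqrt \<bar>det (\<chi> i k. h p (X i) (X k))\<bar>))"

text \<open>\<open>S = H Id\<close> with constant \<open>H\<close>; the affine sphere is improper if \<open>H = 0\<close>.\<close>

definition affine_sphere ::
    "'a topology \<Rightarrow> ('n::finite, 'a) chart set \<Rightarrow> ('a \<Rightarrow> real ^ 'm::finite) \<Rightarrow>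
     ('a \<Rightarrow> real ^ 'm \<Rightarrow> real ^ 'm) \<Rightarrow> real \<Rightarrow> bool" where
  "affine_sphere M A \<phi> S H \<longleftrightarrow>
     (\<forall>p\<in>topspace M. \<forall>X\<in>tangent_space A \<phi> p. S p X = H *\<^sub>R X)"

definition positive_definite ::
    "'a topology \<Rightarrow> ('n::finite, 'a) chart set \<Rightarrow> ('a \<Rightarrow> real ^ 'm::finite) \<Rightarrow>
     ('a \<Rightarrow> real ^ 'm \<Rightarrow> real ^ 'm \<Rightarrow> real) \<Rightarrow> bool" where
  "positive_definite M A \<phi> h \<longleftrightarrow>
     (\<forall>p\<in>topspace M. \<forall>X\<in>tangent_space A \<phi> p. X \<noteq> 0 \<longrightarrow> h p X X > 0)"

definition indefinite ::
    "'a topology \<Rightarrow> ('n::finite, 'a) chart set \<Rightarrow> ('a \<Rightarrow> real ^ 'm::finite) \<Rightarrow>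
     ('a \<Rightarrow> real ^ 'm \<Rightarrow> real ^ 'm \<Rightarrow> real) \<Rightarrow> bool" where
  "indefinite M A \<phi> h \<longleftrightarrow>
     (\<forall>p\<in>topspace M. (\<exists>X\<in>tangent_space A \<phi> p. h p X X > 0) \<and> (\<exists>X\<in>tangent_space A \<phi> p. h p X X < 0))"

definition one_negative_direction ::
    "'a topology \<Rightarrow> ('n::finite, 'a) chart set \<Rightarrow> ('a \<Rightarrow> real ^ 'm::finite) \<Rightarrow>
     ('a \<Rightarrow> real ^ 'm \<Rightarrow> real ^ 'm \<Rightarrow> real) \<Rightarrow> bool" where
  "one_negative_direction M A \<phi> h \<longleftrightarrow>
     (\<forall>p\<in>topspace M.
        (\<exists>X\<in>tangent_space A \<phi> p. h p X X < 0) \<and>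
        (\<forall>V. subspace V \<longrightarrow> V \<subseteq> tangent_space A \<phi> p \<longrightarrow> (\<forall>X\<in>V. X \<noteq> 0 \<longrightarrow> h p X X < 0) \<longrightarrow> dim V \<le> 1))"

definition pos_def_improper_affine_sphere ::
    "'a topology \<Rightarrow> ('n::finite, 'a) chart set \<Rightarrow> ('a \<Rightarrow> real ^ 'm::finite) \<Rightarrow> ('a \<Rightarrow> real ^ 'm) \<Rightarrow> bool" where
  "pos_def_improper_affine_sphere M A \<psi> \<xi> \<longleftrightarrow>
     (\<exists>nab h S. blaschke_hypersurface M A \<psi> \<xi> nab h S \<and> affine_sphere M A \<psi> S 0 \<and>
        positive_definite M A \<psi> h)"

subsection \<open>Levi-Civita connection and difference tensor\<close>

text \<open>Under the identification of \<open>X\<close> with its image, the Lie bracket \<open>[X, Y]\<close> is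
  \<open>D\<^sub>X Y - D\<^sub>Y X\<close>; this is the right-hand side of the torsion condition.\<close>

definition levi_civita_connection ::
    "'a topology \<Rightarrow> ('n::finite, 'a) chart set \<Rightarrow> ('a \<Rightarrow> real ^ 'm::finite) \<Rightarrow>
     ('a \<Rightarrow> real ^ 'm \<Rightarrow> real ^ 'm \<Rightarrow> real) \<Rightarrow>
     ('a \<Rightarrow> real ^ 'm \<Rightarrow> ('a \<Rightarrow> real ^ 'm) \<Rightarrow> real ^ 'm) \<Rightarrow> bool" where
  "levi_civita_connection M A \<phi> h lc \<longleftrightarrow>
     (\<forall>W Y p X. tangent_field M A \<phi> W Y \<longrightarrow> p \<in> W \<longrightarrow> X \<in> tangent_space A \<phi> p \<longrightarrow>
        lc p X Y \<in> tangent_space A \<phi> p) \<and>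
     (\<forall>W X Y. tangent_field M A \<phi> W X \<longrightarrow> tangent_field M A \<phi> W Y \<longrightarrow>
        smooth_map_on A W (\<lambda>q. lc q (X q) Y)) \<and>
     (\<forall>W Y p X X' a b. tangent_field M A \<phi> W Y \<longrightarrow> p \<in> W \<longrightarrow>
        X \<in> tangent_space A \<phi> p \<longrightarrow> X' \<in> tangent_space A \<phi> p \<longrightarrow>
        lc p (a *\<^sub>R X + b *\<^sub>R X') Y = a *\<^sub>R lc p X Y + b *\<^sub>R lc p X' Y) \<and>
     (\<forall>W Y Z p X. tangent_field M A \<phi> W Y \<longrightarrow> tangent_field M A \<phi> W Z \<longrightarrow>
        p \<in> W \<longrightarrow> X \<in> tangent_space A \<phi> p \<longrightarrow>
        lc p X (\<lambda>q. Y q + Z q) = lc p X Y + lc p X Z) \<and>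
     (\<forall>W Y (f :: 'a \<Rightarrow> real) p X. tangent_field M A \<phi> W Y \<longrightarrow> smooth_map_on A W f \<longrightarrow>
        p \<in> W \<longrightarrow> X \<in> tangent_space A \<phi> p \<longrightarrow>
        lc p X (\<lambda>q. f q *\<^sub>R Y q) = deriv_along A \<phi> f p X *\<^sub>R Y p + f p *\<^sub>R lc p X Y) \<and>
     (\<forall>W X Y p. tangent_field M A \<phi> W X \<longrightarrow> tangent_field M A \<phi> W Y \<longrightarrow> p \<in> W \<longrightarrow>
        lc p (X p) Y - lc p (Y p) X = deriv_along A \<phi> Y p (X p) - deriv_along A \<phi> X p (Y p)) \<and>
     (\<forall>W Y Z p X. tangent_field M A \<phi> W Y \<longrightarrow> tangent_field M A \<phi> W Z \<longrightarrow>
        p \<in> W \<longrightarrow> X \<in> tangent_space A \<phi> p \<longrightarrow>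
        deriv_along A \<phi> (\<lambda>q. h q (Y q) (Z q)) p X = h p (lc p X Y) (Z p) + h p (Y p) (lc p X Z))"

definition difference_tensor ::
    "'a topology \<Rightarrow> ('n::finite, 'a) chart set \<Rightarrow> ('a \<Rightarrow> real ^ 'm::finite) \<Rightarrow>
     ('a \<Rightarrow> real ^ 'm \<Rightarrow> ('a \<Rightarrow> real ^ 'm) \<Rightarrow> real ^ 'm) \<Rightarrow>
     ('a \<Rightarrow> real ^ 'm \<Rightarrow> ('a \<Rightarrow> real ^ 'm) \<Rightarrow> real ^ 'm) \<Rightarrow>
     ('a \<Rightarrow> real ^ 'm \<Rightarrow> real ^ 'm \<Rightarrow> real ^ 'm) \<Rightarrow> bool" where
  "difference_tensor M A \<phi> nab lc K \<longleftrightarrow>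
     (\<forall>W Y p X. tangent_field M A \<phi> W Y \<longrightarrow> p \<in> W \<longrightarrow> X \<in> tangent_space A \<phi> p \<longrightarrow>
        K p X (Y p) = nab p X Y - lc p X Y)"

subsection \<open>Pointwise symmetry\<close>

definition canonical_basis ::
    "('n::finite, 'a) chart set \<Rightarrow> ('a \<Rightarrow> real ^ 'm::finite) \<Rightarrow>
     ('a \<Rightarrow> real ^ 'm \<Rightarrow> real ^ 'm \<Rightarrow> real) \<Rightarrow> ('a \<Rightarrow> real ^ 'm \<Rightarrow> real ^ 'm \<Rightarrow> real ^ 'm) \<Rightarrow>
     'a \<Rightarrow> real ^ 'm \<Rightarrow> real ^ 'm \<Rightarrow> real ^ 'm \<Rightarrow> real \<Rightarrow> real \<Rightarrow> bool" where
  "canonical_basis A \<phi> h K p T V W a4 a6 \<longleftrightarrow>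
     independent {T, V, W} \<and> span {T, V, W} = tangent_space A \<phi> p \<and>
     h p T T = -1 \<and> h p V V = 1 \<and> h p W W = 1 \<and> h p T V = 0 \<and> h p T W = 0 \<and> h p V W = 0 \<and>
     K p T T = (-2 * a4) *\<^sub>R T \<and>
     K p T V = a4 *\<^sub>R V \<and>
     K p T W = a4 *\<^sub>R W \<and>
     K p V V = (- a4) *\<^sub>R T + a6 *\<^sub>R V \<and>
     K p V W = (- a6) *\<^sub>R W \<and>
     K p W W = (- a4) *\<^sub>R T - a6 *\<^sub>R V"

text \<open>The vector field \<open>T\<close> and the function \<open>a4\<close> are parameters of the two symmetry predicates,
  which determine them uniquely.\<close>

definition pointwise_Z3_symmetry ::
    "'a topology \<Rightarrow> ('n::finite, 'a) chart set \<Rightarrow> ('a \<Rightarrow> real ^ 'm::finite) \<Rightarrow>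
     ('a \<Rightarrow> real ^ 'm \<Rightarrow> real ^ 'm \<Rightarrow> real) \<Rightarrow> ('a \<Rightarrow> real ^ 'm \<Rightarrow> real ^ 'm \<Rightarrow> real ^ 'm) \<Rightarrow>
     ('a \<Rightarrow> real ^ 'm) \<Rightarrow> ('a \<Rightarrow> real) \<Rightarrow> bool" where
  "pointwise_Z3_symmetry M A \<phi> h K T a4 \<longleftrightarrow>
     (\<forall>p\<in>topspace M. a4 p > 0 \<and> (\<exists>V W a6. a6 > 0 \<and> canonical_basis A \<phi> h K p (T p) V W (a4 p) a6))"

definition pointwise_SO2_symmetry ::
    "'a topology \<Rightarrow> ('n::finite, 'a) chart set \<Rightarrow> ('a \<Rightarrow> real ^ 'm::finite) \<Rightarrow>
     ('a \<Rightarrow> real ^ 'm \<Rightarrow> real ^ 'm \<Rightarrow> real) \<Rightarrow> ('a \<Rightarrow> real ^ 'm \<Rightarrow> real ^ 'm \<Rightarrow> real ^ 'm) \<Rightarrow>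
     ('a \<Rightarrow> real ^ 'm) \<Rightarrow> ('a \<Rightarrow> real) \<Rightarrow> bool" where
  "pointwise_SO2_symmetry M A \<phi> h K T a4 \<longleftrightarrow>
     (\<forall>p\<in>topspace M. a4 p > 0 \<and> (\<exists>V W. canonical_basis A \<phi> h K p (T p) V W (a4 p) 0))"

text \<open>\<open>h(\<nabla>\<^sub>V T, V)\<close> for the Levi-Civita connection; the value does not depend on the choice
  of the unit vector \<open>V\<close> orthogonal to \<open>T\<close>.\<close>

definition a22 ::
    "('n::finite, 'a) chart set \<Rightarrow> ('a \<Rightarrow> real ^ 'm::finite) \<Rightarrow>
     ('a \<Rightarrow> real ^ 'm \<Rightarrow> real ^ 'm \<Rightarrow> real) \<Rightarrow>
     ('a \<Rightarrow> real ^ 'm \<Rightarrow> ('a \<Rightarrow> real ^ 'm) \<Rightarrow> real ^ 'm) \<Rightarrow> ('a \<Rightarrow> real ^ 'm) \<Rightarrow> 'a \<Rightarrow> real" where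
  "a22 A \<phi> h lc T p =
     (let V = (SOME V. V \<in> tangent_space A \<phi> p \<and> h p V V = 1 \<and> h p (T p) V = 0)
      in h p (lc p V T) V)"

subsection \<open>The model hypersurfaces\<close>

definition affine_transformation :: "('a::real_vector \<Rightarrow> 'a) \<Rightarrow> bool" where
  "affine_transformation L \<longleftrightarrow> (\<exists>B b. linear B \<and> bij B \<and> L = (\<lambda>x. B x + b))"

definition open_positive_interval :: "real set \<Rightarrow> bool" where
  "open_positive_interval I \<longleftrightarrow> is_interval I \<and> open I \<and> I \<subseteq> {0<..}"

text \<open>The product of \<open>I\<close> and \<open>N\<close> with coordinates \<open>(t, v, w)\<close>.\<close>

definition interval_times :: "real set \<Rightarrow> (real ^ 2) set \<Rightarrow> (real ^ 3) set" where
  "interval_times I N = {u. u $ 1 \<in> I \<and> vector [u $ 2, u $ 3] \<in> N}"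

definition graph_immersion :: "(real \<Rightarrow> real \<Rightarrow> real) \<Rightarrow> real ^ 2 \<Rightarrow> real ^ 3" where
  "graph_immersion f y = vector [y $ 1, y $ 2, f (y $ 1) (y $ 2)]"

text \<open>\<open>N\<close> carries the standard coordinates \<open>(v, w)\<close>, i.e. the identity as its only chart.\<close>

definition improper_affine_graph :: "(real ^ 2) set \<Rightarrow> (real \<Rightarrow> real \<Rightarrow> real) \<Rightarrow> bool" where
  "improper_affine_graph N f \<longleftrightarrow>
     pos_def_improper_affine_sphere (top_of_set N) {(N, \<lambda>y. y)} (graph_immersion f)
       (\<lambda>_. vector [0, 0, 1])"

definition elliptic_paraboloid :: "(real ^ 3) set \<Rightarrow> bool" where
  "elliptic_paraboloid P \<longleftrightarrow>
     (\<exists>L. affine_transformation L \<and> P = L ` {z. z $ 3 = (z $ 1)\<^sup>2 + (z $ 2)\<^sup>2})"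

definition on_elliptic_paraboloid :: "(real ^ 2) set \<Rightarrow> (real \<Rightarrow> real \<Rightarrow> real) \<Rightarrow> bool" where
  "on_elliptic_paraboloid N f \<longleftrightarrow> (\<exists>P. elliptic_paraboloid P \<and> graph_immersion f ` N \<subseteq> P)"

definition model_plus :: "real \<Rightarrow> (real \<Rightarrow> real \<Rightarrow> real) \<Rightarrow> real ^ 3 \<Rightarrow> real ^ 4" where
  "model_plus c f u =
     (let t = u $ 1; v = u $ 2; w = u $ 3
      in vector [t * v, t * w, t * f v w - c * t ^ 4, t])"

definition model_minus :: "real \<Rightarrow> (real \<Rightarrow> real \<Rightarrow> real) \<Rightarrow> real ^ 3 \<Rightarrow> real ^ 4" where
  "model_minus c f u =
     (let t = u $ 1; v = u $ 2; w = u $ 3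
      in vector [v, w, f v w + c * t ^ 3, t ^ 4])"

text \<open>\<open>(M, \<phi>)\<close> is affine equivalent with the hypersurfaces \<open>model c f\<close>, where \<open>f\<close> is the function
  of a positive definite improper affine sphere over \<open>N\<close> and \<open>Q N f\<close> is an additional property.
  The equivalence is local in \<open>M\<close>, since \<open>M\<close> need not be globally a product: a single affine
  transformation and a single constant \<open>c\<close> serve all of \<open>M\<close>, and every point of \<open>M\<close> has an open
  neighbourhood that is reparametrized by a product of an interval with a surface.\<close>

definition affine_equivalent_to_model ::
    "(real \<Rightarrow> (real \<Rightarrow> real \<Rightarrow> real) \<Rightarrow> real ^ 3 \<Rightarrow> real ^ 4) \<Rightarrow>
     ((real ^ 2) set \<Rightarrow> (real \<Rightarrow> real \<Rightarrow> real) \<Rightarrow> bool) \<Rightarrow>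
     'a topology \<Rightarrow> (3, 'a) chart set \<Rightarrow> ('a \<Rightarrow> real ^ 4) \<Rightarrow> bool" where
  "affine_equivalent_to_model model Q M A \<phi> \<longleftrightarrow>
     (\<exists>L c. affine_transformation L \<and> c > 0 \<and>
        (\<forall>p\<in>topspace M. \<exists>I N f F.
           open_positive_interval I \<and> improper_affine_graph N f \<and> Q N f \<and>
           diffeo_onto_open M A (interval_times I N) F \<and> p \<in> F ` interval_times I N \<and>
           (\<forall>u\<in>interval_times I N. L (\<phi> (F u)) = model c f u)))"

end

theory Submission
  imports Defs
begin

text \<open>Since \<open>S = 0\<close>, the affine normal is constant, so after a linear change of coordinates \<open>M\<close> is locally
  the graph of a function \<open>F\<close> on an open subset of \<open>\<real>\<^sup>3\<close>. There \<open>h\<close> is the Hessian of \<open>F\<close>, the tensor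
  \<open>h(K(X, Y), Z)\<close> is minus one half of the third derivative of \<open>F\<close>, and \<open>det Hess F\<close> has constant
  absolute value.

  Symmetry of the fourth derivative of \<open>F\<close> in a canonical frame (together with the vanishing of the
  curvature of the flat connection when \<open>a\<^sub>6 = 2 a\<^sub>4\<close>) gives
  \<open>D\<^sub>X T = \<beta> X + (\<beta> + 2 a\<^sub>4) h(T, X) T\<close> and \<open>X a\<^sub>4 = - 4 a\<^sub>4 (a\<^sub>4 - \<beta>) h(T, X)\<close> with
  \<open>\<beta> = a\<^sub>2\<^sub>2 + a\<^sub>4\<close>, so \<open>\<beta> = 0\<close> or \<open>\<beta> = 2 a\<^sub>4\<close> throughout. Put \<open>q = a\<^sub>4 powr (- 1 / 2)\<close>, which becomes the
  coordinate \<open>t\<close>.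

  If \<open>\<beta> = 0\<close>, then \<open>T = q e\<close> for a constant vector \<open>e\<close>, the function \<open>F + q\<^sup>4 / 16\<close> is affine, and \<open>q\<^sup>3\<close> is
  affine with slope \<open>- 6\<close> along \<open>e\<close>. If \<open>\<beta> = 2 a\<^sub>4\<close>, then \<open>y\<^sub>0 = y - q\<^sup>2 T / 2\<close> is constant, \<open>q\<close> is linear
  in \<open>y - y\<^sub>0\<close>, and \<open>F + q\<^sup>4 / 48\<close> is, up to an additive constant, homogeneous of degree one about \<open>y\<^sub>0\<close>.
  In both cases the Hessian of the remaining function \<open>f\<close> of two variables is a multiple of the
  restriction of \<open>h\<close> to the orthogonal complement of \<open>T\<close>; its determinant is \<open>1\<close> after scaling, and
  the Hessian is constant if \<open>a\<^sub>6 = 0\<close>. All integration constants agree on overlapping charts and hence are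
  global, because \<open>M\<close> is connected.\<close>

subsection \<open>Smooth functions\<close>

text \<open>The symmetry hypotheses are pointwise: they say nothing about how \<open>T\<close>,
  \<open>a4\<close> or the rest of the frame vary with the point, while the Codazzi equations
  differentiate a frame. The vector \<open>T\<close> and \<open>a4\<close> are recovered from
  contractions of the cubic form; the other two vectors are made smooth only near each point, by
  Gram-Schmidt and, if a_6 > 0, a rotation that kills one coefficient. Symmetry of the fourth
  derivative makes the flat derivative of \<open>T\<close> along itself a multiple of
  \<open>T\<close> only where a_6 differs from 2 a_4; that is why flatness enters in the remaining
  case. The factors 1/16 and 1/48 solve linear equations: \<open>F + s * q ^ 4\<close> has zero
  Hessian for s = 1/16 in one case and satisfies Euler's relation, up to an additive constant, for s
  = 1/48 in the other. The freedom left in the linear coordinates is spent on a map \<open>P\<close>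
  with 4 (det P)^2 |det Hess F| = 1, the condition under which the Hessian of \<open>f\<close> has
  determinant 1. Charts can be compared directly because their parameter is the projection of \<phi>
  along \<xi>, which leaves no choice on overlaps.\<close>

definition dir_deriv :: "'a::real_normed_vector \<Rightarrow> ('a \<Rightarrow> 'b::real_normed_vector) \<Rightarrow> 'a \<Rightarrow> 'b" ("\<partial>")
  where "\<partial> v f x = frechet_derivative f (at x) v"

lemma dir_deriv_eq: "(f has_derivative f') (at x) \<Longrightarrow> \<partial> v f x = f' v"
  unfolding dir_deriv_def using frechet_derivative_at by metis

lemma has_derivative_dir_deriv:
  "f differentiable (at x) \<Longrightarrow> (f has_derivative (\<lambda>v. \<partial> v f x)) (at x)"
  unfolding dir_deriv_def using frechet_derivative_works by blast

lemma linear_dir_deriv: "f differentiable (at x) \<Longrightarrow> linear (\<lambda>v. \<partial> v f x)"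
  using has_derivative_dir_deriv has_derivative_linear by blast

lemma differentiable_cong_open:
  assumes "open S" "x \<in> S" "\<And>y. y \<in> S \<Longrightarrow> f y = g y" "f differentiable (at x)"
  shows "g differentiable (at x)" "\<partial> v g x = \<partial> v f x"
proof -
  have "(g has_derivative (\<lambda>v. \<partial> v f x)) (at x)"
    using has_derivative_transform_within_open[OF has_derivative_dir_deriv[OF assms(4)] assms(1,2)]
      assms(3) by auto
  then show "g differentiable (at x)" "\<partial> v g x = \<partial> v f x"
    using dir_deriv_eq by (auto simp: differentiable_def)
qed

lemma Ck_on_Suc_iff:
  "Ck_on (Suc k) S f \<longleftrightarrow> (\<forall>x\<in>S. f differentiable (at x)) \<and> (\<forall>v. Ck_on k S (\<partial> v f))"
  by (simp add: dir_deriv_def[abs_def])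

declare Ck_on.simps(2) [simp del]

text \<open>The condition at a point of \<open>S\<close> involves values of \<open>f\<close> in a
  neighbourhood; openness of \<open>S\<close> keeps that neighbourhood inside the set where
  \<open>f\<close> and \<open>g\<close> agree.\<close>

lemma Ck_on_cong:
  assumes "open S" "\<And>x. x \<in> S \<Longrightarrow> f x = g x" "Ck_on k S f"
  shows "Ck_on k S g"
  using assms(2,3)
proof (induction k arbitrary: f g)
  case 0
  then show ?case by (metis Ck_on.simps(1) continuous_on_cong)
next
  case (Suc k)
  have *: "g differentiable (at x)" "\<partial> v g x = \<partial> v f x" if "x \<in> S" for x v
    using Suc.prems that unfolding Ck_on_Suc_iff
    by (intro differentiable_cong_open[OF assms(1) that, of f g]; blast)+
  have "Ck_on k S (\<partial> v g)" for v
    by (rule Suc.IH[OF *(2)[symmetric]]) (use Suc.prems(2) in \<open>simp_all add: Ck_on_Suc_iff\<close>)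
  then show ?case using *(1) by (simp add: Ck_on_Suc_iff)
qed

lemma Ck_on_subset: "Ck_on k S f \<Longrightarrow> T \<subseteq> S \<Longrightarrow> Ck_on k T f"
proof (induction k arbitrary: f)
  case 0
  then show ?case by (auto intro: continuous_on_subset)
next
  case (Suc k)
  then show ?case unfolding Ck_on_Suc_iff by blast
qed

lemma Ck_on_Suc_imp: "Ck_on (Suc k) S f \<Longrightarrow> Ck_on k S f"
proof (induction k arbitrary: f)
  case 0
  then show ?case
    by (auto simp: Ck_on_Suc_iff intro!: continuous_at_imp_continuous_on differentiable_imp_continuous_within)
next
  case (Suc k)
  then show ?case using Ck_on_Suc_iff by blast
qed

lemma Ck_on_local:
  assumes "\<And>x. x \<in> S \<Longrightarrow> \<exists>U. open U \<and> x \<in> U \<and> Ck_on k U f"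
  shows "Ck_on k S f"
  using assms
proof (induction k arbitrary: f)
  case 0
  have "isCont f x" if x: "x \<in> S" for x
  proof -
    obtain U where "open U" "x \<in> U" "Ck_on 0 U f" using 0[OF x] by blast
    then show ?thesis using continuous_on_eq_continuous_at[of U f] by simp
  qed
  then show ?case by (auto intro: continuous_at_imp_continuous_on)
next
  case (Suc k)
  have "f differentiable (at x)" if x: "x \<in> S" for x
    using Suc.prems[OF x] unfolding Ck_on_Suc_iff by blast
  moreover have "Ck_on k S (\<partial> v f)" for v
    using Suc.prems unfolding Ck_on_Suc_iff by (intro Suc.IH) metis
  ultimately show ?case unfolding Ck_on_Suc_iff by blast
qed

lemma Ck_on_const: "Ck_on k S (\<lambda>x. c)"
proof (induction k arbitrary: c)
  case (Suc k)
  have "\<partial> v (\<lambda>x. c) = (\<lambda>x. 0)" for v :: 'a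
    by (rule ext, rule dir_deriv_eq[where f'="\<lambda>v. 0"]) simp
  with Suc show ?case by (simp add: Ck_on_Suc_iff)
qed auto

lemma Ck_on_bounded_linear:
  assumes "open S" "bounded_linear L" "Ck_on k S f"
  shows "Ck_on k S (\<lambda>x. L (f x))"
  using assms(3)
proof (induction k arbitrary: f)
  case 0
  then show ?case using assms(2) by (auto intro: linear_continuous_on_compose bounded_linear.continuous_on)
next
  case (Suc k)
  have d: "((\<lambda>x. L (f x)) has_derivative (\<lambda>v. L (\<partial> v f x))) (at x)" if "x \<in> S" for x
    using bounded_linear.has_derivative[OF assms(2) has_derivative_dir_deriv] Suc(2) that
    unfolding Ck_on_Suc_iff by blast
  have "Ck_on k S (\<partial> v (\<lambda>x. L (f x)))" for v
    by (rule Ck_on_cong[OF assms(1) _ Suc(1)[of "\<partial> v f"]])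
      (use Suc(2) in \<open>auto simp: Ck_on_Suc_iff dir_deriv_eq[OF d]\<close>)
  with d show ?case unfolding Ck_on_Suc_iff differentiable_def by blast
qed

lemma Ck_on_add:
  assumes "open S" "Ck_on k S f" "Ck_on k S g"
  shows "Ck_on k S (\<lambda>x. f x + g x)"
  using assms(2,3)
proof (induction k arbitrary: f g)
  case 0
  then show ?case by (auto intro: continuous_on_add)
next
  case (Suc k)
  have d: "((\<lambda>x. f x + g x) has_derivative (\<lambda>v. \<partial> v f x + \<partial> v g x)) (at x)" if "x \<in> S" for x
    using Suc(2,3) that unfolding Ck_on_Suc_iff
    by (intro has_derivative_add has_derivative_dir_deriv) auto
  have "Ck_on k S (\<partial> v (\<lambda>x. f x + g x))" for v
    by (rule Ck_on_cong[OF assms(1) _ Suc(1)[of "\<partial> v f" "\<partial> v g"]])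
      (use Suc(2,3) in \<open>auto simp: Ck_on_Suc_iff dir_deriv_eq[OF d]\<close>)
  with d show ?case unfolding Ck_on_Suc_iff differentiable_def by blast
qed

lemma Ck_on_bilinear:
  assumes "open S" "bounded_bilinear b" "Ck_on k S f" "Ck_on k S g"
  shows "Ck_on k S (\<lambda>x. b (f x) (g x))"
  using assms(3,4)
proof (induction k arbitrary: f g)
  case 0
  then show ?case using assms(2) by (auto intro: bounded_bilinear.continuous_on)
next
  case (Suc k)
  have d: "((\<lambda>x. b (f x) (g x)) has_derivative (\<lambda>v. b (f x) (\<partial> v g x) + b (\<partial> v f x) (g x))) (at x)"
    if "x \<in> S" for x
    using Suc(2,3) that unfolding Ck_on_Suc_iff
    by (intro bounded_bilinear.FDERIV[OF assms(2)] has_derivative_dir_deriv) auto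
  have "Ck_on k S (\<partial> v (\<lambda>x. b (f x) (g x)))" for v
    by (rule Ck_on_cong[OF assms(1) _ Ck_on_add[OF assms(1) Suc(1)[of f "\<partial> v g"] Suc(1)[of "\<partial> v f" g]]])
      (use Suc(2,3) Ck_on_Suc_imp[OF Suc(2)] Ck_on_Suc_imp[OF Suc(3)]
        in \<open>auto simp: Ck_on_Suc_iff dir_deriv_eq[OF d]\<close>)
  with d show ?case unfolding Ck_on_Suc_iff differentiable_def by blast
qed

lemma Ck_on_sum:
  assumes "open S" "\<And>i. i \<in> I \<Longrightarrow> Ck_on k S (f i)"
  shows "Ck_on k S (\<lambda>x. \<Sum>i\<in>I. f i x)"
  using assms(2)
  by (induction I rule: infinite_finite_induct) (auto intro: Ck_on_const Ck_on_add[OF assms(1)])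

text \<open>The chain rule differentiates \<open>f\<close> in the direction
  \<open>\<partial> v g x\<close>, which moves with \<open>x\<close>, whereas the induction
  hypothesis speaks of fixed directions. Expanding this direction in the standard basis separates
  the two dependences.\<close>

lemma Ck_on_compose:
  fixes f :: "'b::euclidean_space \<Rightarrow> 'c::real_normed_vector"
  assumes "open S" "open T" "g ` S \<subseteq> T" "Ck_on k S g" "Ck_on k T f"
  shows "Ck_on k S (\<lambda>x. f (g x))"
  using assms(4,5)
proof (induction k arbitrary: f)
  case 0
  then show ?case using assms(3) by (auto intro: continuous_on_compose2)
next
  case (Suc k)
  have d: "((\<lambda>x. f (g x)) has_derivative (\<lambda>v. \<partial> (\<partial> v g x) f (g x))) (at x)" if "x \<in> S" for x
    using Suc(2,3) that assms(3) unfolding Ck_on_Suc_iff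
    by (intro has_derivative_compose[OF has_derivative_dir_deriv has_derivative_dir_deriv]) auto
  have eq: "\<partial> v (\<lambda>x. f (g x)) x = (\<Sum>b\<in>Basis. (\<partial> v g x \<bullet> b) *\<^sub>R \<partial> b f (g x))" if "x \<in> S" for v x
  proof -
    have lin: "linear (\<lambda>v. \<partial> v f (g x))"
      using Suc(3) that assms(3) by (auto simp: Ck_on_Suc_iff intro: linear_dir_deriv)
    have "\<partial> v (\<lambda>x. f (g x)) x = \<partial> (\<Sum>b\<in>Basis. (\<partial> v g x \<bullet> b) *\<^sub>R b) f (g x)"
      using dir_deriv_eq[OF d[OF that]] by (simp add: euclidean_representation)
    then show ?thesis
      by (simp add: linear_sum[OF lin] linear_scale[OF lin])
  qed
  have "Ck_on k S (\<partial> v (\<lambda>x. f (g x)))" for v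
  proof (rule Ck_on_cong[OF assms(1) eq[symmetric]], assumption)
    show "Ck_on k S (\<lambda>x. \<Sum>b\<in>Basis. (\<partial> v g x \<bullet> b) *\<^sub>R \<partial> b f (g x))"
      using Suc(2,3) Ck_on_Suc_imp[OF Suc(2)]
      by (intro Ck_on_sum Ck_on_bilinear[OF assms(1) bounded_bilinear_scaleR]
          Ck_on_bounded_linear[OF assms(1) bounded_linear_inner_left] assms(1) Suc(1))
        (auto simp: Ck_on_Suc_iff)
  qed
  with d show ?case unfolding Ck_on_Suc_iff differentiable_def by blast
qed

lemma smooth_on_cong: "open S \<Longrightarrow> (\<And>x. x \<in> S \<Longrightarrow> f x = g x) \<Longrightarrow> smooth_on S f \<Longrightarrow> smooth_on S g"
  unfolding smooth_on_def using Ck_on_cong by blast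

lemma smooth_on_subset: "smooth_on S f \<Longrightarrow> T \<subseteq> S \<Longrightarrow> smooth_on T f"
  unfolding smooth_on_def using Ck_on_subset by blast

lemma smooth_on_local:
  "(\<And>x. x \<in> S \<Longrightarrow> \<exists>U. open U \<and> x \<in> U \<and> smooth_on U f) \<Longrightarrow> smooth_on S f"
  unfolding smooth_on_def by (metis Ck_on_local)

lemma smooth_on_differentiable: "smooth_on S f \<Longrightarrow> x \<in> S \<Longrightarrow> f differentiable (at x)"
  unfolding smooth_on_def using Ck_on_Suc_iff by blast

lemma smooth_on_has_derivative:
  "smooth_on S f \<Longrightarrow> x \<in> S \<Longrightarrow> (f has_derivative (\<lambda>v. \<partial> v f x)) (at x)"
  using smooth_on_differentiable has_derivative_dir_deriv by blast

lemma smooth_on_dir_deriv: "smooth_on S f \<Longrightarrow> smooth_on S (\<partial> v f)"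
  unfolding smooth_on_def using Ck_on_Suc_iff by blast

lemma smooth_on_continuous: "smooth_on S f \<Longrightarrow> continuous_on S f"
  unfolding smooth_on_def using Ck_on.simps(1) by blast

lemma smooth_on_const [simp]: "smooth_on S (\<lambda>x. c)"
  by (simp add: smooth_on_def Ck_on_const)

lemma smooth_on_id [simp]: "smooth_on S (\<lambda>x. x)"
proof -
  have "Ck_on k S (\<lambda>x. x)" for k
  proof (cases k)
    case (Suc j)
    have "\<partial> v (\<lambda>x. x) = (\<lambda>x. v)" for v :: 'a
      by (rule ext, rule dir_deriv_eq[where f'="\<lambda>v. v"]) simp
    then show ?thesis by (simp add: Suc Ck_on_Suc_iff Ck_on_const)
  qed auto
  then show ?thesis by (simp add: smooth_on_def)
qed

lemma smooth_on_linear: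
  fixes L :: "'b::euclidean_space \<Rightarrow> 'c::real_normed_vector"
  shows "open S \<Longrightarrow> linear L \<Longrightarrow> smooth_on S f \<Longrightarrow> smooth_on S (\<lambda>x. L (f x))"
  by (simp add: smooth_on_def Ck_on_bounded_linear linear_conv_bounded_linear)

lemma smooth_on_bilinear:
  "open S \<Longrightarrow> bounded_bilinear b \<Longrightarrow> smooth_on S f \<Longrightarrow> smooth_on S g \<Longrightarrow> smooth_on S (\<lambda>x. b (f x) (g x))"
  by (simp add: smooth_on_def Ck_on_bilinear)

lemma smooth_on_add:
  "open S \<Longrightarrow> smooth_on S f \<Longrightarrow> smooth_on S g \<Longrightarrow> smooth_on S (\<lambda>x. f x + g x)"
  by (simp add: smooth_on_def Ck_on_add)

lemmas smooth_on_scaleR = smooth_on_bilinear[OF _ bounded_bilinear_scaleR]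
lemmas smooth_on_mult = smooth_on_bilinear[OF _ bounded_bilinear_mult]
lemmas smooth_on_inner = smooth_on_bilinear[OF _ bounded_bilinear_inner]

lemma smooth_on_minus: "open S \<Longrightarrow> smooth_on S f \<Longrightarrow> smooth_on S (\<lambda>x. - f x)"
  using smooth_on_scaleR[of S "\<lambda>x. -1" f] by simp

lemma smooth_on_diff:
  "open S \<Longrightarrow> smooth_on S f \<Longrightarrow> smooth_on S g \<Longrightarrow> smooth_on S (\<lambda>x. f x - g x)"
  using smooth_on_add[of S f "\<lambda>x. - g x"] smooth_on_minus by auto

lemma smooth_on_sum:
  "open S \<Longrightarrow> (\<And>i. i \<in> I \<Longrightarrow> smooth_on S (f i)) \<Longrightarrow> smooth_on S (\<lambda>x. \<Sum>i\<in>I. f i x)"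
  by (simp add: smooth_on_def Ck_on_sum)

lemma smooth_on_power:
  fixes f :: "'a::real_normed_vector \<Rightarrow> real"
  shows "open S \<Longrightarrow> smooth_on S f \<Longrightarrow> smooth_on S (\<lambda>x. f x ^ n)"
  by (induction n) (auto intro: smooth_on_mult)

lemma smooth_on_compose:
  fixes f :: "'b::euclidean_space \<Rightarrow> 'c::real_normed_vector"
  assumes "open S" "open T" "g ` S \<subseteq> T" "smooth_on S g" "smooth_on T f"
  shows "smooth_on S (\<lambda>x. f (g x))"
  using assms by (auto simp: smooth_on_def intro: Ck_on_compose)

lemma smooth_on_vec_nth: "open S \<Longrightarrow> smooth_on S f \<Longrightarrow> smooth_on S (\<lambda>x. f x $ i)"
  for f :: "'a::real_normed_vector \<Rightarrow> real ^ 'n::finite"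
  using Ck_on_bounded_linear[OF _ bounded_linear_vec_nth, of S _ f] by (auto simp: smooth_on_def)

lemma smooth_on_vec_lambda:
  fixes f :: "'n::finite \<Rightarrow> 'a::real_normed_vector \<Rightarrow> real"
  assumes "open S" "\<And>i. smooth_on S (f i)"
  shows "smooth_on S (\<lambda>x. \<chi> i. f i x)"
proof -
  have "(\<lambda>x. \<chi> i. f i x) = (\<lambda>x. \<Sum>i\<in>UNIV. f i x *\<^sub>R axis i 1)"
    by (rule ext) (simp add: vec_eq_iff axis_def if_distrib cong: if_cong)
  then show ?thesis
    using assms by (auto intro!: smooth_on_sum smooth_on_scaleR)
qed

lemma smooth_on_vec_iff:
  fixes f :: "'a::real_normed_vector \<Rightarrow> real ^ 'n::finite"
  assumes "open S"
  shows "smooth_on S f \<longleftrightarrow> (\<forall>i. smooth_on S (\<lambda>x. f x $ i))"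
  using smooth_on_vec_nth[OF assms, of f] smooth_on_vec_lambda[OF assms, of "\<lambda>i x. f x $ i"] by auto

text \<open>Bootstrap: the last assumption makes \<open>f'\<close> as regular as \<open>f\<close>,
  so each order of differentiability yields the next one.\<close>

lemma smooth_on_real_ODE:
  fixes f :: "real \<Rightarrow> real"
  assumes "\<And>x. x \<in> S \<Longrightarrow> (f has_real_derivative f' x) (at x)" "open S"
    and "\<And>k. Ck_on k S f \<Longrightarrow> Ck_on k S f'"
  shows "smooth_on S f"
  unfolding smooth_on_def
proof
  have d: "(f has_derivative (\<lambda>v. v * f' x)) (at x)" if "x \<in> S" for x
    using assms(1)[OF that] unfolding has_field_derivative_def
    by (rule has_derivative_eq_rhs) (simp add: fun_eq_iff)
  show "Ck_on k S f" for k
  proof (induction k)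
    case 0
    then show ?case
      using assms(1) by (auto intro!: continuous_at_imp_continuous_on DERIV_isCont)
  next
    case (Suc k)
    have "Ck_on k S (\<partial> v f)" for v
      by (rule Ck_on_cong[OF assms(2) _ Ck_on_bounded_linear[OF assms(2) bounded_linear_mult_right[of v] assms(3)[OF Suc]]])
        (simp add: dir_deriv_eq[OF d])
    then show ?case unfolding Ck_on_Suc_iff using d differentiable_def by blast
  qed
qed

lemma smooth_on_powr:
  fixes f :: "'a::real_normed_vector \<Rightarrow> real"
  assumes "open S" "smooth_on S f" "\<And>x. x \<in> S \<Longrightarrow> f x > 0"
  shows "smooth_on S (\<lambda>x. f x powr r)"
proof -
  have op: "open {0::real<..}" by simp
  have "Ck_on k {0::real<..} (\<lambda>x::real. x powr r)" for k r
  proof (induction k arbitrary: r)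
    case 0
    then show ?case by (auto intro!: continuous_intros)
  next
    case (Suc k)
    have d: "((\<lambda>x. x powr r) has_derivative (\<lambda>v. v * (r * x powr (r - 1)))) (at x)" if "x > 0" for x :: real
      using has_real_derivative_powr[OF that, of r] unfolding has_field_derivative_def
      by (rule has_derivative_eq_rhs) (simp add: fun_eq_iff)
    have "Ck_on k {0<..} (\<partial> v (\<lambda>x. x powr r))" for v
      by (rule Ck_on_cong[OF op _ Ck_on_bounded_linear[OF op bounded_linear_mult_right[of v]
              Ck_on_bounded_linear[OF op bounded_linear_mult_right[of r] Suc[of "r - 1"]]]])
        (simp add: dir_deriv_eq[OF d])
    then show ?case unfolding Ck_on_Suc_iff using d differentiable_def by blast
  qed
  then have "smooth_on {0::real<..} (\<lambda>x::real. x powr r)" by (simp add: smooth_on_def)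
  from smooth_on_compose[OF assms(1) op _ assms(2) this] show ?thesis using assms(3) by auto
qed

lemma smooth_on_sqrt:
  fixes f :: "'a::real_normed_vector \<Rightarrow> real"
  assumes "open S" "smooth_on S f" "\<And>x. x \<in> S \<Longrightarrow> f x > 0"
  shows "smooth_on S (\<lambda>x. sqrt (f x))"
  by (rule smooth_on_cong[OF assms(1) _ smooth_on_powr[OF assms, of "1/2"]])
    (auto simp: powr_half_sqrt assms(3) less_imp_le)

lemma smooth_on_inverse:
  fixes f :: "'a::real_normed_vector \<Rightarrow> real"
  assumes "open S" "smooth_on S f" "\<And>x. x \<in> S \<Longrightarrow> f x \<noteq> 0"
  shows "smooth_on S (\<lambda>x. inverse (f x))"
proof -
  have pos: "f x * f x > 0" if "x \<in> S" for x using assms(3)[OF that] by (simp add: less_le)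
  \<comment> \<open>Powers with real exponent are available for positive bases only; multiplying the
    power of the square by \<open>f x\<close> restores the sign.\<close>
  have "smooth_on S (\<lambda>x. f x * (f x * f x) powr (-1))"
    using pos assms by (intro smooth_on_mult smooth_on_powr) auto
  moreover have "f x * (f x * f x) powr (-1) = inverse (f x)" if "x \<in> S" for x
    using pos[OF that] assms(3)[OF that] by (simp add: powr_minus)
  ultimately show ?thesis
    by (rule smooth_on_cong[OF assms(1), rotated])
qed

lemma smooth_on_divide:
  fixes f g :: "'a::real_normed_vector \<Rightarrow> real"
  shows "open S \<Longrightarrow> smooth_on S f \<Longrightarrow> smooth_on S g \<Longrightarrow> (\<And>x. x \<in> S \<Longrightarrow> g x \<noteq> 0) \<Longrightarrow>
    smooth_on S (\<lambda>x. f x / g x)"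
  by (auto simp: divide_inverse intro!: smooth_on_mult smooth_on_inverse)

lemma smooth_on_cos_sin:
  fixes f :: "'a::real_normed_vector \<Rightarrow> real"
  assumes "open S" "smooth_on S f"
  shows "smooth_on S (\<lambda>x. cos (f x))" "smooth_on S (\<lambda>x. sin (f x))"
proof -
  have c: "(cos has_derivative (\<lambda>v. (- v) * sin x)) (at x)"
    and s: "(sin has_derivative (\<lambda>v. v * cos x)) (at x)" for x :: real
    using DERIV_cos[of x] DERIV_sin[of x]
    by (auto simp: has_field_derivative_def mult.commute[of _ "cos x"] mult.commute[of _ "sin x"]
        elim!: has_derivative_eq_rhs)
  have "Ck_on k UNIV (cos :: real \<Rightarrow> real) \<and> Ck_on k UNIV (sin :: real \<Rightarrow> real)" for k
  proof (induction k)
    case (Suc k)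
    have "\<partial> v cos = (\<lambda>x::real. (- v) * sin x)" "\<partial> v sin = (\<lambda>x::real. v * cos x)" for v
      using dir_deriv_eq[OF c] dir_deriv_eq[OF s] by auto
    moreover have "Ck_on k UNIV (\<lambda>x::real. (- v) * sin x)" "Ck_on k UNIV (\<lambda>x::real. v * cos x)" for v
      using Suc by (blast intro: Ck_on_bounded_linear[OF open_UNIV bounded_linear_mult_right])+
    moreover have "cos differentiable (at x)" "sin differentiable (at x)" for x :: real
      using c s differentiable_def by blast+
    ultimately show ?case by (simp add: Ck_on_Suc_iff)
  qed (auto intro: continuous_intros)
  then have "smooth_on UNIV (cos :: real \<Rightarrow> real)" "smooth_on UNIV (sin :: real \<Rightarrow> real)"
    by (auto simp: smooth_on_def)
  from this[THEN smooth_on_compose[OF assms(1) open_UNIV subset_UNIV assms(2)]]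
  show "smooth_on S (\<lambda>x. cos (f x))" "smooth_on S (\<lambda>x. sin (f x))" by auto
qed

lemma smooth_on_arctan:
  fixes f :: "'a::real_normed_vector \<Rightarrow> real"
  assumes "open S" "smooth_on S f"
  shows "smooth_on S (\<lambda>x. arctan (f x))"
proof -
  have nz: "1 + x * x \<noteq> 0" for x :: real
    by (metis add_pos_nonneg less_irrefl zero_le_square zero_less_one)
  have "smooth_on UNIV (\<lambda>x::real. inverse (1 + x * x))"
    by (intro smooth_on_inverse smooth_on_add smooth_on_mult) (auto simp: nz)
  then have "smooth_on UNIV arctan"
    using DERIV_arctan by (intro smooth_on_real_ODE[where f'="\<lambda>x. inverse (1 + x * x)"])
      (auto simp: power2_eq_square smooth_on_def)
  from smooth_on_compose[OF assms(1) open_UNIV _ assms(2) this] show ?thesis by auto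
qed

lemma Ck_on_prod:
  fixes f :: "'i \<Rightarrow> 'a::real_normed_vector \<Rightarrow> real"
  assumes "open S" "\<And>i. i \<in> I \<Longrightarrow> Ck_on k S (f i)"
  shows "Ck_on k S (\<lambda>x. \<Prod>i\<in>I. f i x)"
  using assms(2)
  by (induction I rule: infinite_finite_induct)
    (auto intro: Ck_on_const Ck_on_bilinear[OF assms(1) bounded_bilinear_mult])

lemma Ck_on_det:
  fixes A :: "'a::real_normed_vector \<Rightarrow> real ^ 'n::finite ^ 'n"
  assumes "open S" "\<And>i j. Ck_on k S (\<lambda>x. A x $ i $ j)"
  shows "Ck_on k S (\<lambda>x. det (A x))"
  unfolding det_def
  by (intro Ck_on_sum Ck_on_bilinear[OF _ bounded_bilinear_mult] Ck_on_const Ck_on_prod assms)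

lemma Ck_on_inverse:
  fixes f :: "'a::real_normed_vector \<Rightarrow> real"
  assumes "open S" "Ck_on k S f" "\<And>x. x \<in> S \<Longrightarrow> f x \<noteq> 0"
  shows "Ck_on k S (\<lambda>x. inverse (f x))"
proof -
  have "smooth_on {x::real. x \<noteq> 0} (\<lambda>x. inverse x)"
    by (intro smooth_on_inverse) (auto simp: open_Collect_neq)
  then show ?thesis
    using assms by (intro Ck_on_compose[OF assms(1) _ _ assms(2), of "{x. x \<noteq> 0}" inverse])
      (auto simp: smooth_on_def open_Collect_neq)
qed

text \<open>Cramer's rule expresses the derivative of the inverse map through the derivative of the map,
  so the regularity of the inverse bootstraps.\<close>

lemma smooth_on_inverse_function:
  fixes f :: "real ^ 'n::finite \<Rightarrow> real ^ 'n"
  assumes S: "open S" and T: "open T" and f: "smooth_on S f" and sub: "g ` T \<subseteq> S"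
    and inv: "\<And>y. y \<in> T \<Longrightarrow> f (g y) = y" and diff: "\<And>y. y \<in> T \<Longrightarrow> g differentiable (at y)"
  shows "smooth_on T g"
proof -
  define A where "A x = (\<chi> i j. \<partial> (axis j 1) f x $ i)" for x
  have mat: "A x *v v = \<partial> v f x" if "x \<in> S" for x v
    using fun_cong[OF matrix_vector_mul(2)[OF linear_dir_deriv[OF smooth_on_differentiable[OF f that]]], of v]
    by (simp add: A_def matrix_def)
  have eq: "A (g y) *v \<partial> v g y = v" if "y \<in> T" for y v
  proof -
    have "((\<lambda>y. f (g y)) has_derivative (\<lambda>v. \<partial> (\<partial> v g y) f (g y))) (at y)"
      using sub that by (intro has_derivative_compose[OF has_derivative_dir_deriv[OF diff] smooth_on_has_derivative[OF f]]) auto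
    moreover have "((\<lambda>y. f (g y)) has_derivative (\<lambda>v. v)) (at y)"
      using inv that T by (intro has_derivative_transform_within_open[OF has_derivative_ident T]) auto
    ultimately have "\<partial> (\<partial> v g y) f (g y) = v" by (rule fun_cong[OF has_derivative_unique])
    then show ?thesis using mat sub that by auto
  qed
  have det: "det (A (g y)) \<noteq> 0" if "y \<in> T" for y
  proof -
    have "A (g y) ** matrix (\<lambda>v. \<partial> v g y) = mat 1"
      by (rule matrix_eq[THEN iffD2])
        (use eq[OF that] in \<open>simp add: matrix_vector_mul_assoc[symmetric]
          matrix_vector_mul(2)[OF linear_dir_deriv[OF diff[OF that]], THEN fun_cong]\<close>)
    then show ?thesis by (metis det_I det_mul mult_zero_left zero_neq_one)
  qed
  have "Ck_on k T g" for k
  proof (induction k)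
    case 0
    then show ?case using diff
      by (auto intro!: continuous_at_imp_continuous_on differentiable_imp_continuous_within)
  next
    case (Suc k)
    have ent: "Ck_on k T (\<lambda>y. A (g y) $ i $ j)" for i j
    proof -
      have "smooth_on S (\<lambda>x. A x $ i $ j)"
        by (simp add: A_def) (intro smooth_on_vec_nth smooth_on_dir_deriv f S)
      then have "Ck_on k S (\<lambda>x. A x $ i $ j)" by (simp add: smooth_on_def)
      from Ck_on_compose[OF T S sub Suc this] show ?thesis .
    qed
    have "Ck_on k T (\<lambda>y. \<partial> v g y $ i)" for v i
    proof (rule Ck_on_cong[OF T])
      let ?B = "\<lambda>y. (\<chi> i' j. if j = i then v $ i' else A (g y) $ i' $ j)"
      show "det (?B y) * inverse (det (A (g y))) = \<partial> v g y $ i" if "y \<in> T" for y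
        using cramer[OF det[OF that], of "\<partial> v g y" v] eq[OF that, of v] by (simp add: divide_inverse)
      have "Ck_on k T (\<lambda>y. ?B y $ i' $ j)" for i' j
        using ent by (cases "j = i") (auto intro: Ck_on_const)
      then show "Ck_on k T (\<lambda>y. det (?B y) * inverse (det (A (g y))))"
        using ent det by (intro Ck_on_bilinear[OF T bounded_bilinear_mult] Ck_on_det Ck_on_inverse T) auto
    qed
    then have *: "Ck_on k T (\<lambda>y. \<Sum>i\<in>UNIV. \<partial> v g y $ i *\<^sub>R axis i 1)" for v
      by (intro Ck_on_sum Ck_on_bilinear[OF T bounded_bilinear_scaleR] Ck_on_const T)
    have "Ck_on k T (\<partial> v g)" for v
      by (rule Ck_on_cong[OF T _ *[of v]]) (simp add: vec_eq_iff axis_def if_distrib cong: if_cong)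
    then show ?case using diff by (simp add: Ck_on_Suc_iff)
  qed
  then show ?thesis by (simp add: smooth_on_def)
qed

lemma smooth_on_det:
  fixes A :: "'a::real_normed_vector \<Rightarrow> real ^ 'n::finite ^ 'n"
  assumes "open S" "\<And>i j. smooth_on S (\<lambda>x. A x $ i $ j)"
  shows "smooth_on S (\<lambda>x. det (A x))"
  using assms by (simp add: smooth_on_def Ck_on_det)

section \<open>Symmetry of second derivatives\<close>

lemma mixed_difference:
  fixes f :: "'a::real_normed_vector \<Rightarrow> real"
  assumes h: "h > 0"
    and S: "\<And>s t. 0 \<le> s \<Longrightarrow> s \<le> h \<Longrightarrow> 0 \<le> t \<Longrightarrow> t \<le> h \<Longrightarrow> x + s *\<^sub>R u + t *\<^sub>R v \<in> S"
    and d1: "\<And>y. y \<in> S \<Longrightarrow> f differentiable (at y)"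
    and d2: "\<And>y. y \<in> S \<Longrightarrow> \<partial> v f differentiable (at y)"
  shows "\<exists>s t. 0 \<le> s \<and> s \<le> h \<and> 0 \<le> t \<and> t \<le> h \<and>
    f (x + h *\<^sub>R u + h *\<^sub>R v) - f (x + h *\<^sub>R u) - f (x + h *\<^sub>R v) + f x
      = h * h * \<partial> u (\<partial> v f) (x + s *\<^sub>R u + t *\<^sub>R v)"
proof -
  have D: "((\<lambda>t. g (c + t *\<^sub>R w)) has_real_derivative \<partial> w g (c + t *\<^sub>R w)) (at t)"
    if "g differentiable (at (c + t *\<^sub>R w))" for g :: "'a \<Rightarrow> real" and c w t
  proof -
    have "((\<lambda>t. c + t *\<^sub>R w) has_derivative (\<lambda>t. t *\<^sub>R w)) (at t)"
      by (auto intro!: derivative_eq_intros)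
    from has_derivative_compose[OF this has_derivative_dir_deriv[OF that]]
    show ?thesis
      by (simp add: has_field_derivative_def linear_scale[OF linear_dir_deriv[OF that]] mult.commute[of _ "\<partial> w g _"])
  qed
  define \<phi> where "\<phi> t = f ((x + h *\<^sub>R u) + t *\<^sub>R v) - f (x + t *\<^sub>R v)" for t
  have "\<exists>t>0. t < h \<and> \<phi> h - \<phi> 0 = (h - 0) * (\<partial> v f (x + h *\<^sub>R u + t *\<^sub>R v) - \<partial> v f (x + t *\<^sub>R v))"
    unfolding \<phi>_def using h S[of h] S[of 0] d1
    by (intro MVT2 DERIV_diff D) auto
  then obtain t where t: "0 < t" "t < h"
    "\<phi> h - \<phi> 0 = h * (\<partial> v f (x + h *\<^sub>R u + t *\<^sub>R v) - \<partial> v f (x + t *\<^sub>R v))" by auto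
  have c: "x + t *\<^sub>R v + s *\<^sub>R u = x + s *\<^sub>R u + t *\<^sub>R v" for s by (simp add: algebra_simps)
  have "\<exists>s>0. s < h \<and> \<partial> v f (x + t *\<^sub>R v + h *\<^sub>R u) - \<partial> v f (x + t *\<^sub>R v + 0 *\<^sub>R u) =
      (h - 0) * \<partial> u (\<partial> v f) (x + t *\<^sub>R v + s *\<^sub>R u)"
    using h t S d2 by (intro MVT2 D) (auto simp: c)
  then obtain s where "0 < s" "s < h"
    "\<partial> v f (x + h *\<^sub>R u + t *\<^sub>R v) - \<partial> v f (x + t *\<^sub>R v) = h * \<partial> u (\<partial> v f) (x + s *\<^sub>R u + t *\<^sub>R v)"
    by (auto simp: c)
  with t show ?thesis unfolding \<phi>_def
    by (intro exI[of _ s] exI[of _ t]) (auto simp: algebra_simps)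
qed

text \<open>The second difference over the parallelogram with sides \<open>h *\<^sub>R u\<close> and
  \<open>h *\<^sub>R v\<close> is symmetric in \<open>u\<close> and \<open>v\<close>. By
  \<open>mixed_difference\<close> it equals \<open>h * h\<close> times either mixed derivative at
  some point of the parallelogram, and both mixed derivatives are continuous at
  \<open>x\<close>.\<close>

lemma dir_deriv_commute_real:
  fixes f :: "'a::real_normed_vector \<Rightarrow> real"
  assumes S: "open S" and f: "smooth_on S f" and x: "x \<in> S"
  shows "\<partial> u (\<partial> v f) x = \<partial> v (\<partial> u f) x"
proof -
  have "\<bar>\<partial> u (\<partial> v f) x - \<partial> v (\<partial> u f) x\<bar> \<le> 2 * \<epsilon>" if \<epsilon>: "\<epsilon> > 0" for \<epsilon>
  proof -
    have "\<exists>d>0. \<forall>y. dist y x < d \<longrightarrow> y \<in> S \<and> \<bar>g y - g x\<bar> < \<epsilon>" if "smooth_on S g" for g :: "'a \<Rightarrow> real"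
    proof -
      have "isCont g x" using smooth_on_continuous[OF that] S x continuous_on_eq_continuous_at by blast
      then obtain d1 where d1: "d1 > 0" "\<And>y. dist y x < d1 \<Longrightarrow> \<bar>g y - g x\<bar> < \<epsilon>"
        using \<epsilon> by (auto simp: continuous_at_eps_delta dist_real_def)
      obtain d2 where "d2 > 0" "ball x d2 \<subseteq> S" using S x openE by blast
      then show ?thesis using d1
        by (intro exI[of _ "min d1 d2"]) (auto simp: dist_commute subset_iff)
    qed
    from this[OF smooth_on_dir_deriv[OF smooth_on_dir_deriv[OF f]], of u v]
      this[OF smooth_on_dir_deriv[OF smooth_on_dir_deriv[OF f]], of v u]
    obtain d1 d2 where d: "d1 > 0" "d2 > 0"
      "\<And>y. dist y x < d1 \<Longrightarrow> y \<in> S \<and> \<bar>\<partial> u (\<partial> v f) y - \<partial> u (\<partial> v f) x\<bar> < \<epsilon>"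
      "\<And>y. dist y x < d2 \<Longrightarrow> \<bar>\<partial> v (\<partial> u f) y - \<partial> v (\<partial> u f) x\<bar> < \<epsilon>" by blast
    \<comment> \<open>The parallelogram then stays within half of \<open>min d1 d2\<close> of
      \<open>x\<close>; the summand 1 avoids a zero denominator when both directions vanish.\<close>
    define h where "h = min d1 d2 / (2 * (norm u + norm v + 1))"
    have np: "norm u + norm v + 1 > 0" by (smt (verit) norm_ge_zero)
    then have h: "h > 0" using d by (simp add: h_def)
    have "h * (norm u + norm v + 1) = min d1 d2 / 2"
    proof -
      have "m / (2 * n) * n = m / 2" if "n > 0" for m n :: real using that by simp
      from this[OF np] show ?thesis unfolding h_def .
    qed
    then have hb: "h * (norm u + norm v + 1) < min d1 d2" using d(1,2) by linarith
    have near: "dist (x + s *\<^sub>R u + t *\<^sub>R v) x < min d1 d2"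
      if "0 \<le> s" "s \<le> h" "0 \<le> t" "t \<le> h" for s t
    proof -
      have "dist (x + s *\<^sub>R u + t *\<^sub>R v) x = norm (s *\<^sub>R u + t *\<^sub>R v)"
        by (simp add: dist_norm algebra_simps)
      also have "\<dots> \<le> s * norm u + t * norm v" using that by (metis abs_of_nonneg norm_scaleR norm_triangle_ineq)
      also have "\<dots> \<le> h * norm u + h * norm v" using that by (intro add_mono mult_right_mono) auto
      also have "\<dots> \<le> h * (norm u + norm v + 1)" using h by (simp add: algebra_simps)
      finally show ?thesis using hb by linarith
    qed
    have dif: "f differentiable (at y)" "\<partial> w f differentiable (at y)" if "y \<in> S" for y w
      using smooth_on_differentiable[OF f that] smooth_on_differentiable[OF smooth_on_dir_deriv[OF f] that] .
    have c: "x + s *\<^sub>R v + t *\<^sub>R u = x + t *\<^sub>R u + s *\<^sub>R v" for s t by (simp add: algebra_simps)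
    have S1: "x + s *\<^sub>R u + t *\<^sub>R v \<in> S" and S2: "x + s *\<^sub>R v + t *\<^sub>R u \<in> S"
      if "0 \<le> s" "s \<le> h" "0 \<le> t" "t \<le> h" for s t
      using near[OF that] near[OF that(3,4,1,2)] d(3) by (auto simp: c)
    obtain s t where 1: "0 \<le> s" "s \<le> h" "0 \<le> t" "t \<le> h"
      "f (x + h *\<^sub>R u + h *\<^sub>R v) - f (x + h *\<^sub>R u) - f (x + h *\<^sub>R v) + f x
        = h * h * \<partial> u (\<partial> v f) (x + s *\<^sub>R u + t *\<^sub>R v)"
      using mixed_difference[OF h S1 dif] by auto
    obtain s' t' where 2: "0 \<le> s'" "s' \<le> h" "0 \<le> t'" "t' \<le> h"
      "f (x + h *\<^sub>R v + h *\<^sub>R u) - f (x + h *\<^sub>R v) - f (x + h *\<^sub>R u) + f x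
        = h * h * \<partial> v (\<partial> u f) (x + s' *\<^sub>R v + t' *\<^sub>R u)"
      using mixed_difference[OF h S2 dif] by auto
    have "h * h * \<partial> u (\<partial> v f) (x + s *\<^sub>R u + t *\<^sub>R v) = h * h * \<partial> v (\<partial> u f) (x + t' *\<^sub>R u + s' *\<^sub>R v)"
      using 1(5) 2(5) unfolding c by linarith
    then have "\<partial> u (\<partial> v f) (x + s *\<^sub>R u + t *\<^sub>R v) = \<partial> v (\<partial> u f) (x + t' *\<^sub>R u + s' *\<^sub>R v)"
      using h by simp
    then show ?thesis
      using d(3)[of "x + s *\<^sub>R u + t *\<^sub>R v"] d(4)[of "x + t' *\<^sub>R u + s' *\<^sub>R v"]
        near[OF 1(1-4)] near[OF 2(3,4) 2(1,2)] by auto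
  qed
  \<comment> \<open>With a quarter of the difference as bound, the difference is at most half of
    itself, hence zero.\<close>
  from this[of "\<bar>\<partial> u (\<partial> v f) x - \<partial> v (\<partial> u f) x\<bar> / 4"] show ?thesis by fastforce
qed

lemma dir_deriv_linear:
  assumes "bounded_linear L" "f differentiable (at x)"
  shows "\<partial> v (\<lambda>y. L (f y)) x = L (\<partial> v f x)"
  by (rule dir_deriv_eq[OF bounded_linear.has_derivative[OF assms(1) has_derivative_dir_deriv[OF assms(2)]]])

lemma dir_deriv_commute:
  fixes f :: "'a::real_normed_vector \<Rightarrow> 'b::euclidean_space"
  assumes S: "open S" and f: "smooth_on S f" and x: "x \<in> S"
  shows "\<partial> u (\<partial> v f) x = \<partial> v (\<partial> u f) x"
proof (rule euclidean_eqI)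
  fix b :: 'b assume "b \<in> Basis"
  have *: "\<partial> u (\<partial> v f) x \<bullet> b = \<partial> u (\<partial> v (\<lambda>y. f y \<bullet> b)) x" for u v
  proof -
    have "\<partial> u (\<partial> v f) x \<bullet> b = \<partial> u (\<lambda>y. \<partial> v f y \<bullet> b) x"
      by (rule dir_deriv_linear[OF bounded_linear_inner_left, symmetric])
        (rule smooth_on_differentiable[OF smooth_on_dir_deriv[OF f] x])
    also have "\<dots> = \<partial> u (\<partial> v (\<lambda>y. f y \<bullet> b)) x"
      by (rule differentiable_cong_open(2)[OF S x])
       (use f x in \<open>auto simp: dir_deriv_linear[OF bounded_linear_inner_left] smooth_on_differentiable
          intro!: smooth_on_differentiable[OF smooth_on_dir_deriv[OF smooth_on_inner[OF S f smooth_on_const]]]\<close>)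
    finally show ?thesis .
  qed
  show "\<partial> u (\<partial> v f) x \<bullet> b = \<partial> v (\<partial> u f) x \<bullet> b"
    unfolding * by (rule dir_deriv_commute_real[OF S _ x]) (intro smooth_on_inner S f smooth_on_const)
qed

subsection \<open>Parametrizations of manifolds\<close>

lemma local_parametrization_open_vimage:
  assumes "local_parametrization M U x" "openin M W"
  shows "open (U \<inter> x -` W)"
proof -
  have "continuous_map (top_of_set U) M x"
    using assms(1) unfolding local_parametrization_def
    by (meson continuous_map_in_subtopology homeomorphic_imp_continuous_map)
  from openin_continuous_map_preimage[OF this assms(2)]
  have "openin (top_of_set U) {u \<in> U. x u \<in> W}" by simp
  then have "open {u \<in> U. x u \<in> W}"
    using assms(1) by (simp add: local_parametrization_def openin_open_eq)
  moreover have "{u \<in> U. x u \<in> W} = U \<inter> x -` W" by auto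
  ultimately show ?thesis by simp
qed

lemma local_parametrization_open_image:
  assumes "local_parametrization M U x" "open V" "V \<subseteq> U"
  shows "openin M (x ` V)"
proof -
  have "open_map (top_of_set U) (subtopology M (x ` U)) x"
    using assms(1) unfolding local_parametrization_def by (meson homeomorphic_imp_open_map)
  then have "openin (subtopology M (x ` U)) (x ` V)"
    using assms(2,3) by (meson open_map_def open_subset)
  then show ?thesis
    using assms(1) by (meson local_parametrization_def openin_trans_full)
qed

lemma local_parametrization_inj: "local_parametrization M U x \<Longrightarrow> inj_on x U"
  unfolding local_parametrization_def using homeomorphic_imp_injective_map by fastforce

lemma local_parametrization_restrict:
  assumes "local_parametrization M U x" "open V" "V \<subseteq> U"
  shows "local_parametrization M V x"
proof -
  have "homeomorphic_map (subtopology (top_of_set U) V) (subtopology (subtopology M (x ` U)) (x ` V)) x"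
    using assms unfolding local_parametrization_def
    by (intro homeomorphic_map_subtopologies[of "top_of_set U"]) (auto dest: openin_subset)
  moreover have "x ` U \<inter> x ` V = x ` V" using assms(3) by auto
  ultimately show ?thesis
    using assms local_parametrization_open_image[OF assms]
    by (simp add: local_parametrization_def subtopology_subtopology Int_absorb1)
qed

lemma local_parametrization_comp:
  assumes x: "local_parametrization M U x" and V: "open V" and sub: "m ` V \<subseteq> U"
    and hom: "homeomorphism V (m ` V) m m'" and img: "open (m ` V)"
  shows "local_parametrization M V (x \<circ> m)"
proof -
  have "homeomorphic_map (top_of_set V) (top_of_set (m ` V)) m"
    unfolding homeomorphic_map_maps homeomorphic_maps_def
    using hom by (intro exI[of _ m']) (auto simp: homeomorphism_def)
  moreover have "homeomorphic_map (top_of_set (m ` V)) (subtopology M (x ` m ` V)) x"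
    using local_parametrization_restrict[OF x img sub] by (simp add: local_parametrization_def)
  ultimately have "homeomorphic_map (top_of_set V) (subtopology M (x ` m ` V)) (x \<circ> m)"
    by (rule homeomorphic_map_compose)
  then show ?thesis
    using V local_parametrization_open_image[OF x img sub]
    by (simp add: local_parametrization_def image_comp)
qed

locale oriented_manifold =
  fixes M :: "'a topology" and A :: "('n::finite, 'a) chart set"
  assumes manifold: "connected_oriented_manifold M A"
begin

lemma chart_diffeo: "(U, x) \<in> A \<Longrightarrow> diffeo_onto_open M A U x"
proof -
  assume c: "(U, x) \<in> A"
  have lp: "\<forall>(U, x)\<in>A. local_parametrization M U x"
    and st: "\<forall>(U, x)\<in>A. \<forall>(V, y)\<in>A. smooth_transition U x V y \<and>
        (\<forall>u \<in> U \<inter> x -` (y ` V). det (matrix (frechet_derivative (inv_into V y \<circ> x) (at u))) > 0)"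
    using manifold unfolding connected_oriented_manifold_def by simp_all
  have "local_parametrization M U x" using bspec[OF lp c] by simp
  moreover have "smooth_transition U x V y \<and> smooth_transition V y U x" if "(V, y) \<in> A" for V y
    using bspec[OF bspec[OF st c, simplified split] that] bspec[OF bspec[OF st that, simplified split] c]
    by simp
  ultimately show ?thesis unfolding diffeo_onto_open_def by blast
qed

lemma chart_parametrization: "(U, x) \<in> A \<Longrightarrow> local_parametrization M U x"
  using chart_diffeo diffeo_onto_open_def by blast

lemma chart_exists:
  assumes "p \<in> topspace M"
  obtains U x u where "(U, x) \<in> A" "u \<in> U" "x u = p"
proof -
  have "p \<in> (\<Union>(U, x)\<in>A. x ` U)"
    using assms manifold by (simp add: connected_oriented_manifold_def)
  then show ?thesis using that by auto
qed

lemma diffeo_image_subset: "diffeo_onto_open M A D G \<Longrightarrow> G ` D \<subseteq> topspace M"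
  unfolding diffeo_onto_open_def local_parametrization_def using openin_subset by blast

lemma diffeo_open: "diffeo_onto_open M A D G \<Longrightarrow> open D" "diffeo_onto_open M A D G \<Longrightarrow> openin M (G ` D)"
  unfolding diffeo_onto_open_def local_parametrization_def by auto

lemma diffeo_inj: "diffeo_onto_open M A D G \<Longrightarrow> inj_on G D"
  unfolding diffeo_onto_open_def using local_parametrization_inj by blast

lemma diffeo_onto_open_comp:
  fixes m m' :: "real ^ 'n::finite \<Rightarrow> real ^ 'n"
  assumes G: "diffeo_onto_open M A D G" and V: "open V" and sub: "m ` V \<subseteq> D" and img: "open (m ` V)"
    and m: "smooth_on V m" and m': "smooth_on (m ` V) m'" and inv: "\<And>u. u \<in> V \<Longrightarrow> m' (m u) = u"
  shows "diffeo_onto_open M A V (G \<circ> m)"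
  unfolding diffeo_onto_open_def
proof (intro conjI ballI)
  have lpG: "local_parametrization M D G" using G by (simp add: diffeo_onto_open_def)
  have hom: "homeomorphism V (m ` V) m m'"
    using inv smooth_on_continuous[OF m] smooth_on_continuous[OF m'] by (auto simp: homeomorphism_def image_iff)
  show lp: "local_parametrization M V (G \<circ> m)" by (rule local_parametrization_comp[OF lpG V sub hom img])
  have injG: "inj_on G D" by (rule local_parametrization_inj[OF lpG])
  have injm: "inj_on m V" using inv by (metis inj_on_inverseI)
  fix c assume c: "c \<in> A"
  obtain U y where [simp]: "c = (U, y)" by force
  have GU: "smooth_transition D G U y" "smooth_transition U y D G"
    using G c by (auto simp: diffeo_onto_open_def)
  have lpU: "local_parametrization M U y" using chart_parametrization c by simp
  have "smooth_transition V (G \<circ> m) U y \<and> smooth_transition U y V (G \<circ> m)"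
    unfolding smooth_transition_def
    proof (intro conjI)
      have o1: "open (V \<inter> (G \<circ> m) -` (y ` U))"
        by (rule local_parametrization_open_vimage[OF lp]) (use lpU in \<open>simp add: local_parametrization_def\<close>)
      have o2: "open (D \<inter> G -` (y ` U))"
        by (rule local_parametrization_open_vimage[OF lpG]) (use lpU in \<open>simp add: local_parametrization_def\<close>)
      have "smooth_on (V \<inter> (G \<circ> m) -` (y ` U)) (\<lambda>u. (inv_into U y \<circ> G) (m u))"
        using GU(1) sub by (intro smooth_on_compose[OF o1 o2 _ smooth_on_subset[OF m]])
          (auto simp: smooth_transition_def o_def)
      then show "smooth_on (V \<inter> (G \<circ> m) -` (y ` U)) (inv_into U y \<circ> (G \<circ> m))"
        by (simp add: comp_def)
      have o3: "open (U \<inter> y -` ((G \<circ> m) ` V))"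
        by (rule local_parametrization_open_vimage[OF lpU]) (use lp in \<open>simp add: local_parametrization_def\<close>)
      have e: "inv_into D G (y u) \<in> m ` V" "m' (inv_into D G (y u)) = inv_into V (G \<circ> m) (y u)"
        if "u \<in> U \<inter> y -` ((G \<circ> m) ` V)" for u
      proof -
        from that obtain v where v: "v \<in> V" "y u = G (m v)" by auto
        have "m v \<in> D" using v sub by auto
        then have i: "inv_into D G (y u) = m v" using v injG by simp
        have "inv_into V (G \<circ> m) (y u) = v"
          using v injm injG sub inv_into_f_f[of "G \<circ> m" V v] by (simp add: comp_inj_on inj_on_subset)
        then show "inv_into D G (y u) \<in> m ` V" "m' (inv_into D G (y u)) = inv_into V (G \<circ> m) (y u)"
          using i inv v by auto
      qed
      have "smooth_on (U \<inter> y -` ((G \<circ> m) ` V)) (\<lambda>u. m' ((inv_into D G \<circ> y) u))"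
        using sub e
        by (intro smooth_on_compose[OF o3 img _ smooth_on_subset[OF GU(2)[unfolded smooth_transition_def]] m'])
          auto
      then show "smooth_on (U \<inter> y -` ((G \<circ> m) ` V)) (inv_into V (G \<circ> m) \<circ> y)"
        by (rule smooth_on_cong[OF o3, rotated]) (use e in auto)
    qed
  then show "case c of (U, y) \<Rightarrow> smooth_transition V (G \<circ> m) U y \<and> smooth_transition U y V (G \<circ> m)"
    by simp
qed

lemma transition_to:
  fixes f :: "'a \<Rightarrow> 'b::real_normed_vector"
  assumes G: "diffeo_onto_open M A D G" and c: "(U, x) \<in> A"
  defines "Q \<equiv> U \<inter> x -` (G ` D)" and "\<tau> \<equiv> inv_into D G \<circ> x"
  shows "open Q" "smooth_on Q \<tau>" "\<tau> ` Q \<subseteq> D" "\<And>u. u \<in> Q \<Longrightarrow> G (\<tau> u) = x u"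
proof -
  show "open Q" unfolding Q_def
    by (rule local_parametrization_open_vimage[OF chart_parametrization[OF c] diffeo_open(2)[OF G]])
  show "smooth_on Q \<tau>"
    using G c by (auto simp: diffeo_onto_open_def smooth_transition_def Q_def \<tau>_def)
  show "\<tau> ` Q \<subseteq> D" "\<And>u. u \<in> Q \<Longrightarrow> G (\<tau> u) = x u"
    by (auto simp: Q_def \<tau>_def inv_into_into f_inv_into_f)
qed

lemma transition_from:
  assumes G: "diffeo_onto_open M A D G" and c: "(U, x) \<in> A"
  defines "Q \<equiv> D \<inter> G -` (x ` U)" and "\<tau> \<equiv> inv_into U x \<circ> G"
  shows "open Q" "smooth_on Q \<tau>" "\<tau> ` Q \<subseteq> U" "\<And>u. u \<in> Q \<Longrightarrow> x (\<tau> u) = G u"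
proof -
  have "openin M (x ` U)" using diffeo_open(2)[OF chart_diffeo[OF c]] .
  then show "open Q" unfolding Q_def
    using local_parametrization_open_vimage G by (auto simp: diffeo_onto_open_def)
  show "smooth_on Q \<tau>"
    using G c by (auto simp: diffeo_onto_open_def smooth_transition_def Q_def \<tau>_def)
  show "\<tau> ` Q \<subseteq> U" "\<And>u. u \<in> Q \<Longrightarrow> x (\<tau> u) = G u"
    by (auto simp: Q_def \<tau>_def inv_into_into f_inv_into_f)
qed

text \<open>\<open>smooth_map_on\<close> tests the charts of \<open>A\<close> only. The adapted
  charts used later are compatible with the atlas but need not belong to it, so smoothness has to be
  transferred through the transition maps.\<close>

lemma smooth_map_onD:
  fixes f :: "'a \<Rightarrow> 'b::real_normed_vector"
  assumes f: "smooth_map_on A W f" and W: "openin M W" and G: "diffeo_onto_open M A D G"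
  shows "smooth_on (D \<inter> G -` W) (\<lambda>y. f (G y))"
proof (rule smooth_on_local)
  fix y assume y: "y \<in> D \<inter> G -` W"
  obtain U x u where c: "(U, x) \<in> A" "u \<in> U" "x u = G y"
    by (rule chart_exists[of "G y"]) (use y openin_subset[OF W] in auto)
  note t = transition_from[OF G c(1)]
  let ?\<tau> = "inv_into U x \<circ> G"
  have o1: "open (U \<inter> x -` W)" by (rule local_parametrization_open_vimage[OF chart_parametrization[OF c(1)] W])
  have oW: "open (D \<inter> G -` W)"
    using local_parametrization_open_vimage[OF _ W, of D G] G by (auto simp: diffeo_onto_open_def)
  let ?V = "D \<inter> G -` W \<inter> (D \<inter> G -` (x ` U))"
  have oV: "open ?V" using oW t(1) by auto
  have "smooth_on (U \<inter> x -` W) (f \<circ> x)" using f c(1) by (auto simp: smooth_map_on_def)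
  moreover have "?\<tau> ` ?V \<subseteq> U \<inter> x -` W" using t(3,4) by force
  ultimately have "smooth_on ?V (\<lambda>y. (f \<circ> x) (?\<tau> y))"
    by (intro smooth_on_compose[OF oV o1 _ smooth_on_subset[OF t(2)]]) (auto simp: o_def)
  then have "smooth_on ?V (\<lambda>y. f (G y))"
    by (rule smooth_on_cong[OF oV, rotated]) (use t(4) in auto)
  moreover have "y \<in> ?V" using y c by (auto intro: rev_image_eqI)
  ultimately show "\<exists>V. open V \<and> y \<in> V \<and> smooth_on V (\<lambda>y. f (G y))" using oV by blast
qed

lemma smooth_map_onI:
  fixes f :: "'a \<Rightarrow> 'b::real_normed_vector"
  assumes "\<And>p. p \<in> W \<Longrightarrow> \<exists>D G. diffeo_onto_open M A D G \<and> p \<in> G ` D \<and> smooth_on D (\<lambda>y. f (G y))"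
  shows "smooth_map_on A W f"
  unfolding smooth_map_on_def
proof (clarify, rule smooth_on_local)
  fix U x u assume c: "(U, x) \<in> A" and u: "u \<in> U \<inter> x -` W"
  then obtain D G where G: "diffeo_onto_open M A D G" "x u \<in> G ` D" "smooth_on D (\<lambda>y. f (G y))"
    using assms[of "x u"] by auto
  note t = transition_to[OF G(1) c]
  have "smooth_on (U \<inter> x -` (G ` D)) (\<lambda>u. f (G ((inv_into D G \<circ> x) u)))"
    by (rule smooth_on_compose[OF t(1) diffeo_open(1)[OF G(1)] t(3,2) G(3)])
  then have "smooth_on (U \<inter> x -` (G ` D)) (f \<circ> x)"
    by (rule smooth_on_cong[OF t(1), rotated]) (use t(4) in auto)
  then show "\<exists>V. open V \<and> u \<in> V \<and> smooth_on V (f \<circ> x)" using t(1) u G(2) by blast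
qed

lemma chain_to:
  fixes f :: "'a \<Rightarrow> 'b::real_normed_vector"
  assumes G: "diffeo_onto_open M A D G" and c: "(U, x) \<in> A" and u: "u \<in> U" and y: "y \<in> D" and eq: "x u = G y"
    and f: "(\<lambda>y. f (G y)) differentiable (at y)"
  shows "(f \<circ> x) differentiable (at u)"
    "\<partial> \<zeta> (f \<circ> x) u = \<partial> (\<partial> \<zeta> (inv_into D G \<circ> x) u) (\<lambda>y. f (G y)) y"
proof -
  note t = transition_to[OF G c]
  let ?\<tau> = "inv_into D G \<circ> x"
  have u': "u \<in> U \<inter> x -` (G ` D)" using u y eq by auto
  have \<tau>u: "?\<tau> u = y" using eq y diffeo_inj[OF G] by simp
  have "((\<lambda>u. f (G (?\<tau> u))) has_derivative (\<lambda>\<zeta>. \<partial> (\<partial> \<zeta> ?\<tau> u) (\<lambda>y. f (G y)) y)) (at u)"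
    using has_derivative_compose[OF smooth_on_has_derivative[OF t(2) u'], of "\<lambda>y. f (G y)"]
      has_derivative_dir_deriv[OF f] \<tau>u by simp
  then have *: "((f \<circ> x) has_derivative (\<lambda>\<zeta>. \<partial> (\<partial> \<zeta> ?\<tau> u) (\<lambda>y. f (G y)) y)) (at u)"
    by (rule has_derivative_transform_within_open[OF _ t(1) u']) (use t(4) in auto)
  then show "(f \<circ> x) differentiable (at u)" by (auto simp: differentiable_def)
  show "\<partial> \<zeta> (f \<circ> x) u = \<partial> (\<partial> \<zeta> ?\<tau> u) (\<lambda>y. f (G y)) y" by (rule dir_deriv_eq[OF *])
qed

lemma chain_from:
  fixes f :: "'a \<Rightarrow> 'b::real_normed_vector"
  assumes G: "diffeo_onto_open M A D G" and c: "(U, x) \<in> A" and u: "u \<in> U" and y: "y \<in> D" and eq: "x u = G y"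
    and f: "(f \<circ> x) differentiable (at u)"
  shows "\<partial> \<zeta> (\<lambda>y. f (G y)) y = \<partial> (\<partial> \<zeta> (inv_into U x \<circ> G) y) (f \<circ> x) u"
proof -
  note t = transition_from[OF G c]
  let ?\<tau> = "inv_into U x \<circ> G"
  have y': "y \<in> D \<inter> G -` (x ` U)" using u y eq by (auto intro: rev_image_eqI)
  have \<tau>y: "?\<tau> y = u" using eq u diffeo_inj[OF chart_diffeo[OF c]] by (metis comp_apply inv_into_f_f)
  have "((\<lambda>y. (f \<circ> x) (?\<tau> y)) has_derivative (\<lambda>\<zeta>. \<partial> (\<partial> \<zeta> ?\<tau> y) (f \<circ> x) u)) (at y)"
    using has_derivative_compose[OF smooth_on_has_derivative[OF t(2) y'], of "f \<circ> x"]
      has_derivative_dir_deriv[OF f] \<tau>y by simp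
  then have *: "((\<lambda>y. f (G y)) has_derivative (\<lambda>\<zeta>. \<partial> (\<partial> \<zeta> ?\<tau> y) (f \<circ> x) u)) (at y)"
    by (rule has_derivative_transform_within_open[OF _ t(1) y']) (use t(4) in auto)
  show ?thesis by (rule dir_deriv_eq[OF *])
qed

text \<open>The tangent space is defined as a union over all charts through the point. The chain
  rule in both directions shows that a single compatible parametrization already yields all of
  it.\<close>

lemma tangent_space_eq:
  fixes \<phi> :: "'a \<Rightarrow> real ^ 'm::finite"
  assumes G: "diffeo_onto_open M A D G" and y: "y \<in> D" and \<phi>: "(\<lambda>y. \<phi> (G y)) differentiable (at y)"
  shows "tangent_space A \<phi> (G y) = range (\<lambda>\<zeta>. \<partial> \<zeta> (\<lambda>y. \<phi> (G y)) y)"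
proof
  show "tangent_space A \<phi> (G y) \<subseteq> range (\<lambda>\<zeta>. \<partial> \<zeta> (\<lambda>y. \<phi> (G y)) y)"
  proof
    fix X assume "X \<in> tangent_space A \<phi> (G y)"
    then obtain U x u \<zeta> where c: "(U, x) \<in> A" "u \<in> U" "x u = G y" "X = \<partial> \<zeta> (\<phi> \<circ> x) u"
      by (auto simp: tangent_space_def dir_deriv_def)
    then show "X \<in> range (\<lambda>\<zeta>. \<partial> \<zeta> (\<lambda>y. \<phi> (G y)) y)"
      using chain_to(2)[OF G c(1,2) y c(3) \<phi>] by auto
  qed
  show "range (\<lambda>\<zeta>. \<partial> \<zeta> (\<lambda>y. \<phi> (G y)) y) \<subseteq> tangent_space A \<phi> (G y)"
  proof clarify
    fix \<zeta>
    obtain U x u where c: "(U, x) \<in> A" "u \<in> U" "x u = G y"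
      by (rule chart_exists[of "G y"]) (use y diffeo_image_subset[OF G] in auto)
    then show "\<partial> \<zeta> (\<lambda>y. \<phi> (G y)) y \<in> tangent_space A \<phi> (G y)"
      using chain_from[OF G c(1,2) y c(3) chain_to(1)[OF G c(1,2) y c(3) \<phi>], of \<zeta>]
      by (auto simp: tangent_space_def dir_deriv_def intro!: bexI[OF _ c(1)])
  qed
qed

text \<open>Injectivity of the differential lets the tangent vector determine its coordinate vector,
  so the description operator has exactly one candidate, whichever chart is taken.\<close>

lemma deriv_along_eq:
  fixes \<phi> :: "'a \<Rightarrow> real ^ 'm::finite" and f :: "'a \<Rightarrow> 'b::real_normed_vector"
  assumes G: "diffeo_onto_open M A D G" and y: "y \<in> D" and \<phi>: "(\<lambda>y. \<phi> (G y)) differentiable (at y)"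
    and inj: "inj (\<lambda>\<zeta>. \<partial> \<zeta> (\<lambda>y. \<phi> (G y)) y)" and f: "(\<lambda>y. f (G y)) differentiable (at y)"
  shows "deriv_along A \<phi> f (G y) (\<partial> \<zeta> (\<lambda>y. \<phi> (G y)) y) = \<partial> \<zeta> (\<lambda>y. f (G y)) y"
  unfolding deriv_along_def
proof (rule the_equality)
  obtain U x u where c: "(U, x) \<in> A" "u \<in> U" "x u = G y"
    by (rule chart_exists[of "G y"]) (use y diffeo_image_subset[OF G] in auto)
  show "\<exists>(U, x)\<in>A. \<exists>u\<in>U. x u = G y \<and>
      (\<exists>\<zeta>'. \<partial> \<zeta> (\<lambda>y. \<phi> (G y)) y = frechet_derivative (\<phi> \<circ> x) (at u) \<zeta>' \<and>
        \<partial> \<zeta> (\<lambda>y. f (G y)) y = frechet_derivative (f \<circ> x) (at u) \<zeta>')"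
    using chain_from[OF G c(1,2) y c(3) chain_to(1)[OF G c(1,2) y c(3) \<phi>], of \<zeta>]
      chain_from[OF G c(1,2) y c(3) chain_to(1)[OF G c(1,2) y c(3) f], of \<zeta>]
    by (intro bexI[OF _ c(1)]) (use c(2,3) in \<open>auto simp: dir_deriv_def\<close>)
next
  fix d
  assume "\<exists>(U, x)\<in>A. \<exists>u\<in>U. x u = G y \<and>
      (\<exists>\<zeta>'. \<partial> \<zeta> (\<lambda>y. \<phi> (G y)) y = frechet_derivative (\<phi> \<circ> x) (at u) \<zeta>' \<and>
        d = frechet_derivative (f \<circ> x) (at u) \<zeta>')"
  then obtain U x u \<zeta>' where c: "(U, x) \<in> A" "u \<in> U" "x u = G y"
    "\<partial> \<zeta> (\<lambda>y. \<phi> (G y)) y = \<partial> \<zeta>' (\<phi> \<circ> x) u" "d = \<partial> \<zeta>' (f \<circ> x) u"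
    by (auto simp: dir_deriv_def)
  note ch = chain_to(2)[OF G c(1,2) y c(3)]
  have "\<partial> \<zeta>' (inv_into D G \<circ> x) u = \<zeta>"
    using c(4) ch[of \<phi> \<zeta>', OF \<phi>] inj by (metis (mono_tags, lifting) injD)
  then show "d = \<partial> \<zeta> (\<lambda>y. f (G y)) y" using c(5) ch[of f \<zeta>', OF f] by simp
qed

lemma locally_constant:
  assumes "\<And>p. p \<in> topspace M \<Longrightarrow> \<exists>Q. openin M Q \<and> p \<in> Q \<and> (\<forall>q\<in>Q. g q = g p)"
    and "p \<in> topspace M" "q \<in> topspace M"
  shows "g p = g q"
proof (rule ccontr)
  assume ne: "g p \<noteq> g q"
  have conn: "connected_space M" using manifold by (simp add: connected_oriented_manifold_def)
  have op: "openin M {r \<in> topspace M. P (g r)}" for P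
  proof (subst openin_subopen, clarify)
    fix r assume r: "r \<in> topspace M" "P (g r)"
    obtain Q where Q: "openin M Q" "r \<in> Q" "\<forall>q\<in>Q. g q = g r" using assms(1)[OF r(1)] by blast
    have "Q \<subseteq> {r \<in> topspace M. P (g r)}"
    proof
      fix q assume "q \<in> Q"
      then have "g q = g r" "q \<in> topspace M" using Q(3) openin_subset[OF Q(1)] by blast+
      with r(2) show "q \<in> {r \<in> topspace M. P (g r)}" by simp
    qed
    with Q(1,2) show "\<exists>T. openin M T \<and> r \<in> T \<and> T \<subseteq> {r \<in> topspace M. P (g r)}" by blast
  qed
  have "openin M {r \<in> topspace M. g r = g p}" "openin M {r \<in> topspace M. g r \<noteq> g p}"
    using op[of "\<lambda>z. z = g p"] op[of "\<lambda>z. z \<noteq> g p"] by auto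
  moreover have "topspace M \<subseteq> {r \<in> topspace M. g r = g p} \<union> {r \<in> topspace M. g r \<noteq> g p}" by auto
  moreover have "{r \<in> topspace M. g r = g p} \<inter> {r \<in> topspace M. g r \<noteq> g p} = {}" by auto
  moreover have "{r \<in> topspace M. g r = g p} \<noteq> {}" "{r \<in> topspace M. g r \<noteq> g p} \<noteq> {}"
    using assms(2,3) ne by auto
  ultimately show False using conn unfolding connected_space_def by blast
qed

end

subsection \<open>The Codazzi equations in a canonical frame\<close>

definition \<epsilon> :: "nat \<Rightarrow> real" where "\<epsilon> i = (if i = 0 then -1 else 1)"

text \<open>The components of the third derivative of the graph function in a canonical frame
  \<open>T\<close>, \<open>V\<close>, \<open>W\<close>, numbered 0, 1, 2, with \<open>a\<close> for
  a_4 and \<open>b\<close> for a_6: minus twice h(K(e_i, e_j), e_k). Counting the indices 1 and 2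
  builds the total symmetry into the formula.\<close>

definition cub :: "real \<Rightarrow> real \<Rightarrow> nat \<Rightarrow> nat \<Rightarrow> nat \<Rightarrow> real" where
  "cub a b i j k =
     (let m = of_bool (i = 1) + of_bool (j = 1) + of_bool (k = 1) :: nat;
          n = of_bool (i = 2) + of_bool (j = 2) + of_bool (k = 2) :: nat
      in if m = 0 \<and> n = 0 then - 4 * a else if m = 2 \<and> n = 0 \<or> m = 0 \<and> n = 2 then - 2 * a
         else if m = 3 then - 2 * b else if m = 1 \<and> n = 2 then 2 * b else 0)"

lemma sum_upto_3: "(\<Sum>m<3::nat. f m) = f 0 + f 1 + (f 2 :: 'a::comm_monoid_add)"
  by (simp add: numeral_3_eq_3 numeral_2_eq_2 add.assoc)

declare One_nat_def [simp del]

text \<open>\<open>g i j k\<close> stands for \<open>h(D\<^sub>X Y, Z)\<close> with \<open>X, Y, Z\<close> the frame fields of index \<open>i, j, k\<close>, and \<open>da\<close>, \<open>db\<close>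
  for the derivatives of \<open>a\<close>, \<open>b\<close> along the frame.\<close>

locale codazzi =
  fixes a b :: real and da db :: "nat \<Rightarrow> real" and g :: "nat \<Rightarrow> nat \<Rightarrow> nat \<Rightarrow> real"
  assumes a: "a > 0"
    and metric: "\<And>i j k. i < 3 \<Longrightarrow> j < 3 \<Longrightarrow> k < 3 \<Longrightarrow> g i j k + g i k j = - cub a b i j k"
    and codazzi: "\<And>i j k l. i < 3 \<Longrightarrow> j < 3 \<Longrightarrow> k < 3 \<Longrightarrow> l < 3 \<Longrightarrow>
      cub (da i) (db i) j k l - (\<Sum>m<3. \<epsilon> m * (g i j m * cub a b m k l + g i k m * cub a b j m l + g i l m * cub a b j k m))
      = cub (da j) (db j) i k l - (\<Sum>m<3. \<epsilon> m * (g j i m * cub a b m k l + g j k m * cub a b i m l + g j l m * cub a b i k m))"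
begin

text \<open>Differentiating the constants h(e_j, e_k) gives 18 equations for the 27 coefficients.
  What remains unknown is \<open>g i 0 1\<close>, \<open>g i 0 2\<close> and
  \<open>g i 1 2\<close>.\<close>

lemma metric_eqs:
  "g 0 0 0 = 2 * a" "g 1 0 0 = 0" "g 2 0 0 = 0"
  "g 0 1 0 = - g 0 0 1" "g 1 1 0 = 2 * a - g 1 0 1" "g 2 1 0 = - g 2 0 1"
  "g 0 2 0 = - g 0 0 2" "g 1 2 0 = - g 1 0 2" "g 2 2 0 = 2 * a - g 2 0 2"
  "g 0 1 1 = a" "g 1 1 1 = b" "g 2 1 1 = 0"
  "g 0 2 1 = - g 0 1 2" "g 1 2 1 = - g 1 1 2" "g 2 2 1 = - 2 * b - g 2 1 2"
  "g 0 2 2 = a" "g 1 2 2 = - b" "g 2 2 2 = 0"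
  using metric[of 0 0 0] metric[of 1 0 0] metric[of 2 0 0]
    metric[of 0 1 0] metric[of 1 1 0] metric[of 2 1 0]
    metric[of 0 2 0] metric[of 1 2 0] metric[of 2 2 0]
    metric[of 0 1 1] metric[of 1 1 1] metric[of 2 1 1]
    metric[of 0 2 1] metric[of 1 2 1] metric[of 2 2 1]
    metric[of 0 2 2] metric[of 1 2 2] metric[of 2 2 2]
  by (simp_all add: cub_def)

lemmas codazzi_simps = sum_upto_3 cub_def \<epsilon>_def

text \<open>In the component (i, 0, 0, 0) everything cancels except the derivative of
  \<open>a\<close> along e_i and the e_i-component of the flat derivative of \<open>T\<close> along
  itself.\<close>

lemma eqA: "da 1 = - 2 * a * g 0 0 1" "da 2 = - 2 * a * g 0 0 2"
proof -
  show "da 1 = - 2 * a * g 0 0 1"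
    using codazzi[of 1 0 0 0, simplified, simplified codazzi_simps, simplified, unfolded metric_eqs] by algebra
  show "da 2 = - 2 * a * g 0 0 2"
    using codazzi[of 2 0 0 0, simplified, simplified codazzi_simps, simplified, unfolded metric_eqs] by algebra
qed

lemma eqB: "4 * a * g 1 0 1 = 4 * a * a - da 0 + b * g 0 0 1"
  "4 * a * g 2 0 2 = 4 * a * a - da 0 - b * g 0 0 1"
  "4 * a * g 1 0 2 = - b * g 0 0 2" "4 * a * g 2 0 1 = - b * g 0 0 2"
proof -
  show "4 * a * g 1 0 1 = 4 * a * a - da 0 + b * g 0 0 1"
    using codazzi[of 1 0 1 0, simplified, simplified codazzi_simps, simplified, unfolded metric_eqs]
    by (((simp only: algebra_simps)?; linarith) | algebra)
  show "4 * a * g 2 0 2 = 4 * a * a - da 0 - b * g 0 0 1"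
    using codazzi[of 2 0 2 0, simplified, simplified codazzi_simps, simplified, unfolded metric_eqs]
    by (((simp only: algebra_simps)?; linarith) | algebra)
  show "4 * a * g 1 0 2 = - b * g 0 0 2"
    using codazzi[of 1 0 2 0, simplified, simplified codazzi_simps, simplified, unfolded metric_eqs]
    by (((simp only: algebra_simps)?; linarith) | algebra)
  show "4 * a * g 2 0 1 = - b * g 0 0 2"
    using codazzi[of 2 0 1 0, simplified, simplified codazzi_simps, simplified, unfolded metric_eqs]
    by (((simp only: algebra_simps)?; linarith) | algebra)
qed

text \<open>The components of the derivative of \<open>T\<close> along itself and the derivative of
  \<open>a\<close> along \<open>T\<close>, divided by \<open>4 * a\<close>: in these unknowns
  \<open>eqA\<close> and \<open>eqB\<close> are solved without denominators, and the remaining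
  equations are polynomial.\<close>

definition "P = g 0 0 1 / (4 * a)"
definition "Q = g 0 0 2 / (4 * a)"
definition "d = da 0 / (4 * a)"

lemma PQ_eqs:
  "g 0 0 1 = 4 * a * P" "g 0 0 2 = 4 * a * Q" "da 0 = 4 * a * d"
  "da 1 = - 8 * a * a * P" "da 2 = - 8 * a * a * Q"
  "g 1 0 1 = a - d + b * P" "g 2 0 2 = a - d - b * P" "g 1 0 2 = - b * Q" "g 2 0 1 = - b * Q"
proof -
  show 1: "g 0 0 1 = 4 * a * P" "g 0 0 2 = 4 * a * Q" "da 0 = 4 * a * d"
    using a by (auto simp: P_def Q_def d_def)
  show "da 1 = - 8 * a * a * P" "da 2 = - 8 * a * a * Q"
    using eqA by (auto simp: 1)
  have "4 * a * g 1 0 1 = 4 * a * (a - d + b * P)" "4 * a * g 2 0 2 = 4 * a * (a - d - b * P)"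
    "4 * a * g 1 0 2 = 4 * a * (- b * Q)" "4 * a * g 2 0 1 = 4 * a * (- b * Q)"
    by (simp_all only: eqB 1) (simp_all add: algebra_simps)
  then show "g 1 0 1 = a - d + b * P" "g 2 0 2 = a - d - b * P" "g 1 0 2 = - b * Q" "g 2 0 1 = - b * Q"
    using a mult_left_cancel[of "4 * a"] by (metis mult_eq_0_iff order_less_irrefl zero_neq_numeral)+
qed

text \<open>The components (1, 2, 0, 2) and (1, 2, 0, 1) after elimination. Wherever
  \<open>T\<close> has a derivative along itself that is not a multiple of \<open>T\<close>, they
  force b^2 = 4 a^2; this is the exceptional case.\<close>

lemma eqC: "(b * b - 4 * a * a) * P = 0" "(b * b - 4 * a * a) * Q = 0"
proof -
  show "(b * b - 4 * a * a) * P = 0"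
    using codazzi[of 1 2 0 2, simplified, simplified codazzi_simps, simplified, unfolded metric_eqs PQ_eqs]
    by (((simp only: algebra_simps)?; linarith) | algebra)
  show "(b * b - 4 * a * a) * Q = 0"
    using codazzi[of 1 2 0 1, simplified, simplified codazzi_simps, simplified, unfolded metric_eqs PQ_eqs]
    by (((simp only: algebra_simps)?; linarith) | algebra)
qed

text \<open>In the exceptional case the derivatives of \<open>b\<close> repeat those of
  \<open>a\<close>, so the components (0, 1, 1, 1), (0, 1, 1, 2), (1, 2, 1, 1) and (1, 2, 1, 2) can
  be solved for the derivative of \<open>a\<close> along \<open>T\<close> and for the coefficients
  \<open>g i 1 2\<close>.\<close>

lemma eqD:
  assumes "b = 2 * a" "\<And>i. i < 3 \<Longrightarrow> db i = 2 * da i"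
  shows "da 0 = 0" "g 0 1 2 = 0" "g 1 1 2 = - g 0 0 2 / 2" "g 2 1 2 = g 0 0 1 / 2 - 2 * a"
proof -
  have db: "db 0 = 2 * da 0" "db 1 = 2 * da 1" "db 2 = 2 * da 2" using assms(2) by auto
  have "a * d = 0"
    using codazzi[of 0 1 1 1, simplified, simplified codazzi_simps, simplified, unfolded metric_eqs db PQ_eqs assms(1)]
    by (((simp only: algebra_simps)?; linarith) | algebra)
  moreover have "a * g 0 1 2 = 0"
    using codazzi[of 0 1 1 2, simplified, simplified codazzi_simps, simplified, unfolded metric_eqs db PQ_eqs assms(1)]
    by (((simp only: algebra_simps)?; linarith) | algebra)
  moreover have "a * (g 1 1 2 + 2 * a * Q) = 0"
    using codazzi[of 1 2 1 1, simplified, simplified codazzi_simps, simplified, unfolded metric_eqs db PQ_eqs assms(1)]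
    by (((simp only: algebra_simps)?; linarith) | algebra)
  moreover have "a * (g 2 1 2 - 2 * a * P + 2 * a) = 0"
    using codazzi[of 1 2 1 2, simplified, simplified codazzi_simps, simplified, unfolded metric_eqs db PQ_eqs assms(1)]
    by (((simp only: algebra_simps)?; linarith) | algebra)
  ultimately show "da 0 = 0" "g 0 1 2 = 0" "g 1 1 2 = - g 0 0 2 / 2" "g 2 1 2 = g 0 0 1 / 2 - 2 * a"
    using a by (auto simp: PQ_eqs)
qed

end

text \<open>\<open>dg i j k l\<close> stands for the derivative of \<open>g j k l\<close> along e_i.
  The equation \<open>flat\<close> expresses that the flat connection has no curvature; its
  \<open>cub\<close> terms arise from differentiating h inside \<open>g\<close>, its last term from
  the bracket of e_i and e_j. The assumptions \<open>dg1\<close> to \<open>dg4\<close> are the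
  derivatives of relations among the \<open>g\<close> that hold in the exceptional case.\<close>

locale codazzi_flat = codazzi +
  fixes dg :: "nat \<Rightarrow> nat \<Rightarrow> nat \<Rightarrow> nat \<Rightarrow> real"
  assumes flat: "\<And>i j k l. i < 3 \<Longrightarrow> j < 3 \<Longrightarrow> k < 3 \<Longrightarrow> l < 3 \<Longrightarrow>
      dg i j k l - dg j i k l = (\<Sum>m<3. \<epsilon> m * (g j k m * cub a b i m l - g i k m * cub a b j m l
        + g j k m * g i l m - g i k m * g j l m + (g i j m - g j i m) * g m k l))"
    and b: "b = 2 * a" and db: "\<And>i. i < 3 \<Longrightarrow> db i = 2 * da i"
    and dg1: "\<And>i. i < 3 \<Longrightarrow> dg i 1 0 1 = da i + dg i 0 0 1 / 2"
    and dg2: "\<And>i. i < 3 \<Longrightarrow> dg i 2 0 2 = da i - dg i 0 0 1 / 2"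
    and dg3: "\<And>i. i < 3 \<Longrightarrow> dg i 2 2 1 = - 2 * da i - dg i 0 0 1 / 2"
    and dg4: "\<And>i. i < 3 \<Longrightarrow> dg i 1 2 1 = dg i 0 0 2 / 2"
begin

text \<open>The Ricci curvature in the direction of the timelike field and the sectional curvature of its
  orthogonal complement give two different values for the same divergence.\<close>

lemma contradiction: False
proof -
  have db': "db 0 = 2 * da 0" "db 1 = 2 * da 1" "db 2 = 2 * da 2" using db by auto
  note D = eqD[OF b db, simplified]
  note g = PQ_eqs(6-9)[unfolded b]
  have dgs: "dg 0 1 0 1 = da 0 + dg 0 0 0 1 / 2" "dg 0 2 0 2 = da 0 - dg 0 0 0 1 / 2"
    "dg 1 2 2 1 = - 2 * da 1 - dg 1 0 0 1 / 2" "dg 2 1 2 1 = dg 2 0 0 2 / 2"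
    by (simp_all add: dg1 dg2 dg3 dg4)
  note facts = flat[of 0 1 0 1, simplified, simplified codazzi_simps, simplified, unfolded metric_eqs dgs D PQ_eqs b]
    flat[of 0 2 0 2, simplified, simplified codazzi_simps, simplified, unfolded metric_eqs dgs D PQ_eqs b]
    flat[of 1 2 2 1, simplified, simplified codazzi_simps, simplified, unfolded metric_eqs dgs D PQ_eqs b]
  have d: "d = 0" using D(1) a by (simp add: d_def)
  have "a * a = 0" using facts[unfolded d, simplified]
    by (simp only: algebra_simps add_divide_distrib diff_divide_distrib)
  then show False using a by simp
qed

end

section \<open>Higher derivatives as symmetric multilinear forms\<close>

definition hess :: "('n::real_normed_vector \<Rightarrow> real) \<Rightarrow> 'n \<Rightarrow> 'n \<Rightarrow> 'n \<Rightarrow> real"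
  where "hess F y u v = \<partial> u (\<partial> v F) y"

definition third :: "('n::real_normed_vector \<Rightarrow> real) \<Rightarrow> 'n \<Rightarrow> 'n \<Rightarrow> 'n \<Rightarrow> 'n \<Rightarrow> real"
  where "third F y u v w = \<partial> u (\<partial> v (\<partial> w F)) y"

definition fourth :: "('n::real_normed_vector \<Rightarrow> real) \<Rightarrow> 'n \<Rightarrow> 'n \<Rightarrow> 'n \<Rightarrow> 'n \<Rightarrow> 'n \<Rightarrow> real"
  where "fourth F y x u v w = \<partial> x (\<partial> u (\<partial> v (\<partial> w F))) y"

lemma linear_euclidean:
  fixes L :: "'n::euclidean_space \<Rightarrow> 'b::real_normed_vector"
  assumes "linear L" shows "(\<Sum>b\<in>Basis. (x \<bullet> b) *\<^sub>R L b) = L x"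
proof -
  have "L x = L (\<Sum>b\<in>Basis. (x \<bullet> b) *\<^sub>R b)" by (simp add: euclidean_representation)
  then show ?thesis by (simp add: linear_sum[OF assms] linear_scale[OF assms])
qed

text \<open>A product rule: expanding \<open>f z\<close> in the standard basis leaves
  \<open>T\<close> with fixed second arguments, whose derivatives are known. Applied one argument at
  a time, it differentiates Hessians and third derivatives along vector fields.\<close>

lemma has_derivative_linear_family:
  fixes T :: "'n::real_normed_vector \<Rightarrow> 'm::euclidean_space \<Rightarrow> 'b::real_normed_vector"
  assumes D: "open D" "y \<in> D" and lin: "\<And>z. z \<in> D \<Longrightarrow> linear (T z)"
    and T: "\<And>u. (\<lambda>z. T z u) differentiable (at y)" and T': "\<And>x. linear (\<lambda>u. \<partial> x (\<lambda>z. T z u) y)"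
    and f: "f differentiable (at y)"
  shows "((\<lambda>z. T z (f z)) has_derivative (\<lambda>x. \<partial> x (\<lambda>z. T z (f y)) y + T y (\<partial> x f y))) (at y)"
proof (rule has_derivative_transform_within_open[OF _ D])
  show "(\<Sum>b\<in>Basis. (f z \<bullet> b) *\<^sub>R T z b) = T z (f z)" if "z \<in> D" for z
    by (rule linear_euclidean[OF lin[OF that]])
  show "((\<lambda>z. \<Sum>b\<in>Basis. (f z \<bullet> b) *\<^sub>R T z b) has_derivative
      (\<lambda>x. \<partial> x (\<lambda>z. T z (f y)) y + T y (\<partial> x f y))) (at y)"
    by (rule has_derivative_eq_rhs, rule has_derivative_sum, rule has_derivative_scaleR,
        rule has_derivative_inner_left[OF has_derivative_dir_deriv[OF f]], rule has_derivative_dir_deriv[OF T])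
      (simp add: sum.distrib linear_euclidean[OF lin[OF D(2)]]
        linear_euclidean[OF T'])
qed

lemma smooth_on_linear_family:
  fixes T :: "'n::real_normed_vector \<Rightarrow> 'm::euclidean_space \<Rightarrow> 'b::real_normed_vector"
  assumes "open D" "\<And>z. z \<in> D \<Longrightarrow> linear (T z)" "\<And>u. smooth_on D (\<lambda>z. T z u)" "smooth_on D f"
  shows "smooth_on D (\<lambda>z. T z (f z))"
proof (rule smooth_on_cong[OF assms(1)])
  show "(\<Sum>b\<in>Basis. (f z \<bullet> b) *\<^sub>R T z b) = T z (f z)" if "z \<in> D" for z
    by (rule linear_euclidean[OF assms(2)[OF that]])
  show "smooth_on D (\<lambda>z. \<Sum>b\<in>Basis. (f z \<bullet> b) *\<^sub>R T z b)"
    by (intro smooth_on_sum smooth_on_scaleR smooth_on_inner assms smooth_on_const)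
qed

lemma smooth_on_dir_deriv_field:
  fixes f :: "'n::euclidean_space \<Rightarrow> 'b::real_normed_vector"
  assumes "open D" "smooth_on D f" "smooth_on D X"
  shows "smooth_on D (\<lambda>y. \<partial> (X y) f y)"
  by (rule smooth_on_linear_family[OF assms(1) _ _ assms(3), where T="\<lambda>y u. \<partial> u f y"])
    (use assms(2) in \<open>auto intro: linear_dir_deriv smooth_on_differentiable smooth_on_dir_deriv\<close>)

lemma linear_dir_deriv_dir:
  fixes f :: "'n::real_normed_vector \<Rightarrow> 'b::euclidean_space"
  assumes "open D" "smooth_on D f" "y \<in> D"
  shows "linear (\<lambda>u. \<partial> x (\<partial> u f) y)"
  unfolding dir_deriv_commute[OF assms, of x]
  by (rule linear_dir_deriv[OF smooth_on_differentiable[OF smooth_on_dir_deriv[OF assms(2)] assms(3)]])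

lemma dir_deriv_dir_deriv_field:
  fixes f :: "'n::euclidean_space \<Rightarrow> 'b::euclidean_space"
  assumes D: "open D" "y \<in> D" and f: "smooth_on D f" and X: "X differentiable (at y)"
  shows "\<partial> x (\<lambda>y. \<partial> (X y) f y) y = \<partial> x (\<partial> (X y) f) y + \<partial> (\<partial> x X y) f y"
  by (rule dir_deriv_eq[OF has_derivative_linear_family[OF D, where T="\<lambda>y u. \<partial> u f y"]])
    (auto intro: linear_dir_deriv smooth_on_differentiable[OF f] smooth_on_differentiable[OF smooth_on_dir_deriv[OF f] D(2)]
      linear_dir_deriv_dir[OF D(1) f D(2)] X)

locale smooth_function =
  fixes F :: "'n::euclidean_space \<Rightarrow> real" and D :: "'n set"
  assumes open_D: "open D" and smooth_F: "smooth_on D F"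
begin

lemma hess_commute: "y \<in> D \<Longrightarrow> hess F y u v = hess F y v u"
  unfolding hess_def by (rule dir_deriv_commute[OF open_D smooth_F])

lemma third_commute12: "y \<in> D \<Longrightarrow> third F y u v w = third F y v u w"
  unfolding third_def by (rule dir_deriv_commute[OF open_D smooth_on_dir_deriv[OF smooth_F]])

lemma third_commute23: "y \<in> D \<Longrightarrow> third F y u v w = third F y u w v"
  unfolding third_def
  by (rule differentiable_cong_open(2)[OF open_D, symmetric])
    (auto intro: dir_deriv_commute[OF open_D smooth_F] smooth_on_differentiable smooth_on_dir_deriv smooth_F)

lemma third_commute13: "y \<in> D \<Longrightarrow> third F y u v w = third F y w v u"
  using third_commute12 third_commute23 by metis

lemma fourth_commute12: "y \<in> D \<Longrightarrow> fourth F y x u v w = fourth F y u x v w"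
  unfolding fourth_def
  by (rule dir_deriv_commute[OF open_D smooth_on_dir_deriv[OF smooth_on_dir_deriv[OF smooth_F]]])

lemma hess_linear:
  assumes "y \<in> D" shows "linear (\<lambda>u. hess F y u v)" "linear (hess F y u)"
proof -
  show *: "linear (\<lambda>u. hess F y u v)" for v
    unfolding hess_def using assms by (auto intro!: linear_dir_deriv smooth_on_differentiable smooth_on_dir_deriv smooth_F)
  have "linear (\<lambda>v. hess F y u v)" unfolding hess_commute[OF assms, of u] by (rule *)
  then show "linear (hess F y u)" .
qed

lemma third_linear:
  assumes "y \<in> D"
  shows "linear (\<lambda>u. third F y u v w)" "linear (\<lambda>v. third F y u v w)" "linear (third F y u v)"
proof -
  show *: "linear (\<lambda>u. third F y u v w)" for v w
    unfolding third_def using assms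
    by (auto intro!: linear_dir_deriv smooth_on_differentiable[of D] smooth_on_dir_deriv smooth_F)
  show "linear (\<lambda>v. third F y u v w)" unfolding third_commute12[OF assms, of u] by (rule *)
  have "linear (\<lambda>w. third F y u v w)" unfolding third_commute13[OF assms, of u] by (rule *)
  then show "linear (third F y u v)" .
qed

lemmas hess_add = hess_linear[THEN linear_add]
  and hess_scale = hess_linear[THEN linear_scale]
  and hess_diff = hess_linear[THEN linear_diff]
  and third_add = third_linear[THEN linear_add]
  and third_scale = third_linear[THEN linear_scale]

lemma smooth_hess_const: "smooth_on D (\<lambda>y. hess F y u v)"
  unfolding hess_def by (intro smooth_on_dir_deriv smooth_F)

lemma smooth_third_const: "smooth_on D (\<lambda>y. third F y u v w)"
  unfolding third_def by (intro smooth_on_dir_deriv smooth_F)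

lemma smooth_hess:
  assumes "S \<subseteq> D" "open S" "smooth_on S f" "smooth_on S g"
  shows "smooth_on S (\<lambda>y. hess F y (f y) (g y))"
proof (rule smooth_on_linear_family[OF assms(2) _ _ assms(4)])
  show "linear (hess F z (f z))" if "z \<in> S" for z using hess_linear(2) that assms(1) by blast
  show "smooth_on S (\<lambda>z. hess F z (f z) u)" for u
    by (rule smooth_on_linear_family[OF assms(2) _ _ assms(3), where T="\<lambda>z v. hess F z v u"])
     (use assms(1) in \<open>auto intro: hess_linear smooth_on_subset[OF smooth_hess_const]\<close>)
qed

lemma smooth_third:
  assumes "S \<subseteq> D" "open S" "smooth_on S f" "smooth_on S g" "smooth_on S h"
  shows "smooth_on S (\<lambda>y. third F y (f y) (g y) (h y))"
proof (rule smooth_on_linear_family[OF assms(2) _ _ assms(5)])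
  show "linear (third F z (f z) (g z))" if "z \<in> S" for z using third_linear(3) that assms(1) by blast
  show "smooth_on S (\<lambda>z. third F z (f z) (g z) u)" for u
  proof (rule smooth_on_linear_family[OF assms(2) _ _ assms(4)])
    show "linear (\<lambda>w. third F z (f z) w u)" if "z \<in> S" for z using third_linear(2) that assms(1) by blast
    show "smooth_on S (\<lambda>z. third F z (f z) v u)" for v
      by (rule smooth_on_linear_family[OF assms(2) _ _ assms(3), where T="\<lambda>z w. third F z w v u"])
       (use assms(1) in \<open>auto intro: third_linear smooth_on_subset[OF smooth_third_const]\<close>)
  qed
qed

lemma dir_deriv_hess_const: "\<partial> x (\<lambda>z. hess F z u v) y = third F y x u v"
  by (simp add: hess_def third_def)

lemma dir_deriv_third_const: "\<partial> x (\<lambda>z. third F z u v w) y = fourth F y x u v w"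
  by (simp add: fourth_def third_def)

text \<open>Linearity in the innermost slots is not visible from the definition. It is inherited
  from the slot next to the outer derivative by differentiating the symmetries of
  \<open>third\<close>.\<close>

lemma fourth_linear:
  assumes "y \<in> D"
  shows "linear (\<lambda>u. fourth F y x u v w)" "linear (\<lambda>v. fourth F y x u v w)" "linear (fourth F y x u v)"
proof -
  have c: "fourth F y x u v w = fourth F y x v u w" "fourth F y x u v w = fourth F y x u w v" for u v w
    unfolding dir_deriv_third_const[symmetric]
    using third_commute12 third_commute23
    by (auto intro!: differentiable_cong_open(2)[OF open_D assms] smooth_on_differentiable[OF smooth_third_const assms])
  show *: "linear (\<lambda>u. fourth F y x u v w)" for v w
    using linear_dir_deriv_dir[OF open_D smooth_on_dir_deriv[OF smooth_on_dir_deriv[OF smooth_F]] assms]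
    by (simp add: fourth_def)
  show **: "linear (\<lambda>v. fourth F y x u v w)" for u w unfolding c(1)[of u] by (rule *)
  have "linear (\<lambda>w. fourth F y x u v w)" unfolding c(2)[of u v] by (rule **)
  then show "linear (fourth F y x u v)" .
qed

lemma has_derivative_hess:
  assumes y: "y \<in> D" and f: "f differentiable (at y)" and g: "g differentiable (at y)"
  shows "((\<lambda>z. hess F z (f z) (g z)) has_derivative
    (\<lambda>x. third F y x (f y) (g y) + hess F y (\<partial> x f y) (g y) + hess F y (f y) (\<partial> x g y))) (at y)"
proof -
  have 1: "((\<lambda>z. hess F z (f z) u) has_derivative (\<lambda>x. third F y x (f y) u + hess F y (\<partial> x f y) u)) (at y)" for u
    using has_derivative_linear_family[OF open_D y _ _ _ f, where T="\<lambda>z v. hess F z v u"]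
    by (simp add: hess_linear third_linear y dir_deriv_hess_const smooth_on_differentiable[OF smooth_hess_const])
  have 2: "linear (\<lambda>u. third F y x (f y) u + hess F y (\<partial> x f y) u)" for x
    by (intro linear_compose_add third_linear hess_linear y)
  show ?thesis
    using has_derivative_linear_family[OF open_D y _ _ _ g, where T="\<lambda>z. hess F z (f z)"] 2 differentiableI[OF 1]
    by (simp add: hess_linear dir_deriv_eq[OF 1])
qed

lemma has_derivative_third:
  assumes y: "y \<in> D" and f: "f differentiable (at y)" and g: "g differentiable (at y)" and h: "h differentiable (at y)"
  shows "((\<lambda>z. third F z (f z) (g z) (h z)) has_derivative
    (\<lambda>x. fourth F y x (f y) (g y) (h y) + third F y (\<partial> x f y) (g y) (h y) + third F y (f y) (\<partial> x g y) (h y)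
      + third F y (f y) (g y) (\<partial> x h y))) (at y)"
proof -
  have 1: "((\<lambda>z. third F z (f z) v u) has_derivative (\<lambda>x. fourth F y x (f y) v u + third F y (\<partial> x f y) v u)) (at y)" for u v
    using has_derivative_linear_family[OF open_D y _ _ _ f, where T="\<lambda>z w. third F z w v u"]
    by (simp add: fourth_linear third_linear y dir_deriv_third_const smooth_on_differentiable[OF smooth_third_const])
  have 2: "((\<lambda>z. third F z (f z) (g z) u) has_derivative
      (\<lambda>x. fourth F y x (f y) (g y) u + third F y (\<partial> x f y) (g y) u + third F y (f y) (\<partial> x g y) u)) (at y)" for u
    using has_derivative_linear_family[OF open_D y _ _ _ g, where T="\<lambda>z w. third F z (f z) w u"] differentiableI[OF 1]
    by (simp add: third_linear dir_deriv_eq[OF 1] linear_compose_add fourth_linear y)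
  show ?thesis
    using has_derivative_linear_family[OF open_D y _ _ _ h, where T="\<lambda>z. third F z (f z) (g z)"] differentiableI[OF 2]
    by (simp add: third_linear dir_deriv_eq[OF 2] linear_compose_add fourth_linear y)
qed

end

text \<open>The canonical form of the cubic form in terms of the third derivatives of a graph function:
  \<open>h (K(x, y), z)\<close> is minus one half of the third derivative.\<close>

locale canonical_frame = smooth_function F D for F :: "real ^ 3 \<Rightarrow> real" and D +
  fixes e :: "nat \<Rightarrow> real ^ 3 \<Rightarrow> real ^ 3" and a b :: "real ^ 3 \<Rightarrow> real"
  assumes smooth_e: "\<And>i. i < 3 \<Longrightarrow> smooth_on D (e i)"
    and orth: "\<And>y i j. y \<in> D \<Longrightarrow> i < 3 \<Longrightarrow> j < 3 \<Longrightarrow> hess F y (e i y) (e j y) = (if i = j then \<epsilon> i else 0)"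
    and cubic: "\<And>y i j k. y \<in> D \<Longrightarrow> i < 3 \<Longrightarrow> j < 3 \<Longrightarrow> k < 3 \<Longrightarrow>
      third F y (e i y) (e j y) (e k y) = cub (a y) (b y) i j k"
    and a_pos: "\<And>y. y \<in> D \<Longrightarrow> a y > 0"
    and b_sign: "(\<forall>y\<in>D. b y > 0) \<or> (\<forall>y\<in>D. b y = 0)"
begin

definition g :: "real ^ 3 \<Rightarrow> nat \<Rightarrow> nat \<Rightarrow> nat \<Rightarrow> real"
  where "g y i j k = hess F y (\<partial> (e i y) (e j) y) (e k y)"

text \<open>Pairing with the frame recovers the coefficients of a combination up to sign, so the
  combinations are injective in the coefficients; dimension three makes them exhaust the
  space.\<close>

lemma frame_expand:
  assumes y: "y \<in> D" shows "x = (\<Sum>m<3. (\<epsilon> m * hess F y x (e m y)) *\<^sub>R e m y)"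
proof -
  define L where "L c = c $ 1 *\<^sub>R e 0 y + c $ 2 *\<^sub>R e 1 y + c $ 3 *\<^sub>R e 2 y" for c :: "real ^ 3"
  have lin: "linear L"
    by (auto simp: L_def linear_iff algebra_simps)
  have p: "hess F y (L c) (e 0 y) = - c $ 1" "hess F y (L c) (e 1 y) = c $ 2" "hess F y (L c) (e 2 y) = c $ 3" for c
    by (simp_all add: L_def hess_add[OF y] hess_scale[OF y] orth[OF y] \<epsilon>_def)
  have "inj L"
  proof (rule injI)
    fix c c' assume eq: "L c = L c'"
    show "c = c'" using p[of c] p[of c'] unfolding eq by (simp add: vec_eq_iff forall_3)
  qed
  then obtain c where c: "x = L c" using linear_injective_imp_surjective[OF lin] by (metis surjD)
  show ?thesis unfolding c sum_upto_3 p by (simp add: L_def \<epsilon>_def)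
qed

lemma hess_expand: "y \<in> D \<Longrightarrow> hess F y x v = (\<Sum>m<3. \<epsilon> m * hess F y x (e m y) * hess F y (e m y) v)"
proof -
  assume y: "y \<in> D"
  have "hess F y x v = hess F y (\<Sum>m<3. (\<epsilon> m * hess F y x (e m y)) *\<^sub>R e m y) v"
    using frame_expand[OF y, of x] by simp
  then show ?thesis by (simp add: sum_upto_3 hess_add[OF y] hess_scale[OF y])
qed

lemma third_expand: "y \<in> D \<Longrightarrow> third F y x v w = (\<Sum>m<3. \<epsilon> m * hess F y x (e m y) * third F y (e m y) v w)"
proof -
  assume y: "y \<in> D"
  have "third F y x v w = third F y (\<Sum>m<3. (\<epsilon> m * hess F y x (e m y)) *\<^sub>R e m y) v w"
    using frame_expand[OF y, of x] by simp
  then show ?thesis by (simp add: sum_upto_3 third_add[OF y] third_scale[OF y])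
qed

lemma diff_e: "y \<in> D \<Longrightarrow> i < 3 \<Longrightarrow> e i differentiable (at y)"
  using smooth_on_differentiable smooth_e by blast

text \<open>The function \<open>a\<close> is, up to a factor, a component of the third derivative in
  a smooth frame, and inherits its regularity; the same applies to \<open>b\<close>.\<close>

lemma smooth_a: "smooth_on D a"
proof (rule smooth_on_cong[OF open_D])
  show "smooth_on D (\<lambda>y. (- 1 / 4) * third F y (e 0 y) (e 0 y) (e 0 y))"
    by (intro smooth_on_mult smooth_third open_D smooth_e smooth_on_const order_refl) auto
  show "(- 1 / 4) * third F y (e 0 y) (e 0 y) (e 0 y) = a y" if "y \<in> D" for y
    using that by (simp add: cubic cub_def)
qed

lemma smooth_b: "smooth_on D b"
proof (rule smooth_on_cong[OF open_D])
  show "smooth_on D (\<lambda>y. (- 1 / 2) * third F y (e 1 y) (e 1 y) (e 1 y))"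
    by (intro smooth_on_mult smooth_third open_D smooth_e smooth_on_const order_refl) auto
  show "(- 1 / 2) * third F y (e 1 y) (e 1 y) (e 1 y) = b y" if "y \<in> D" for y
    using that by (simp add: cubic cub_def)
qed

lemma cub_linear: "cub x y i j k = x * cub 1 0 i j k + y * cub 0 1 i j k"
proof -
  have "(if p then - 4 * x else if q then - 2 * x else if r then - 2 * y else if s then 2 * y else 0) =
    x * (if p then - 4 * 1 else if q then - 2 * 1 else if r then - 2 * 0 else if s then 2 * 0 else 0) +
    y * (if p then - 4 * 0 else if q then - 2 * 0 else if r then - 2 * 1 else if s then 2 * 1 else 0)" for p q r s
    by simp
  then show ?thesis unfolding cub_def Let_def by blast
qed

text \<open>The metric equations come from differentiating the constants \<open>orth\<close>. For
  the Codazzi equations \<open>cubic\<close> is differentiated along e_i: what the derivatives of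
  the frame contribute is moved to the other side, and the remaining fourth derivative is symmetric
  in its first two slots.\<close>

lemma codazzi_frame:
  assumes y: "y \<in> D"
  shows "codazzi (a y) (b y) (\<lambda>i. \<partial> (e i y) a y) (\<lambda>i. \<partial> (e i y) b y) (g y)"
proof
  show "a y > 0" by (rule a_pos[OF y])
  fix i j k :: nat assume i: "i < 3" and j: "j < 3" and k: "k < 3"
  have "((\<lambda>z. hess F z (e j z) (e k z)) has_derivative (\<lambda>x. 0)) (at y)"
    by (rule has_derivative_transform_within_open[OF has_derivative_const open_D y]) (simp add: orth j k)
  from has_derivative_unique[OF this has_derivative_hess[OF y diff_e[OF y j] diff_e[OF y k]], THEN fun_cong, of "e i y"]
  show "g y i j k + g y i k j = - cub (a y) (b y) i j k"
    by (simp add: g_def cubic[OF y i j k] hess_commute[OF y, of "e j y"])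
next
  have four: "fourth F y (e i y) (e j y) (e k y) (e l y) = cub (\<partial> (e i y) a y) (\<partial> (e i y) b y) j k l -
      (\<Sum>m<3. \<epsilon> m * (g y i j m * cub (a y) (b y) m k l + g y i k m * cub (a y) (b y) j m l + g y i l m * cub (a y) (b y) j k m))"
    if i: "i < 3" and j: "j < 3" and k: "k < 3" and l: "l < 3" for i j k l
  proof -
    have "((\<lambda>z. a z * cub 1 0 j k l + b z * cub 0 1 j k l) has_derivative
        (\<lambda>x. \<partial> x a y * cub 1 0 j k l + \<partial> x b y * cub 0 1 j k l)) (at y)"
      by (intro has_derivative_add has_derivative_mult_left has_derivative_dir_deriv
          smooth_on_differentiable[OF smooth_a y] smooth_on_differentiable[OF smooth_b y])
    then have "((\<lambda>z. third F z (e j z) (e k z) (e l z)) has_derivative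
        (\<lambda>x. \<partial> x a y * cub 1 0 j k l + \<partial> x b y * cub 0 1 j k l)) (at y)"
      by (rule has_derivative_transform_within_open[OF _ open_D y])
        (simp add: cubic j k l cub_linear[of "a _"])
    from has_derivative_unique[OF this has_derivative_third[OF y diff_e[OF y j] diff_e[OF y k] diff_e[OF y l]],
        THEN fun_cong, of "e i y"]
    have *: "cub (\<partial> (e i y) a y) (\<partial> (e i y) b y) j k l = fourth F y (e i y) (e j y) (e k y) (e l y) +
        third F y (\<partial> (e i y) (e j) y) (e k y) (e l y) + third F y (e j y) (\<partial> (e i y) (e k) y) (e l y) +
        third F y (e j y) (e k y) (\<partial> (e i y) (e l) y)"
      by (simp add: cub_linear[of "\<partial> _ a y"])
    have t: "third F y (\<partial> (e i y) (e j) y) (e k y) (e l y) = (\<Sum>m<3. \<epsilon> m * g y i j m * cub (a y) (b y) m k l)"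
      "third F y (e j y) (\<partial> (e i y) (e k) y) (e l y) = (\<Sum>m<3. \<epsilon> m * g y i k m * cub (a y) (b y) j m l)"
      "third F y (e j y) (e k y) (\<partial> (e i y) (e l) y) = (\<Sum>m<3. \<epsilon> m * g y i l m * cub (a y) (b y) j k m)"
        apply (subst third_expand[OF y])
        apply (simp add: g_def cubic[OF y] k l)
       apply (subst third_commute12[OF y], subst third_expand[OF y], subst third_commute12[OF y])
       apply (simp add: g_def cubic[OF y] j l)
      apply (subst third_commute13[OF y], subst third_expand[OF y], subst third_commute13[OF y])
      apply (simp add: g_def cubic[OF y] k j)
      done
    show ?thesis using * unfolding t
      by (simp add: algebra_simps sum.distrib)
  qed
  fix i j k l :: nat assume i: "i < 3" and j: "j < 3" and k: "k < 3" and l: "l < 3"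
  show "cub (\<partial> (e i y) a y) (\<partial> (e i y) b y) j k l -
      (\<Sum>m<3. \<epsilon> m * (g y i j m * cub (a y) (b y) m k l + g y i k m * cub (a y) (b y) j m l + g y i l m * cub (a y) (b y) j k m))
    = cub (\<partial> (e j y) a y) (\<partial> (e j y) b y) i k l -
      (\<Sum>m<3. \<epsilon> m * (g y j i m * cub (a y) (b y) m k l + g y j k m * cub (a y) (b y) i m l + g y j l m * cub (a y) (b y) i k m))"
    using four[OF i j k l] four[OF j i k l] fourth_commute12[OF y] by metis
qed

lemma smooth_g: "i < 3 \<Longrightarrow> j < 3 \<Longrightarrow> k < 3 \<Longrightarrow> smooth_on D (\<lambda>y. g y i j k)"
  unfolding g_def by (intro smooth_hess order_refl open_D smooth_on_dir_deriv_field smooth_e)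

text \<open>Second derivatives of e_k in two fixed directions commute. The coefficient
  \<open>g\<close> differs from such a derivative because it contains the varying metric and the
  varying direction e_j; the terms on the right correct for both.\<close>

lemma flat_frame:
  assumes y: "y \<in> D" and ijkl: "i < 3" "j < 3" "k < 3" "l < 3"
  shows "\<partial> (e i y) (\<lambda>y. g y j k l) y - \<partial> (e j y) (\<lambda>y. g y i k l) y =
    (\<Sum>m<3. \<epsilon> m * (g y j k m * cub (a y) (b y) i m l - g y i k m * cub (a y) (b y) j m l
        + g y j k m * g y i l m - g y i k m * g y j l m + (g y i j m - g y j i m) * g y m k l))"
proof -
  have *: "\<partial> (e i y) (\<lambda>y. g y j k l) y = (\<Sum>m<3. \<epsilon> m * (g y j k m * cub (a y) (b y) i m l + g y j k m * g y i l m
      + g y i j m * g y m k l)) + hess F y (\<partial> (e i y) (\<partial> (e j y) (e k)) y) (e l y)"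
    if ijkl: "i < 3" "j < 3" "k < 3" "l < 3" for i j k l
  proof -
    let ?W = "\<lambda>y. \<partial> (e j y) (e k) y"
    have W: "smooth_on D ?W" by (intro smooth_on_dir_deriv_field open_D smooth_e ijkl)
    have "\<partial> (e i y) (\<lambda>y. g y j k l) y = third F y (e i y) (?W y) (e l y) +
        hess F y (\<partial> (e i y) ?W y) (e l y) + hess F y (?W y) (\<partial> (e i y) (e l) y)"
      unfolding g_def
      by (rule dir_deriv_eq[OF has_derivative_hess[OF y smooth_on_differentiable[OF W y] diff_e[OF y ijkl(4)]]])
    also have "\<partial> (e i y) ?W y = \<partial> (e i y) (\<partial> (e j y) (e k)) y + \<partial> (\<partial> (e i y) (e j) y) (e k) y"
      by (rule dir_deriv_dir_deriv_field[OF open_D y smooth_e[OF ijkl(3)] diff_e[OF y ijkl(2)]])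
    also have "third F y (e i y) (?W y) (e l y) = (\<Sum>m<3. \<epsilon> m * g y j k m * cub (a y) (b y) i m l)"
      by (subst third_commute12[OF y], subst third_expand[OF y], subst third_commute12[OF y])
        (simp add: g_def cubic[OF y] ijkl)
    also have "hess F y (?W y) (\<partial> (e i y) (e l) y) = (\<Sum>m<3. \<epsilon> m * g y j k m * g y i l m)"
      by (subst hess_expand[OF y]) (simp add: g_def hess_commute[OF y, of "e _ y"])
    also have "\<partial> (\<partial> (e i y) (e j) y) (e k) y = (\<Sum>m<3. (\<epsilon> m * g y i j m) *\<^sub>R \<partial> (e m y) (e k) y)"
    proof -
      have l: "linear (\<lambda>u. \<partial> u (e k) y)" by (rule linear_dir_deriv[OF diff_e[OF y ijkl(3)]])
      have "\<partial> (\<partial> (e i y) (e j) y) (e k) y = \<partial> (\<Sum>m<3. (\<epsilon> m * g y i j m) *\<^sub>R e m y) (e k) y"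
        using frame_expand[OF y, of "\<partial> (e i y) (e j) y"] by (simp add: g_def)
      then show ?thesis by (simp add: linear_sum[OF l] linear_scale[OF l])
    qed
    finally show ?thesis
      by (simp add: hess_add[OF y] hess_scale[OF y] sum_upto_3 g_def[symmetric] algebra_simps)
  qed
  show ?thesis
    unfolding *[OF ijkl] *[OF ijkl(2,1,3,4)] dir_deriv_commute[OF open_D smooth_e[OF ijkl(3)] y, of "e i y"]
    by (simp add: sum_upto_3 algebra_simps)
qed

text \<open>Equality of \<open>b\<close> and \<open>2 * a\<close> at one point would say nothing
  about derivatives. The set \<Omega> where the claim fails is open, and by \<open>eqC\<close> the
  equality holds on all of it; hence it and the relations derived from it may be differentiated
  there, which is the input of \<open>codazzi_flat\<close>.\<close>

lemma s_eq_0: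
  assumes y: "y \<in> D"
  shows "g y 0 0 1 = 0 \<and> g y 0 0 2 = 0"
proof (rule ccontr)
  define \<Omega> where "\<Omega> = {y \<in> D. g y 0 0 1 \<noteq> 0 \<or> g y 0 0 2 \<noteq> 0}"
  assume "\<not> (g y 0 0 1 = 0 \<and> g y 0 0 2 = 0)"
  then have y\<Omega>: "y \<in> \<Omega>" using y by (simp add: \<Omega>_def)
  have "\<Omega> = (D \<inter> (\<lambda>y. g y 0 0 1) -` (- {0})) \<union> (D \<inter> (\<lambda>y. g y 0 0 2) -` (- {0}))"
    by (auto simp: \<Omega>_def)
  moreover have "open (D \<inter> (\<lambda>y. g y 0 0 k) -` (- {0}))" if "k < 3" for k
    using smooth_on_continuous[OF smooth_g[of 0 0 k]] that
    by (intro continuous_open_preimage open_D) auto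
  ultimately have op: "open \<Omega>" by auto
  have sub: "\<Omega> \<subseteq> D" by (auto simp: \<Omega>_def)
  have b2: "b z = 2 * a z" if z: "z \<in> \<Omega>" for z
  proof -
    interpret codazzi "a z" "b z" "\<lambda>i. \<partial> (e i z) a z" "\<lambda>i. \<partial> (e i z) b z" "g z"
      using codazzi_frame z sub by auto
    have "P \<noteq> 0 \<or> Q \<noteq> 0" using z a by (auto simp: \<Omega>_def P_def Q_def)
    then have "b z * b z = (2 * a z) * (2 * a z)" using eqC by auto
    moreover have "b z \<ge> 0" using b_sign z sub by (auto intro: less_imp_le)
    ultimately show ?thesis using a by (smt (verit, ccfv_threshold) mult_mono mult_strict_mono)
  qed
  have dbda: "\<partial> x b z = 2 * \<partial> x a z" if "z \<in> \<Omega>" for x z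
  proof -
    have "\<partial> x b z = \<partial> x (\<lambda>z. 2 * a z) z"
      using that b2 sub
      by (intro differentiable_cong_open(2)[OF op that]) (auto intro!: derivative_intros smooth_on_differentiable[OF smooth_a])
    also have "\<dots> = 2 * \<partial> x a z"
      using that sub by (intro dir_deriv_linear bounded_linear_mult_right smooth_on_differentiable[OF smooth_a]) auto
    finally show ?thesis .
  qed
  have D: "g z 1 1 2 = - g z 0 0 2 / 2 \<and> g z 2 1 2 = g z 0 0 1 / 2 - 2 * a z \<and> g z 1 0 1 = a z + g z 0 0 1 / 2 \<and>
    g z 2 0 2 = a z - g z 0 0 1 / 2 \<and> g z 2 2 1 = - 2 * a z - g z 0 0 1 / 2 \<and> g z 1 2 1 = g z 0 0 2 / 2"
    if z: "z \<in> \<Omega>" for z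
  proof -
    interpret codazzi "a z" "b z" "\<lambda>i. \<partial> (e i z) a z" "\<lambda>i. \<partial> (e i z) b z" "g z"
      using codazzi_frame z sub by auto
    note d = eqD[OF b2[OF z] dbda[OF z]]
    have "a z * (g z 1 0 1 - a z - g z 0 0 1 / 2) = 0" "a z * (g z 2 0 2 - a z + g z 0 0 1 / 2) = 0"
      using eqB(1,2) d(1) b2[OF z] by algebra+
    then have "g z 1 0 1 = a z + g z 0 0 1 / 2" "g z 2 0 2 = a z - g z 0 0 1 / 2" using a by auto
    then show ?thesis using d metric_eqs b2[OF z] by simp
  qed
  have dd: "\<partial> x (\<lambda>z. g z 1 0 1) y = \<partial> x a y + \<partial> x (\<lambda>z. g z 0 0 1) y / 2"
    "\<partial> x (\<lambda>z. g z 2 0 2) y = \<partial> x a y - \<partial> x (\<lambda>z. g z 0 0 1) y / 2"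
    "\<partial> x (\<lambda>z. g z 2 2 1) y = - 2 * \<partial> x a y - \<partial> x (\<lambda>z. g z 0 0 1) y / 2"
    "\<partial> x (\<lambda>z. g z 1 2 1) y = \<partial> x (\<lambda>z. g z 0 0 2) y / 2" for x
  proof -
    have a': "(a has_derivative (\<lambda>x. \<partial> x a y)) (at y)"
      and s': "((\<lambda>z. g z 0 0 1) has_derivative (\<lambda>x. \<partial> x (\<lambda>z. g z 0 0 1) y)) (at y)"
      and t': "((\<lambda>z. g z 0 0 2) has_derivative (\<lambda>x. \<partial> x (\<lambda>z. g z 0 0 2) y)) (at y)"
      using y by (auto intro!: smooth_on_has_derivative[of D] smooth_a smooth_g)
    show "\<partial> x (\<lambda>z. g z 1 0 1) y = \<partial> x a y + \<partial> x (\<lambda>z. g z 0 0 1) y / 2"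
      by (rule dir_deriv_eq, rule has_derivative_transform_within_open[OF _ op y\<Omega>, of "\<lambda>z. a z + g z 0 0 1 / 2"])
        (auto intro!: derivative_eq_intros a' s' simp: D)
    show "\<partial> x (\<lambda>z. g z 2 0 2) y = \<partial> x a y - \<partial> x (\<lambda>z. g z 0 0 1) y / 2"
      by (rule dir_deriv_eq, rule has_derivative_transform_within_open[OF _ op y\<Omega>, of "\<lambda>z. a z - g z 0 0 1 / 2"])
        (auto intro!: derivative_eq_intros a' s' simp: D)
    show "\<partial> x (\<lambda>z. g z 2 2 1) y = - 2 * \<partial> x a y - \<partial> x (\<lambda>z. g z 0 0 1) y / 2"
      by (rule dir_deriv_eq, rule has_derivative_transform_within_open[OF _ op y\<Omega>, of "\<lambda>z. - 2 * a z - g z 0 0 1 / 2"])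
        (auto intro!: derivative_eq_intros a' s' simp: D)
    show "\<partial> x (\<lambda>z. g z 1 2 1) y = \<partial> x (\<lambda>z. g z 0 0 2) y / 2"
      by (rule dir_deriv_eq, rule has_derivative_transform_within_open[OF _ op y\<Omega>, of "\<lambda>z. g z 0 0 2 / 2"])
        (auto intro!: derivative_eq_intros t' simp: D)
  qed
  interpret codazzi "a y" "b y" "\<lambda>i. \<partial> (e i y) a y" "\<lambda>i. \<partial> (e i y) b y" "g y"
    by (rule codazzi_frame[OF y])
  interpret codazzi_flat "a y" "b y" "\<lambda>i. \<partial> (e i y) a y" "\<lambda>i. \<partial> (e i y) b y" "g y"
    "\<lambda>i j k l. \<partial> (e i y) (\<lambda>y. g y j k l) y"
    by unfold_locales (auto simp: flat_frame[OF y] b2[OF y\<Omega>] dbda[OF y\<Omega>] dd)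
  show False by (rule contradiction)
qed

text \<open>With \<open>P\<close> and \<open>Q\<close> zero, the derivative of \<open>T\<close>
  along itself is \<open>- 2 * a\<close> times \<open>T\<close>, and along X orthogonal to
  \<open>T\<close> it is \<open>\<beta>\<close> times X, where \<open>\<beta> = a - d\<close>. The
  stated formula is the common linear extension; its second term corrects the direction of
  \<open>T\<close>, for which h(T, T) = -1.\<close>

lemma structure_equations:
  assumes y: "y \<in> D"
  shows "\<exists>\<beta>. \<forall>x. \<partial> x (e 0) y = \<beta> *\<^sub>R x + ((\<beta> + 2 * a y) * hess F y (e 0 y) x) *\<^sub>R e 0 y \<and>
    \<partial> x a y = - 4 * a y * (a y - \<beta>) * hess F y (e 0 y) x"
proof -
  interpret codazzi "a y" "b y" "\<lambda>i. \<partial> (e i y) a y" "\<lambda>i. \<partial> (e i y) b y" "g y"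
    by (rule codazzi_frame[OF y])
  have PQ: "P = 0" "Q = 0" using s_eq_0[OF y] by (auto simp: P_def Q_def)
  define \<beta> where "\<beta> = a y - d"
  note E = PQ_eqs[unfolded PQ]
  let ?R = "\<lambda>x. \<beta> *\<^sub>R x + ((\<beta> + 2 * a y) * hess F y (e 0 y) x) *\<^sub>R e 0 y"
  have ex: "\<partial> (e i y) (e 0) y = (- g y i 0 0) *\<^sub>R e 0 y + g y i 0 1 *\<^sub>R e 1 y + g y i 0 2 *\<^sub>R e 2 y" for i
    using frame_expand[OF y, of "\<partial> (e i y) (e 0) y"] unfolding sum_upto_3 g_def[symmetric] by (simp add: \<epsilon>_def)
  have i: "\<partial> (e i y) (e 0) y = ?R (e i y) \<and> \<partial> (e i y) a y = - 4 * a y * (a y - \<beta>) * hess F y (e 0 y) (e i y)"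
    if "i < 3" for i
  proof -
    have "i = 0 \<or> i = 1 \<or> i = 2" using that by arith
    then consider "i = 0" | "i = 1" | "i = 2" by blast
    then show ?thesis
    proof cases
      case 1
      have "hess F y (e 0 y) (e 0 y) = -1" by (simp add: orth[OF y] \<epsilon>_def)
      then show ?thesis unfolding 1 ex
        by (simp add: metric_eqs E \<beta>_def scaleR_left_distrib[symmetric])
    next
      case 2
      have "hess F y (e 0 y) (e 1 y) = 0" by (simp add: orth[OF y])
      then show ?thesis unfolding 2 ex
        by (simp add: metric_eqs E \<beta>_def)
    next
      case 3
      have "hess F y (e 0 y) (e 2 y) = 0" by (simp add: orth[OF y])
      then show ?thesis unfolding 3 ex
        by (simp add: metric_eqs E \<beta>_def)
    qed
  qed
  have L1: "linear (\<lambda>x. \<partial> x (e 0) y)" by (rule linear_dir_deriv[OF diff_e[OF y]]) simp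
  have L2: "linear (\<lambda>x. \<partial> x a y)" by (rule linear_dir_deriv[OF smooth_on_differentiable[OF smooth_a y]])
  have L3: "linear ?R"
    by (auto simp: linear_iff hess_add[OF y] hess_scale[OF y] algebra_simps)
  have L4: "linear (\<lambda>x. - 4 * a y * (a y - \<beta>) * hess F y (e 0 y) x)"
    by (auto simp: linear_iff hess_add[OF y] hess_scale[OF y] algebra_simps)
  have "\<partial> x (e 0) y = ?R x \<and> \<partial> x a y = - 4 * a y * (a y - \<beta>) * hess F y (e 0 y) x" for x
  proof -
    define c where "c m = \<epsilon> m * hess F y x (e m y)" for m
    have x: "x = (\<Sum>m<3. c m *\<^sub>R e m y)" using frame_expand[OF y, of x] by (simp add: c_def)
    have "\<partial> (\<Sum>m<3. c m *\<^sub>R e m y) (e 0) y = ?R (\<Sum>m<3. c m *\<^sub>R e m y)"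
      unfolding linear_sum[OF L1] linear_sum[OF L3] linear_scale[OF L1] linear_scale[OF L3]
      by (rule sum.cong) (use i in auto)
    moreover have "\<partial> (\<Sum>m<3. c m *\<^sub>R e m y) a y = - 4 * a y * (a y - \<beta>) * hess F y (e 0 y) (\<Sum>m<3. c m *\<^sub>R e m y)"
      unfolding linear_sum[OF L2] linear_sum[OF L4] linear_scale[OF L2] linear_scale[OF L4]
      by (rule sum.cong) (use i in auto)
    ultimately show ?thesis using x by simp
  qed
  then show ?thesis by blast
qed

end

subsection \<open>Smoothness of the distinguished direction\<close>

definition orthonormal_at :: "(real ^ 3 \<Rightarrow> real) \<Rightarrow> real ^ 3 \<Rightarrow> (nat \<Rightarrow> real ^ 3) \<Rightarrow> bool" where
  "orthonormal_at F y e \<longleftrightarrow> (\<forall>i<3. \<forall>j<3. hess F y (e i) (e j) = (if i = j then \<epsilon> i else 0))"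

definition canonical_at :: "(real ^ 3 \<Rightarrow> real) \<Rightarrow> real ^ 3 \<Rightarrow> (nat \<Rightarrow> real ^ 3) \<Rightarrow> real \<Rightarrow> real \<Rightarrow> bool" where
  "canonical_at F y e a b \<longleftrightarrow>
     orthonormal_at F y e \<and> (\<forall>i<3. \<forall>j<3. \<forall>k<3. third F y (e i) (e j) (e k) = cub a b i j k)"

definition frame3 :: "'v \<Rightarrow> 'v \<Rightarrow> 'v \<Rightarrow> nat \<Rightarrow> 'v" where
  "frame3 u v w i = (if i = 0 then u else if i = 1 then v else w)"

lemma all_less_3: "(\<forall>i<3::nat. P i) \<longleftrightarrow> P 0 \<and> P 1 \<and> P 2"
  by (auto simp: numeral_3_eq_3 numeral_2_eq_2 One_nat_def less_Suc_eq)

locale smooth_function3 = smooth_function F D for F :: "real ^ 3 \<Rightarrow> real" and D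
begin

lemma canonical_atI:
  assumes y: "y \<in> D"
    and "hess F y u u = -1" "hess F y v v = 1" "hess F y w w = 1"
      "hess F y u v = 0" "hess F y u w = 0" "hess F y v w = 0"
    and "third F y u u u = - 4 * a" "third F y u u v = 0" "third F y u u w = 0"
      "third F y u v v = - 2 * a" "third F y u v w = 0" "third F y u w w = - 2 * a"
      "third F y v v v = - 2 * b" "third F y v v w = 0" "third F y v w w = 2 * b" "third F y w w w = 0"
  shows "canonical_at F y (frame3 u v w) a b"
proof -
  have h: "hess F y v u = 0" "hess F y w u = 0" "hess F y w v = 0"
    using assms(5-7) hess_commute[OF y] by auto
  have t: "third F y u v u = 0" "third F y v u u = 0" "third F y u w u = 0" "third F y w u u = 0"
    "third F y v u v = - 2 * a" "third F y v v u = - 2 * a" "third F y w u w = - 2 * a" "third F y w w u = - 2 * a"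
    "third F y u w v = 0" "third F y v u w = 0" "third F y v w u = 0" "third F y w u v = 0" "third F y w v u = 0"
    "third F y v w v = 0" "third F y w v v = 0" "third F y w v w = 2 * b" "third F y w w v = 2 * b"
    using assms(8-) third_commute12[OF y] third_commute23[OF y] by metis+
  show ?thesis unfolding canonical_at_def orthonormal_at_def all_less_3
    using assms(2-) h t by (simp add: frame3_def \<epsilon>_def cub_def)
qed

lemma canonical_orth: "canonical_at F y e a b \<Longrightarrow> orthonormal_at F y e"
  by (simp add: canonical_at_def)

lemma canonical_expand:
  assumes y: "y \<in> D" and can: "orthonormal_at F y e"
  shows "x = (\<Sum>m<3. (\<epsilon> m * hess F y x (e m)) *\<^sub>R e m)"
proof -
  have h: "hess F y (e 0) (e 0) = -1" "hess F y (e 1) (e 1) = 1" "hess F y (e 2) (e 2) = 1"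
    "hess F y (e 0) (e 1) = 0" "hess F y (e 0) (e 2) = 0" "hess F y (e 1) (e 2) = 0"
    "hess F y (e 1) (e 0) = 0" "hess F y (e 2) (e 0) = 0" "hess F y (e 2) (e 1) = 0"
    using can by (auto simp: canonical_at_def orthonormal_at_def all_less_3 \<epsilon>_def)
  define L where "L c = c $ 1 *\<^sub>R e 0 + c $ 2 *\<^sub>R e 1 + c $ 3 *\<^sub>R e 2" for c :: "real ^ 3"
  have lin: "linear L"
    by (auto simp: L_def linear_iff algebra_simps)
  have p: "hess F y (L c) (e 0) = - c $ 1" "hess F y (L c) (e 1) = c $ 2" "hess F y (L c) (e 2) = c $ 3" for c
    by (simp_all add: L_def hess_add[OF y] hess_scale[OF y] h)
  have "inj L"
  proof (rule injI)
    fix c c' assume eq: "L c = L c'"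
    show "c = c'" using p[of c] p[of c'] unfolding eq by (simp add: vec_eq_iff forall_3)
  qed
  then obtain c where c: "x = L c" using linear_injective_imp_surjective[OF lin] by (metis surjD)
  show ?thesis unfolding c sum_upto_3 p by (simp add: L_def \<epsilon>_def)
qed

text \<open>By Cramer's rule, the vectors dual to the standard basis with respect to the Hessian.\<close>

definition dualvec :: "3 \<Rightarrow> real ^ 3 \<Rightarrow> real ^ 3" where
  "dualvec j y = (\<chi> k. det (\<chi> i l. if l = k then axis j 1 $ i else hess F y (axis i 1) (axis l 1))
     / det (\<chi> i l. hess F y (axis i 1) (axis l 1)))"

lemma hess_matrix:
  assumes y: "y \<in> D"
  shows "(\<chi> i l. hess F y (axis i 1) (axis l 1)) *v x = (\<chi> i. hess F y (axis i 1) x)"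
proof -
  have "(\<Sum>l\<in>UNIV. hess F y u (axis l 1) * x $ l) = hess F y u x" for u
  proof -
    have "hess F y u x = hess F y u (\<Sum>l\<in>UNIV. x $ l *\<^sub>R axis l 1)"
      by (simp add: basis_expansion scalar_mult_eq_scaleR[symmetric])
    then show ?thesis
      by (simp add: linear_sum[OF hess_linear(2)[OF y]] hess_scale[OF y] mult.commute)
  qed
  then show ?thesis by (simp add: matrix_vector_mult_def)
qed

context
  fixes y e assumes y: "y \<in> D" and can: "orthonormal_at F y e"
begin

lemma hess_nondegenerate: "(\<And>x. hess F y x v = 0) \<Longrightarrow> v = 0"
proof -
  assume "\<And>x. hess F y x v = 0"
  then have "hess F y v x = 0" for x using hess_commute[OF y] by metis
  then show "v = 0" by (subst canonical_expand[OF y can]) simp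
qed

lemma det_hess_nz: "det (\<chi> i l. hess F y (axis i 1) (axis l 1)) \<noteq> 0"
proof
  let ?A = "(\<chi> i l. hess F y (axis i 1) (axis l 1)) :: real ^ 3 ^ 3"
  assume "det ?A = 0"
  then have "\<not> inj ((*v) ?A)"
    unfolding matrix_left_invertible_injective[symmetric] invertible_left_inverse[symmetric] invertible_det_nz
    by simp
  then obtain v where v: "v \<noteq> 0" "?A *v v = 0"
    using linear_injective_0[OF matrix_vector_mul_linear[of ?A]] by blast
  then have ax: "hess F y (axis i 1) v = 0" for i
    unfolding hess_matrix[OF y] by (simp add: vec_eq_iff)
  have "hess F y x v = 0" for x
  proof -
    have "hess F y x v = hess F y (\<Sum>l\<in>UNIV. x $ l *\<^sub>R axis l 1) v"
      by (simp add: basis_expansion scalar_mult_eq_scaleR[symmetric])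
    then show ?thesis
      by (simp add: linear_sum[OF hess_linear(1)[OF y]] hess_scale[OF y] ax)
  qed
  then show False using hess_nondegenerate v(1) by blast
qed

lemma hess_dualvec: "hess F y (dualvec j y) x = x $ j"
proof -
  have "(\<chi> i l. hess F y (axis i 1) (axis l 1)) *v dualvec j y = axis j 1"
    using cramer[OF det_hess_nz, of "dualvec j y" "axis j 1"]
    by (simp add: dualvec_def cong: if_cong)
  then have ax: "hess F y (axis i 1) (dualvec j y) = (if i = j then 1 else 0)" for i
    unfolding hess_matrix[OF y] by (auto simp: vec_eq_iff axis_def)
  have "hess F y (dualvec j y) x = hess F y (\<Sum>l\<in>UNIV. x $ l *\<^sub>R axis l 1) (dualvec j y)"
    by (simp add: basis_expansion scalar_mult_eq_scaleR[symmetric] hess_commute[OF y, of x])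
  also have "\<dots> = x $ j"
    by (simp add: linear_sum[OF hess_linear(1)[OF y]] hess_scale[OF y] ax if_distrib cong: if_cong)
  finally show ?thesis .
qed

text \<open>The two sides are the trace of \<open>B\<close> with respect to the Hessian. The left
  one is visibly smooth in \<open>y\<close>, the right one can be evaluated in a canonical frame
  about whose dependence on \<open>y\<close> nothing is known.\<close>

lemma trace_eq:
  fixes B :: "real ^ 3 \<Rightarrow> real ^ 3 \<Rightarrow> 'b::real_vector"
  assumes B: "\<And>v. linear (\<lambda>u. B u v)" "\<And>u. linear (B u)"
  shows "(\<Sum>j\<in>UNIV. B (dualvec j y) (axis j 1)) = (\<Sum>m<3. \<epsilon> m *\<^sub>R B (e m) (e m))"
proof -
  have "B (dualvec j y) v = (\<Sum>m<3. (\<epsilon> m * e m $ j) *\<^sub>R B (e m) v)" for j v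
  proof -
    have "B (dualvec j y) v = B (\<Sum>m<3. (\<epsilon> m * hess F y (dualvec j y) (e m)) *\<^sub>R e m) v"
      using canonical_expand[OF y can, of "dualvec j y"] by simp
    then show ?thesis by (simp add: linear_sum[OF B(1)] linear_scale[OF B(1)] hess_dualvec)
  qed
  then have "(\<Sum>j\<in>UNIV. B (dualvec j y) (axis j 1)) = (\<Sum>m<3. \<Sum>j\<in>UNIV. (\<epsilon> m * e m $ j) *\<^sub>R B (e m) (axis j 1))"
    by (simp add: sum.swap[of _ UNIV])
  also have "\<dots> = (\<Sum>m<3. \<epsilon> m *\<^sub>R B (e m) (e m))"
  proof (rule sum.cong)
    fix m
    have "B (e m) (e m) = B (e m) (\<Sum>j\<in>UNIV. e m $ j *\<^sub>R axis j 1)"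
      by (simp add: basis_expansion scalar_mult_eq_scaleR[symmetric])
    then show "(\<Sum>j\<in>UNIV. (\<epsilon> m * e m $ j) *\<^sub>R B (e m) (axis j 1)) = \<epsilon> m *\<^sub>R B (e m) (e m)"
      by (simp add: linear_sum[OF B(2)] linear_scale[OF B(2)] scaleR_sum_right)
  qed simp
  finally show ?thesis .
qed

end

text \<open>In index notation with F_{ijk} the third derivative and indices raised by the Hessian,
  \<open>contr2\<close> is F_{xkl} F_{x'}^{kl}, \<open>contr3\<close> contracts it with F_{xkl}, and
  \<open>contrvec\<close> raises the last index. A cubic expression is used because the single trace
  of F_{ijk} vanishes, see \<open>third_trace\<close>.\<close>

definition contr2 :: "real ^ 3 \<Rightarrow> real ^ 3 \<Rightarrow> real ^ 3 \<Rightarrow> real" where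
  "contr2 y x x' = (\<Sum>k\<in>UNIV. \<Sum>l\<in>UNIV. third F y x (dualvec k y) (dualvec l y) * third F y x' (axis k 1) (axis l 1))"

definition contr3 :: "real ^ 3 \<Rightarrow> real ^ 3 \<Rightarrow> real" where
  "contr3 y x = (\<Sum>k\<in>UNIV. \<Sum>l\<in>UNIV. contr2 y (dualvec k y) (dualvec l y) * third F y x (axis k 1) (axis l 1))"

definition contrvec :: "real ^ 3 \<Rightarrow> real ^ 3" where
  "contrvec y = (\<Sum>j\<in>UNIV. contr3 y (dualvec j y) *\<^sub>R axis j 1)"

context
  fixes y e a b assumes y: "y \<in> D" and can: "canonical_at F y e a b"
begin

lemmas orth = can[THEN canonical_orth]

lemma linear_mult_family: "linear L \<Longrightarrow> linear (\<lambda>x. L x * c)" "linear L \<Longrightarrow> linear (\<lambda>x. c * L x)"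
  for L :: "'v::real_vector \<Rightarrow> real"
  by (auto simp: linear_iff algebra_simps)

lemma double_contraction:
  fixes p q :: "real ^ 3 \<Rightarrow> real ^ 3 \<Rightarrow> real"
  assumes "\<And>u u'. (\<Sum>l\<in>UNIV. p u (dualvec l y) * q u' (axis l 1)) = (\<Sum>n<3. \<epsilon> n * (p u (e n) * q u' (e n)))"
    and "\<And>v v'. (\<Sum>k\<in>UNIV. p (dualvec k y) v * q (axis k 1) v') = (\<Sum>m<3. \<epsilon> m * (p (e m) v * q (e m) v'))"
  shows "(\<Sum>k\<in>UNIV. \<Sum>l\<in>UNIV. p (dualvec k y) (dualvec l y) * q (axis k 1) (axis l 1)) =
    (\<Sum>m<3. \<Sum>n<3. \<epsilon> m * \<epsilon> n * (p (e m) (e n) * q (e m) (e n)))"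
proof -
  have "(\<Sum>k\<in>UNIV. \<Sum>l\<in>UNIV. p (dualvec k y) (dualvec l y) * q (axis k 1) (axis l 1)) =
    (\<Sum>n<3. \<Sum>k\<in>UNIV. \<epsilon> n * (p (dualvec k y) (e n) * q (axis k 1) (e n)))"
    unfolding assms(1) by (rule sum.swap)
  also have "\<dots> = (\<Sum>n<3. \<epsilon> n * (\<Sum>m<3. \<epsilon> m * (p (e m) (e n) * q (e m) (e n))))"
    unfolding sum_distrib_left[symmetric] assms(2) ..
  also have "\<dots> = (\<Sum>n<3. \<Sum>m<3. \<epsilon> m * \<epsilon> n * (p (e m) (e n) * q (e m) (e n)))"
    by (simp add: sum_distrib_left mult_ac)
  also have "\<dots> = (\<Sum>m<3. \<Sum>n<3. \<epsilon> m * \<epsilon> n * (p (e m) (e n) * q (e m) (e n)))"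
    by (rule sum.swap)
  finally show ?thesis .
qed

lemma contr2_eq: "contr2 y x x' = (\<Sum>m<3. \<Sum>n<3. \<epsilon> m * \<epsilon> n * (third F y x (e m) (e n) * third F y x' (e m) (e n)))"
proof -
  have "(\<Sum>l\<in>UNIV. third F y x u (dualvec l y) * third F y x' u' (axis l 1)) =
    (\<Sum>n<3. \<epsilon> n * (third F y x u (e n) * third F y x' u' (e n)))" for u u'
    using trace_eq[OF y orth, of "\<lambda>v v'. third F y x u v * third F y x' u' v'"]
    by (simp add: linear_mult_family third_linear[OF y])
  moreover have "(\<Sum>k\<in>UNIV. third F y x (dualvec k y) v * third F y x' (axis k 1) v') =
    (\<Sum>m<3. \<epsilon> m * (third F y x (e m) v * third F y x' (e m) v'))" for v v'
    using trace_eq[OF y orth, of "\<lambda>u u'. third F y x u v * third F y x' u' v'"]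
    by (simp add: linear_mult_family third_linear[OF y])
  ultimately show ?thesis unfolding contr2_def by (rule double_contraction)
qed

lemma contr2_linear: "linear (\<lambda>x. contr2 y x x')" "linear (contr2 y x)"
  unfolding contr2_def
  by (intro linear_compose_sum ballI linear_mult_family third_linear[OF y])+

lemma contr3_eq: "contr3 y x = (\<Sum>m<3. \<Sum>n<3. \<epsilon> m * \<epsilon> n * (contr2 y (e m) (e n) * third F y x (e m) (e n)))"
proof -
  have "(\<Sum>l\<in>UNIV. contr2 y u (dualvec l y) * third F y x u' (axis l 1)) =
    (\<Sum>n<3. \<epsilon> n * (contr2 y u (e n) * third F y x u' (e n)))" for u u'
    using trace_eq[OF y orth, of "\<lambda>v v'. contr2 y u v * third F y x u' v'"]
    by (simp add: linear_mult_family third_linear[OF y] contr2_linear)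
  moreover have "(\<Sum>k\<in>UNIV. contr2 y (dualvec k y) v * third F y x (axis k 1) v') =
    (\<Sum>m<3. \<epsilon> m * (contr2 y (e m) v * third F y x (e m) v'))" for v v'
    using trace_eq[OF y orth, of "\<lambda>u u'. contr2 y u v * third F y x u' v'"]
    by (simp add: linear_mult_family third_linear[OF y] contr2_linear)
  ultimately show ?thesis unfolding contr3_def by (rule double_contraction)
qed

lemma contr3_linear: "linear (contr3 y)"
  unfolding contr3_def by (intro linear_compose_sum ballI linear_mult_family third_linear[OF y])

lemma contrvec_eq: "contrvec y = (\<Sum>m<3. \<epsilon> m *\<^sub>R (contr3 y (e m) *\<^sub>R e m))"
proof -
  have l: "linear (\<lambda>u. contr3 y u *\<^sub>R v)" "linear (\<lambda>v. contr3 y u *\<^sub>R v)" for u and v :: "real ^ 3"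
    using contr3_linear by (auto simp: linear_iff algebra_simps)
  show ?thesis unfolding contrvec_def
    by (rule trace_eq[OF y orth, of "\<lambda>u v. contr3 y u *\<^sub>R v", OF l])
qed

text \<open>\<open>contr2\<close> is diagonal in the canonical frame with equal entries on e_1 and
  e_2. The cubic form is trace-free on the plane of e_1 and e_2, so only the component along e_0
  survives. Its coefficient is positive for positive \<open>a\<close>, also when \<open>b\<close> is
  zero.\<close>

lemma contrvec_canonical: "contrvec y = (4 * a * (16 * a * a + 8 * b * b)) *\<^sub>R e 0"
proof -
  have t: "third F y (e i) (e j) (e k) = cub a b i j k" if "i < 3" "j < 3" "k < 3" for i j k
    using can that by (simp add: canonical_at_def orthonormal_at_def)
  have c2: "contr2 y (e 0) (e 0) = 24 * a * a" "contr2 y (e 1) (e 1) = 8 * b * b - 8 * a * a"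
    "contr2 y (e 2) (e 2) = 8 * b * b - 8 * a * a"
    "contr2 y (e 0) (e 1) = 0" "contr2 y (e 0) (e 2) = 0" "contr2 y (e 1) (e 2) = 0"
    "contr2 y (e 1) (e 0) = 0" "contr2 y (e 2) (e 0) = 0" "contr2 y (e 2) (e 1) = 0"
    by (simp_all add: contr2_eq sum_upto_3 t \<epsilon>_def cub_def)
  have c3: "contr3 y (e 0) = - 4 * a * (16 * a * a + 8 * b * b)" "contr3 y (e 1) = 0" "contr3 y (e 2) = 0"
    by (simp_all add: contr3_eq sum_upto_3 c2 t \<epsilon>_def cub_def algebra_simps)
  show ?thesis by (simp add: contrvec_eq sum_upto_3 c3 \<epsilon>_def)
qed

text \<open>The coefficient \<open>b\<close> lives on the plane orthogonal to e_0 only, so inserting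
  e_0 removes it and both symmetry types obey the same formula.\<close>

lemma third_theta: "third F y (e 0) x x' = - 2 * a * (hess F y x x' + 3 * hess F y (e 0) x * hess F y (e 0) x')"
proof -
  have t: "third F y (e i) (e j) (e k) = cub a b i j k" if "i < 3" "j < 3" "k < 3" for i j k
    using can that by (simp add: canonical_at_def orthonormal_at_def)
  have h: "hess F y (e i) (e j) = (if i = j then \<epsilon> i else 0)" if "i < 3" "j < 3" for i j
    using can that by (simp add: canonical_at_def orthonormal_at_def)
  have ex: "x = (\<Sum>m<3. (\<epsilon> m * hess F y x (e m)) *\<^sub>R e m)" for x
    by (rule canonical_expand[OF y orth])
  define c where "c m = \<epsilon> m * hess F y x (e m)" for m
  define c' where "c' m = \<epsilon> m * hess F y x' (e m)" for m
  have x: "x = c 0 *\<^sub>R e 0 + c 1 *\<^sub>R e 1 + c 2 *\<^sub>R e 2" "x' = c' 0 *\<^sub>R e 0 + c' 1 *\<^sub>R e 1 + c' 2 *\<^sub>R e 2"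
    using ex[of x] ex[of x'] by (simp_all add: sum_upto_3 c_def c'_def)
  show ?thesis unfolding x
    by (simp add: hess_add[OF y] hess_scale[OF y] third_add[OF y] third_scale[OF y] t h cub_def \<epsilon>_def algebra_simps)
qed

text \<open>Apolarity of the cubic form: the entries -4a, -2a, -2a cancel because of the sign of the
  timelike direction, and -2b cancels against 2b.\<close>

lemma third_trace: "(\<Sum>j\<in>UNIV. third F y x (dualvec j y) (axis j 1)) = 0"
proof -
  have t: "third F y (e i) (e j) (e k) = cub a b i j k" if "i < 3" "j < 3" "k < 3" for i j k
    using can that by (simp add: canonical_at_def orthonormal_at_def)
  have "(\<Sum>j\<in>UNIV. third F y x (dualvec j y) (axis j 1)) = (\<Sum>m<3. \<epsilon> m * third F y x (e m) (e m))" for x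
    using trace_eq[OF y orth, of "third F y x"] by (simp add: third_linear[OF y])
  moreover have "(\<Sum>m<3. \<epsilon> m * third F y x (e m) (e m)) = 0"
  proof -
    define c where "c m = \<epsilon> m * hess F y x (e m)" for m
    have x: "x = c 0 *\<^sub>R e 0 + c 1 *\<^sub>R e 1 + c 2 *\<^sub>R e 2"
      using canonical_expand[OF y orth, of x] by (simp add: sum_upto_3 c_def)
    show ?thesis unfolding x
      by (simp add: sum_upto_3 third_add[OF y] third_scale[OF y] t \<epsilon>_def cub_def)
  qed
  ultimately show ?thesis by simp
qed

end

end

section \<open>From pointwise canonical bases to smooth canonical frames\<close>

locale pointwise_canonical = smooth_function3 F D for F :: "real ^ 3 \<Rightarrow> real" and D +
  fixes \<theta> :: "real ^ 3 \<Rightarrow> real ^ 3" and \<alpha> :: "real ^ 3 \<Rightarrow> real"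
  assumes \<alpha>_pos: "\<And>y. y \<in> D \<Longrightarrow> \<alpha> y > 0"
    and symmetric: "(\<forall>y\<in>D. \<exists>e b. b > 0 \<and> e 0 = \<theta> y \<and> canonical_at F y e (\<alpha> y) b) \<or>
      (\<forall>y\<in>D. \<exists>e. e 0 = \<theta> y \<and> canonical_at F y e (\<alpha> y) 0)"
begin

lemma canonical:
  assumes "y \<in> D" obtains e b where "b \<ge> 0" "e 0 = \<theta> y" "canonical_at F y e (\<alpha> y) b"
  using symmetric assms by (metis less_imp_le order_refl)

lemma hess_theta_theta: "y \<in> D \<Longrightarrow> hess F y (\<theta> y) (\<theta> y) = -1"
  by (rule canonical[of y]) (auto simp: canonical_at_def orthonormal_at_def \<epsilon>_def all_less_3)

lemma third_theta_eq: "y \<in> D \<Longrightarrow> third F y (\<theta> y) x x' =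
    - 2 * \<alpha> y * (hess F y x x' + 3 * hess F y (\<theta> y) x * hess F y (\<theta> y) x')"
  by (rule canonical[of y], assumption, use third_theta[of y _ "\<alpha> y" _ x x'] in metis)

lemma det_hess_nonzero: "y \<in> D \<Longrightarrow> det (\<chi> i l. hess F y (axis i 1) (axis l 1)) \<noteq> 0"
  by (rule canonical[of y]) (auto simp: det_hess_nz dest: canonical_orth)

lemma smooth_dualvec: "smooth_on D (dualvec j)"
proof -
  have c: "smooth_on D (\<lambda>y. (\<chi> i l. if l = k then axis j 1 $ i else hess F y (axis i 1) (axis l 1)) $ i $ l)"
    for i l k :: 3
    using smooth_hess_const by (cases "l = k") auto
  have "smooth_on D (\<lambda>y. dualvec j y)"
    unfolding dualvec_def
    by (intro smooth_on_vec_lambda smooth_on_divide smooth_on_det c open_D det_hess_nonzero)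
      (auto simp: smooth_hess_const)
  then show ?thesis by simp
qed

lemma smooth_contrvec: "smooth_on D contrvec"
proof -
  have 2: "smooth_on D (\<lambda>y. contr2 y (f y) (g y))" if "smooth_on D f" "smooth_on D g" for f g
    unfolding contr2_def
    by (intro smooth_on_sum smooth_on_mult smooth_third open_D order_refl smooth_on_const smooth_dualvec that)
  have 3: "smooth_on D (\<lambda>y. contr3 y (f y))" if "smooth_on D f" for f
    unfolding contr3_def
    by (intro smooth_on_sum smooth_on_mult smooth_third open_D order_refl smooth_on_const smooth_dualvec that 2)
  have "smooth_on D (\<lambda>y. contrvec y)"
    unfolding contrvec_def
    by (intro smooth_on_sum smooth_on_scaleR open_D smooth_on_const smooth_dualvec 3)
  then show ?thesis by simp
qed

lemma contrvec_theta:
  assumes "y \<in> D" obtains c where "c > 0" "contrvec y = c *\<^sub>R \<theta> y"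
proof (rule canonical[OF assms])
  fix e b assume *: "b \<ge> 0" "e 0 = \<theta> y" "canonical_at F y e (\<alpha> y) b"
  have "4 * \<alpha> y * (16 * \<alpha> y * \<alpha> y + 8 * b * b) > 0"
    using \<alpha>_pos[OF assms] *(1) by (simp add: add_pos_nonneg)
  then show thesis using contrvec_canonical[OF assms *(3)] *(2) that by metis
qed

text \<open>A double contraction of the square of the cubic form with itself is a positive multiple of the
  distinguished timelike direction, so that this direction is smooth.\<close>

lemma smooth_theta: "smooth_on D \<theta>"
proof (rule smooth_on_cong[OF open_D])
  have c: "\<exists>c>0. contrvec y = c *\<^sub>R \<theta> y \<and> - hess F y (contrvec y) (contrvec y) = c\<^sup>2" if y: "y \<in> D" for y
    by (rule contrvec_theta[OF y])
      (auto simp: hess_scale[OF y] hess_theta_theta[OF y] power2_eq_square)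
  show "smooth_on D (\<lambda>y. inverse (sqrt (- hess F y (contrvec y) (contrvec y))) *\<^sub>R contrvec y)"
    using c by (intro smooth_on_scaleR smooth_on_inverse smooth_on_sqrt smooth_on_minus smooth_hess
        smooth_contrvec open_D order_refl) fastforce+
  show "inverse (sqrt (- hess F y (contrvec y) (contrvec y))) *\<^sub>R contrvec y = \<theta> y" if "y \<in> D" for y
    using c[OF that] by auto
qed

lemma smooth_alpha: "smooth_on D \<alpha>"
proof (rule smooth_on_cong[OF open_D])
  show "smooth_on D (\<lambda>y. (- 1 / 4) * third F y (\<theta> y) (\<theta> y) (\<theta> y))"
    by (intro smooth_on_mult smooth_third open_D smooth_theta smooth_on_const order_refl)
  show "(- 1 / 4) * third F y (\<theta> y) (\<theta> y) (\<theta> y) = \<alpha> y" if "y \<in> D" for y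
    using that by (simp add: third_theta_eq hess_theta_theta)
qed

text \<open>Without \<open>b\<close> the cubic form is built from the Hessian and the covector
  h(\<theta>, .) alone. The coefficients 2 and 10 are fixed by the values -2a on (T, V, V) and -4a
  on (T, T, T).\<close>

lemma third_zero:
  assumes y: "y \<in> D" and e: "canonical_at F y e (\<alpha> y) 0" "e 0 = \<theta> y"
  shows "third F y u v w = 2 * \<alpha> y * (hess F y (\<theta> y) u * hess F y v w + hess F y (\<theta> y) v * hess F y u w
      + hess F y (\<theta> y) w * hess F y u v) + 10 * \<alpha> y * (hess F y (\<theta> y) u * hess F y (\<theta> y) v * hess F y (\<theta> y) w)"
proof -
  have t: "third F y (e i) (e j) (e k) = cub (\<alpha> y) 0 i j k" if "i < 3" "j < 3" "k < 3" for i j k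
    using e that by (simp add: canonical_at_def orthonormal_at_def)
  have h: "hess F y (e i) (e j) = (if i = j then \<epsilon> i else 0)" if "i < 3" "j < 3" for i j
    using e that by (simp add: canonical_at_def orthonormal_at_def)
  have x: "\<exists>p q r. x = p *\<^sub>R e 0 + q *\<^sub>R e 1 + r *\<^sub>R e 2" for x
    using canonical_expand[OF y canonical_orth[OF e(1)], of x] unfolding sum_upto_3 by blast
  obtain p q r where u: "u = p *\<^sub>R e 0 + q *\<^sub>R e 1 + r *\<^sub>R e 2" using x by blast
  obtain p' q' r' where v: "v = p' *\<^sub>R e 0 + q' *\<^sub>R e 1 + r' *\<^sub>R e 2" using x by blast
  obtain p'' q'' r'' where w: "w = p'' *\<^sub>R e 0 + q'' *\<^sub>R e 1 + r'' *\<^sub>R e 2" using x by blast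
  show ?thesis unfolding e(2)[symmetric] u v w
    by (simp add: hess_add[OF y] hess_scale[OF y] third_add[OF y] third_scale[OF y] t h cub_def \<epsilon>_def)
      (simp add: algebra_simps)
qed

lemma hess_pos:
  assumes "y \<in> D" "hess F y (\<theta> y) x = 0" "x \<noteq> 0" shows "hess F y x x > 0"
proof (rule canonical[OF assms(1)])
  fix e b assume *: "b \<ge> 0" "e 0 = \<theta> y" "canonical_at F y e (\<alpha> y) b"
  have h: "hess F y (e i) (e j) = (if i = j then \<epsilon> i else 0)" if "i < 3" "j < 3" for i j
    using * that by (simp add: canonical_at_def orthonormal_at_def)
  define c where "c m = \<epsilon> m * hess F y x (e m)" for m
  have c0: "c 0 = 0" using assms(2) *(2) hess_commute[OF assms(1)] by (simp add: c_def)
  have "x = c 0 *\<^sub>R e 0 + c 1 *\<^sub>R e 1 + c 2 *\<^sub>R e 2"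
    using canonical_expand[OF assms(1) canonical_orth[OF *(3)], of x] by (simp add: sum_upto_3 c_def)
  then have x: "x = c 1 *\<^sub>R e 1 + c 2 *\<^sub>R e 2" by (simp add: c0)
  have "hess F y x x = (c 1)\<^sup>2 + (c 2)\<^sup>2"
    unfolding x by (simp add: hess_add[OF assms(1)] hess_scale[OF assms(1)] h \<epsilon>_def power2_eq_square)
  moreover have "c 1 \<noteq> 0 \<or> c 2 \<noteq> 0" using x assms(3) by auto
  ultimately show ?thesis by (auto simp: sum_power2_gt_zero_iff)
qed

text \<open>A trace with respect to the Hessian has the same value in every orthonormal frame, so
  apolarity carries over from the canonical frame.\<close>

lemma third_trace_orthonormal:
  assumes y: "y \<in> D" and e: "orthonormal_at F y e"
  shows "third F y x (e 1) (e 1) + third F y x (e 2) (e 2) = third F y x (e 0) (e 0)"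
proof (rule canonical[OF y])
  fix e' b assume *: "canonical_at F y e' (\<alpha> y) b"
  have "(\<Sum>m<3. \<epsilon> m *\<^sub>R third F y x (e m) (e m)) = 0"
    unfolding third_trace[OF y *, of x, symmetric]
    by (rule trace_eq[OF y e, symmetric]) (auto simp: third_linear[OF y])
  then show ?thesis by (simp add: sum_upto_3 \<epsilon>_def)
qed

text \<open>A trace-free cubic form on a plane is the real part of a complex multiple of z^3, and
  rotating the axes by \<phi> turns that multiple by the angle \<open>3 * \<phi>\<close>. The chosen
  angle makes it real and positive, with value sqrt (p^2 + q^2).\<close>

lemma rotate_cubic:
  fixes p q :: real
  assumes p: "p > 0"
  defines "\<phi> \<equiv> - arctan (q / p) / 3"
  defines "c \<equiv> cos \<phi>" and "s \<equiv> sin \<phi>"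
  shows "p * (3 * c\<^sup>2 * s - s ^ 3) + q * (c ^ 3 - 3 * c * s\<^sup>2) = 0"
    "p * (c ^ 3 - 3 * c * s\<^sup>2) - q * (3 * c\<^sup>2 * s - s ^ 3) > 0"
proof -
  have 3: "3 * \<phi> = \<phi> + (\<phi> + \<phi>)" by simp
  have c3: "cos (3 * \<phi>) = c ^ 3 - 3 * c * s\<^sup>2" and s3: "sin (3 * \<phi>) = 3 * c\<^sup>2 * s - s ^ 3"
    unfolding 3 cos_add sin_add c_def s_def by (simp_all add: algebra_simps power2_eq_square power3_eq_cube)
  have "3 * \<phi> = - arctan (q / p)" by (simp add: \<phi>_def)
  then have cs: "cos (3 * \<phi>) = cos (arctan (q / p))" "sin (3 * \<phi>) = - sin (arctan (q / p))" by simp_all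
  have pos: "cos (arctan (q / p)) > 0" by (simp add: cos_arctan add_pos_nonneg)
  have sn: "sin (arctan (q / p)) = q / p * cos (arctan (q / p))"
    by (simp add: cos_arctan sin_arctan)
  show "p * (3 * c\<^sup>2 * s - s ^ 3) + q * (c ^ 3 - 3 * c * s\<^sup>2) = 0"
    unfolding c3[symmetric] s3[symmetric] cs sn using p by simp
  have "p * cos (3 * \<phi>) - q * sin (3 * \<phi>) = (p + q\<^sup>2 / p) * cos (arctan (q / p))"
    unfolding cs sn using p by (simp add: power2_eq_square algebra_simps)
  also have "\<dots> > 0" using p pos by (intro mult_pos_pos add_pos_nonneg) auto
  finally show "p * (c ^ 3 - 3 * c * s\<^sup>2) - q * (3 * c\<^sup>2 * s - s ^ 3) > 0" unfolding c3 s3 .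
qed

text \<open>Gram-Schmidt applied to \<theta> and the constant vectors \<open>e0 1\<close>,
  \<open>e0 2\<close>. At \<open>y0\<close> it changes nothing, so the squared lengths under the
  roots are positive nearby; the neighbourhoods \<open>Q1\<close> and \<open>Q2\<close> are where
  this persists.\<close>

lemma orthonormal_frame:
  assumes y0: "y0 \<in> D" and e0: "e0 0 = \<theta> y0" "orthonormal_at F y0 e0"
  shows "\<exists>Q E1 E2. open Q \<and> y0 \<in> Q \<and> Q \<subseteq> D \<and> smooth_on Q E1 \<and> smooth_on Q E2 \<and> E1 y0 = e0 1 \<and> E2 y0 = e0 2 \<and>
    (\<forall>y\<in>Q. orthonormal_at F y (frame3 (\<theta> y) (E1 y) (E2 y)))"
proof -
  have pos_open: "open {y \<in> S. f y > 0}" if "open S" "smooth_on S f" for S and f :: "real ^ 3 \<Rightarrow> real"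
  proof -
    have "{y \<in> S. f y > 0} = S \<inter> f -` {0<..}" by auto
    then show ?thesis using continuous_open_preimage[OF smooth_on_continuous[OF that(2)] that(1), of "{0<..}"] by simp
  qed
  \<comment> \<open>The projection is added, not subtracted, because \<theta> has square -1.\<close>
  define f1 where "f1 y = e0 1 + hess F y (e0 1) (\<theta> y) *\<^sub>R \<theta> y" for y
  have sf1: "smooth_on D f1" unfolding f1_def
    by (intro smooth_on_add smooth_on_scaleR smooth_hess open_D order_refl smooth_on_const smooth_theta)
  define Q1 where "Q1 = {y \<in> D. hess F y (f1 y) (f1 y) > 0}"
  have Q1: "open Q1" "Q1 \<subseteq> D" unfolding Q1_def
    using pos_open[OF open_D smooth_hess[OF order_refl open_D sf1 sf1]] by auto
  define E1 where "E1 y = inverse (sqrt (hess F y (f1 y) (f1 y))) *\<^sub>R f1 y" for y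
  have th: "smooth_on Q1 \<theta>" "smooth_on Q1 f1"
    using smooth_on_subset Q1(2) smooth_theta sf1 by blast+
  have sE1: "smooth_on Q1 E1" unfolding E1_def
    by (intro smooth_on_scaleR smooth_on_inverse smooth_on_sqrt smooth_hess Q1 th) (auto simp: Q1_def)
  define f2 where "f2 y = e0 2 + hess F y (e0 2) (\<theta> y) *\<^sub>R \<theta> y - hess F y (e0 2) (E1 y) *\<^sub>R E1 y" for y
  have sf2: "smooth_on Q1 f2" unfolding f2_def
    by (intro smooth_on_add smooth_on_diff smooth_on_scaleR smooth_hess Q1 smooth_on_const th sE1)
  define Q2 where "Q2 = {y \<in> Q1. hess F y (f2 y) (f2 y) > 0}"
  have Q2: "open Q2" "Q2 \<subseteq> Q1" "Q2 \<subseteq> D" unfolding Q2_def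
    using Q1(2) pos_open[OF Q1(1) smooth_hess[OF Q1(2,1) sf2 sf2]] by auto
  define E2 where "E2 y = inverse (sqrt (hess F y (f2 y) (f2 y))) *\<^sub>R f2 y" for y
  have sf2': "smooth_on Q2 f2" using smooth_on_subset Q2(2) sf2 by blast
  have sE2: "smooth_on Q2 E2" unfolding E2_def
    by (intro smooth_on_scaleR smooth_on_inverse smooth_on_sqrt smooth_hess Q2 sf2') (auto simp: Q2_def)
  have o1: "hess F y (\<theta> y) (f1 y) = 0" "hess F y (\<theta> y) (E1 y) = 0" if "y \<in> D" for y
    using that by (simp_all add: f1_def E1_def hess_add hess_scale hess_theta_theta hess_commute[of y "\<theta> y"])
  have o2: "hess F y (E1 y) (E1 y) = 1" if "y \<in> Q1" for y
    using that by (auto simp: Q1_def E1_def hess_scale field_simps)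
  have o3: "hess F y (\<theta> y) (f2 y) = 0" "hess F y (E1 y) (f2 y) = 0"
    "hess F y (\<theta> y) (E2 y) = 0" "hess F y (E1 y) (E2 y) = 0" if "y \<in> Q1" for y
  proof -
    have y: "y \<in> D" using that Q1 by auto
    show a: "hess F y (\<theta> y) (f2 y) = 0"
      using y by (simp add: f2_def hess_add hess_diff hess_scale hess_theta_theta hess_commute[of y "\<theta> y" "e0 2"] o1(2))
    show b: "hess F y (E1 y) (f2 y) = 0"
    proof -
      have "hess F y (E1 y) (\<theta> y) = 0" using o1(2)[OF y] hess_commute[OF y] by metis
      then show ?thesis
        using y hess_commute[OF y, of "E1 y" "e0 2"]
        by (simp add: f2_def hess_add hess_diff hess_scale o2[OF that])
    qed
    show "hess F y (\<theta> y) (E2 y) = 0" "hess F y (E1 y) (E2 y) = 0"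
      using a b by (simp_all add: E2_def hess_scale y)
  qed
  have o4: "hess F y (E2 y) (E2 y) = 1" if "y \<in> Q2" for y
    using that Q2 by (auto simp: Q2_def Q1_def E2_def hess_scale field_simps)
  have h0: "hess F y0 (e0 1) (\<theta> y0) = 0" "hess F y0 (e0 2) (\<theta> y0) = 0" "hess F y0 (e0 2) (e0 1) = 0"
    "hess F y0 (e0 1) (e0 1) = 1" "hess F y0 (e0 2) (e0 2) = 1"
    using e0 by (auto simp: orthonormal_at_def \<epsilon>_def all_less_3)
  have at1: "f1 y0 = e0 1" "y0 \<in> Q1" using y0 by (auto simp: f1_def h0 Q1_def)
  then have at2: "E1 y0 = e0 1" by (simp add: E1_def h0)
  then have at3: "f2 y0 = e0 2" "y0 \<in> Q2" using at1 by (auto simp: f2_def h0 Q2_def)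
  then have at4: "E2 y0 = e0 2" by (simp add: E2_def h0)
  have "orthonormal_at F y (frame3 (\<theta> y) (E1 y) (E2 y))" if "y \<in> Q2" for y
  proof -
    have y: "y \<in> D" "y \<in> Q1" using that Q2 by auto
    show ?thesis
      using o1[OF y(1)] o2[OF y(2)] o3[OF y(2)] o4[OF that] hess_theta_theta[OF y(1)]
        hess_commute[OF y(1), of "E1 y" "\<theta> y"] hess_commute[OF y(1), of "E2 y" "\<theta> y"] hess_commute[OF y(1), of "E2 y" "E1 y"]
      by (simp add: orthonormal_at_def all_less_3 frame3_def \<epsilon>_def)
  qed
  then show ?thesis using Q2 at2 at3 at4 sE2 smooth_on_subset[OF sE1 Q2(2)] by blast
qed

text \<open>If the cubic form has no \<open>b\<close>-part, \<open>third_zero\<close> makes every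
  orthonormal frame that starts with \<theta> canonical. Otherwise an orthonormal frame is turned in
  the plane orthogonal to \<theta> until the form is canonical there.\<close>

lemma local_frame:
  assumes y0: "y0 \<in> D"
  shows "\<exists>Q e b. open Q \<and> y0 \<in> Q \<and> Q \<subseteq> D \<and> canonical_frame F Q e \<alpha> b \<and> (\<forall>y. e 0 y = \<theta> y)"
proof -
  have mk: ?thesis if Q: "open Q" "y0 \<in> Q" "Q \<subseteq> D" and sm: "smooth_on Q V" "smooth_on Q W"
    and can: "\<And>y. y \<in> Q \<Longrightarrow> canonical_at F y (frame3 (\<theta> y) (V y) (W y)) (\<alpha> y) (b y)"
    and b: "(\<forall>y\<in>Q. b y > 0) \<or> (\<forall>y\<in>Q. b y = 0)" for Q V W and b :: "real ^ 3 \<Rightarrow> real"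
  proof -
    define e where "e i y = frame3 (\<theta> y) (V y) (W y) i" for i y
    have "smooth_on Q (e i)" if "i < 3" for i
    proof -
      have "e i = (if i = 0 then \<theta> else if i = 1 then V else W)" by (auto simp: e_def frame3_def)
      then show ?thesis using sm smooth_on_subset[OF smooth_theta Q(3)] by simp
    qed
    then have "canonical_frame F Q e \<alpha> b"
      using Q can b smooth_on_subset[OF smooth_F Q(3)] \<alpha>_pos
      by unfold_locales (auto simp: canonical_at_def orthonormal_at_def e_def)
    moreover have "e 0 y = \<theta> y" for y by (simp add: e_def frame3_def)
    ultimately show ?thesis using Q by blast
  qed
  have th: "third F y (\<theta> y) (\<theta> y) (\<theta> y) = - 4 * \<alpha> y" "third F y (\<theta> y) (\<theta> y) u = 0"
    "third F y (\<theta> y) u w = - 2 * \<alpha> y * hess F y u w"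
    if "y \<in> D" "hess F y (\<theta> y) u = 0" "hess F y (\<theta> y) w = 0" for y u w
    using that by (simp_all add: third_theta_eq hess_theta_theta)
  show ?thesis
  proof (cases "\<forall>y\<in>D. \<exists>e b. b > 0 \<and> e 0 = \<theta> y \<and> canonical_at F y e (\<alpha> y) b")
    case False
    then have zero: "\<exists>e. e 0 = \<theta> y \<and> canonical_at F y e (\<alpha> y) 0" if "y \<in> D" for y
      using symmetric that by blast
    then obtain e0 where e0: "e0 0 = \<theta> y0" "canonical_at F y0 e0 (\<alpha> y0) 0" using y0 by blast
    obtain Q V W where Q: "open Q" "y0 \<in> Q" "Q \<subseteq> D" "smooth_on Q V" "smooth_on Q W"
      and o: "\<forall>y\<in>Q. orthonormal_at F y (frame3 (\<theta> y) (V y) (W y))"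
      using orthonormal_frame[OF y0 e0(1) canonical_orth[OF e0(2)]] by blast
    have "canonical_at F y (frame3 (\<theta> y) (V y) (W y)) (\<alpha> y) 0" if "y \<in> Q" for y
    proof -
      have y: "y \<in> D" using that Q by auto
      have h: "hess F y (\<theta> y) (V y) = 0" "hess F y (\<theta> y) (W y) = 0" "hess F y (V y) (W y) = 0"
        "hess F y (V y) (V y) = 1" "hess F y (W y) (W y) = 1"
        using o that by (auto simp: orthonormal_at_def all_less_3 frame3_def \<epsilon>_def)
      obtain e where e: "e 0 = \<theta> y" "canonical_at F y e (\<alpha> y) 0" using zero[OF y] by blast
      show ?thesis
        by (rule canonical_atI[OF y]) (simp_all add: h hess_theta_theta y th third_zero[OF y e(2,1)])
    qed
    then show ?thesis by (intro mk[OF Q, of "\<lambda>_. 0"]) auto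
  next
    case True
    then obtain e0 b0 where e0: "b0 > 0" "e0 0 = \<theta> y0" "canonical_at F y0 e0 (\<alpha> y0) b0" using y0 by blast
    obtain Q E1 E2 where Q: "open Q" "y0 \<in> Q" "Q \<subseteq> D" "smooth_on Q E1" "smooth_on Q E2"
      and at: "E1 y0 = e0 1" "E2 y0 = e0 2"
      and o: "\<forall>y\<in>Q. orthonormal_at F y (frame3 (\<theta> y) (E1 y) (E2 y))"
      using orthonormal_frame[OF y0 e0(2) canonical_orth[OF e0(3)]] by blast
    define p where "p y = - third F y (E1 y) (E1 y) (E1 y) / 2" for y
    define q where "q y = - third F y (E2 y) (E2 y) (E2 y) / 2" for y
    have sp: "smooth_on Q p" and sq: "smooth_on Q q"
      unfolding p_def q_def by (intro smooth_on_divide smooth_on_minus smooth_third Q smooth_on_const; simp)+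
    \<comment> \<open>At \<open>y0\<close> the frame is canonical and \<open>p\<close> equals
      \<open>b0 > 0\<close>; on the set where \<open>p\<close> stays positive the quotient in the
      rotation angle is smooth.\<close>
    define Q' where "Q' = Q \<inter> p -` {0<..}"
    have "p y0 = b0" using e0 by (simp add: p_def at canonical_at_def cub_def)
    then have Q': "open Q'" "y0 \<in> Q'" "Q' \<subseteq> Q" "Q' \<subseteq> D"
      unfolding Q'_def using Q e0(1) by (auto intro!: continuous_open_preimage smooth_on_continuous sp)
    define \<phi> where "\<phi> y = - arctan (q y / p y) / 3" for y
    have s\<phi>: "smooth_on Q' \<phi>" unfolding \<phi>_def
      using Q' smooth_on_subset[OF sp Q'(3)] smooth_on_subset[OF sq Q'(3)]
      by (intro smooth_on_divide smooth_on_minus smooth_on_arctan smooth_on_const) (auto simp: Q'_def)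
    define V where "V y = cos (\<phi> y) *\<^sub>R E1 y + sin (\<phi> y) *\<^sub>R E2 y" for y
    define W where "W y = (- sin (\<phi> y)) *\<^sub>R E1 y + cos (\<phi> y) *\<^sub>R E2 y" for y
    note sE = smooth_on_subset[OF Q(4) Q'(3)] smooth_on_subset[OF Q(5) Q'(3)]
    have sV: "smooth_on Q' V" and sW: "smooth_on Q' W" unfolding V_def W_def
      by (intro smooth_on_add smooth_on_scaleR smooth_on_minus smooth_on_cos_sin s\<phi> Q'(1) sE)+
    define b where "b y = - third F y (V y) (V y) (V y) / 2" for y
    have "canonical_at F y (frame3 (\<theta> y) (V y) (W y)) (\<alpha> y) (b y) \<and> b y > 0" if yQ: "y \<in> Q'" for y
    proof -
      have y: "y \<in> D" "y \<in> Q" "p y > 0" using yQ Q' by (auto simp: Q'_def)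
      define c where "c = cos (\<phi> y)"
      define s where "s = sin (\<phi> y)"
      have cs: "c * c + s * s = 1" unfolding c_def s_def
        by (metis power2_eq_square sin_cos_squared_add2)
      have h: "hess F y (\<theta> y) (E1 y) = 0" "hess F y (\<theta> y) (E2 y) = 0" "hess F y (E1 y) (E2 y) = 0" "hess F y (E2 y) (E1 y) = 0"
        "hess F y (E1 y) (E1 y) = 1" "hess F y (E2 y) (E2 y) = 1"
        using o y(2) by (auto simp: orthonormal_at_def all_less_3 frame3_def \<epsilon>_def)
      \<comment> \<open>On the plane orthogonal to \<theta> a symmetric cubic form has four
        components; apolarity expresses all of them by \<open>p\<close> and
        \<open>q\<close>.\<close>
      have tr: "third F y x (E1 y) (E1 y) + third F y x (E2 y) (E2 y) = third F y x (\<theta> y) (\<theta> y)" for x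
        using third_trace_orthonormal[OF y(1), of "frame3 (\<theta> y) (E1 y) (E2 y)" x] o y(2) by (auto simp: frame3_def)
      have t111: "third F y (E1 y) (E1 y) (E1 y) = - 2 * p y" and t222: "third F y (E2 y) (E2 y) (E2 y) = - 2 * q y"
        by (simp_all add: p_def q_def)
      have z: "third F y x (\<theta> y) (\<theta> y) = 0" if "hess F y (\<theta> y) x = 0" for x
        using third_commute13[OF y(1), of x] th(2)[OF y(1) that that] by simp
      have t122: "third F y (E1 y) (E2 y) (E2 y) = 2 * p y" and t211: "third F y (E2 y) (E1 y) (E1 y) = 2 * q y"
        using tr[of "E1 y"] tr[of "E2 y"] t111 t222 z h by auto
      have tt: "third F y (E1 y) (E1 y) (E2 y) = 2 * q y" "third F y (E1 y) (E2 y) (E1 y) = 2 * q y"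
        "third F y (E2 y) (E1 y) (E2 y) = 2 * p y" "third F y (E2 y) (E2 y) (E1 y) = 2 * p y"
        using t122 t211 third_commute12[OF y(1)] third_commute13[OF y(1)] by metis+
      note ev = V_def W_def c_def[symmetric] s_def[symmetric] hess_add[OF y(1)] hess_scale[OF y(1)]
        hess_diff[OF y(1)] third_linear[OF y(1), THEN linear_diff] third_add[OF y(1)] third_scale[OF y(1)] h t111 t222 t122 t211 tt
      have hV: "hess F y (\<theta> y) (V y) = 0" "hess F y (\<theta> y) (W y) = 0" "hess F y (V y) (W y) = 0"
        "hess F y (V y) (V y) = 1" "hess F y (W y) (W y) = 1" "hess F y (W y) (V y) = 0"
        using cs by (simp_all add: ev algebra_simps)
      have VVV: "third F y (V y) (V y) (V y) = - 2 * (p y * (c ^ 3 - 3 * c * s\<^sup>2) - q y * (3 * c\<^sup>2 * s - s ^ 3))"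
        by (simp add: ev power2_eq_square power3_eq_cube algebra_simps)
      have VVW: "third F y (V y) (V y) (W y) = 2 * (p y * (3 * c\<^sup>2 * s - s ^ 3) + q y * (c ^ 3 - 3 * c * s\<^sup>2))"
        by (simp add: ev power2_eq_square power3_eq_cube algebra_simps)
      note rot = rotate_cubic[OF y(3), of "q y", folded \<phi>_def, folded c_def s_def]
      have VVW0: "third F y (V y) (V y) (W y) = 0" unfolding VVW rot(1) by simp
      have bpos: "b y > 0" using rot(2) by (simp add: b_def VVV)
      have "orthonormal_at F y (frame3 (\<theta> y) (V y) (W y))"
        using hV hess_theta_theta[OF y(1)] hess_commute[OF y(1), of "V y" "\<theta> y"] hess_commute[OF y(1), of "W y" "\<theta> y"]
        by (simp add: orthonormal_at_def all_less_3 frame3_def \<epsilon>_def)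
      then have trV: "third F y x (V y) (V y) + third F y x (W y) (W y) = third F y x (\<theta> y) (\<theta> y)" for x
        using third_trace_orthonormal[OF y(1), of "frame3 (\<theta> y) (V y) (W y)" x] by (auto simp: frame3_def)
      have "third F y (V y) (W y) (W y) = 2 * b y" "third F y (W y) (W y) (W y) = 0"
        using trV[of "V y"] trV[of "W y"] z hV VVW0 third_commute13[OF y(1), of "W y" "V y" "V y"]
        by (simp_all add: b_def)
      then have "canonical_at F y (frame3 (\<theta> y) (V y) (W y)) (\<alpha> y) (b y)"
        using hV VVW0 by (intro canonical_atI[OF y(1)]) (simp_all add: hess_theta_theta y(1) th b_def)
      then show ?thesis using bpos by simp
    qed
    then show ?thesis by (intro mk[OF Q'(1,2,4) sV sW, of b]) auto
  qed
qed

lemma structure_equations: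
  assumes y: "y \<in> D"
  shows "\<exists>\<beta>. \<forall>x. \<partial> x \<theta> y = \<beta> *\<^sub>R x + ((\<beta> + 2 * \<alpha> y) * hess F y (\<theta> y) x) *\<^sub>R \<theta> y \<and>
    \<partial> x \<alpha> y = - 4 * \<alpha> y * (\<alpha> y - \<beta>) * hess F y (\<theta> y) x"
proof -
  obtain Q e b where Q: "y \<in> Q" "canonical_frame F Q e \<alpha> b" "\<And>y. e 0 y = \<theta> y"
    using local_frame[OF y] by blast
  have e: "e 0 = \<theta>" using Q(3) by auto
  show ?thesis using canonical_frame.structure_equations[OF Q(2,1)] unfolding e .
qed

end

subsection \<open>Integration of the structure equations\<close>

lemma constant_on_convex:
  fixes f :: "'a::real_normed_vector \<Rightarrow> 'b::real_normed_vector"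
  assumes "convex D" "\<And>y. y \<in> D \<Longrightarrow> (f has_derivative (\<lambda>x. 0)) (at y)"
  obtains c where "\<And>y. y \<in> D \<Longrightarrow> f y = c"
  using has_derivative_zero_constant[OF assms(1), of f] assms(2) has_derivative_at_withinI by metis

lemma affine_on_convex:
  fixes f :: "'a::euclidean_space \<Rightarrow> real"
  assumes D: "convex D" "open D" and f: "smooth_on D f"
    and zero: "\<And>x u y. y \<in> D \<Longrightarrow> \<partial> x (\<partial> u f) y = 0"
  obtains l c where "\<And>y. y \<in> D \<Longrightarrow> f y = l \<bullet> y + c"
proof -
  have "\<exists>c. \<forall>y\<in>D. \<partial> u f y = c" for u
  proof -
    have "(\<partial> u f has_derivative (\<lambda>x. 0)) (at y)" if "y \<in> D" for y
      using smooth_on_has_derivative[OF smooth_on_dir_deriv[OF f] that, of u] zero[OF that] by simp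
    then show ?thesis by (rule constant_on_convex[OF D(1)]) auto
  qed
  then obtain c where c: "\<And>u y. y \<in> D \<Longrightarrow> \<partial> u f y = c u" by metis
  define l where "l = (\<Sum>b\<in>Basis. c b *\<^sub>R b)"
  have "((\<lambda>y. f y - l \<bullet> y) has_derivative (\<lambda>x. 0)) (at y)" if y: "y \<in> D" for y
  proof -
    have lin: "linear (\<lambda>x. \<partial> x f y)" by (rule linear_dir_deriv[OF smooth_on_differentiable[OF f y]])
    have "\<partial> x f y = l \<bullet> x" for x
      using linear_euclidean[OF lin, of x]
      by (simp add: l_def c[OF y] inner_sum_left inner_commute[of x] mult.commute)
    then show ?thesis
      using smooth_on_has_derivative[OF f y] by (auto intro!: derivative_eq_intros)
  qed
  then obtain k where "\<And>y. y \<in> D \<Longrightarrow> f y - l \<bullet> y = k"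
    by (rule constant_on_convex[OF D(1)]) (assumption, rule that)
  then show thesis using that[of l k] by (metis diff_add_cancel add.commute)
qed

context pointwise_canonical
begin

definition q :: "real ^ 3 \<Rightarrow> real" where "q y = inverse (sqrt (\<alpha> y))"

text \<open>The number in \<open>structure_equations\<close> is only known to exist at each point.
  Taking the trace of the derivative of \<theta> gives 3 \<beta> - (\<beta> + 2 \<alpha>), so this
  divergence formula recovers it and shows that it is continuous.\<close>

definition \<beta> :: "real ^ 3 \<Rightarrow> real" where "\<beta> y = (\<Sum>i\<in>UNIV. \<partial> (axis i 1) \<theta> y $ i) / 2 + \<alpha> y"

lemma q_pos: "y \<in> D \<Longrightarrow> q y > 0" using \<alpha>_pos by (simp add: q_def)

lemma alpha_q: "y \<in> D \<Longrightarrow> \<alpha> y = inverse ((q y)\<^sup>2)"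
  using \<alpha>_pos[of y] by (simp add: q_def power_inverse)

lemma smooth_q: "smooth_on D q"
proof -
  have "smooth_on D (\<lambda>y. inverse (sqrt (\<alpha> y)))"
    using \<alpha>_pos by (intro smooth_on_inverse smooth_on_sqrt open_D smooth_alpha) (auto dest: less_imp_neq[symmetric])
  then show ?thesis by (simp add: q_def[abs_def])
qed

lemma structure_beta:
  assumes y: "y \<in> D"
  shows "\<partial> x \<theta> y = \<beta> y *\<^sub>R x + ((\<beta> y + 2 * \<alpha> y) * hess F y (\<theta> y) x) *\<^sub>R \<theta> y"
    "\<partial> x \<alpha> y = - 4 * \<alpha> y * (\<alpha> y - \<beta> y) * hess F y (\<theta> y) x"
proof -
  obtain b where b: "\<And>x. \<partial> x \<theta> y = b *\<^sub>R x + ((b + 2 * \<alpha> y) * hess F y (\<theta> y) x) *\<^sub>R \<theta> y"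
    "\<And>x. \<partial> x \<alpha> y = - 4 * \<alpha> y * (\<alpha> y - b) * hess F y (\<theta> y) x"
    using structure_equations[OF y] by blast
  have "hess F y (\<theta> y) (\<theta> y) = hess F y (\<theta> y) (\<Sum>i\<in>UNIV. \<theta> y $ i *\<^sub>R axis i 1)"
    by (simp add: basis_expansion scalar_mult_eq_scaleR[symmetric])
  then have "(\<Sum>i\<in>UNIV. \<theta> y $ i * hess F y (\<theta> y) (axis i 1)) = - 1"
    using hess_theta_theta[OF y] by (simp add: linear_sum[OF hess_linear(2)[OF y]] hess_scale[OF y])
  moreover have "(\<Sum>i\<in>UNIV. \<partial> (axis i 1) \<theta> y $ i) =
      3 * b + (b + 2 * \<alpha> y) * (\<Sum>i\<in>UNIV. \<theta> y $ i * hess F y (\<theta> y) (axis i 1))"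
    unfolding b by (simp add: sum_3 axis_def algebra_simps)
  ultimately have "b = \<beta> y" by (simp add: \<beta>_def field_simps)
  then show "\<partial> x \<theta> y = \<beta> y *\<^sub>R x + ((\<beta> y + 2 * \<alpha> y) * hess F y (\<theta> y) x) *\<^sub>R \<theta> y"
    "\<partial> x \<alpha> y = - 4 * \<alpha> y * (\<alpha> y - \<beta> y) * hess F y (\<theta> y) x"
    using b by auto
qed

lemma continuous_beta: "continuous_on D \<beta>"
proof -
  have "smooth_on D (\<lambda>y. \<partial> (axis i 1) \<theta> y $ i)" for i
    by (intro smooth_on_vec_nth open_D smooth_on_dir_deriv smooth_theta)
  then show ?thesis unfolding \<beta>_def[abs_def]
    by (intro continuous_intros smooth_on_continuous smooth_alpha) auto
qed

lemma has_derivative_theta: "y \<in> D \<Longrightarrow> (\<theta> has_derivative (\<lambda>x. \<partial> x \<theta> y)) (at y)"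
  by (rule smooth_on_has_derivative[OF smooth_theta])

lemma has_derivative_q:
  assumes y: "y \<in> D"
  shows "(q has_derivative (\<lambda>x. 2 * (q y ^ 3) * \<alpha> y * (\<alpha> y - \<beta> y) * hess F y (\<theta> y) x)) (at y)"
proof -
  have a: "\<alpha> y > 0" by (rule \<alpha>_pos[OF y])
  have "(\<alpha> has_derivative (\<lambda>x. - 4 * \<alpha> y * (\<alpha> y - \<beta> y) * hess F y (\<theta> y) x)) (at y)"
    using smooth_on_has_derivative[OF smooth_alpha y] structure_beta(2)[OF y] by simp
  then show ?thesis unfolding q_def[abs_def]
    using a by (auto intro!: derivative_eq_intros simp: power3_eq_cube field_simps)
qed

lemma has_derivative_form:
  assumes y: "y \<in> D"
  shows "((\<lambda>z. hess F z (\<theta> z) u) has_derivative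
    (\<lambda>x. - 2 * \<alpha> y * (hess F y x u + 3 * hess F y (\<theta> y) x * hess F y (\<theta> y) u)
      + \<beta> y * hess F y x u + (\<beta> y + 2 * \<alpha> y) * hess F y (\<theta> y) x * hess F y (\<theta> y) u)) (at y)"
  by (rule has_derivative_eq_rhs[OF has_derivative_hess[OF y smooth_on_differentiable[OF smooth_theta y] differentiable_const]])
    (auto simp: fun_eq_iff dir_deriv_eq[OF has_derivative_const] structure_beta(1)[OF y] third_commute12[OF y, of _ "\<theta> y"]
      third_theta_eq[OF y] hess_add[OF y] hess_scale[OF y] linear_0[OF hess_linear(2)[OF y]] algebra_simps)

text \<open>The Hessian composed with the orthogonal projection along \<open>\<theta> y\<close>.\<close>

definition tform :: "real ^ 3 \<Rightarrow> real ^ 3 \<Rightarrow> real ^ 3 \<Rightarrow> real" where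
  "tform y u v = hess F y u v + hess F y (\<theta> y) u * hess F y (\<theta> y) v"

lemma tform_commute: "y \<in> D \<Longrightarrow> tform y u v = tform y v u"
  by (simp add: tform_def hess_commute mult.commute)

text \<open>The value is the square of the projection of \<open>x\<close> to the orthogonal
  complement of \<theta>, where the Hessian is positive; the projection vanishes only on multiples
  of \<theta>.\<close>

lemma tform_pos:
  assumes y: "y \<in> D" and x: "\<And>c. x \<noteq> c *\<^sub>R \<theta> y"
  shows "tform y x x > 0"
proof -
  define p where "p = x + hess F y (\<theta> y) x *\<^sub>R \<theta> y"
  have "p \<noteq> 0" using x[of "- hess F y (\<theta> y) x"] by (auto simp: p_def add_eq_0_iff2)
  moreover have "hess F y (\<theta> y) p = 0" by (simp add: p_def hess_add[OF y] hess_scale[OF y] hess_theta_theta[OF y])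
  ultimately have "hess F y p p > 0" using hess_pos[OF y] by blast
  also have "hess F y p p = tform y x x"
    by (simp add: p_def tform_def hess_add[OF y] hess_scale[OF y] hess_theta_theta[OF y]
        hess_commute[OF y, of x "\<theta> y"] algebra_simps)
  finally show ?thesis .
qed

lemma has_derivative_tform:
  assumes y: "y \<in> D" and e: "canonical_at F y e (\<alpha> y) 0" "e 0 = \<theta> y"
  shows "((\<lambda>z. tform z u v) has_derivative
    (\<lambda>x. 2 * \<alpha> y * hess F y (\<theta> y) x * hess F y u v
      + \<beta> y * (hess F y x u * hess F y (\<theta> y) v + hess F y x v * hess F y (\<theta> y) u)
      + (2 * \<beta> y + 2 * \<alpha> y) * hess F y (\<theta> y) x * hess F y (\<theta> y) u * hess F y (\<theta> y) v)) (at y)"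
proof -
  have "((\<lambda>z. hess F z u v) has_derivative (\<lambda>x. third F y x u v)) (at y)"
    using smooth_on_has_derivative[OF smooth_hess_const y] by (simp add: dir_deriv_hess_const)
  then show ?thesis unfolding tform_def
    by (rule has_derivative_eq_rhs[OF has_derivative_add[OF _ has_derivative_mult[OF
            has_derivative_form[OF y] has_derivative_form[OF y]]]])
      (simp add: fun_eq_iff third_zero[OF y e] hess_commute[OF y, of v u], simp add: algebra_simps)
qed

text \<open>A Schur complement: the Gram determinant splits off the timelike direction if
  \<open>u1\<close>, \<open>u2\<close> are orthogonal to \<theta> or if \<open>u3\<close> is a
  multiple of it. The first alternative serves \<beta> = 2 \<alpha>, where the slices are orthogonal
  to \<theta>, the second \<beta> = 0, where the third axis is parallel to \<theta>.\<close>

lemma det_tform: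
  assumes y: "y \<in> D"
    and *: "hess F y (\<theta> y) u1 = 0 \<and> hess F y (\<theta> y) u2 = 0 \<or> (\<exists>c. u3 = c *\<^sub>R \<theta> y)"
  shows "det (vector [vector [hess F y u1 u1, hess F y u1 u2, hess F y u1 u3],
      vector [hess F y u2 u1, hess F y u2 u2, hess F y u2 u3],
      vector [hess F y u3 u1, hess F y u3 u2, hess F y u3 u3]] :: real ^ 3 ^ 3) =
    - (hess F y (\<theta> y) u3)\<^sup>2 * (tform y u1 u1 * tform y u2 u2 - (tform y u1 u2)\<^sup>2)"
  using *
proof (elim disjE exE conjE)
  assume z: "hess F y (\<theta> y) u1 = 0" "hess F y (\<theta> y) u2 = 0"
  show ?thesis
  proof (rule canonical[OF y])
    fix e b assume e: "e 0 = \<theta> y" "canonical_at F y e (\<alpha> y) b"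
    have h: "hess F y (e i) (e j) = (if i = j then \<epsilon> i else 0)" if "i < 3" "j < 3" for i j
      using canonical_orth[OF e(2)] that by (simp add: orthonormal_at_def)
    have x: "x = (- hess F y (e 0) x) *\<^sub>R e 0 + hess F y (e 1) x *\<^sub>R e 1 + hess F y (e 2) x *\<^sub>R e 2" for x
      using canonical_expand[OF y canonical_orth[OF e(2)], of x]
      by (simp add: sum_upto_3 \<epsilon>_def hess_commute[OF y, of x])
    have hx: "hess F y u v = - hess F y (e 0) u * hess F y (e 0) v + hess F y (e 1) u * hess F y (e 1) v
        + hess F y (e 2) u * hess F y (e 2) v" for u v
    proof -
      have "hess F y u v = hess F y ((- hess F y (e 0) u) *\<^sub>R e 0 + hess F y (e 1) u *\<^sub>R e 1 + hess F y (e 2) u *\<^sub>R e 2) v"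
        using x[of u] by simp
      then show ?thesis by (simp only: hess_add[OF y] hess_scale[OF y] real_scaleR_def)
    qed
    show ?thesis
      unfolding tform_def det_3 vector_3 hx[of u1] hx[of u2] hx[of u3] e(1) z by algebra
  qed
next
  fix c assume c: "u3 = c *\<^sub>R \<theta> y"
  have comm: "hess F y u1 (\<theta> y) = hess F y (\<theta> y) u1" "hess F y u2 (\<theta> y) = hess F y (\<theta> y) u2" "hess F y u2 u1 = hess F y u1 u2"
    using hess_commute[OF y] by blast+
  show ?thesis
    unfolding c tform_def det_3 vector_3 hess_scale[OF y] real_scaleR_def hess_theta_theta[OF y] comm by algebra
qed

end

section \<open>Integration in the case \<beta> = 0\<close>

locale minus_type = pointwise_canonical +
  assumes convex_D: "convex D" and beta_0: "\<And>y. y \<in> D \<Longrightarrow> \<beta> y = 0"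
begin

lemma dq: "y \<in> D \<Longrightarrow> (q has_derivative (\<lambda>x. 2 / q y * hess F y (\<theta> y) x)) (at y)"
  by (rule has_derivative_eq_rhs[OF has_derivative_q])
    (use q_pos[of y] in \<open>auto simp: fun_eq_iff beta_0 alpha_q power2_eq_square power3_eq_cube field_simps\<close>)

lemma dform: "y \<in> D \<Longrightarrow> ((\<lambda>z. hess F z (\<theta> z) u) has_derivative
    (\<lambda>x. - 2 / (q y)\<^sup>2 * (hess F y x u + 2 * hess F y (\<theta> y) x * hess F y (\<theta> y) u))) (at y)"
  by (rule has_derivative_eq_rhs[OF has_derivative_form])
    (use q_pos[of y] in \<open>auto simp: fun_eq_iff beta_0 alpha_q field_simps\<close>)

lemma theta_direction:
  obtains e where "\<And>y. y \<in> D \<Longrightarrow> \<theta> y = q y *\<^sub>R e"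
proof -
  have "((\<lambda>y. inverse (q y) *\<^sub>R \<theta> y) has_derivative (\<lambda>x. 0)) (at y)" if y: "y \<in> D" for y
    using q_pos[OF y]
    by (auto intro!: derivative_eq_intros dq[OF y] has_derivative_theta[OF y]
        simp: fun_eq_iff structure_beta(1)[OF y] beta_0[OF y] alpha_q[OF y] power2_eq_square field_simps)
  then obtain e where e: "\<And>y. y \<in> D \<Longrightarrow> inverse (q y) *\<^sub>R \<theta> y = e"
    by (rule constant_on_convex[OF convex_D]) (assumption, rule that)
  show thesis by (rule that[of e]) (use e q_pos in \<open>force simp: scaleR_scaleR[symmetric]\<close>)
qed

text \<open>By \<open>dq\<close> the differential of \<open>q ^ 4 / 16\<close> is
  \<open>(q y)\<^sup>2 / 2\<close> times h(\<theta>, .), and by \<open>dform\<close> the derivative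
  of this is minus the Hessian of \<open>F\<close>.\<close>

lemma graph_function:
  obtains l c where "\<And>y. y \<in> D \<Longrightarrow> F y + (q y) ^ 4 / 16 = l \<bullet> y + c"
proof (rule affine_on_convex[OF convex_D open_D])
  show "smooth_on D (\<lambda>y. F y + (q y) ^ 4 / 16)"
    by (intro smooth_on_add smooth_on_divide smooth_on_power smooth_F smooth_q smooth_on_const open_D) auto
  show "\<partial> x (\<partial> u (\<lambda>y. F y + (q y) ^ 4 / 16)) y = 0" if y: "y \<in> D" for x u y
  proof -
    have 1: "\<partial> u (\<lambda>y. F y + (q y) ^ 4 / 16) y = \<partial> u F y + (q y)\<^sup>2 / 2 * hess F y (\<theta> y) u" if "y \<in> D" for y
      using q_pos[OF that]
      by (intro dir_deriv_eq[where f'="\<lambda>u. \<partial> u F y + (q y)\<^sup>2 / 2 * hess F y (\<theta> y) u"])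
        (auto intro!: derivative_eq_intros dq[OF that] smooth_on_has_derivative[OF smooth_F that]
          simp: fun_eq_iff power2_eq_square power3_eq_cube field_simps)
    have "((\<lambda>y. \<partial> u F y + (q y)\<^sup>2 / 2 * hess F y (\<theta> y) u) has_derivative (\<lambda>x. 0)) (at y)"
      using q_pos[OF y]
      by (auto intro!: derivative_eq_intros dq[OF y] dform[OF y] smooth_on_has_derivative[OF smooth_on_dir_deriv[OF smooth_F] y]
          simp: fun_eq_iff hess_def[symmetric] power2_eq_square field_simps)
    then have "(\<partial> u (\<lambda>y. F y + (q y) ^ 4 / 16) has_derivative (\<lambda>x. 0)) (at y)"
      by (rule has_derivative_transform_within_open[OF _ open_D y]) (simp add: 1)
    then show ?thesis using dir_deriv_eq by blast
  qed
qed (use that in blast)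

lemma dir_deriv_q3: "y \<in> D \<Longrightarrow> ((\<lambda>y. q y ^ 3) has_derivative (\<lambda>x. 6 * q y * hess F y (\<theta> y) x)) (at y)"
  using q_pos[of y]
  by (auto intro!: derivative_eq_intros dq simp: fun_eq_iff power2_eq_square field_simps)

text \<open>By \<open>has_derivative_tform\<close> with \<beta> = 0, \<open>tform\<close> and
  \<open>q\<close> have the same logarithmic derivative, namely \<open>2 * \<alpha> y\<close> times
  h(\<theta>, .).\<close>

lemma tform_constant:
  assumes "\<And>y. y \<in> D \<Longrightarrow> \<exists>e. e 0 = \<theta> y \<and> canonical_at F y e (\<alpha> y) 0"
  obtains c where "\<And>y. y \<in> D \<Longrightarrow> inverse (q y) * tform y u v = c"
proof (rule constant_on_convex[OF convex_D])
  fix y assume y: "y \<in> D"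
  obtain e where e: "canonical_at F y e (\<alpha> y) 0" "e 0 = \<theta> y" using assms[OF y] by blast
  show "((\<lambda>y. inverse (q y) * tform y u v) has_derivative (\<lambda>x. 0)) (at y)"
    using q_pos[OF y]
    by (intro has_derivative_eq_rhs[OF has_derivative_mult[OF
            Deriv.has_derivative_inverse[OF _ dq[OF y]] has_derivative_tform[OF y e]]])
      (auto simp: fun_eq_iff tform_def beta_0[OF y] alpha_q[OF y] power2_eq_square field_simps)
qed (use that in blast)

end

section \<open>Integration in the case \<beta> = 2 \<alpha>\<close>

locale plus_type = pointwise_canonical +
  assumes convex_D: "convex D" and beta_2: "\<And>y. y \<in> D \<Longrightarrow> \<beta> y = 2 * \<alpha> y"
begin

lemma dq: "y \<in> D \<Longrightarrow> (q has_derivative (\<lambda>x. - 2 / q y * hess F y (\<theta> y) x)) (at y)"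
  by (rule has_derivative_eq_rhs[OF has_derivative_q])
    (use q_pos[of y] in \<open>auto simp: fun_eq_iff beta_2 alpha_q power2_eq_square power3_eq_cube field_simps\<close>)

lemma dform: "y \<in> D \<Longrightarrow> ((\<lambda>z. hess F z (\<theta> z) u) has_derivative
    (\<lambda>x. - 2 / (q y)\<^sup>2 * (hess F y (\<theta> y) x * hess F y (\<theta> y) u))) (at y)"
  by (rule has_derivative_eq_rhs[OF has_derivative_form])
    (use q_pos[of y] in \<open>auto simp: fun_eq_iff beta_2 alpha_q field_simps\<close>)

text \<open>The derivative of \<open>((q y)\<^sup>2 / 2) *\<^sub>R \<theta> y\<close> is the
  identity. Geometrically, the lines in the direction of \<theta> all pass through
  \<open>y0\<close>.\<close>

lemma center:
  obtains y0 where "\<And>y. y \<in> D \<Longrightarrow> y - ((q y)\<^sup>2 / 2) *\<^sub>R \<theta> y = y0"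
proof (rule constant_on_convex[OF convex_D])
  fix y assume y: "y \<in> D"
  show "((\<lambda>y. y - ((q y)\<^sup>2 / 2) *\<^sub>R \<theta> y) has_derivative (\<lambda>x. 0)) (at y)"
    using q_pos[OF y]
    by (auto intro!: derivative_eq_intros dq[OF y] has_derivative_theta[OF y]
        simp: fun_eq_iff structure_beta(1)[OF y] beta_2[OF y] alpha_q[OF y] algebra_simps)
qed (use that in blast)

lemma q_affine:
  obtains l c where "\<And>y. y \<in> D \<Longrightarrow> q y = l \<bullet> y + c"
proof (rule affine_on_convex[OF convex_D open_D smooth_q])
  show "\<partial> x (\<partial> u q) y = 0" if y: "y \<in> D" for x u y
  proof -
    have "((\<lambda>y. - 2 / q y * hess F y (\<theta> y) u) has_derivative (\<lambda>x. 0)) (at y)"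
      using q_pos[OF y]
      by (auto intro!: derivative_eq_intros dq[OF y] dform[OF y] simp: fun_eq_iff power2_eq_square field_simps)
    then have "(\<partial> u q has_derivative (\<lambda>x. 0)) (at y)"
      by (rule has_derivative_transform_within_open[OF _ open_D y]) (simp add: dir_deriv_eq[OF dq])
    then show ?thesis using dir_deriv_eq by blast
  qed
qed (use that in blast)

text \<open>Euler's operator about \<open>y0\<close> differentiates along \<theta>. The derivative
  of its defect on \<open>F\<close> is h(y - y0, .), that is \<open>(q y)\<^sup>2 / 2\<close> times
  h(\<theta>, .), which the derivative of \<open>q ^ 4 / 16\<close> cancels.\<close>

lemma euler_F:
  assumes y0: "\<And>y. y \<in> D \<Longrightarrow> y - ((q y)\<^sup>2 / 2) *\<^sub>R \<theta> y = y0"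
  obtains k where "\<And>y. y \<in> D \<Longrightarrow> \<partial> (y - y0) F y - F y + (q y) ^ 4 / 16 = k"
proof (rule constant_on_convex[OF convex_D])
  fix y assume y: "y \<in> D"
  have e: "y - y0 = ((q y)\<^sup>2 / 2) *\<^sub>R \<theta> y" using y0[OF y] by (simp add: algebra_simps)
  have d1: "\<partial> x (\<lambda>z. z - y0) y = x" for x
    by (rule dir_deriv_eq) (auto intro!: derivative_eq_intros)
  have "((\<lambda>y. \<partial> (y - y0) F y) has_derivative (\<lambda>x. hess F y x (y - y0) + \<partial> x F y)) (at y)"
    by (rule has_derivative_eq_rhs[OF has_derivative_linear_family[OF open_D y, where T="\<lambda>y u. \<partial> u F y"]])
      (auto intro!: linear_dir_deriv smooth_on_differentiable[OF smooth_F] smooth_on_differentiable[OF smooth_on_dir_deriv[OF smooth_F] y]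
        derivative_intros linear_dir_deriv_dir[OF open_D smooth_F y] simp: hess_def fun_eq_iff d1)
  then show "((\<lambda>y. \<partial> (y - y0) F y - F y + (q y) ^ 4 / 16) has_derivative (\<lambda>x. 0)) (at y)"
    using q_pos[OF y] unfolding e
    by (auto intro!: derivative_eq_intros dq[OF y] smooth_on_has_derivative[OF smooth_F y]
        simp: fun_eq_iff hess_scale[OF y] hess_commute[OF y, of _ "\<theta> y"] power2_eq_square power3_eq_cube field_simps)
qed (use that in blast)

text \<open>The factor 1/48 comes from Euler's relation: by \<open>euler_F\<close> the defect of
  \<open>F + k\<close> is \<open>- q ^ 4 / 16\<close> for the right \<open>k\<close>. Since
  \<open>q\<close> has degree one about the center, a term s q^4 adds 3 s q^4 to the defect.\<close>

lemma hess_G: "y \<in> D \<Longrightarrow> hess (\<lambda>y. F y + k + (q y) ^ 4 / 48) y x u = tform y x u"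
proof -
  assume y: "y \<in> D"
  have 1: "\<partial> u (\<lambda>y. F y + k + (q y) ^ 4 / 48) y = \<partial> u F y - (q y)\<^sup>2 / 6 * hess F y (\<theta> y) u" if "y \<in> D" for y
    using q_pos[OF that]
    by (intro dir_deriv_eq[where f'="\<lambda>u. \<partial> u F y - (q y)\<^sup>2 / 6 * hess F y (\<theta> y) u"])
      (auto intro!: derivative_eq_intros dq[OF that] smooth_on_has_derivative[OF smooth_F that]
        simp: fun_eq_iff power2_eq_square power3_eq_cube field_simps)
  have "((\<lambda>y. \<partial> u F y - (q y)\<^sup>2 / 6 * hess F y (\<theta> y) u) has_derivative (\<lambda>x. tform y x u)) (at y)"
    using q_pos[OF y]
    by (auto intro!: derivative_eq_intros dq[OF y] dform[OF y] smooth_on_has_derivative[OF smooth_on_dir_deriv[OF smooth_F] y]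
        simp: fun_eq_iff hess_def[symmetric] tform_def power2_eq_square field_simps)
  then have "(\<partial> u (\<lambda>y. F y + k + (q y) ^ 4 / 48) has_derivative (\<lambda>x. tform y x u)) (at y)"
    by (rule has_derivative_transform_within_open[OF _ open_D y]) (simp add: 1)
  then show ?thesis unfolding hess_def by (rule dir_deriv_eq)
qed

text \<open>For \<open>u\<close> and \<open>v\<close> orthogonal to \<theta> the \<beta>-terms of
  \<open>has_derivative_tform\<close> vanish; the logarithmic derivative that is left is the
  negative of that of \<open>q\<close>.\<close>

lemma tform_constant:
  assumes "\<And>y. y \<in> D \<Longrightarrow> \<exists>e. e 0 = \<theta> y \<and> canonical_at F y e (\<alpha> y) 0"
    and uv: "\<And>y. y \<in> D \<Longrightarrow> hess F y (\<theta> y) u = 0" "\<And>y. y \<in> D \<Longrightarrow> hess F y (\<theta> y) v = 0"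
  obtains c where "\<And>y. y \<in> D \<Longrightarrow> q y * tform y u v = c"
proof (rule constant_on_convex[OF convex_D])
  fix y assume y: "y \<in> D"
  obtain e where e: "canonical_at F y e (\<alpha> y) 0" "e 0 = \<theta> y" using assms(1)[OF y] by blast
  show "((\<lambda>y. q y * tform y u v) has_derivative (\<lambda>x. 0)) (at y)"
    using q_pos[OF y]
    by (intro has_derivative_eq_rhs[OF has_derivative_mult[OF dq[OF y] has_derivative_tform[OF y e]]])
      (auto simp: fun_eq_iff uv[OF y] tform_def beta_2[OF y] alpha_q[OF y] power2_eq_square field_simps)
qed (use that in blast)

end

subsection \<open>Graphs as improper affine spheres\<close>

lemma second_countable_euclidean: "second_countable (euclidean :: 'a::second_countable_topology topology)"
proof -
  obtain B :: "'a set set" where "countable B" "topological_basis B" using ex_countable_basis by blast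
  then show ?thesis
    unfolding second_countable_def
  proof (intro exI[of _ B] conjI ballI allI impI)
    show "openin euclidean V" if "V \<in> B" for V
      using topological_basis_open[OF \<open>topological_basis B\<close> that] by (simp add: open_openin[symmetric])
    show "\<exists>V\<in>B. x \<in> V \<and> V \<subseteq> U" if "openin euclidean U \<and> x \<in> U" for U x
    proof -
      have U: "open U" "x \<in> U" using that by (simp_all add: open_openin[symmetric])
      obtain V where "V \<in> B" "x \<in> V" "V \<subseteq> U"
        by (rule topological_basisE[OF \<open>topological_basis B\<close> U])
      then show ?thesis by auto
    qed
  qed (use \<open>countable B\<close> in simp)
qed

lemma vec2_expand: "x = x $ 1 *\<^sub>R axis 1 1 + x $ 2 *\<^sub>R axis 2 1" for x :: "real ^ 2"
  by (simp add: vec_eq_iff forall_2 axis_def)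

lemma has_derivative_vec3:
  fixes f :: "'v::real_normed_vector \<Rightarrow> real ^ 3"
  assumes "\<And>i. ((\<lambda>x. f x $ i) has_derivative (\<lambda>v. f' v $ i)) (at y)"
  shows "(f has_derivative f') (at y)"
  using assms has_derivative_componentwise_within[of f f' y UNIV]
  by (auto simp: Basis_vec_def inner_axis)

lemma identity_chart_manifold:
  fixes N :: "(real ^ 'n::finite) set"
  assumes N: "open N" "connected N"
  shows "connected_oriented_manifold (top_of_set N) {(N, \<lambda>y. y)}"
proof -
  have inv: "inv_into N (\<lambda>y. y) u = u" if "u \<in> N" for u :: "real ^ 'n"
    using inv_into_f_f[of "\<lambda>y. y" N u] that by (simp add: inj_on_def)
  have "local_parametrization (top_of_set N) N (\<lambda>y. y)"
    using N homeomorphic_map_id[of "top_of_set N" "top_of_set N"]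
    by (simp add: local_parametrization_def id_def subtopology_subtopology)
  moreover have "smooth_transition N (\<lambda>y. y) N (\<lambda>y. y)"
    unfolding smooth_transition_def
    by (rule smooth_on_cong[of _ "\<lambda>y. y"]) (use N inv in auto)
  moreover have "det (matrix (frechet_derivative (inv_into N (\<lambda>y. y) \<circ> (\<lambda>y. y)) (at u))) > 0" if "u \<in> N" for u
  proof -
    have "((\<lambda>y. y) has_derivative id) (at u)" by (simp add: id_def)
    then have "((inv_into N (\<lambda>y. y) \<circ> (\<lambda>y. y)) has_derivative id) (at u)"
      by (rule has_derivative_transform_within_open[OF _ N(1) that]) (simp add: inv)
    from frechet_derivative_at[OF this] show ?thesis by (metis det_I matrix_id_mat_1 zero_less_one)
  qed
  moreover have "Hausdorff_space (top_of_set N)"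
    by (intro Hausdorff_space_subtopology) simp
  moreover have "second_countable (top_of_set N)"
    by (intro second_countable_subtopology second_countable_euclidean)
  moreover have "connected_space (top_of_set N)"
    using N(2) connectedin_iff_connected connectedin_def by blast
  ultimately show ?thesis by (simp add: connected_oriented_manifold_def)
qed

lemma hess_bilinear_2:
  fixes u :: "real ^ 2"
  assumes "smooth_function F D" "y \<in> D"
  shows "hess F y u v = u $ 1 * v $ 1 * hess F y (axis 1 1) (axis 1 1) + (u $ 1 * v $ 2 + u $ 2 * v $ 1) * hess F y (axis 1 1) (axis 2 1)
    + u $ 2 * v $ 2 * hess F y (axis 2 1) (axis 2 1)"
proof -
  interpret smooth_function F D by fact
  have "hess F y u v = hess F y (u $ 1 *\<^sub>R axis 1 1 + u $ 2 *\<^sub>R axis 2 1) (v $ 1 *\<^sub>R axis 1 1 + v $ 2 *\<^sub>R axis 2 1)"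
    using vec2_expand by metis
  then show ?thesis
    by (simp add: hess_add[OF assms(2)] hess_scale[OF assms(2)] hess_commute[OF assms(2), of "axis 2 1" "axis 1 1"] algebra_simps)
qed

text \<open>\<open>fl\<close> is \<open>f\<close> as a function of one vector, so that the calculus
  above applies. The determinant condition will be the volume condition for the normal (0, 0,
  1).\<close>

locale convex_graph =
  fixes N :: "(real ^ 2) set" and f :: "real \<Rightarrow> real \<Rightarrow> real" and fl :: "real ^ 2 \<Rightarrow> real"
  assumes N: "open N" "connected N" and fl: "\<And>y. fl y = f (y $ 1) (y $ 2)" and smooth_fl: "smooth_on N fl"
    and det: "\<And>y. y \<in> N \<Longrightarrow> hess fl y (axis 1 1) (axis 1 1) * hess fl y (axis 2 1) (axis 2 1)
      - (hess fl y (axis 1 1) (axis 2 1))\<^sup>2 = 1"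
    and pos: "\<And>y x. y \<in> N \<Longrightarrow> x \<noteq> 0 \<Longrightarrow> hess fl y x x > 0"

sublocale convex_graph \<subseteq> smooth_function fl N
  using N smooth_fl by unfold_locales

sublocale convex_graph \<subseteq> oriented_manifold "top_of_set N" "{(N, \<lambda>y. y)}"
  using identity_chart_manifold[OF N] by unfold_locales

context convex_graph
begin

abbreviation (input) "A \<equiv> {(N, \<lambda>y::real ^ 2. y)}"
abbreviation (input) "\<psi> \<equiv> graph_immersion f"
definition "\<pi> X = (vector [X $ 1, X $ 2] :: real ^ 2)" for X :: "real ^ 3"
definition "lift y \<zeta> = (vector [\<zeta> $ 1, \<zeta> $ 2, \<partial> \<zeta> fl y] :: real ^ 3)" for y \<zeta> :: "real ^ 2"

lemma chart: "diffeo_onto_open (top_of_set N) A N (\<lambda>y. y)"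
  by (rule chart_diffeo) simp

lemma psi_eq: "\<psi> = (\<lambda>y. \<chi> i. if i = 1 then y $ 1 else if i = 2 then y $ 2 else fl y)"
  by (auto simp: graph_immersion_def fl vec_eq_iff forall_3)

lemma has_derivative_psi:
  assumes "y \<in> N" shows "(\<psi> has_derivative lift y) (at y)"
proof (rule has_derivative_vec3)
  fix i :: 3
  have "i = 1 \<or> i = 2 \<or> i = 3" using exhaust_3 by auto
  then show "((\<lambda>y. \<psi> y $ i) has_derivative (\<lambda>v. lift y v $ i)) (at y)"
    using smooth_on_has_derivative[OF smooth_fl assms] bounded_linear_imp_has_derivative[OF bounded_linear_vec_nth]
    by (auto simp: psi_eq lift_def)
qed

lemma psi_dir_deriv: "y \<in> N \<Longrightarrow> \<partial> \<zeta> \<psi> y = lift y \<zeta>"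
  by (rule dir_deriv_eq[OF has_derivative_psi])

lemma psi_diff: "y \<in> N \<Longrightarrow> \<psi> differentiable (at y)"
  using has_derivative_psi differentiable_def by blast

lemma smooth_psi: "smooth_on N \<psi>"
proof (subst smooth_on_vec_iff[OF N(1)], rule allI)
  fix i :: 3
  have "i = 1 \<or> i = 2 \<or> i = 3" using exhaust_3 by auto
  then show "smooth_on N (\<lambda>y. \<psi> y $ i)"
    using smooth_on_vec_nth[OF N(1) smooth_on_id] smooth_fl by (auto simp: psi_eq)
qed

lemma pi_lift [simp]: "\<pi> (lift y \<zeta>) = \<zeta>"
  by (simp add: \<pi>_def lift_def vec_eq_iff forall_2)

lemma lift_0: "y \<in> N \<Longrightarrow> lift y 0 = 0"
  using linear_0[OF linear_dir_deriv[OF smooth_on_differentiable[OF smooth_fl]]]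
  by (simp add: lift_def vec_eq_iff forall_3)

lemma inj_lift: "inj (lift y)"
  by (metis injI pi_lift)

lemma tangent: "y \<in> N \<Longrightarrow> tangent_space A \<psi> y = range (lift y)"
  using tangent_space_eq[OF chart, of y \<psi>] psi_diff by (simp add: psi_dir_deriv)

lemma deriv_along_graph:
  assumes "y \<in> N" "g differentiable (at y)"
  shows "deriv_along A \<psi> g y (lift y \<zeta>) = \<partial> \<zeta> g y"
  using deriv_along_eq[OF chart assms(1), of \<psi> g \<zeta>] assms psi_diff inj_lift
  by (simp add: psi_dir_deriv)

lemma smooth_map_iff:
  fixes g :: "real ^ 2 \<Rightarrow> 'b::real_normed_vector"
  shows "smooth_map_on A W g \<longleftrightarrow> smooth_on (N \<inter> W) g"
  by (simp add: smooth_map_on_def vimage_def o_def)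

text \<open>In the last component the product rule for \<open>\<partial> (\<pi> (Y q)) fl q\<close>
  yields the slope of the differentiated field, which makes up its lift, and the Hessian, which is
  left over in the direction (0, 0, 1). Thus the affine metric of a graph is the Hessian.\<close>

lemma deriv_field:
  assumes W: "openin (top_of_set N) W" and sm: "smooth_map_on A W Y"
    and tan: "\<And>q. q \<in> W \<Longrightarrow> Y q \<in> tangent_space A \<psi> q" and p: "p \<in> W"
  shows "\<partial> \<zeta> Y p = lift p (\<partial> \<zeta> (\<lambda>q. \<pi> (Y q)) p) + hess fl p \<zeta> (\<pi> (Y p)) *\<^sub>R vector [0, 0, 1]"
proof -
  have WN: "W \<subseteq> N" "open W" using W N(1) by (auto simp: openin_open_eq)
  have pN: "p \<in> N" using p WN by auto
  have sY: "smooth_on W Y" using sm WN by (simp add: smooth_map_iff Int_absorb1)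
  define \<eta> where "\<eta> q = \<pi> (Y q)" for q
  have "smooth_on W (\<lambda>q. \<pi> (Y q))"
    unfolding \<pi>_def by (subst smooth_on_vec_iff[OF WN(2)]) (auto simp: forall_2 intro!: smooth_on_vec_nth WN sY)
  then have s\<eta>: "smooth_on W \<eta>" by (simp add: \<eta>_def[abs_def])
  have Y: "Y q = lift q (\<eta> q)" if q: "q \<in> W" for q
  proof -
    have "q \<in> N" using q WN by blast
    then obtain \<zeta> where "Y q = lift q \<zeta>" using tan[OF q] unfolding tangent[OF \<open>q \<in> N\<close>] by blast
    then show ?thesis by (simp add: \<eta>_def)
  qed
  have dY: "Y differentiable (at p)" and d\<eta>: "\<eta> differentiable (at p)"
    using smooth_on_differentiable[OF sY p] smooth_on_differentiable[OF s\<eta> p] by auto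
  have c: "\<partial> \<zeta> Y p $ i = \<partial> \<zeta> (\<lambda>q. Y q $ i) p" for i
    by (rule dir_deriv_linear[OF bounded_linear_vec_nth dY, symmetric])
  have c': "\<partial> \<zeta> \<eta> p $ i = \<partial> \<zeta> (\<lambda>q. \<eta> q $ i) p" for i
    by (rule dir_deriv_linear[OF bounded_linear_vec_nth d\<eta>, symmetric])
  have "\<partial> \<zeta> (\<lambda>q. Y q $ 3) p = \<partial> \<zeta> (\<lambda>q. \<partial> (\<eta> q) fl q) p"
    by (rule differentiable_cong_open(2)[OF WN(2) p])
      (use smooth_on_subset[OF smooth_fl WN(1)] in \<open>auto simp: Y lift_def intro!: smooth_on_differentiable[OF
        smooth_on_dir_deriv_field[OF WN(2) _ s\<eta>] p]\<close>)
  also have "\<dots> = hess fl p \<zeta> (\<eta> p) + \<partial> (\<partial> \<zeta> \<eta> p) fl p"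
    unfolding hess_def by (rule dir_deriv_dir_deriv_field[OF N(1) pN smooth_fl d\<eta>])
  finally have 3: "\<partial> \<zeta> Y p $ 3 = hess fl p \<zeta> (\<eta> p) + \<partial> (\<partial> \<zeta> \<eta> p) fl p" unfolding c .
  have 12: "\<partial> \<zeta> Y p $ 1 = \<partial> \<zeta> \<eta> p $ 1" "\<partial> \<zeta> Y p $ 2 = \<partial> \<zeta> \<eta> p $ 2"
    unfolding c c' by (simp_all add: \<eta>_def \<pi>_def)
  show ?thesis
    unfolding \<eta>_def[symmetric] by (simp add: vec_eq_iff forall_3 3 12 lift_def)
qed

lemma improper_affine: "improper_affine_graph N f"
proof -
  define h where "h p X Y = hess fl p (\<pi> X) (\<pi> Y)" for p X Y
  \<comment> \<open>The Gauss formula leaves no other choice; \<open>deriv_field\<close> then shows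
    that the result is tangent.\<close>
  define nab where "nab p X Y = deriv_along A \<psi> Y p X - h p X (Y p) *\<^sub>R vector [0, 0, 1]" for p X Y
  have hpos: "h p X X > 0" if p: "p \<in> N" and t: "X \<in> tangent_space A \<psi> p" and nz: "X \<noteq> 0" for p X
  proof -
    from t obtain \<zeta> where X: "X = lift p \<zeta>" unfolding tangent[OF p] by blast
    have "\<zeta> \<noteq> 0"
    proof
      assume "\<zeta> = 0"
      then have "X = 0" using lift_0[OF p] by (simp add: X)
      then show False using nz by simp
    qed
    then show ?thesis using pos[OF p] by (simp add: h_def X)
  qed
  have zero: "0 \<in> tangent_space A \<psi> p" if "p \<in> N" for p
    using lift_0[OF that] tangent[OF that] by (metis rangeI)
  have "blaschke_hypersurface (top_of_set N) A \<psi> (\<lambda>_. vector [0, 0, 1]) nab h (\<lambda>_ _. 0)"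
    unfolding blaschke_hypersurface_def
  proof (intro conjI allI impI ballI)
    show "connected_oriented_manifold (top_of_set N) A" by (rule manifold)
    have "frechet_derivative \<psi> (at y) = lift y" if "y \<in> N" for y
      using psi_dir_deriv[OF that] by (auto simp: dir_deriv_def)
    then show "immersion (top_of_set N) A \<psi>"
      using smooth_psi inj_lift by (simp add: immersion_def smooth_map_iff o_def)
    show "smooth_map_on A (topspace (top_of_set N)) (\<lambda>_. vector [0, 0, 1] :: real ^ 3)"
      by (simp add: smooth_map_iff)
    show "vector [0, 0, 1] \<notin> tangent_space A \<psi> p" if p: "p \<in> topspace (top_of_set N)" for p
    proof
      assume "vector [0, 0, 1] \<in> tangent_space A \<psi> p"
      moreover have pN: "p \<in> N" using p by simp
      ultimately obtain \<zeta> where z: "vector [0, 0, 1] = lift p \<zeta>" unfolding tangent[OF pN] by blast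
      then have "\<pi> (vector [0, 0, 1]) = \<zeta>" by simp
      then have "\<zeta> = 0" by (simp add: \<pi>_def vec_eq_iff forall_2)
      then have "lift p \<zeta> = 0" using lift_0[OF pN] by simp
      with z show False by (simp add: vec_eq_iff forall_3)
    qed
  next
    fix W Y p X assume Y: "tangent_field (top_of_set N) A \<psi> W Y" and p: "p \<in> W" and X: "X \<in> tangent_space A \<psi> p"
    have Y': "openin (top_of_set N) W" "smooth_map_on A W Y" "\<And>q. q \<in> W \<Longrightarrow> Y q \<in> tangent_space A \<psi> q"
      using Y by (auto simp: tangent_field_def)
    have WN: "W \<subseteq> N" "open W" using Y'(1) N(1) by (auto simp: openin_open_eq)
    have pN: "p \<in> N" using p WN by auto
    obtain \<zeta> where \<zeta>: "X = lift p \<zeta>" using X tangent[OF pN] by auto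
    have "smooth_on W Y" using Y'(2) WN by (simp add: smooth_map_iff Int_absorb1)
    then have "deriv_along A \<psi> Y p X = \<partial> \<zeta> Y p"
      unfolding \<zeta> using smooth_on_differentiable p pN by (intro deriv_along_graph) auto
    then have "nab p X Y = lift p (\<partial> \<zeta> (\<lambda>q. \<pi> (Y q)) p)"
      using deriv_field[OF Y' p, of \<zeta>] by (simp add: nab_def h_def \<zeta>)
    then show "nab p X Y \<in> tangent_space A \<psi> p" using tangent[OF pN] by simp
    show "deriv_along A \<psi> Y p X = nab p X Y + h p X (Y p) *\<^sub>R vector [0, 0, 1]" by (simp add: nab_def)
  next
    fix p X assume p: "p \<in> topspace (top_of_set N)" and X: "X \<in> tangent_space A \<psi> p"
    then have pN: "p \<in> N" by simp
    show "0 \<in> tangent_space A \<psi> p" by (rule zero[OF pN])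
    obtain \<zeta> where \<zeta>: "X = lift p \<zeta>" using X tangent[OF pN] by auto
    show "deriv_along A \<psi> (\<lambda>_. vector [0, 0, 1] :: real ^ 3) p X = - 0"
      unfolding \<zeta> using dir_deriv_eq[OF has_derivative_const] by (subst deriv_along_graph[OF pN]) auto
    show "\<exists>Y\<in>tangent_space A \<psi> p. h p X Y \<noteq> 0" if "X \<noteq> 0"
      using hpos[OF pN X that] X by force
  next
    define \<sigma> :: "3 \<Rightarrow> 2 option" where "\<sigma> j = (if j = 1 then Some 1 else if j = 2 then Some 2 else None)" for j
    have "bij \<sigma>"
    proof (rule bijI)
      show "inj \<sigma>"
      proof (rule injI)
        fix i j assume "\<sigma> i = \<sigma> j"
        then show "i = j" using exhaust_3[of i] exhaust_3[of j] by (auto simp: \<sigma>_def split: if_splits)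
      qed
      have "z \<in> range \<sigma>" for z
      proof (cases z)
        case None
        then have "z = \<sigma> 3" by (simp add: \<sigma>_def)
        then show ?thesis by blast
      next
        case (Some i)
        then have "z = \<sigma> 1 \<or> z = \<sigma> 2" using exhaust_2[of i] by (auto simp: \<sigma>_def)
        then show ?thesis by blast
      qed
      then show "surj \<sigma>" by blast
    qed
    moreover have "\<bar>det (\<chi> j. case \<sigma> j of Some i \<Rightarrow> X i | None \<Rightarrow> vector [0, 0, 1])\<bar> =
        sqrt \<bar>det (\<chi> i k. h p (X i) (X k))\<bar>"
      if p: "p \<in> topspace (top_of_set N)" and X: "\<forall>i. X i \<in> tangent_space A \<psi> p" for p and X :: "2 \<Rightarrow> real ^ 3"
    proof -
      have pN: "p \<in> N" using p by simp
      obtain a where a: "X 1 = lift p a" using X tangent[OF pN] by blast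
      obtain b where b: "X 2 = lift p b" using X tangent[OF pN] by blast
      have 1: "det (\<chi> j. case \<sigma> j of Some i \<Rightarrow> X i | None \<Rightarrow> vector [0, 0, 1]) = a $ 1 * b $ 2 - a $ 2 * b $ 1"
        by (simp add: det_3 \<sigma>_def a b lift_def)
      note hb = hess_bilinear_2[OF smooth_function_axioms pN]
      \<comment> \<open>The Gram determinant of two vectors is the square of their coordinate
        determinant times the determinant of the form, which is 1 here.\<close>
      have "det (\<chi> i k. h p (X i) (X k)) = (a $ 1 * b $ 2 - a $ 2 * b $ 1)\<^sup>2 *
          (hess fl p (axis 1 1) (axis 1 1) * hess fl p (axis 2 1) (axis 2 1) - (hess fl p (axis 1 1) (axis 2 1))\<^sup>2)"
        unfolding det_2 by (simp add: h_def a b hb[of a] hb[of b]) (simp add: power2_eq_square algebra_simps)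
      then have "det (\<chi> i k. h p (X i) (X k)) = (a $ 1 * b $ 2 - a $ 2 * b $ 1)\<^sup>2"
        by (simp add: det[OF pN])
      then show ?thesis unfolding 1 by simp
    qed
    ultimately show "\<exists>\<sigma> :: 3 \<Rightarrow> 2 option. bij \<sigma> \<and> (\<forall>p\<in>topspace (top_of_set N). \<forall>X. (\<forall>i. X i \<in> tangent_space A \<psi> p) \<longrightarrow>
        \<bar>det (\<chi> j. case \<sigma> j of Some i \<Rightarrow> X i | None \<Rightarrow> vector [0, 0, 1])\<bar> = sqrt \<bar>det (\<chi> i k. h p (X i) (X k))\<bar>)"
      by blast
  qed
  moreover have "affine_sphere (top_of_set N) A \<psi> (\<lambda>_ _. 0) 0"
    by (simp add: affine_sphere_def)
  moreover have "positive_definite (top_of_set N) A \<psi> h"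
    using hpos by (simp add: positive_definite_def)
  ultimately show ?thesis unfolding improper_affine_graph_def pos_def_improper_affine_sphere_def by blast
qed

text \<open>Subtracting the quadratic form of the constant Hessian leaves an affine function.
  Completing the square in the quadratic form and absorbing the affine function yields the affine
  map.\<close>

lemma paraboloid:
  assumes conv: "convex N"
    and const: "\<And>u v. \<exists>c. \<forall>y\<in>N. hess fl y u v = c"
  shows "on_elliptic_paraboloid N f"
proof (cases "N = {}")
  case True
  have "affine_transformation (\<lambda>x::real ^ 3. x)" unfolding affine_transformation_def
    by (rule exI[of _ "\<lambda>x. x"], rule exI[of _ 0]) (auto simp: linear_iff bij_def inj_def)
  then show ?thesis by (auto simp: on_elliptic_paraboloid_def elliptic_paraboloid_def True)
next
  case False
  then obtain p where p: "p \<in> N" by blast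
  define A11 where "A11 = hess fl p (axis 1 1) (axis 1 1)"
  define A12 where "A12 = hess fl p (axis 1 1) (axis 2 1)"
  define A22 where "A22 = hess fl p (axis 2 1) (axis 2 1)"
  have c: "hess fl y u v = hess fl p u v" if "y \<in> N" for y u v using const[of u v] p that by metis
  define Qf where "Qf y = (A11 * (y $ 1 * y $ 1) + 2 * A12 * (y $ 1 * y $ 2) + A22 * (y $ 2 * y $ 2)) / 2" for y :: "real ^ 2"
  have dQ: "(Qf has_derivative (\<lambda>u. A11 * u $ 1 * y $ 1 + A12 * (u $ 1 * y $ 2 + u $ 2 * y $ 1) + A22 * u $ 2 * y $ 2)) (at y)" for y
    unfolding Qf_def[abs_def]
    by (auto intro!: derivative_eq_intros bounded_linear_imp_has_derivative[OF bounded_linear_vec_nth] simp: fun_eq_iff algebra_simps)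
  have sQ: "smooth_on N Qf" unfolding Qf_def[abs_def]
    by (intro smooth_on_divide smooth_on_add smooth_on_mult smooth_on_const smooth_on_vec_nth smooth_on_id N(1)) auto
  have "\<partial> x (\<partial> u (\<lambda>y. fl y - Qf y)) y = 0" if y: "y \<in> N" for x u y
  proof -
    have d1: "\<partial> u (\<lambda>y. fl y - Qf y) z = \<partial> u fl z - (A11 * u $ 1 * z $ 1 + A12 * (u $ 1 * z $ 2 + u $ 2 * z $ 1) + A22 * u $ 2 * z $ 2)"
      if "z \<in> N" for z
      by (rule dir_deriv_eq[OF has_derivative_diff[OF smooth_on_has_derivative[OF smooth_fl that] dQ]])
    have d2: "((\<lambda>z. \<partial> u fl z - (A11 * u $ 1 * z $ 1 + A12 * (u $ 1 * z $ 2 + u $ 2 * z $ 1) + A22 * u $ 2 * z $ 2))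
       has_derivative (\<lambda>x. 0)) (at y)"
    proof (rule has_derivative_eq_rhs[OF has_derivative_diff[OF
            smooth_on_has_derivative[OF smooth_on_dir_deriv[OF smooth_fl] y] linear_imp_has_derivative]])
      show "linear (\<lambda>z::real ^ 2. A11 * u $ 1 * z $ 1 + A12 * (u $ 1 * z $ 2 + u $ 2 * z $ 1) + A22 * u $ 2 * z $ 2)"
        by (auto simp: linear_iff algebra_simps)
      have "\<partial> x (\<partial> u fl) y = A11 * u $ 1 * x $ 1 + A12 * (u $ 1 * x $ 2 + u $ 2 * x $ 1) + A22 * u $ 2 * x $ 2" for x
        using c[OF y, of x u] hess_bilinear_2[OF smooth_function_axioms p, of x u]
        by (simp add: hess_def[symmetric] A11_def A12_def A22_def algebra_simps)
      then show "(\<lambda>x. \<partial> x (\<partial> u fl) y - (A11 * u $ 1 * x $ 1 + A12 * (u $ 1 * x $ 2 + u $ 2 * x $ 1) + A22 * u $ 2 * x $ 2)) = (\<lambda>x. 0)"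
        by simp
    qed
    have "(\<partial> u (\<lambda>y. fl y - Qf y) has_derivative (\<lambda>x. 0)) (at y)"
      by (rule has_derivative_transform_within_open[OF d2 N(1) y d1[symmetric]])
    then show ?thesis by (rule dir_deriv_eq)
  qed
  then obtain l k where lk: "\<And>y. y \<in> N \<Longrightarrow> fl y - Qf y = l \<bullet> y + k"
    by (rule affine_on_convex[OF conv N(1) smooth_on_diff[OF N(1) smooth_fl sQ]]) (assumption, rule that)
  have A11: "A11 > 0" unfolding A11_def by (rule pos[OF p]) (simp add: axis_eq_0_iff)
  have dA: "A11 * A22 - A12\<^sup>2 = 1" using det[OF p] by (simp add: A11_def A12_def A22_def)
  \<comment> \<open>With A_11 A_22 - A_12^2 = 1, completing the square leaves the coefficient 1 / (2
    A_11) for the second square.\<close>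
  define r where "r = sqrt (A11 / 2)"
  define s where "s = sqrt (1 / (2 * A11))"
  have r: "r > 0" "r * r = A11 / 2" and s: "s > 0" "s * s = 1 / (2 * A11)" using A11 by (auto simp: r_def s_def)
  have sq: "Qf y = (r * (y $ 1 + A12 / A11 * y $ 2))\<^sup>2 + (s * y $ 2)\<^sup>2" for y
  proof -
    have "(r * (y $ 1 + A12 / A11 * y $ 2))\<^sup>2 + (s * y $ 2)\<^sup>2 =
      (r * r) * (y $ 1 + A12 / A11 * y $ 2)\<^sup>2 + (s * s) * (y $ 2)\<^sup>2" by (simp add: power2_eq_square algebra_simps)
    also have "\<dots> = (A11 * (y $ 1 * y $ 1) + 2 * A12 * (y $ 1 * y $ 2) + ((A12\<^sup>2 + 1) / A11) * (y $ 2 * y $ 2)) / 2"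
      unfolding r s using A11 by (simp add: power2_eq_square field_simps)
    also have "(A12\<^sup>2 + 1) / A11 = A22" using A11 dA by (simp add: field_simps)
    finally show ?thesis by (simp add: Qf_def)
  qed
  text \<open>The inverse of \<open>(y\<^sub>1, y\<^sub>2, z) \<mapsto> (r (y\<^sub>1 + A\<^sub>1\<^sub>2 y\<^sub>2 / A\<^sub>1\<^sub>1), s y\<^sub>2, z - l \<bullet> y - k)\<close>.\<close>
  define y1 where "y1 z = z $ 1 / r - A12 / A11 * (z $ 2 / s)" for z :: "real ^ 3"
  define y2 where "y2 z = z $ 2 / s" for z :: "real ^ 3"
  define B where "B z = (vector [y1 z, y2 z, z $ 3 + l $ 1 * y1 z + l $ 2 * y2 z] :: real ^ 3)" for z :: "real ^ 3"
  have linB: "linear B"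
    by (auto simp: linear_iff vec_eq_iff forall_3 B_def y1_def y2_def add_divide_distrib algebra_simps)
  have "inj B"
  proof (rule linear_injective_0[OF linB, THEN iffD2], intro allI impI)
    fix z assume "B z = 0"
    then have "B z $ i = 0" for i by simp
    from this[of 1] this[of 2] this[of 3]
    have e: "y1 z = 0" "y2 z = 0" "z $ 3 + l $ 1 * y1 z + l $ 2 * y2 z = 0"
      unfolding B_def vector_3 .
    have "z $ 3 = 0" using e(3) unfolding e(1,2) by simp
    with e(1,2) show "z = 0" using r s by (simp add: vec_eq_iff forall_3 y1_def y2_def)
  qed
  then have "bij B" using linB linear_injective_imp_surjective by (auto simp: bij_def)
  then have aff: "affine_transformation (\<lambda>z. B z + vector [0, 0, k])"
    unfolding affine_transformation_def using linB by blast
  have "\<psi> ` N \<subseteq> (\<lambda>z. B z + vector [0, 0, k]) ` {z. z $ 3 = (z $ 1)\<^sup>2 + (z $ 2)\<^sup>2}"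
  proof clarify
    fix y assume y: "y \<in> N"
    define z where "z = (vector [r * (y $ 1 + A12 / A11 * y $ 2), s * y $ 2, Qf y] :: real ^ 3)"
    have "y2 z = y $ 2" using s by (simp add: y2_def z_def)
    moreover have "y1 z = y $ 1" using r s by (simp add: y1_def z_def field_simps)
    moreover have "l \<bullet> y = l $ 1 * y $ 1 + l $ 2 * y $ 2" by (simp add: inner_vec_def sum_2)
    ultimately have "\<psi> y = B z + vector [0, 0, k]"
      using lk[OF y] by (simp add: psi_eq B_def vec_eq_iff forall_3 z_def)
    moreover have "z $ 3 = (z $ 1)\<^sup>2 + (z $ 2)\<^sup>2" by (simp add: z_def sq)
    ultimately show "\<psi> y \<in> (\<lambda>z. B z + vector [0, 0, k]) ` {z. z $ 3 = (z $ 1)\<^sup>2 + (z $ 2)\<^sup>2}" by blast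
  qed
  then show ?thesis using aff unfolding on_elliptic_paraboloid_def elliptic_paraboloid_def by blast
qed

end

subsection \<open>Adapted charts of an improper affine sphere\<close>

text \<open>A graph point: \<open>y\<close> is the parameter and \<open>t\<close> the height. The
  fourth axis is the direction to which the affine normal will be moved.\<close>

definition vec4 :: "real ^ 3 \<Rightarrow> real \<Rightarrow> real ^ 4" where
  "vec4 y t = (\<chi> i. if i = 4 then t else if i = 1 then y $ 1 else if i = 2 then y $ 2 else y $ 3)"

definition proj3 :: "real ^ 4 \<Rightarrow> real ^ 3" where
  "proj3 X = (\<chi> i. if i = 1 then X $ 1 else if i = 2 then X $ 2 else X $ 3)"

lemma proj3_vec4 [simp]: "proj3 (vec4 y t) = y"
  by (simp add: proj3_def vec4_def vec_eq_iff forall_3)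

lemma vec4_nth_4 [simp]: "vec4 y t $ 4 = t"
  by (simp add: vec4_def)

lemma vec4_proj3: "vec4 (proj3 X) (X $ 4) = X"
  by (simp add: proj3_def vec4_def vec_eq_iff forall_4)

lemma linear_proj3: "linear proj3"
  by (auto simp: linear_iff proj3_def vec_eq_iff)

lemma vec4_add: "vec4 (x + y) (s + t) = vec4 x s + vec4 y t"
  by (simp add: vec4_def vec_eq_iff)

lemma vec4_scale: "vec4 (c *\<^sub>R x) (c * t) = c *\<^sub>R vec4 x t"
  by (simp add: vec4_def vec_eq_iff)

lemma linear_vec4: "linear (\<lambda>(y, t). vec4 y t)"
  by (auto simp: linear_iff vec4_add vec4_scale)

text \<open>In the numeral type the element 4 equals 0, so it is the least index and not the
  greatest. The triangularity argument below relies on this order.\<close>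

lemma not_less_4: "\<not> (i::4) < 4"
proof -
  have 4: "(4::4) = 0" by simp
  have "Rep_bit0 (0::4) = 0" by (rule bit0.Rep_0)
  moreover have "Rep_bit0 i \<ge> 0" using Rep_bit0[of i] by auto
  ultimately show ?thesis unfolding 4 less_bit0_def by simp
qed

text \<open>The bijection only permutes rows, which costs a sign. In the standard arrangement the
  slopes stand in column 4, the least index, so that the matrix is lower triangular with ones on the
  diagonal.\<close>

lemma abs_det_graph_frame:
  fixes \<sigma> :: "4 \<Rightarrow> 3 option" and l :: "3 \<Rightarrow> real"
  assumes "bij \<sigma>"
  shows "\<bar>det (\<chi> j. case \<sigma> j of Some i \<Rightarrow> vec4 (axis i 1) (l i) | None \<Rightarrow> axis 4 1)\<bar> = 1"
proof -
  define \<iota> :: "3 \<Rightarrow> 4" where "\<iota> i = (if i = 1 then 1 else if i = 2 then 2 else 3)" for i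
  define \<kappa> :: "4 \<Rightarrow> 3" where "\<kappa> k = (if k = 1 then 1 else if k = 2 then 2 else 3)" for k
  define \<tau> where "\<tau> j = (case \<sigma> j of Some i \<Rightarrow> \<iota> i | None \<Rightarrow> 4)" for j
  define N :: "real ^ 4 ^ 4" where "N = (\<chi> k. if k = 4 then axis 4 1 else vec4 (axis (\<kappa> k) 1) (l (\<kappa> k)))"
  have \<kappa>\<iota>: "\<kappa> (\<iota> i) = i" "\<iota> i \<noteq> 4" for i
    using exhaust_3[of i] by (auto simp: \<iota>_def \<kappa>_def)
  have inj_tau: "inj \<tau>"
  proof (rule injI)
    fix i j assume "\<tau> i = \<tau> j"
    then have "\<sigma> i = \<sigma> j"
      using \<kappa>\<iota> by (cases "\<sigma> i"; cases "\<sigma> j"; simp add: \<tau>_def) metis+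
    then show "i = j" using assms by (simp add: bij_def inj_eq)
  qed
  have "\<tau> permutes UNIV"
    using finite_UNIV_inj_surj[OF _ inj_tau] inj_tau by (intro bij_imp_permutes) (auto simp: bij_betw_def)
  then have "det (\<chi> j. N $ \<tau> j) = of_int (sign \<tau>) * det N" by (rule det_permute_rows)
  moreover have "(\<chi> j. N $ \<tau> j) = (\<chi> j. case \<sigma> j of Some i \<Rightarrow> vec4 (axis i 1) (l i) | None \<Rightarrow> axis 4 1)"
    using \<kappa>\<iota> by (simp add: vec_eq_iff N_def \<tau>_def split: option.split)
  moreover have "det N = 1"
  proof -
    have "N $ i $ j = 0" if "i < j" for i j
    proof -
      have "j \<noteq> 4" "i \<noteq> j" using that not_less_4 by auto
      then show ?thesis using exhaust_4[of i] exhaust_4[of j]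
        by (auto simp: N_def vec4_def axis_def \<kappa>_def)
    qed
    then have "det N = (\<Prod>i\<in>UNIV. N $ i $ i)" by (rule det_lowerdiagonal)
    also have "\<dots> = (\<Prod>i\<in>(UNIV::4 set). 1)"
    proof (rule prod.cong)
      fix i :: 4
      show "N $ i $ i = 1" using exhaust_4[of i] by (auto simp: N_def vec4_def axis_def \<kappa>_def)
    qed simp
    finally show ?thesis by simp
  qed
  moreover have "\<bar>of_int (sign \<tau>) :: real\<bar> = 1" by (simp add: sign_def)
  ultimately show ?thesis by (simp add: abs_mult)
qed

lemma has_derivative_vec4:
  assumes "(f has_derivative f') (at y)" "(t has_derivative t') (at y)"
  shows "((\<lambda>y. vec4 (f y) (t y)) has_derivative (\<lambda>v. vec4 (f' v) (t' v))) (at y)"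
  using bounded_linear.has_derivative[OF _ has_derivative_Pair[OF assms], of "\<lambda>(y, t). vec4 y t"] linear_vec4
  by (simp add: linear_conv_bounded_linear)

lemma smooth_on_vec4:
  assumes "open S" "smooth_on S f" "smooth_on S t"
  shows "smooth_on S (\<lambda>y. vec4 (f y) (t y))"
  unfolding vec4_def
proof (rule smooth_on_vec_lambda[OF assms(1)])
  fix i :: 4
  show "smooth_on S (\<lambda>x. if i = 4 then t x else if i = 1 then f x $ 1 else if i = 2 then f x $ 2 else f x $ 3)"
    using assms smooth_on_vec_nth[OF assms(1,2)] by (cases "i = 4"; cases "i = 1"; cases "i = 2") auto
qed

locale improper_sphere = oriented_manifold M A for M :: "'a topology" and A :: "(3, 'a) chart set" +
  fixes \<phi> \<xi> :: "'a \<Rightarrow> real ^ 4"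
    and nab :: "'a \<Rightarrow> real ^ 4 \<Rightarrow> ('a \<Rightarrow> real ^ 4) \<Rightarrow> real ^ 4"
    and h :: "'a \<Rightarrow> real ^ 4 \<Rightarrow> real ^ 4 \<Rightarrow> real"
    and S :: "'a \<Rightarrow> real ^ 4 \<Rightarrow> real ^ 4"
  assumes hypersurface: "blaschke_hypersurface M A \<phi> \<xi> nab h S"
    and improper: "affine_sphere M A \<phi> S 0"
begin

lemma
  shows immersion: "immersion M A \<phi>"
    and smooth_xi: "smooth_map_on A (topspace M) \<xi>"
    and xi_transversal: "p \<in> topspace M \<Longrightarrow> \<xi> p \<notin> tangent_space A \<phi> p"
    and gauss: "tangent_field M A \<phi> W Y \<Longrightarrow> p \<in> W \<Longrightarrow> X \<in> tangent_space A \<phi> p \<Longrightarrow>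
        nab p X Y \<in> tangent_space A \<phi> p \<and> deriv_along A \<phi> Y p X = nab p X Y + h p X (Y p) *\<^sub>R \<xi> p"
    and shape: "p \<in> topspace M \<Longrightarrow> X \<in> tangent_space A \<phi> p \<Longrightarrow> deriv_along A \<phi> \<xi> p X = - S p X"
    and volume: "\<exists>\<sigma> :: 4 \<Rightarrow> 3 option. bij \<sigma> \<and>
        (\<forall>p\<in>topspace M. \<forall>X :: 3 \<Rightarrow> real ^ 4. (\<forall>i. X i \<in> tangent_space A \<phi> p) \<longrightarrow>
           \<bar>det (\<chi> j. case \<sigma> j of Some i \<Rightarrow> X i | None \<Rightarrow> \<xi> p)\<bar> = sqrt \<bar>det (\<chi> i k. h p (X i) (X k))\<bar>)"
  using hypersurface unfolding blaschke_hypersurface_def by simp_all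

lemma smooth_phi:
  assumes G: "diffeo_onto_open M A D G" shows "smooth_on D (\<lambda>y. \<phi> (G y))"
proof -
  have "D \<inter> G -` topspace M = D" using diffeo_image_subset[OF G] by auto
  then show ?thesis
    using smooth_map_onD[OF _ openin_topspace G, of \<phi>] immersion by (simp add: immersion_def)
qed

lemma inj_phi:
  assumes "(U, x) \<in> A" "u \<in> U" shows "inj (\<lambda>\<zeta>. \<partial> \<zeta> (\<lambda>u. \<phi> (x u)) u)"
proof -
  have "\<forall>u\<in>U. inj (frechet_derivative (\<phi> \<circ> x) (at u))"
    using immersion assms(1) unfolding immersion_def by fast
  then have "inj (frechet_derivative (\<phi> \<circ> x) (at u))" using assms(2) by blast
  then show ?thesis by (simp add: dir_deriv_def o_def)
qed

lemma xi_constant: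
  assumes "p \<in> topspace M" "q \<in> topspace M" shows "\<xi> p = \<xi> q"
proof (rule locally_constant[OF _ assms])
  fix p assume p: "p \<in> topspace M"
  obtain U x u where c: "(U, x) \<in> A" "u \<in> U" "x u = p" by (rule chart_exists[OF p])
  note G = chart_diffeo[OF c(1)]
  have UM: "U \<inter> x -` topspace M = U" using diffeo_image_subset[OF G] by auto
  have s: "smooth_on U (\<lambda>u. \<xi> (x u))"
    using smooth_map_onD[OF smooth_xi openin_topspace G] UM by simp
  obtain r where r: "r > 0" "ball u r \<subseteq> U" using diffeo_open(1)[OF G] c(2) openE by blast
  have "((\<lambda>u. \<xi> (x u)) has_derivative (\<lambda>\<zeta>. 0)) (at v)" if v: "v \<in> ball u r" for v
  proof -
    have vU: "v \<in> U" using v r by auto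
    have xv: "x v \<in> topspace M" using vU diffeo_image_subset[OF G] by auto
    have d: "(\<lambda>u. \<phi> (x u)) differentiable (at v)" by (rule smooth_on_differentiable[OF smooth_phi[OF G] vU])
    have "\<partial> \<zeta> (\<lambda>u. \<xi> (x u)) v = 0" for \<zeta>
    proof -
      let ?X = "\<partial> \<zeta> (\<lambda>u. \<phi> (x u)) v"
      have X: "?X \<in> tangent_space A \<phi> (x v)"
        unfolding tangent_space_eq[OF G vU d] by blast
      have "\<partial> \<zeta> (\<lambda>u. \<xi> (x u)) v = deriv_along A \<phi> \<xi> (x v) ?X"
        by (rule deriv_along_eq[OF G vU d inj_phi[OF c(1) vU] smooth_on_differentiable[OF s vU], symmetric])
      also have "\<dots> = 0" using shape[OF xv X] improper xv X by (simp add: affine_sphere_def)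
      finally show ?thesis .
    qed
    then show ?thesis using smooth_on_has_derivative[OF s vU] by simp
  qed
  then obtain k where k: "\<And>v. v \<in> ball u r \<Longrightarrow> \<xi> (x v) = k"
    by (rule constant_on_convex[OF convex_ball]) (assumption, rule that)
  have "openin M (x ` ball u r)"
    by (rule local_parametrization_open_image[OF chart_parametrization[OF c(1)] open_ball r(2)])
  moreover have "p \<in> x ` ball u r" using c(3) r(1) by auto
  moreover have "\<xi> q = \<xi> p" if "q \<in> x ` ball u r" for q
    using that k c(3) r(1) by (metis centre_in_ball imageE)
  ultimately show "\<exists>Q. openin M Q \<and> p \<in> Q \<and> (\<forall>q\<in>Q. \<xi> q = \<xi> p)" by blast
qed

lemma zero_tangent:
  assumes "p \<in> topspace M" shows "0 \<in> tangent_space A \<phi> p"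
proof -
  obtain U x u where c: "(U, x) \<in> A" "u \<in> U" "x u = p" by (rule chart_exists[OF assms])
  note d = smooth_on_differentiable[OF smooth_phi[OF chart_diffeo[OF c(1)]] c(2)]
  show ?thesis
    using tangent_space_eq[OF chart_diffeo[OF c(1)] c(2) d] c(3) linear_0[OF linear_dir_deriv[OF d]]
    by (metis rangeI)
qed

text \<open>An orthogonal map turns \<xi> to a positive multiple of the fourth axis and a homothety
  removes the factor. One map serves all points by \<open>xi_constant\<close>.\<close>

lemma normalizing_map:
  obtains B :: "real ^ 4 \<Rightarrow> real ^ 4" where "linear B" "bij B" "\<And>p. p \<in> topspace M \<Longrightarrow> B (\<xi> p) = axis 4 1"
proof (cases "topspace M = {}")
  case True
  show ?thesis by (rule that[of "\<lambda>x. x"]) (auto simp: True linear_iff bij_def inj_def)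
next
  case False
  then obtain p where p: "p \<in> topspace M" by blast
  have nz: "\<xi> p \<noteq> 0" using xi_transversal[OF p] zero_tangent[OF p] by metis
  have "norm (\<xi> p) = norm (norm (\<xi> p) *\<^sub>R axis 4 (1::real) :: real ^ 4)" by simp
  then obtain f :: "real ^ 4 \<Rightarrow> real ^ 4" where f: "orthogonal_transformation f" "f (\<xi> p) = norm (\<xi> p) *\<^sub>R axis 4 1"
    by (rule orthogonal_transformation_exists)
  have lf: "linear f" and bf: "bij f"
    using f(1) orthogonal_transformation_linear orthogonal_transformation_bij by auto
  show ?thesis
  proof (rule that[of "\<lambda>x. inverse (norm (\<xi> p)) *\<^sub>R f x"])
    show lin: "linear (\<lambda>x. inverse (norm (\<xi> p)) *\<^sub>R f x)"
      using lf by (auto simp: linear_iff algebra_simps)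
    have "inj (\<lambda>x. inverse (norm (\<xi> p)) *\<^sub>R f x)"
      using nz bf by (auto intro!: injI simp: bij_def dest: injD)
    then show "bij (\<lambda>x. inverse (norm (\<xi> p)) *\<^sub>R f x)"
      using linear_injective_imp_surjective[OF lin] by (simp add: bij_def)
    show "inverse (norm (\<xi> p)) *\<^sub>R f (\<xi> q) = axis 4 1" if "q \<in> topspace M" for q
      using xi_constant[OF that p] f(2) nz by simp
  qed
qed

end

locale graph_sphere = improper_sphere +
  fixes B :: "real ^ 4 \<Rightarrow> real ^ 4"
  assumes linear_B: "linear B" and bij_B: "bij B" and B_xi: "\<And>p. p \<in> topspace M \<Longrightarrow> B (\<xi> p) = axis 4 1"
begin

definition Binv :: "real ^ 4 \<Rightarrow> real ^ 4" where "Binv = inv B"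

lemma Binv_B [simp]: "Binv (B x) = x" and B_Binv [simp]: "B (Binv x) = x"
  using bij_B by (auto simp: Binv_def bij_is_inj bij_is_surj surj_f_inv_f)

lemma linear_Binv: "linear Binv"
  unfolding Binv_def using linear_B bij_B
  by (metis bij_is_inj bij_is_surj inj_linear_imp_inv_linear)

definition \<pi> :: "real ^ 4 \<Rightarrow> real ^ 3" where "\<pi> X = proj3 (B X)"

lemma linear_pi: "linear \<pi>"
  unfolding \<pi>_def[abs_def] by (rule linear_compose[OF linear_B linear_proj3, unfolded o_def])

lemma pi_Binv [simp]: "\<pi> (Binv (vec4 y t)) = y"
  by (simp add: \<pi>_def)

text \<open>The parameter is the projection of the immersed point along \<xi>, so \<open>y\<close>
  and \<open>F y\<close> are determined by the point \<open>G y\<close>.\<close>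

definition adapted :: "(real ^ 3) set \<Rightarrow> (real ^ 3 \<Rightarrow> 'a) \<Rightarrow> (real ^ 3 \<Rightarrow> real) \<Rightarrow> bool" where
  "adapted D G F \<longleftrightarrow> diffeo_onto_open M A D G \<and> smooth_on D F \<and> (\<forall>y\<in>D. \<phi> (G y) = Binv (vec4 y (F y)))"

text \<open>The kernel of \<open>\<pi>\<close> is the line of \<xi>, which is transversal to the
  tangent spaces; hence \<open>\<pi>\<close> composed with the immersion has injective differential
  and can be inverted locally.\<close>

lemma adapted_exists:
  assumes p: "p \<in> topspace M"
  obtains D G F where "adapted D G F" "convex D" "p \<in> G ` D"
proof -
  obtain U x u where c: "(U, x) \<in> A" "u \<in> U" "x u = p" by (rule chart_exists[OF p])
  note G0 = chart_diffeo[OF c(1)]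
  have oU: "open U" by (rule diffeo_open(1)[OF G0])
  have s\<phi>: "smooth_on U (\<lambda>u. \<phi> (x u))" by (rule smooth_phi[OF G0])
  define g where "g u = \<pi> (\<phi> (x u))" for u
  have sg: "smooth_on U g" unfolding g_def[abs_def] by (rule smooth_on_linear[OF oU linear_pi s\<phi>])
  have dg: "\<partial> \<zeta> g v = \<pi> (\<partial> \<zeta> (\<lambda>u. \<phi> (x u)) v)" if "v \<in> U" for v \<zeta>
    unfolding g_def[abs_def]
    by (rule dir_deriv_linear) (use linear_pi linear_conv_bounded_linear smooth_on_differentiable[OF s\<phi> that] in auto)
  have inj: "inj (\<lambda>\<zeta>. \<partial> \<zeta> g v)" if v: "v \<in> U" for v
  proof -
    have d: "(\<lambda>u. \<phi> (x u)) differentiable (at v)" by (rule smooth_on_differentiable[OF s\<phi> v])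
    have l: "linear (\<lambda>\<zeta>. \<partial> \<zeta> (\<lambda>u. \<phi> (x u)) v)" by (rule linear_dir_deriv[OF d])
    have lg: "linear (\<lambda>\<zeta>. \<partial> \<zeta> g v)" by (rule linear_dir_deriv[OF smooth_on_differentiable[OF sg v]])
    have xv: "x v \<in> topspace M" using v diffeo_image_subset[OF G0] by auto
    show ?thesis
    proof (rule linear_injective_0[OF lg, THEN iffD2], intro allI impI)
      fix \<zeta> assume z: "\<partial> \<zeta> g v = 0"
      define X where "X = \<partial> \<zeta> (\<lambda>u. \<phi> (x u)) v"
      have "proj3 (B X) = 0" using z dg[OF v] by (simp add: X_def \<pi>_def)
      then have "B X = vec4 0 (B X $ 4)" using vec4_proj3[of "B X"] by simp
      also have "\<dots> = (B X $ 4) *\<^sub>R axis 4 1" by (simp add: vec4_def axis_def vec_eq_iff)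
      also have "\<dots> = B ((B X $ 4) *\<^sub>R \<xi> (x v))" using B_xi[OF xv] by (simp add: linear_scale[OF linear_B])
      finally have X: "X = (B X $ 4) *\<^sub>R \<xi> (x v)" by (metis Binv_B)
      have "B X $ 4 = 0"
      proof (rule ccontr)
        assume nz: "B X $ 4 \<noteq> 0"
        then have "\<xi> (x v) = inverse (B X $ 4) *\<^sub>R X" by (subst X) simp
        also have "\<dots> = \<partial> (inverse (B X $ 4) *\<^sub>R \<zeta>) (\<lambda>u. \<phi> (x u)) v"
          by (simp add: linear_scale[OF l] X_def)
        finally have "\<xi> (x v) \<in> tangent_space A \<phi> (x v)" unfolding tangent_space_eq[OF G0 v d] by blast
        then show False using xi_transversal[OF xv] by blast
      qed
      then have "\<partial> \<zeta> (\<lambda>u. \<phi> (x u)) v = 0" using X by (simp add: X_def)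
      then show "\<zeta> = 0" using inj_phi[OF c(1) v] linear_injective_0[OF l] by blast
    qed
  qed
  \<comment> \<open>The inverse function theorem asks for the derivative as a continuous map into
    the bounded linear maps.\<close>
  define g' where "g' v = Blinfun (\<lambda>\<zeta>. \<partial> \<zeta> g v)" for v
  have g': "blinfun_apply (g' v) = (\<lambda>\<zeta>. \<partial> \<zeta> g v)" if "v \<in> U" for v
    unfolding g'_def
    by (rule bounded_linear_Blinfun_apply, rule has_derivative_bounded_linear[OF smooth_on_has_derivative[OF sg that]])
  have cont: "continuous_on U g'"
  proof (rule continuous_on_blinfun_componentwise)
    fix i :: "real ^ 3"
    show "continuous_on U (\<lambda>v. blinfun_apply (g' v) i)"
      by (rule continuous_on_eq[OF smooth_on_continuous[OF smooth_on_dir_deriv[OF sg, of i]]]) (simp add: g')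
  qed
  have lu: "linear (\<lambda>\<zeta>. \<partial> \<zeta> g u)" by (rule linear_dir_deriv[OF smooth_on_differentiable[OF sg c(2)]])
  obtain k where k: "linear k" "k \<circ> (\<lambda>\<zeta>. \<partial> \<zeta> g u) = id"
    using linear_injective_left_inverse[OF lu inj[OF c(2)]] by blast
  have left_inv: "Blinfun k o\<^sub>L g' u = id_blinfun"
    using k by (intro blinfun_eqI)
      (simp add: g'[OF c(2)] bounded_linear_Blinfun_apply linear_conv_bounded_linear fun_eq_iff)
  have der: "(g has_derivative blinfun_apply (g' v)) (at v)" if "v \<in> U" for v
    using g'[OF that] smooth_on_has_derivative[OF sg that] by simp
  obtain U' V ginv ginv' where inv: "open U'" "U' \<subseteq> U" "u \<in> U'" "open V" "g u \<in> V" "homeomorphism U' V g ginv"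
    "\<And>y. y \<in> V \<Longrightarrow> (ginv has_derivative ginv' y) (at y)"
    by (rule inverse_function_theorem[OF oU der cont c(2) left_inv]) (assumption, rule that)
  have gi: "g (ginv y) = y" "ginv y \<in> U'" if "y \<in> V" for y
    using inv(6) that by (auto simp: homeomorphism_def)
  obtain r where r: "r > 0" "ball (g u) r \<subseteq> V" using inv(4,5) openE by blast
  \<comment> \<open>A ball, since the later integrations need a convex domain.\<close>
  define D where "D = ball (g u) r"
  have oD: "open D" and DV: "D \<subseteq> V" using r by (auto simp: D_def)
  have sgi: "smooth_on D ginv"
  proof (rule smooth_on_inverse_function[OF inv(1) oD smooth_on_subset[OF sg inv(2)]])
    show "ginv differentiable (at y)" if "y \<in> D" for y
      using inv(7)[of y] that DV by (blast intro: differentiableI)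
  qed (use gi DV in auto)
  have im: "ginv ` D = U' \<inter> g -` D"
  proof
    show "ginv ` D \<subseteq> U' \<inter> g -` D" using gi DV by auto
    show "U' \<inter> g -` D \<subseteq> ginv ` D"
    proof
      fix v assume v: "v \<in> U' \<inter> g -` D"
      then have "ginv (g v) = v" using inv(6) by (simp add: homeomorphism_def)
      then show "v \<in> ginv ` D" using v by (metis IntD2 image_eqI vimageD)
    qed
  qed
  have oim: "open (ginv ` D)" unfolding im
    by (intro continuous_open_preimage smooth_on_continuous smooth_on_subset[OF sg inv(2)] inv(1) oD)
  have subU: "ginv ` D \<subseteq> U" using im inv(2) by auto
  have G: "diffeo_onto_open M A D (x \<circ> ginv)"
    by (rule diffeo_onto_open_comp[OF G0 oD subU oim sgi smooth_on_subset[OF sg subU]]) (use gi DV in auto)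
  define F where "F y = B (\<phi> ((x \<circ> ginv) y)) $ 4" for y
  have "smooth_on D F" unfolding F_def[abs_def]
    by (intro smooth_on_vec_nth oD smooth_on_linear[OF oD linear_B smooth_phi[OF G]])
  moreover have "\<phi> ((x \<circ> ginv) y) = Binv (vec4 y (F y))" if "y \<in> D" for y
  proof -
    have "proj3 (B (\<phi> ((x \<circ> ginv) y))) = y" using gi(1)[of y] that DV by (auto simp: g_def \<pi>_def)
    then show ?thesis using vec4_proj3[of "B (\<phi> ((x \<circ> ginv) y))"] Binv_B F_def by metis
  qed
  ultimately have "adapted D (x \<circ> ginv) F" using G by (simp add: adapted_def)
  moreover have "convex D" by (simp add: D_def)
  moreover have "p \<in> (x \<circ> ginv) ` D"
  proof (rule image_eqI[of _ _ "g u"])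
    show "g u \<in> D" using r by (simp add: D_def)
    show "p = (x \<circ> ginv) (g u)" using inv(3,6) c(3) by (auto simp: homeomorphism_def)
  qed
  ultimately show thesis using that by blast
qed

definition lift :: "(real ^ 3 \<Rightarrow> real) \<Rightarrow> real ^ 3 \<Rightarrow> real ^ 3 \<Rightarrow> real ^ 4" where
  "lift F y \<zeta> = Binv (vec4 \<zeta> (\<partial> \<zeta> F y))"

lemma pi_lift [simp]: "\<pi> (lift F y \<zeta>) = \<zeta>"
  by (simp add: lift_def)

lemma inj_lift: "inj (lift F y)"
  by (metis injI pi_lift)

end

locale adapted_chart = graph_sphere +
  fixes D G F assumes adapted: "adapted D G F"

sublocale adapted_chart \<subseteq> smooth_function3 F D
  using adapted diffeo_open(1) by unfold_locales (auto simp: adapted_def)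

context adapted_chart
begin

lemma G: "diffeo_onto_open M A D G" and phi_G: "y \<in> D \<Longrightarrow> \<phi> (G y) = Binv (vec4 y (F y))"
  using adapted by (auto simp: adapted_def)

lemma G_top: "y \<in> D \<Longrightarrow> G y \<in> topspace M"
  using diffeo_image_subset[OF G] by auto

lemma lift_linear: "y \<in> D \<Longrightarrow> linear (lift F y)"
proof -
  assume y: "y \<in> D"
  have "linear (\<lambda>\<zeta>. vec4 \<zeta> (\<partial> \<zeta> F y))"
    using linear_dir_deriv[OF smooth_on_differentiable[OF smooth_F y]]
    by (simp add: linear_iff vec4_add vec4_scale)
  from linear_compose[OF this linear_Binv] show ?thesis by (simp add: lift_def[abs_def] o_def)
qed

lemma has_derivative_phi:
  assumes y: "y \<in> D" shows "((\<lambda>y. \<phi> (G y)) has_derivative lift F y) (at y)"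
proof -
  have "((\<lambda>y. Binv (vec4 y (F y))) has_derivative (\<lambda>\<zeta>. Binv (vec4 \<zeta> (\<partial> \<zeta> F y)))) (at y)"
    by (intro bounded_linear.has_derivative[of Binv] has_derivative_vec4 has_derivative_ident
        smooth_on_has_derivative[OF smooth_F y]) (use linear_Binv linear_conv_bounded_linear in auto)
  then have "((\<lambda>y. \<phi> (G y)) has_derivative (\<lambda>\<zeta>. Binv (vec4 \<zeta> (\<partial> \<zeta> F y)))) (at y)"
    by (rule has_derivative_transform_within_open[OF _ open_D y]) (simp add: phi_G)
  then show ?thesis by (simp add: lift_def[abs_def])
qed

lemma phi_diff: "y \<in> D \<Longrightarrow> (\<lambda>y. \<phi> (G y)) differentiable (at y)"
  using has_derivative_phi differentiable_def by blast

lemma phi_dir_deriv: "y \<in> D \<Longrightarrow> \<partial> \<zeta> (\<lambda>y. \<phi> (G y)) y = lift F y \<zeta>"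
  by (rule dir_deriv_eq[OF has_derivative_phi])

lemma tangent: "y \<in> D \<Longrightarrow> tangent_space A \<phi> (G y) = range (lift F y)"
  using tangent_space_eq[OF G _ phi_diff] phi_dir_deriv by auto

lemma tangent_lift: "y \<in> D \<Longrightarrow> X \<in> tangent_space A \<phi> (G y) \<Longrightarrow> X = lift F y (\<pi> X)"
  by (auto simp: tangent)

lemma lift_tangent [simp]: "y \<in> D \<Longrightarrow> lift F y \<zeta> \<in> tangent_space A \<phi> (G y)"
  by (simp add: tangent)

lemma deriv_along_chart:
  fixes f :: "'a \<Rightarrow> 'b::real_normed_vector"
  assumes "y \<in> D" "(\<lambda>y. f (G y)) differentiable (at y)"
  shows "deriv_along A \<phi> f (G y) (lift F y \<zeta>) = \<partial> \<zeta> (\<lambda>y. f (G y)) y"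
  using deriv_along_eq[OF G assms(1) phi_diff[OF assms(1)] _ assms(2), of \<zeta>] inj_lift
  by (simp add: phi_dir_deriv[OF assms(1)])

lemma lift_xi_unique:
  assumes y: "y \<in> D" and eq: "lift F y u + s *\<^sub>R \<xi> (G y) = lift F y v + t *\<^sub>R \<xi> (G y)"
  shows "u = v" "s = t"
proof -
  have x: "\<pi> (\<xi> (G y)) = 0" using B_xi[OF G_top[OF y]] by (simp add: \<pi>_def proj3_def axis_def vec_eq_iff)
  have "\<pi> (lift F y u + s *\<^sub>R \<xi> (G y)) = \<pi> (lift F y v + t *\<^sub>R \<xi> (G y))" by (simp add: eq)
  then show uv: "u = v" by (simp add: linear_add[OF linear_pi] linear_scale[OF linear_pi] x)
  have "\<xi> (G y) \<noteq> 0" using xi_transversal[OF G_top[OF y]] zero_tangent[OF G_top[OF y]] by metis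
  then show "s = t" using eq uv by simp
qed

lemma field_eq:
  assumes Y: "tangent_field M A \<phi> W Y" and W: "W = G ` D"
  shows "smooth_on D (\<lambda>y. \<pi> (Y (G y)))" "\<And>y. y \<in> D \<Longrightarrow> Y (G y) = lift F y (\<pi> (Y (G y)))"
    "smooth_on D (\<lambda>y. Y (G y))"
proof -
  have "D \<inter> G -` W = D" using W by auto
  then show s: "smooth_on D (\<lambda>y. Y (G y))"
    using smooth_map_onD[of W Y D G, OF _ _ G] Y by (simp add: tangent_field_def)
  then show "smooth_on D (\<lambda>y. \<pi> (Y (G y)))" by (rule smooth_on_linear[OF open_D linear_pi])
  show "Y (G y) = lift F y (\<pi> (Y (G y)))" if "y \<in> D" for y
    using Y that W by (intro tangent_lift) (auto simp: tangent_field_def)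
qed

lemma deriv_field:
  assumes Y: "tangent_field M A \<phi> (G ` D) Y" and y: "y \<in> D"
  shows "deriv_along A \<phi> Y (G y) (lift F y \<zeta>) = lift F y (\<partial> \<zeta> (\<lambda>y. \<pi> (Y (G y))) y)
    + hess F y \<zeta> (\<pi> (Y (G y))) *\<^sub>R \<xi> (G y)"
proof -
  define \<eta> where "\<eta> y = \<pi> (Y (G y))" for y
  note f = field_eq[OF Y refl, folded \<eta>_def]
  have d: "\<eta> differentiable (at y)" by (rule smooth_on_differentiable[OF f(1) y])
  have "((\<lambda>y. \<partial> (\<eta> y) F y) has_derivative (\<lambda>\<zeta>. hess F y \<zeta> (\<eta> y) + \<partial> (\<partial> \<zeta> \<eta> y) F y)) (at y)"
    using smooth_on_has_derivative[OF smooth_on_dir_deriv_field[OF open_D smooth_F f(1)] y]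
    by (simp add: dir_deriv_dir_deriv_field[OF open_D y smooth_F d] hess_def)
  then have "((\<lambda>y. lift F y (\<eta> y)) has_derivative
      (\<lambda>\<zeta>. Binv (vec4 (\<partial> \<zeta> \<eta> y) (hess F y \<zeta> (\<eta> y) + \<partial> (\<partial> \<zeta> \<eta> y) F y)))) (at y)"
    unfolding lift_def
    by (intro bounded_linear.has_derivative[of Binv] has_derivative_vec4 has_derivative_dir_deriv d)
     (use linear_Binv linear_conv_bounded_linear in auto)
  then have "((\<lambda>y. Y (G y)) has_derivative
      (\<lambda>\<zeta>. Binv (vec4 (\<partial> \<zeta> \<eta> y) (hess F y \<zeta> (\<eta> y) + \<partial> (\<partial> \<zeta> \<eta> y) F y)))) (at y)"
    by (rule has_derivative_transform_within_open[OF _ open_D y]) (simp add: f(2))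
  then have "\<partial> \<zeta> (\<lambda>y. Y (G y)) y = Binv (vec4 (\<partial> \<zeta> \<eta> y) (hess F y \<zeta> (\<eta> y) + \<partial> (\<partial> \<zeta> \<eta> y) F y))"
    by (rule dir_deriv_eq)
  also have "vec4 (\<partial> \<zeta> \<eta> y) (hess F y \<zeta> (\<eta> y) + \<partial> (\<partial> \<zeta> \<eta> y) F y) =
      vec4 (\<partial> \<zeta> \<eta> y) (\<partial> (\<partial> \<zeta> \<eta> y) F y) + hess F y \<zeta> (\<eta> y) *\<^sub>R B (\<xi> (G y))"
    unfolding B_xi[OF G_top[OF y]] by (simp add: vec_eq_iff vec4_def axis_def)
  finally show ?thesis
    using deriv_along_chart[OF y, of Y \<zeta>] smooth_on_differentiable[OF f(3) y]
    by (simp add: linear_add[OF linear_Binv] linear_scale[OF linear_Binv] lift_def \<eta>_def[abs_def])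
qed

text \<open>Tangential part and \<xi>-part of a vector are unique, so the Gauss formula can be
  compared with \<open>deriv_field\<close>: the induced connection is ordinary differentiation in
  the parameter, and h is the Hessian.\<close>

lemma gauss_chart:
  assumes Y: "tangent_field M A \<phi> (G ` D) Y" and y: "y \<in> D"
  shows "nab (G y) (lift F y \<zeta>) Y = lift F y (\<partial> \<zeta> (\<lambda>y. \<pi> (Y (G y))) y)"
    "h (G y) (lift F y \<zeta>) (Y (G y)) = hess F y \<zeta> (\<pi> (Y (G y)))"
proof -
  have "nab (G y) (lift F y \<zeta>) Y \<in> tangent_space A \<phi> (G y)"
    and eq: "deriv_along A \<phi> Y (G y) (lift F y \<zeta>) = nab (G y) (lift F y \<zeta>) Y + h (G y) (lift F y \<zeta>) (Y (G y)) *\<^sub>R \<xi> (G y)"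
    using gauss[OF Y, of "G y" "lift F y \<zeta>"] y by auto
  then have n: "nab (G y) (lift F y \<zeta>) Y = lift F y (\<pi> (nab (G y) (lift F y \<zeta>) Y))"
    using tangent_lift[OF y] by blast
  have "lift F y (\<pi> (nab (G y) (lift F y \<zeta>) Y)) + h (G y) (lift F y \<zeta>) (Y (G y)) *\<^sub>R \<xi> (G y) =
    lift F y (\<partial> \<zeta> (\<lambda>y. \<pi> (Y (G y))) y) + hess F y \<zeta> (\<pi> (Y (G y))) *\<^sub>R \<xi> (G y)"
    using eq deriv_field[OF Y y, of \<zeta>] n by simp
  from lift_xi_unique[OF y this] n show "nab (G y) (lift F y \<zeta>) Y = lift F y (\<partial> \<zeta> (\<lambda>y. \<pi> (Y (G y))) y)"
    "h (G y) (lift F y \<zeta>) (Y (G y)) = hess F y \<zeta> (\<pi> (Y (G y)))" by auto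
qed

text \<open>The field with constant coefficients \<eta> in the chart. Connections are only
  constrained on vector fields over \<open>M\<close>; these are the fields on which they are
  tested.\<close>

definition fld :: "real ^ 3 \<Rightarrow> 'a \<Rightarrow> real ^ 4" where "fld \<eta> q = lift F (inv_into D G q) \<eta>"

lemma fld_G [simp]: "y \<in> D \<Longrightarrow> fld \<eta> (G y) = lift F y \<eta>"
  using diffeo_inj[OF G] by (simp add: fld_def)

lemma smooth_lift: "smooth_on D \<eta> \<Longrightarrow> smooth_on D (\<lambda>y. lift F y (\<eta> y))"
  unfolding lift_def
  by (intro smooth_on_linear[OF open_D linear_Binv] smooth_on_vec4 open_D smooth_on_dir_deriv_field smooth_F)

lemma tangent_fieldI:
  assumes "smooth_on D \<eta>" "\<And>y. y \<in> D \<Longrightarrow> Y (G y) = lift F y (\<eta> y)"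
  shows "tangent_field M A \<phi> (G ` D) Y"
  unfolding tangent_field_def
proof (intro conjI ballI)
  show "openin M (G ` D)" by (rule diffeo_open(2)[OF G])
  show "smooth_map_on A (G ` D) Y"
  proof (rule smooth_map_onI)
    fix p assume p: "p \<in> G ` D"
    have "smooth_on D (\<lambda>y. Y (G y))"
      by (rule smooth_on_cong[OF open_D _ smooth_lift[OF assms(1)]]) (simp add: assms(2))
    then show "\<exists>D G. diffeo_onto_open M A D G \<and> p \<in> G ` D \<and> smooth_on D (\<lambda>y. Y (G y))"
      using G p by blast
  qed
  show "Y q \<in> tangent_space A \<phi> q" if "q \<in> G ` D" for q
    using that assms(2) by auto
qed

lemma fld_field: "tangent_field M A \<phi> (G ` D) (fld \<eta>)"
  by (rule tangent_fieldI[of "\<lambda>y. \<eta>"]) auto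

lemma h_lift: "y \<in> D \<Longrightarrow> h (G y) (lift F y u) (lift F y v) = hess F y u v"
  using gauss_chart(2)[OF fld_field, of y u v] by simp

lemma nab_fld: "y \<in> D \<Longrightarrow> nab (G y) (lift F y u) (fld v) = 0"
proof -
  assume y: "y \<in> D"
  have "\<partial> u (\<lambda>y. \<pi> (fld v (G y))) y = \<partial> u (\<lambda>y. v) y"
    by (rule differentiable_cong_open(2)[OF open_D y]) auto
  also have "\<dots> = 0" by (rule dir_deriv_eq[OF has_derivative_const])
  finally show ?thesis using gauss_chart(1)[OF fld_field y] linear_0[OF lift_linear[OF y]] by simp
qed

lemma h_tangent:
  "y \<in> D \<Longrightarrow> X \<in> tangent_space A \<phi> (G y) \<Longrightarrow> X' \<in> tangent_space A \<phi> (G y) \<Longrightarrow> h (G y) X X' = hess F y (\<pi> X) (\<pi> X')"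
  using h_lift tangent_lift by metis

end

context graph_sphere
begin

text \<open>The coordinate frame together with \<xi> is the image under \<open>Binv\<close> of rows
  with determinant 1 or -1, so one side of the volume condition is |det Binv| everywhere. The other
  side is the root of the Hessian determinant.\<close>

lemma det_hess_constant:
  obtains \<delta> where "\<delta> > 0"
    "\<And>D G F y. adapted D G F \<Longrightarrow> y \<in> D \<Longrightarrow> \<bar>det (\<chi> i k. hess F y (axis i 1) (axis k 1))\<bar> = \<delta>"
proof -
  obtain \<sigma> :: "4 \<Rightarrow> 3 option" where \<sigma>: "bij \<sigma>"
    and vol: "\<forall>p\<in>topspace M. \<forall>X :: 3 \<Rightarrow> real ^ 4. (\<forall>i. X i \<in> tangent_space A \<phi> p) \<longrightarrow>
           \<bar>det (\<chi> j. case \<sigma> j of Some i \<Rightarrow> X i | None \<Rightarrow> \<xi> p)\<bar> = sqrt \<bar>det (\<chi> i k. h p (X i) (X k))\<bar>"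
    using volume by blast
  have dB: "det (matrix Binv) \<noteq> 0"
  proof -
    have "matrix B ** matrix Binv = mat 1"
      using matrix_compose[OF linear_Binv linear_B] by (simp add: o_def matrix_id_mat_1[unfolded id_def])
    then show ?thesis by (metis det_I det_mul mult_zero_right zero_neq_one)
  qed
  have "\<bar>det (\<chi> i k. hess F y (axis i 1) (axis k 1))\<bar> = (det (matrix Binv))\<^sup>2"
    if ad: "adapted D G F" and y: "y \<in> D" for D G F y
  proof -
    interpret adapted_chart M A \<phi> \<xi> nab h S B D G F
      using ad by unfold_locales
    define X where "X i = lift F y (axis i 1)" for i :: 3
    define w where "w j = (case \<sigma> j of Some i \<Rightarrow> vec4 (axis i 1) (\<partial> (axis i 1) F y) | None \<Rightarrow> axis 4 1)" for j
    have "\<xi> (G y) = Binv (axis 4 1)"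
      using B_xi[OF G_top[OF y]] Binv_B[of "\<xi> (G y)"] by simp
    then have "(\<chi> j. case \<sigma> j of Some i \<Rightarrow> X i | None \<Rightarrow> \<xi> (G y)) = (\<chi> j. Binv (w j))"
      by (simp add: vec_eq_iff w_def X_def lift_def split: option.split)
    also have "\<dots> = (\<chi> j. w j) ** transpose (matrix Binv)"
    proof -
      have "(w j v* transpose (matrix Binv)) = Binv (w j)" for j
        using fun_cong[OF matrix_vector_mul(2)[OF linear_Binv], of "w j"] by simp
      then show ?thesis
        by (simp add: vec_eq_iff matrix_matrix_mult_def vector_matrix_mult_def mult.commute)
    qed
    finally have "\<bar>det (\<chi> j. case \<sigma> j of Some i \<Rightarrow> X i | None \<Rightarrow> \<xi> (G y))\<bar> = \<bar>det (matrix Binv)\<bar>"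
      using abs_det_graph_frame[OF \<sigma>] by (simp add: det_mul det_transpose abs_mult w_def)
    moreover have "\<bar>det (\<chi> j. case \<sigma> j of Some i \<Rightarrow> X i | None \<Rightarrow> \<xi> (G y))\<bar> = sqrt \<bar>det (\<chi> i k. h (G y) (X i) (X k))\<bar>"
      using vol G_top[OF y] y by (simp add: X_def)
    ultimately have "\<bar>det (matrix Binv)\<bar> = sqrt \<bar>det (\<chi> i k. hess F y (axis i 1) (axis k 1))\<bar>"
      by (simp add: X_def h_lift[OF y])
    then show ?thesis by (metis abs_ge_zero power2_abs real_sqrt_pow2)
  qed
  then show thesis using that[of "(det (matrix Binv))\<^sup>2"] dB by simp
qed

end

section \<open>Connections, \<open>K\<close> and \<open>a22\<close> in an adapted chart\<close>

locale symmetric_sphere = graph_sphere +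
  fixes lc :: "'a \<Rightarrow> real ^ 4 \<Rightarrow> ('a \<Rightarrow> real ^ 4) \<Rightarrow> real ^ 4"
    and K :: "'a \<Rightarrow> real ^ 4 \<Rightarrow> real ^ 4 \<Rightarrow> real ^ 4"
    and T :: "'a \<Rightarrow> real ^ 4" and a4 :: "'a \<Rightarrow> real"
  assumes levi_civita: "levi_civita_connection M A \<phi> h lc"
    and difference: "difference_tensor M A \<phi> nab lc K"
    and symmetry: "pointwise_Z3_symmetry M A \<phi> h K T a4 \<or> pointwise_SO2_symmetry M A \<phi> h K T a4"
begin

lemma
  shows lc_tangent: "tangent_field M A \<phi> W Y \<Longrightarrow> p \<in> W \<Longrightarrow> X \<in> tangent_space A \<phi> p \<Longrightarrow> lc p X Y \<in> tangent_space A \<phi> p"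
    and lc_torsion: "tangent_field M A \<phi> W X' \<Longrightarrow> tangent_field M A \<phi> W Y \<Longrightarrow> p \<in> W \<Longrightarrow>
        lc p (X' p) Y - lc p (Y p) X' = deriv_along A \<phi> Y p (X' p) - deriv_along A \<phi> X' p (Y p)"
    and lc_metric: "tangent_field M A \<phi> W Y \<Longrightarrow> tangent_field M A \<phi> W Z \<Longrightarrow> p \<in> W \<Longrightarrow> X \<in> tangent_space A \<phi> p \<Longrightarrow>
        deriv_along A \<phi> (\<lambda>q. h q (Y q) (Z q)) p X = h p (lc p X Y) (Z p) + h p (Y p) (lc p X Z)"
  using levi_civita unfolding levi_civita_connection_def by simp_all

lemma K_eq: "tangent_field M A \<phi> W Y \<Longrightarrow> p \<in> W \<Longrightarrow> X \<in> tangent_space A \<phi> p \<Longrightarrow> K p X (Y p) = nab p X Y - lc p X Y"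
  using difference unfolding difference_tensor_def by blast

end

locale symmetric_chart = symmetric_sphere + adapted_chart
begin

lemma deriv_h:
  assumes Y: "tangent_field M A \<phi> (G ` D) Y" and y: "y \<in> D"
  shows "deriv_along A \<phi> (\<lambda>q. h q (Y q) (fld v q)) (G y) (lift F y u) =
    third F y u (\<pi> (Y (G y))) v + hess F y (\<partial> u (\<lambda>y. \<pi> (Y (G y))) y) v"
proof -
  define \<eta> where "\<eta> y = \<pi> (Y (G y))" for y
  note f = field_eq[OF Y refl, folded \<eta>_def]
  have d: "\<eta> differentiable (at y)" by (rule smooth_on_differentiable[OF f(1) y])
  have eq: "h (G z) (Y (G z)) (fld v (G z)) = hess F z (\<eta> z) v" if "z \<in> D" for z
    using that f(2)[OF that] h_lift by simp
  have "((\<lambda>z. hess F z (\<eta> z) v) has_derivative (\<lambda>u. third F y u (\<eta> y) v + hess F y (\<partial> u \<eta> y) v)) (at y)"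
    by (rule has_derivative_eq_rhs[OF has_derivative_hess[OF y d differentiable_const]])
      (simp add: dir_deriv_eq[OF has_derivative_const] linear_0[OF hess_linear(2)[OF y]])
  then have *: "((\<lambda>z. h (G z) (Y (G z)) (fld v (G z))) has_derivative (\<lambda>u. third F y u (\<eta> y) v + hess F y (\<partial> u \<eta> y) v)) (at y)"
    by (rule has_derivative_transform_within_open[OF _ open_D y]) (simp only: eq)
  show ?thesis
    using deriv_along_chart[OF y, of "\<lambda>q. h q (Y q) (fld v q)" u] dir_deriv_eq[OF *] differentiableI[OF *]
    by (simp add: \<eta>_def[abs_def])
qed

text \<open>The Christoffel symbols of the first kind of the Levi-Civita connection in the parameter
  \<open>y\<close>.\<close>

definition cg :: "real ^ 3 \<Rightarrow> real ^ 3 \<Rightarrow> real ^ 3 \<Rightarrow> real ^ 3 \<Rightarrow> real" where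
  "cg y u v w = hess F y (\<pi> (lc (G y) (lift F y u) (fld v))) w"

lemma lc_fld: "y \<in> D \<Longrightarrow> lc (G y) (lift F y u) (fld v) \<in> tangent_space A \<phi> (G y)"
  using lc_tangent[OF fld_field] by simp

lemma const_dir_deriv: "y \<in> D \<Longrightarrow> \<partial> u (\<lambda>y. \<pi> (fld v (G y))) y = 0"
proof -
  assume y: "y \<in> D"
  have "\<partial> u (\<lambda>y. \<pi> (fld v (G y))) y = \<partial> u (\<lambda>y. v) y"
    by (rule differentiable_cong_open(2)[OF open_D y]) auto
  then show ?thesis using dir_deriv_eq[OF has_derivative_const] by simp
qed

lemma cg_commute: assumes y: "y \<in> D" shows "cg y u v w = cg y v u w"
proof -
  have "lc (G y) (fld u (G y)) (fld v) - lc (G y) (fld v (G y)) (fld u) =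
    deriv_along A \<phi> (fld v) (G y) (fld u (G y)) - deriv_along A \<phi> (fld u) (G y) (fld v (G y))"
    by (rule lc_torsion[OF fld_field fld_field]) (use y in auto)
  also have "\<dots> = 0"
    using deriv_field[OF fld_field y, of v u] deriv_field[OF fld_field y, of u v] y
    by (simp add: const_dir_deriv hess_commute[of y u v])
  finally show ?thesis using y by (simp add: cg_def)
qed

lemma cg_metric: assumes y: "y \<in> D" shows "third F y u v w = cg y u v w + cg y u w v"
proof -
  have "third F y u v w = deriv_along A \<phi> (\<lambda>q. h q (fld v q) (fld w q)) (G y) (lift F y u)"
    using deriv_h[OF fld_field y, of v w u] y by (simp add: const_dir_deriv linear_0[OF hess_linear(1)[OF y]])
  also have "\<dots> = h (G y) (lc (G y) (lift F y u) (fld v)) (fld w (G y)) + h (G y) (fld v (G y)) (lc (G y) (lift F y u) (fld w))"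
    by (rule lc_metric[OF fld_field fld_field]) (use y in auto)
  also have "\<dots> = cg y u v w + cg y u w v"
    using y lc_fld[OF y] by (simp add: h_tangent cg_def hess_commute[of y v])
  finally show ?thesis .
qed

text \<open>The Koszul computation. The derivatives of the metric form a totally symmetric tensor,
  so of its three terms two cancel and half of the third remains.\<close>

lemma cg_eq: assumes y: "y \<in> D" shows "cg y u v w = third F y u v w / 2"
  using cg_metric[OF y, of u v w] cg_metric[OF y, of v u w] cg_metric[OF y, of w u v]
    cg_commute[OF y, of u v w] cg_commute[OF y, of u w v] cg_commute[OF y, of v w u]
    third_commute12[OF y, of v u w] third_commute13[OF y, of w u v] third_commute23[OF y, of v u w]
    third_commute12[OF y, of w u v] third_commute23[OF y, of u v w]
  by linarith

lemma K_third:
  assumes y: "y \<in> D"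
  shows "hess F y (\<pi> (K (G y) (lift F y u) (lift F y v))) w = - third F y u v w / 2"
proof -
  have "K (G y) (lift F y u) (fld v (G y)) = - lc (G y) (lift F y u) (fld v)"
    using K_eq[OF fld_field, of "G y" "lift F y u" v] y nab_fld[OF y] by simp
  then have "\<pi> (K (G y) (lift F y u) (lift F y v)) = - \<pi> (lc (G y) (lift F y u) (fld v))"
    using y by (simp add: linear_neg[OF linear_pi])
  then show ?thesis using cg_eq[OF y, of u v w]
    by (simp add: cg_def linear_neg[OF hess_linear(1)[OF y]])
qed

definition \<theta> :: "real ^ 3 \<Rightarrow> real ^ 3" where "\<theta> y = \<pi> (T (G y))"

definition \<alpha> :: "real ^ 3 \<Rightarrow> real" where "\<alpha> y = a4 (G y)"

lemma canonical_basis_canonical_at: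
  assumes y: "y \<in> D" and can: "canonical_basis A \<phi> h K (G y) (T (G y)) V W a b"
  shows "T (G y) = lift F y (\<theta> y)" "canonical_at F y (frame3 (\<theta> y) (\<pi> V) (\<pi> W)) a b"
proof -
  have sp: "span {T (G y), V, W} = tangent_space A \<phi> (G y)" using can by (simp add: canonical_basis_def)
  then have t: "T (G y) \<in> tangent_space A \<phi> (G y)" "V \<in> tangent_space A \<phi> (G y)" "W \<in> tangent_space A \<phi> (G y)"
    using span_superset[of "{T (G y), V, W}"] by auto
  show T: "T (G y) = lift F y (\<theta> y)" using tangent_lift[OF y t(1)] by (simp add: \<theta>_def)
  have V: "V = lift F y (\<pi> V)" and W: "W = lift F y (\<pi> W)" using tangent_lift[OF y] t by blast+
  have hh: "hess F y (\<theta> y) (\<theta> y) = -1" "hess F y (\<pi> V) (\<pi> V) = 1" "hess F y (\<pi> W) (\<pi> W) = 1"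
    "hess F y (\<theta> y) (\<pi> V) = 0" "hess F y (\<theta> y) (\<pi> W) = 0" "hess F y (\<pi> V) (\<pi> W) = 0"
    using can h_tangent[OF y] t by (auto simp: canonical_basis_def \<theta>_def)
  have kk: "\<pi> (K (G y) (T (G y)) (T (G y))) = (-2 * a) *\<^sub>R \<theta> y" "\<pi> (K (G y) (T (G y)) V) = a *\<^sub>R \<pi> V"
    "\<pi> (K (G y) (T (G y)) W) = a *\<^sub>R \<pi> W" "\<pi> (K (G y) V V) = (- a) *\<^sub>R \<theta> y + b *\<^sub>R \<pi> V"
    "\<pi> (K (G y) V W) = (- b) *\<^sub>R \<pi> W" "\<pi> (K (G y) W W) = (- a) *\<^sub>R \<theta> y - b *\<^sub>R \<pi> V"
    using can unfolding canonical_basis_def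
    by (simp_all add: linear_scale[OF linear_pi] linear_add[OF linear_pi] linear_diff[OF linear_pi] \<theta>_def
        linear_neg[OF linear_pi])
  have th: "third F y u v w = - 2 * hess F y (\<pi> (K (G y) (lift F y u) (lift F y v))) w" for u v w
    using K_third[OF y, of u v w] by simp
  have hl: "hess F y (c *\<^sub>R u) w = c * hess F y u w" "hess F y (u + v) w = hess F y u w + hess F y v w"
    "hess F y (u - v) w = hess F y u w - hess F y v w" for c u v w
    by (simp_all add: hess_scale[OF y] hess_add[OF y] hess_diff[OF y])
  note L = T[symmetric] V[symmetric] W[symmetric]
  show "canonical_at F y (frame3 (\<theta> y) (\<pi> V) (\<pi> W)) a b"
    by (rule canonical_atI[OF y hh]; simp only: th L kk hl hh)
     (simp_all add: hh)
qed

lemma SO2_canonical_at: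
  assumes z: "pointwise_SO2_symmetry M A \<phi> h K T a4" and y: "y \<in> D"
  shows "\<exists>e. e 0 = \<theta> y \<and> canonical_at F y e (\<alpha> y) 0"
proof -
  have f: "frame3 u v w 0 = u" for u v w :: "real ^ 3" by (simp add: frame3_def)
  obtain V W where "canonical_basis A \<phi> h K (G y) (T (G y)) V W (a4 (G y)) 0"
    using z G_top[OF y] by (auto simp: pointwise_SO2_symmetry_def)
  then show ?thesis using canonical_basis_canonical_at(2)[OF y] f \<alpha>_def by metis
qed

lemma pointwise_canonical: "pointwise_canonical F D \<theta> \<alpha>"
proof
  show "\<alpha> y > 0" if "y \<in> D" for y
    using symmetry G_top[OF that] by (auto simp: pointwise_Z3_symmetry_def pointwise_SO2_symmetry_def \<alpha>_def)
  have f: "frame3 u v w 0 = u" for u v w :: "real ^ 3" by (simp add: frame3_def)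
  show "(\<forall>y\<in>D. \<exists>e b. b > 0 \<and> e 0 = \<theta> y \<and> canonical_at F y e (\<alpha> y) b) \<or>
      (\<forall>y\<in>D. \<exists>e. e 0 = \<theta> y \<and> canonical_at F y e (\<alpha> y) 0)"
    using symmetry
  proof
    assume z: "pointwise_Z3_symmetry M A \<phi> h K T a4"
    have "\<exists>e b. b > 0 \<and> e 0 = \<theta> y \<and> canonical_at F y e (\<alpha> y) b" if y: "y \<in> D" for y
    proof -
      obtain V W b where "b > 0" "canonical_basis A \<phi> h K (G y) (T (G y)) V W (a4 (G y)) b"
        using z G_top[OF y] by (auto simp: pointwise_Z3_symmetry_def)
      then show ?thesis using canonical_basis_canonical_at(2)[OF y] f \<alpha>_def by metis
    qed
    then show ?thesis by blast
  next
    assume z: "pointwise_SO2_symmetry M A \<phi> h K T a4"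
    have "\<exists>e. e 0 = \<theta> y \<and> canonical_at F y e (\<alpha> y) 0" if y: "y \<in> D" for y
      by (rule SO2_canonical_at[OF z y])
    then show ?thesis by blast
  qed
qed

end

sublocale symmetric_chart \<subseteq> pointwise_canonical F D \<theta> \<alpha>
  by (rule pointwise_canonical)

context symmetric_chart
begin

lemma T_lift: assumes y: "y \<in> D" shows "T (G y) = lift F y (\<theta> y)"
proof -
  obtain V W b where "canonical_basis A \<phi> h K (G y) (T (G y)) V W (a4 (G y)) b"
    using symmetry G_top[OF y] by (auto simp: pointwise_SO2_symmetry_def pointwise_Z3_symmetry_def)
  then show ?thesis by (rule canonical_basis_canonical_at(1)[OF y])
qed

lemma T_field: "tangent_field M A \<phi> (G ` D) T"
  by (rule tangent_fieldI[OF smooth_theta T_lift])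

text \<open>Metric compatibility for \<open>T\<close> and the constant-coefficient field through V
  gives h(lc_V T, V) as (-2 \<alpha> + \<beta>) - (-\<alpha>). Only h(v, v) = 1 and h(\<theta>, v) =
  0 enter, so any vector that the choice operator may return gives the same value; the canonical
  frame shows that there is one.\<close>

lemma a22_eq:
  assumes y: "y \<in> D" shows "a22 A \<phi> h lc T (G y) = \<beta> y - \<alpha> y"
proof -
  let ?P = "\<lambda>V. V \<in> tangent_space A \<phi> (G y) \<and> h (G y) V V = 1 \<and> h (G y) (T (G y)) V = 0"
  obtain e b where e: "e 0 = \<theta> y" "canonical_at F y e (\<alpha> y) b" by (rule canonical[OF y])
  have "?P (lift F y (e 1))"
    using e(2) y by (simp add: T_lift[OF y] h_lift canonical_at_def orthonormal_at_def all_less_3 \<epsilon>_def e(1)[symmetric])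
  then have P: "?P (SOME V. ?P V)" by (rule someI)
  define V where "V = (SOME V. ?P V)"
  define v where "v = \<pi> V"
  have V: "V = lift F y v" using P tangent_lift[OF y] unfolding V_def[symmetric] v_def by blast
  have hv: "hess F y v v = 1" "hess F y (\<theta> y) v = 0"
    using P unfolding V_def[symmetric] by (simp_all add: V T_lift[OF y] h_lift[OF y])
  have lt: "lc (G y) V T \<in> tangent_space A \<phi> (G y)" using lc_tangent[OF T_field] y by (simp add: V)
  have "third F y v (\<theta> y) v + hess F y (\<partial> v \<theta> y) v =
    h (G y) (lc (G y) V T) (fld v (G y)) + h (G y) (T (G y)) (lc (G y) V (fld v))"
    using lc_metric[OF T_field fld_field, of "G y" V v] deriv_h[OF T_field y, of v v] y
    by (simp add: V \<theta>_def[abs_def])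
  also have "h (G y) (T (G y)) (lc (G y) V (fld v)) = cg y v v (\<theta> y)"
    using lc_fld[OF y] y unfolding V
    by (subst h_tangent[OF y]) (simp_all add: T_lift cg_def hess_commute[OF y, of "\<theta> y"])
  also have "\<dots> = - \<alpha> y"
    using third_commute13[OF y, of v v "\<theta> y"] by (simp add: cg_eq[OF y] third_theta_eq[OF y] hv)
  also have "h (G y) (lc (G y) V T) (fld v (G y)) = h (G y) (lc (G y) V T) V" using y by (simp add: V)
  also have "third F y v (\<theta> y) v = - 2 * \<alpha> y"
    using third_commute12[OF y, of v "\<theta> y" v] by (simp add: third_theta_eq[OF y] hv)
  also have "hess F y (\<partial> v \<theta> y) v = \<beta> y"
    by (simp add: structure_beta(1)[OF y] hess_add[OF y] hess_scale[OF y] hv)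
  finally have "h (G y) (lc (G y) V T) V = \<beta> y - \<alpha> y" by simp
  then show ?thesis by (simp add: a22_def Let_def V_def)
qed

end

subsection \<open>Adapted product coordinates\<close>

lemma smooth_on_vector2:
  fixes f g :: "'v::real_normed_vector \<Rightarrow> real"
  assumes "open S" "smooth_on S f" "smooth_on S g"
  shows "smooth_on S (\<lambda>x. vector [f x, g x] :: real ^ 2)"
  using assms by (subst smooth_on_vec_iff[OF assms(1)]) (simp add: forall_2)

lemma smooth_on_vector3:
  fixes f g h :: "'v::real_normed_vector \<Rightarrow> real"
  assumes "open S" "smooth_on S f" "smooth_on S g" "smooth_on S h"
  shows "smooth_on S (\<lambda>x. vector [f x, g x, h x] :: real ^ 3)"
  using assms by (subst smooth_on_vec_iff[OF assms(1)]) (simp add: forall_3)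

lemma vector2_eta: "vector [y $ 1, y $ 2] = (y :: real ^ 2)"
  by (simp add: vec_eq_iff forall_2)

lemma vector3_eta: "vector [y $ 1, y $ 2, y $ 3] = (y :: real ^ 3)"
  by (simp add: vec_eq_iff forall_3)

lemma vector3_linear:
  "vector [a + a', b + b', c + c'] = (vector [a, b, c] + vector [a', b', c'] :: real ^ 3)"
  "vector [r * a, r * b, r * c] = (r *\<^sub>R vector [a, b, c] :: real ^ 3)"
  by (simp_all add: vec_eq_iff forall_3)

text \<open>Restricting a local diffeomorphism \<open>m\<close> with left inverse \<open>m'\<close> to a small product neighbourhood.\<close>

lemma product_neighbourhood:
  fixes m m' :: "real ^ 3 \<Rightarrow> real ^ 3"
  assumes D: "open D" "yp \<in> D" and N1: "open N1" "z0 \<in> N1" and t0: "t0 > 0"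
    and m: "smooth_on {u. u $ 1 > 0 \<and> vector [u $ 2, u $ 3] \<in> N1} m" and m0: "m (vector [t0, z0 $ 1, z0 $ 2]) = yp"
    and m': "smooth_on D m'"
    and left: "\<And>u. u $ 1 > 0 \<Longrightarrow> vector [u $ 2, u $ 3] \<in> N1 \<Longrightarrow> m u \<in> D \<Longrightarrow> m' (m u) = u"
    and right: "\<And>y. y \<in> D \<Longrightarrow> m' y $ 1 > 0 \<Longrightarrow> vector [m' y $ 2, m' y $ 3] \<in> N1 \<Longrightarrow> m (m' y) = y"
  obtains I N where "open_positive_interval I" "open N" "convex N" "N \<subseteq> N1" "open (interval_times I N)"
    "m ` interval_times I N \<subseteq> D" "open (m ` interval_times I N)" "smooth_on (interval_times I N) m"
    "smooth_on (m ` interval_times I N) m'" "yp \<in> m ` interval_times I N"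
    "\<And>u. u \<in> interval_times I N \<Longrightarrow> u $ 1 > 0 \<and> vector [u $ 2, u $ 3] \<in> N1 \<and> m' (m u) = u"
proof -
  have c23: "continuous_on UNIV (\<lambda>u::real ^ 3. vector [u $ 2, u $ 3] :: real ^ 2)"
    by (intro smooth_on_continuous smooth_on_vector2 smooth_on_vec_nth smooth_on_id open_UNIV)
  have c1: "continuous_on UNIV (\<lambda>u::real ^ 3. u $ 1)"
    by (intro smooth_on_continuous smooth_on_vec_nth smooth_on_id open_UNIV)
  have op: "open {u::real ^ 3. u $ 1 \<in> I \<and> vector [u $ 2, u $ 3] \<in> N}" if "open I" "open N" for I and N :: "(real ^ 2) set"
    using open_Int[OF open_vimage[OF that(1) c1] open_vimage[OF that(2) c23]] by (simp add: vimage_def Collect_conj_eq)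
  define \<Omega> where "\<Omega> = {u::real ^ 3. u $ 1 > 0 \<and> vector [u $ 2, u $ 3] \<in> N1}"
  have o\<Omega>: "open \<Omega>" using op[of "{0<..}" N1] N1 by (simp add: \<Omega>_def)
  define \<Omega>' where "\<Omega>' = \<Omega> \<inter> m -` D"
  have o\<Omega>': "open \<Omega>'" unfolding \<Omega>'_def
    by (intro continuous_open_preimage smooth_on_continuous o\<Omega> D(1)) (use m \<Omega>_def in simp)
  define u0 where "u0 = (vector [t0, z0 $ 1, z0 $ 2] :: real ^ 3)"
  have u0: "u0 \<in> \<Omega>'" using m0 D(2) N1(2) t0 by (simp add: \<Omega>'_def \<Omega>_def u0_def vector2_eta)
  obtain r where r: "r > 0" "ball u0 r \<subseteq> \<Omega>'" using o\<Omega>' u0 openE by blast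
  \<comment> \<open>Half the radius for each factor: the distance in the product is at most the sum
    of the two distances. The maximum keeps the interval positive.\<close>
  define I where "I = {max 0 (t0 - r / 2)<..<t0 + r / 2}"
  define N where "N = ball z0 (r / 2)"
  have small: "u \<in> \<Omega>'" if u: "u $ 1 \<in> I" "vector [u $ 2, u $ 3] \<in> N" for u :: "real ^ 3"
  proof -
    have "t0 - r / 2 < u $ 1" "u $ 1 < t0 + r / 2" using u(1) by (simp_all add: I_def)
    then have 1: "\<bar>u $ 1 - t0\<bar> < r / 2" by linarith
    have 2: "norm (vector [u $ 2, u $ 3] - z0) < r / 2" using u(2) by (simp add: N_def dist_norm norm_minus_commute)
    have "u - u0 = (u $ 1 - t0) *\<^sub>R axis 1 1 + vector [0, u $ 2 - z0 $ 1, u $ 3 - z0 $ 2]"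
      by (simp add: vec_eq_iff forall_3 u0_def axis_def)
    then have "norm (u - u0) \<le> \<bar>u $ 1 - t0\<bar> + norm (vector [0, u $ 2 - z0 $ 1, u $ 3 - z0 $ 2] :: real ^ 3)"
      by (metis norm_triangle_ineq norm_scaleR norm_axis_1 mult.right_neutral)
    also have "norm (vector [0, u $ 2 - z0 $ 1, u $ 3 - z0 $ 2] :: real ^ 3) = norm (vector [u $ 2, u $ 3] - z0)"
      by (simp add: norm_vec_def L2_set_def sum_2 sum_3)
    finally have "norm (u - u0) < r" using 1 2 by simp
    then show ?thesis using r(2) by (auto simp: dist_norm norm_minus_commute)
  qed
  have V: "interval_times I N \<subseteq> \<Omega>'" using small by (auto simp: interval_times_def)
  have oV: "open (interval_times I N)" using op[of I N] by (simp add: interval_times_def I_def N_def)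
  have mV: "m ` interval_times I N \<subseteq> D" using V by (auto simp: \<Omega>'_def)
  have inv: "u $ 1 > 0 \<and> vector [u $ 2, u $ 3] \<in> N1 \<and> m' (m u) = u" if "u \<in> interval_times I N" for u
    using that V left by (auto simp: \<Omega>'_def \<Omega>_def)
  \<comment> \<open>Writing the image as a preimage under the continuous left inverse shows that it
    is open.\<close>
  have "m ` interval_times I N = D \<inter> m' -` interval_times I N"
  proof
    show "m ` interval_times I N \<subseteq> D \<inter> m' -` interval_times I N" using mV inv by auto
    show "D \<inter> m' -` interval_times I N \<subseteq> m ` interval_times I N"
    proof
      fix y assume y: "y \<in> D \<inter> m' -` interval_times I N"
      then have "m' y \<in> \<Omega>" using V by (auto simp: \<Omega>'_def)
      then have "m (m' y) = y" using right y by (auto simp: \<Omega>_def)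
      then show "y \<in> m ` interval_times I N" using y by (metis IntD2 image_eqI vimageD)
    qed
  qed
  then have oim: "open (m ` interval_times I N)"
    using continuous_open_preimage[OF smooth_on_continuous[OF m'] D(1) oV] by simp
  have u0V: "u0 \<in> interval_times I N"
    using r(1) t0 by (simp add: interval_times_def u0_def I_def N_def vector2_eta)
  show thesis
  proof (rule that)
    show "open_positive_interval I" by (auto simp: open_positive_interval_def I_def is_interval_oo)
    show "N \<subseteq> N1"
    proof
      fix z assume z: "z \<in> N"
      have "(vector [t0, z $ 1, z $ 2] :: real ^ 3) \<in> \<Omega>'"
        using r(1) t0 z by (intro small) (auto simp: I_def vector2_eta)
      then show "z \<in> N1" by (simp add: \<Omega>'_def \<Omega>_def vector2_eta)
    qed
    show "smooth_on (interval_times I N) m"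
      by (rule smooth_on_subset[OF m]) (use V in \<open>auto simp: \<Omega>'_def \<Omega>_def\<close>)
    show "yp \<in> m ` interval_times I N" using u0V m0 u0_def by blast
  qed (use oV mV oim inv smooth_on_subset[OF m' mV] in \<open>auto simp: N_def\<close>)
qed

lemma det_gram:
  fixes b :: "real ^ 3 \<Rightarrow> real ^ 3 \<Rightarrow> real"
  assumes "\<And>v. linear (\<lambda>u. b u v)" "\<And>u. linear (b u)" "linear P"
  shows "det (\<chi> i k. b (P (axis i 1)) (P (axis k 1))) = (det (matrix P))\<^sup>2 * det (\<chi> i k. b (axis i 1) (axis k 1))"
proof -
  have b: "b u v = (\<Sum>i\<in>UNIV. \<Sum>k\<in>UNIV. u $ i * v $ k * b (axis i 1) (axis k 1))" for u v
  proof -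
    have "b u v = b (\<Sum>i\<in>UNIV. u $ i *\<^sub>R axis i 1) v"
      by (simp add: basis_expansion scalar_mult_eq_scaleR[symmetric])
    also have "\<dots> = (\<Sum>i\<in>UNIV. u $ i * b (axis i 1) v)"
      by (simp add: linear_sum[OF assms(1)] linear_scale[OF assms(1)])
    also have "\<dots> = (\<Sum>i\<in>UNIV. u $ i * b (axis i 1) (\<Sum>k\<in>UNIV. v $ k *\<^sub>R axis k 1))"
      by (simp add: basis_expansion scalar_mult_eq_scaleR[symmetric])
    also have "\<dots> = (\<Sum>i\<in>UNIV. u $ i * (\<Sum>k\<in>UNIV. v $ k * b (axis i 1) (axis k 1)))"
      by (simp add: linear_sum[OF assms(2)] linear_scale[OF assms(2)])
    finally show ?thesis by (simp add: sum_distrib_left mult.assoc)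
  qed
  have "(\<chi> i k. b (P (axis i 1)) (P (axis k 1))) = transpose (matrix P) ** (\<chi> i k. b (axis i 1) (axis k 1)) ** matrix P"
    unfolding b[of "P _"]
    by (simp add: vec_eq_iff matrix_matrix_mult_def transpose_def matrix_def sum_3 algebra_simps)
  then show ?thesis by (simp add: det_mul det_transpose power2_eq_square)
qed

lemma hess_comp_affine:
  fixes F :: "'m::euclidean_space \<Rightarrow> real" and L :: "'n::euclidean_space \<Rightarrow> 'm"
  assumes D: "open D" and F: "smooth_on D F" and L: "linear L" and z: "L z + b \<in> D"
  shows "hess (\<lambda>z. F (L z + b)) z u v = hess F (L z + b) (L u) (L v)"
proof -
  define S where "S = {z. L z + b \<in> D}"
  have bl: "bounded_linear L" using L linear_conv_bounded_linear by blast
  have "continuous_on UNIV (\<lambda>z. L z + b)"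
    by (intro continuous_intros linear_continuous_on bl)
  then have oS: "open S" unfolding S_def using open_vimage[OF D, of "\<lambda>z. L z + b"] by (simp add: vimage_def)
  have d: "((\<lambda>z. g (L z + b)) has_derivative (\<lambda>u. \<partial> (L u) g (L z + b))) (at z)" if "smooth_on D g" "z \<in> S" for g :: "'m \<Rightarrow> real" and z
  proof -
    have "((\<lambda>z. L z + b) has_derivative L) (at z)"
      by (auto intro!: derivative_eq_intros bounded_linear_imp_has_derivative bl)
    from has_derivative_compose[OF this smooth_on_has_derivative[OF that(1)]] that(2) show ?thesis by (simp add: S_def)
  qed
  have zS: "z \<in> S" using z by (simp add: S_def)
  have "((\<lambda>z. \<partial> (L v) F (L z + b)) has_derivative (\<lambda>u. \<partial> (L u) (\<partial> (L v) F) (L z + b))) (at z)"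
    by (rule d[OF smooth_on_dir_deriv[OF F] zS])
  then have "(\<partial> v (\<lambda>z. F (L z + b)) has_derivative (\<lambda>u. \<partial> (L u) (\<partial> (L v) F) (L z + b))) (at z)"
    by (rule has_derivative_transform_within_open[OF _ oS zS]) (simp add: dir_deriv_eq[OF d[OF F]])
  then show ?thesis unfolding hess_def by (rule dir_deriv_eq)
qed

lemma smooth_comp_affine:
  fixes F :: "'m::euclidean_space \<Rightarrow> real" and L :: "'n::euclidean_space \<Rightarrow> 'm"
  assumes D: "open D" and F: "smooth_on D F" and L: "linear L"
  shows "open {z. L z + b \<in> D}" "smooth_on {z. L z + b \<in> D} (\<lambda>z. F (L z + b))"
proof -
  have "continuous_on UNIV (\<lambda>z. L z + b)"
    using L linear_conv_bounded_linear by (intro continuous_intros linear_continuous_on) blast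
  then show o: "open {z. L z + b \<in> D}" using open_vimage[OF D, of "\<lambda>z. L z + b"] by (simp add: vimage_def)
  show "smooth_on {z. L z + b \<in> D} (\<lambda>z. F (L z + b))"
    by (intro smooth_on_compose[OF o D _ _ F] smooth_on_add o smooth_on_linear[OF o L] smooth_on_id smooth_on_const) auto
qed

lemma constant_on_unit_interval:
  fixes k :: "real \<Rightarrow> real"
  assumes "\<And>t. 0 \<le> t \<Longrightarrow> t \<le> 1 \<Longrightarrow> (k has_real_derivative 0) (at t)"
  shows "k 1 = k 0"
proof -
  show ?thesis using MVT2[of 0 1 k "\<lambda>_. 0"] assms by auto
qed

lemma has_real_derivative_along_line:
  fixes f :: "'a::real_normed_vector \<Rightarrow> real"
  assumes "(f has_derivative f') (at (x + t *\<^sub>R v))"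
  shows "((\<lambda>t. f (x + t *\<^sub>R v)) has_real_derivative f' v) (at t)"
proof -
  have "((\<lambda>t. x + t *\<^sub>R v) has_derivative (\<lambda>h. h *\<^sub>R v)) (at t)" by (auto intro!: derivative_eq_intros)
  from has_derivative_compose[OF this assms]
  show ?thesis
    by (simp add: has_field_derivative_def linear_scale[OF has_derivative_linear[OF assms]] mult.commute[of _ "f' v"])
qed

lemma convex_line: "convex D \<Longrightarrow> x \<in> D \<Longrightarrow> x + v \<in> D \<Longrightarrow> 0 \<le> t \<Longrightarrow> t \<le> 1 \<Longrightarrow> x + t *\<^sub>R v \<in> D"
  for x v :: "'a::real_vector"
proof -
  assume *: "convex D" "x \<in> D" "x + v \<in> D" "0 \<le> t" "t \<le> 1"
  have "(1 - t) *\<^sub>R x + t *\<^sub>R (x + v) \<in> D" using * by (intro convexD) auto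
  then show ?thesis by (simp add: algebra_simps)
qed

definition emb :: "real ^ 2 \<Rightarrow> real ^ 3" where "emb z = vector [z $ 1, z $ 2, 0]"

lemma linear_emb: "linear emb"
  by (auto simp: linear_iff emb_def vec_eq_iff forall_3)

lemma emb_axis: "emb (axis 1 1) = axis 1 1" "emb (axis 2 1) = axis 2 1"
  by (simp_all add: emb_def vec_eq_iff forall_3 axis_def)

context pointwise_canonical
begin

text \<open>This is where the normalization of \<open>P\<close> is used. The Hessian of the
  two-variable function will be \<mu> times \<open>tform\<close> pulled back by \<open>P\<close>; as
  \<mu> is twice h(\<theta>, P e_3) up to sign, its square cancels the timelike factor of
  \<open>det_tform\<close>, and 4 (det P)^2 |det Hess F| = 1 remains.\<close>

lemma det_tform_unit:
  assumes y: "y \<in> D" and P: "linear P" "bij P"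
    and *: "hess F y (\<theta> y) (P (axis 1 1)) = 0 \<and> hess F y (\<theta> y) (P (axis 2 1)) = 0 \<or> (\<exists>c. P (axis 3 1) = c *\<^sub>R \<theta> y)"
    and \<theta>3: "\<And>x. (\<exists>c. P (emb x) = c *\<^sub>R \<theta> y) \<Longrightarrow> x = 0"
    and det: "4 * (det (matrix P))\<^sup>2 * \<bar>det (\<chi> i k. hess F y (axis i 1) (axis k 1))\<bar> = 1"
    and \<mu>: "\<mu>\<^sup>2 = 4 * (hess F y (\<theta> y) (P (axis 3 1)))\<^sup>2"
  shows "\<mu>\<^sup>2 * (tform y (P (axis 1 1)) (P (axis 1 1)) * tform y (P (axis 2 1)) (P (axis 2 1)) - (tform y (P (axis 1 1)) (P (axis 2 1)))\<^sup>2) = 1"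
proof -
  define u where "u i = P (axis i 1)" for i :: 3
  define T11 where "T11 = tform y (u 1) (u 1)"
  define T12 where "T12 = tform y (u 1) (u 2)"
  define T22 where "T22 = tform y (u 2) (u 2)"
  have pos: "tform y (P (emb x)) (P (emb x)) > 0" if "x \<noteq> 0" for x
    using tform_pos[OF y, of "P (emb x)"] \<theta>3[of x] that by blast
  have T11: "T11 > 0" using pos[of "axis 1 1"] by (simp add: T11_def u_def emb_axis axis_eq_0_iff)
  \<comment> \<open>On this vector the quadratic form takes the value T_11 (T_11 T_22 - T_12^2), so
    its positivity is that of the determinant.\<close>
  define x where "x = (vector [- T12, T11] :: real ^ 2)"
  have "x \<noteq> 0" using T11 by (auto simp: x_def vec_eq_iff forall_2)
  moreover have "emb x = (- T12) *\<^sub>R axis 1 1 + T11 *\<^sub>R axis 2 1"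
    by (simp add: x_def emb_def vec_eq_iff forall_3 axis_def)
  then have "P (emb x) = (- T12) *\<^sub>R u 1 + T11 *\<^sub>R u 2"
    by (simp add: u_def linear_add[OF P(1)] linear_scale[OF P(1)] linear_diff[OF P(1)])
  ultimately have "0 < tform y ((- T12) *\<^sub>R u 1 + T11 *\<^sub>R u 2) ((- T12) *\<^sub>R u 1 + T11 *\<^sub>R u 2)"
    using pos[of x] by simp
  also have "\<dots> = T11 * (T11 * T22 - T12\<^sup>2)"
  proof -
    have "tform y (a *\<^sub>R v + b *\<^sub>R w) x = a * tform y v x + b * tform y w x"
      "tform y x (a *\<^sub>R v + b *\<^sub>R w) = a * tform y x v + b * tform y x w" for a b v w x
      by (simp_all add: tform_def hess_add[OF y] hess_scale[OF y] algebra_simps)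
    note * = this
    show ?thesis unfolding * tform_commute[OF y, of "u 2" "u 1"] T11_def[symmetric] T12_def[symmetric] T22_def[symmetric]
      by algebra
  qed
  finally have Tpos: "T11 * T22 - T12\<^sup>2 > 0" using T11 by (simp add: zero_less_mult_iff)
  have e1: "det (\<chi> i k. hess F y (u i) (u k)) = - (hess F y (\<theta> y) (u 3))\<^sup>2 * (T11 * T22 - T12\<^sup>2)"
    using det_tform[OF y *, folded u_def] unfolding T11_def T12_def T22_def
    by (simp add: det_3)
  have e2: "det (\<chi> i k. hess F y (u i) (u k)) = (det (matrix P))\<^sup>2 * det (\<chi> i k. hess F y (axis i 1) (axis k 1))"
    unfolding u_def by (rule det_gram) (auto intro: hess_linear y P)
  have "(det (matrix P))\<^sup>2 * \<bar>det (\<chi> i k. hess F y (axis i 1) (axis k 1))\<bar> = \<bar>det (\<chi> i k. hess F y (u i) (u k))\<bar>"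
    unfolding e2 by (simp add: abs_mult)
  also have "\<dots> = (hess F y (\<theta> y) (u 3))\<^sup>2 * (T11 * T22 - T12\<^sup>2)"
    unfolding e1 using Tpos by (simp add: abs_mult)
  finally have "(det (matrix P))\<^sup>2 * \<bar>det (\<chi> i k. hess F y (axis i 1) (axis k 1))\<bar> = (hess F y (\<theta> y) (u 3))\<^sup>2 * (T11 * T22 - T12\<^sup>2)" .
  then show ?thesis using det \<mu> by (simp add: u_def[symmetric] T11_def[symmetric] T12_def[symmetric] T22_def[symmetric])
qed

end

section \<open>Local model in the case \<beta> = 0\<close>

context minus_type
begin

text \<open>On a slice transversal to \<open>e\<close> the function \<open>f\<close> of the model is
  \<open>c - q ^ 3 / 6\<close>. Its Hessian is degenerate along \<theta>, so every transversal slice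
  sees a definite form.\<close>

lemma hess_slice: assumes y: "y \<in> D" shows "hess (\<lambda>y. c - q y ^ 3 / 6) y x u = 2 / q y * tform y x u"
proof -
  have d: "((\<lambda>y. c - q y ^ 3 / 6) has_derivative (\<lambda>u. - (q y * hess F y (\<theta> y) u))) (at y)" if "y \<in> D" for y
    by (rule has_derivative_eq_rhs[OF has_derivative_diff[OF has_derivative_const
            has_derivative_divide'[OF dir_deriv_q3[OF that] has_derivative_const, of 6]]]) (auto simp: fun_eq_iff)
  have "((\<lambda>y. - (q y * hess F y (\<theta> y) u)) has_derivative (\<lambda>x. 2 / q y * tform y x u)) (at y)"
    using q_pos[OF y]
    by (auto intro!: derivative_eq_intros dq[OF y] dform[OF y]
        simp: fun_eq_iff tform_def power2_eq_square field_simps)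
  then have "(\<partial> u (\<lambda>y. c - q y ^ 3 / 6) has_derivative (\<lambda>x. 2 / q y * tform y x u)) (at y)"
    by (rule has_derivative_transform_within_open[OF _ open_D y]) (simp add: dir_deriv_eq[OF d])
  then show ?thesis unfolding hess_def by (rule dir_deriv_eq)
qed

lemma q3_along_e:
  assumes e: "\<And>y. y \<in> D \<Longrightarrow> \<theta> y = q y *\<^sub>R e" and y: "y \<in> D" "y + r *\<^sub>R e \<in> D"
  shows "q (y + r *\<^sub>R e) ^ 3 = q y ^ 3 - 6 * r"
proof -
  define k where "k t = q (y + t *\<^sub>R (r *\<^sub>R e)) ^ 3 + 6 * r * t" for t
  have "(k has_real_derivative 0) (at t)" if t: "0 \<le> t" "t \<le> 1" for t
  proof -
    let ?z = "y + t *\<^sub>R (r *\<^sub>R e)"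
    have z: "?z \<in> D" by (rule convex_line[OF convex_D y t])
    have "hess F ?z (\<theta> ?z) (q ?z *\<^sub>R e) = -1" using hess_theta_theta[OF z] e[OF z] by simp
    then have he: "q ?z * hess F ?z (\<theta> ?z) e = -1" unfolding hess_scale[OF z] by simp
    have 1: "((\<lambda>t. q (y + t *\<^sub>R (r *\<^sub>R e)) ^ 3) has_real_derivative (6 * q ?z * hess F ?z (\<theta> ?z) (r *\<^sub>R e))) (at t)"
      by (rule has_real_derivative_along_line[OF dir_deriv_q3[OF z]])
    have 2: "6 * q ?z * hess F ?z (\<theta> ?z) (r *\<^sub>R e) = - 6 * r"
      using he unfolding hess_scale[OF z] by (simp add: algebra_simps)
    have "((\<lambda>t. 6 * r * t) has_real_derivative 6 * r) (at t)" by (auto intro!: derivative_eq_intros)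
    from DERIV_add[OF 1[unfolded 2] this] show ?thesis unfolding k_def[abs_def] by simp
  qed
  then have "k 1 = k 0" by (rule constant_on_unit_interval)
  then show ?thesis by (simp add: k_def)
qed

lemma local_model:
  assumes e: "\<And>y. y \<in> D \<Longrightarrow> \<theta> y = q y *\<^sub>R e" and P: "linear P" "bij P" "P (axis 3 1) = - e"
    and det: "\<And>y. y \<in> D \<Longrightarrow> 4 * (det (matrix P))\<^sup>2 * \<bar>det (\<chi> i k. hess F y (axis i 1) (axis k 1))\<bar> = 1"
    and yp: "yp \<in> D"
  obtains I N f m m' where "open_positive_interval I" "improper_affine_graph N f"
    "(\<forall>y\<in>D. \<exists>e. e 0 = \<theta> y \<and> canonical_at F y e (\<alpha> y) 0) \<longrightarrow> on_elliptic_paraboloid N f"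
    "open (interval_times I N)" "m ` interval_times I N \<subseteq> D" "open (m ` interval_times I N)"
    "smooth_on (interval_times I N) m" "smooth_on (m ` interval_times I N) m'" "yp \<in> m ` interval_times I N"
    "\<And>u. u \<in> interval_times I N \<Longrightarrow> m' (m u) = u"
    "\<And>u. u \<in> interval_times I N \<Longrightarrow> q (m u) = u $ 1 \<and> m u = P (vector [u $ 2, u $ 3, f (u $ 2) (u $ 3) + u $ 1 ^ 3 / 6])"
proof -
  define \<Lambda> where "\<Lambda> = inv P"
  have L\<Lambda>: "linear \<Lambda>" unfolding \<Lambda>_def by (metis P(1,2) bij_is_inj bij_is_surj inj_linear_imp_inv_linear)
  have \<Lambda>P [simp]: "\<Lambda> (P x) = x" and P\<Lambda> [simp]: "P (\<Lambda> y) = y" for x y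
    using P(2) by (auto simp: \<Lambda>_def bij_is_inj bij_is_surj surj_f_inv_f)
  define x0 where "x0 = \<Lambda> yp"
  define z0 where "z0 = (vector [x0 $ 1, x0 $ 2] :: real ^ 2)"
  \<comment> \<open>The slice \<open>L z + b\<close> has the constant third coordinate of
    \<open>yp\<close>; there \<open>f\<close> is read off from \<open>q\<close>.\<close>
  define b where "b = x0 $ 3 *\<^sub>R P (axis 3 1)"
  define L where "L z = P (emb z)" for z
  have linL: "linear L" unfolding L_def[abs_def] using linear_compose[OF linear_emb P(1)] by (simp add: o_def)
  have Lb: "L z + b = P (vector [z $ 1, z $ 2, x0 $ 3])" for z
  proof -
    have "vector [z $ 1, z $ 2, x0 $ 3] = emb z + x0 $ 3 *\<^sub>R axis 3 1"
      by (simp add: emb_def vec_eq_iff forall_3 axis_def)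
    then show ?thesis by (simp add: L_def b_def linear_add[OF P(1)] linear_scale[OF P(1)])
  qed
  define N1 where "N1 = {z. L z + b \<in> D}"
  define Fs where "Fs y = x0 $ 3 - q y ^ 3 / 6" for y
  have sFs: "smooth_on D Fs" unfolding Fs_def[abs_def]
    by (intro smooth_on_diff smooth_on_divide smooth_on_power smooth_q smooth_on_const open_D) auto
  define fl where "fl z = Fs (L z + b)" for z
  define f where "f v w = fl (vector [v, w])" for v w
  have N1: "open N1" "smooth_on N1 fl"
    using smooth_comp_affine[OF open_D sFs linL, of b] by (auto simp: N1_def fl_def[abs_def])
  have hfl: "hess fl z u v = 2 / q (L z + b) * tform (L z + b) (L u) (L v)" if "z \<in> N1" for z u v
    using hess_comp_affine[OF open_D sFs linL, of z b u v] that hess_slice[of "L z + b" "x0 $ 3" "L u" "L v"]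
    by (simp add: N1_def fl_def[abs_def] Fs_def[abs_def])
  have Lz0: "L z0 + b = yp" unfolding Lb by (simp add: z0_def vector3_eta x0_def)
  have key: "q y ^ 3 = 6 * (\<Lambda> y $ 3 - fl z)" if "y \<in> D" "z \<in> N1" "z = vector [\<Lambda> y $ 1, \<Lambda> y $ 2]" for y z
  proof -
    define r where "r = x0 $ 3 - \<Lambda> y $ 3"
    have "\<Lambda> y = vector [z $ 1, z $ 2, x0 $ 3] + (- r) *\<^sub>R axis 3 1"
      using that(3) by (simp add: vec_eq_iff forall_3 axis_def r_def)
    then have "P (\<Lambda> y) = (L z + b) + r *\<^sub>R e"
      unfolding Lb by (simp add: linear_add[OF P(1)] linear_scale[OF P(1)] linear_diff[OF P(1)] P(3))
    then have y: "y = (L z + b) + r *\<^sub>R e" by simp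
    have "q ((L z + b) + r *\<^sub>R e) ^ 3 = q (L z + b) ^ 3 - 6 * r"
    proof (rule q3_along_e[OF e])
      show "L z + b \<in> D" using that(2) by (simp add: N1_def)
      show "L z + b + r *\<^sub>R e \<in> D" by (subst y[symmetric]) (rule that(1))
    qed
    then have "q y ^ 3 = q (L z + b) ^ 3 - 6 * r" by (subst y)
    then show ?thesis by (simp add: fl_def Fs_def r_def)
  qed
  define t0 where "t0 = q yp"
  have t0: "t0 > 0" using q_pos[OF yp] by (simp add: t0_def)
  define m where "m u = P (vector [u $ 2, u $ 3, fl (vector [u $ 2, u $ 3]) + u $ 1 ^ 3 / 6])" for u :: "real ^ 3"
  define m' where "m' y = (vector [q y, \<Lambda> y $ 1, \<Lambda> y $ 2] :: real ^ 3)" for y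
  let ?\<Omega> = "{u::real ^ 3. u $ 1 > 0 \<and> vector [u $ 2, u $ 3] \<in> N1}"
  have o\<Omega>: "open ?\<Omega>"
  proof -
    have "continuous_on UNIV (\<lambda>u::real ^ 3. vector [u $ 2, u $ 3] :: real ^ 2)"
      by (intro smooth_on_continuous smooth_on_vector2 smooth_on_vec_nth smooth_on_id open_UNIV)
    from open_vimage[OF N1(1) this] have "open {u::real ^ 3. vector [u $ 2, u $ 3] \<in> N1}" by (simp add: vimage_def)
    moreover have "open {u::real ^ 3. u $ 1 > 0}" by (simp add: open_halfspace_component_gt_cart)
    ultimately have "open ({u::real ^ 3. u $ 1 > 0} \<inter> {u. vector [u $ 2, u $ 3] \<in> N1})" by (intro open_Int)
    then show ?thesis by (simp only: Collect_conj_eq)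
  qed
  have q3: "q (m u) = u $ 1" if "u \<in> ?\<Omega>" "m u \<in> D" for u
  proof -
    have \<Lambda>m: "\<Lambda> (m u) = vector [u $ 2, u $ 3, fl (vector [u $ 2, u $ 3]) + u $ 1 ^ 3 / 6]" by (simp only: m_def \<Lambda>P)
    have "q (m u) ^ 3 = 6 * (\<Lambda> (m u) $ 3 - fl (vector [u $ 2, u $ 3]))"
    proof (rule key[OF that(2)])
      show "vector [u $ 2, u $ 3] \<in> N1" using that(1) by blast
      show "vector [u $ 2, u $ 3] = (vector [\<Lambda> (m u) $ 1, \<Lambda> (m u) $ 2] :: real ^ 2)" unfolding \<Lambda>m by (simp only: vector_3)
    qed
    also have "\<dots> = u $ 1 ^ 3" unfolding \<Lambda>m vector_3 by simp
    finally have "q (m u) ^ 3 = u $ 1 ^ 3" .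
    moreover have "0 \<le> q (m u)" "0 \<le> u $ 1" using q_pos[OF that(2)] that(1) by auto
    ultimately show ?thesis by (rule power_eq_imp_eq_base) simp
  qed
  have sm: "smooth_on ?\<Omega> m" unfolding m_def[abs_def]
    by (intro smooth_on_linear[OF o\<Omega> P(1)] smooth_on_vector3 o\<Omega> smooth_on_vec_nth smooth_on_id smooth_on_add
        smooth_on_divide smooth_on_power smooth_on_const smooth_on_compose[OF o\<Omega> N1(1) _ _ N1(2)] smooth_on_vector2) auto
  have sm': "smooth_on D m'" unfolding m'_def[abs_def]
    by (intro smooth_on_vector3 open_D smooth_q smooth_on_vec_nth smooth_on_linear[OF open_D L\<Lambda>] smooth_on_id)
  have m0: "m (vector [t0, z0 $ 1, z0 $ 2]) = yp"
  proof -
    have "fl z0 + t0 ^ 3 / 6 = x0 $ 3" by (simp add: fl_def Fs_def Lz0 t0_def)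
    then show ?thesis by (simp add: m_def vector2_eta) (simp add: z0_def vector3_eta x0_def)
  qed
  obtain I N where IN: "open_positive_interval I" "open N" "convex N" "N \<subseteq> N1" "open (interval_times I N)"
    "m ` interval_times I N \<subseteq> D" "open (m ` interval_times I N)" "smooth_on (interval_times I N) m"
    "smooth_on (m ` interval_times I N) m'" "yp \<in> m ` interval_times I N"
    "\<And>u. u \<in> interval_times I N \<Longrightarrow> u $ 1 > 0 \<and> vector [u $ 2, u $ 3] \<in> N1 \<and> m' (m u) = u"
  proof (rule product_neighbourhood[OF open_D yp N1(1) _ t0 sm m0 sm'])
    show "z0 \<in> N1" using Lz0 yp by (simp add: N1_def)
    show "m' (m u) = u" if "u $ 1 > 0" "vector [u $ 2, u $ 3] \<in> N1" "m u \<in> D" for u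
      using q3[of u] that by (simp add: m'_def) (simp add: m_def vector3_eta)
    show "m (m' y) = y" if "y \<in> D" "m' y $ 1 > 0" "vector [m' y $ 2, m' y $ 3] \<in> N1" for y
    proof -
      have "fl (vector [\<Lambda> y $ 1, \<Lambda> y $ 2]) + q y ^ 3 / 6 = \<Lambda> y $ 3"
        using key[OF that(1) _ refl] that(3) by (simp add: m'_def field_simps)
      then show ?thesis by (simp add: m_def m'_def vector3_eta)
    qed
  qed (rule that)
  have graph: "convex_graph N f fl"
  proof
    show "open N" "connected N" using IN convex_connected by auto
    show "fl y = f (y $ 1) (y $ 2)" for y by (simp add: f_def vector2_eta)
    show "smooth_on N fl" by (rule smooth_on_subset[OF N1(2) IN(4)])
    fix z assume "z \<in> N"
    then have z: "z \<in> N1" and y: "L z + b \<in> D" using IN(4) by (auto simp: N1_def)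
    have c: "x = 0" if c: "\<exists>c. P (emb x) = c *\<^sub>R \<theta> (L z + b)" for x
    proof -
      obtain c where "P (emb x) = c *\<^sub>R \<theta> (L z + b)" using c by blast
      also have "\<dots> = P ((- c * q (L z + b)) *\<^sub>R axis 3 1)" using e[OF y] by (simp add: linear_scale[OF P(1)] P(3) linear_neg[OF P(1)])
      finally have "emb x = (- c * q (L z + b)) *\<^sub>R axis 3 1" by (metis \<Lambda>P)
      then have "emb x $ 1 = 0" "emb x $ 2 = 0" by (simp_all add: axis_def)
      then show "x = 0" by (simp add: emb_def vec_eq_iff forall_2)
    qed
    show "hess fl z x x > 0" if "x \<noteq> 0" for x
      using tform_pos[OF y, of "L x"] c[of x] that q_pos[OF y] unfolding hfl[OF z] L_def by fastforce
    have e3: "P (axis 3 1) = (- inverse (q (L z + b))) *\<^sub>R \<theta> (L z + b)" using e[OF y] q_pos[OF y] P(3) by simp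
    have "(2 / q (L z + b))\<^sup>2 * (tform (L z + b) (P (axis 1 1)) (P (axis 1 1)) * tform (L z + b) (P (axis 2 1)) (P (axis 2 1))
       - (tform (L z + b) (P (axis 1 1)) (P (axis 2 1)))\<^sup>2) = 1"
    proof (rule det_tform_unit[OF y P(1,2) _ c det[OF y]])
      show "hess F (L z + b) (\<theta> (L z + b)) (P (axis 1 1)) = 0 \<and> hess F (L z + b) (\<theta> (L z + b)) (P (axis 2 1)) = 0 \<or>
        (\<exists>c. P (axis 3 1) = c *\<^sub>R \<theta> (L z + b))" using e3 by blast
      show "(2 / q (L z + b))\<^sup>2 = 4 * (hess F (L z + b) (\<theta> (L z + b)) (P (axis 3 1)))\<^sup>2"
        unfolding e3 hess_scale[OF y] hess_theta_theta[OF y] by (simp add: power2_eq_square divide_inverse)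
    qed
    then show "hess fl z (axis 1 1) (axis 1 1) * hess fl z (axis 2 1) (axis 2 1) - (hess fl z (axis 1 1) (axis 2 1))\<^sup>2 = 1"
      unfolding hfl[OF z] L_def emb_axis by (simp add: power2_eq_square algebra_simps)
  qed
  interpret convex_graph N f fl by (rule graph)
  show thesis
  proof (rule that[of I N f m m'])
    show "improper_affine_graph N f" by (rule improper_affine)
    show "(\<forall>y\<in>D. \<exists>e. e 0 = \<theta> y \<and> canonical_at F y e (\<alpha> y) 0) \<longrightarrow> on_elliptic_paraboloid N f"
    proof (intro impI paraboloid[OF IN(3)])
      fix u v
      assume "\<forall>y\<in>D. \<exists>e. e 0 = \<theta> y \<and> canonical_at F y e (\<alpha> y) 0"
      then have flat: "\<exists>e. e 0 = \<theta> y \<and> canonical_at F y e (\<alpha> y) 0" if "y \<in> D" for y using that by blast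
      obtain c where c: "\<And>y. y \<in> D \<Longrightarrow> inverse (q y) * tform y (L u) (L v) = c"
        by (rule tform_constant[OF flat]) (assumption, rule that)
      have "hess fl z u v = 2 * c" if "z \<in> N" for z
        using that IN(4) hfl[of z u v] c[of "L z + b"] by (auto simp: N1_def divide_inverse)
      then show "\<exists>c. \<forall>y\<in>N. hess fl y u v = c" by blast
    qed
    show "q (m u) = u $ 1 \<and> m u = P (vector [u $ 2, u $ 3, f (u $ 2) (u $ 3) + u $ 1 ^ 3 / 6])"
      if "u \<in> interval_times I N" for u
      using q3[of u] IN(11)[OF that] IN(6) that by (auto simp: m_def f_def)
    show "m' (m u) = u" if "u \<in> interval_times I N" for u using IN(11)[OF that] by simp
  qed (use IN in auto)
qed

end

section \<open>Local model in the case \<beta> = 2 \<alpha>\<close>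

context plus_type
begin

lemma has_derivative_G: "y \<in> D \<Longrightarrow> ((\<lambda>y. F y + k + (q y) ^ 4 / 48) has_derivative
    (\<lambda>u. \<partial> u F y - (q y)\<^sup>2 / 6 * hess F y (\<theta> y) u)) (at y)"
  using q_pos[of y]
  by (auto intro!: derivative_eq_intros dq smooth_on_has_derivative[OF smooth_F]
      simp: fun_eq_iff power2_eq_square power3_eq_cube field_simps)

text \<open>The segment from \<open>y\<close> to its dilated image stays in the convex domain. With
  \<rho> the dilation factor reached at time t, Euler's relation says that \<open>G\<close> divided
  by \<rho> has derivative zero along the segment.\<close>

lemma homogeneous_G:
  assumes y0: "\<And>y. y \<in> D \<Longrightarrow> y - ((q y)\<^sup>2 / 2) *\<^sub>R \<theta> y = y0"
    and k: "\<And>y. y \<in> D \<Longrightarrow> \<partial> (y - y0) F y - F y + (q y) ^ 4 / 16 = k"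
    and y: "y \<in> D" "y0 + r *\<^sub>R (y - y0) \<in> D" and r: "r > 0"
  shows "F (y0 + r *\<^sub>R (y - y0)) + k + (q (y0 + r *\<^sub>R (y - y0))) ^ 4 / 48 = r * (F y + k + (q y) ^ 4 / 48)"
proof -
  define G where "G y = F y + k + (q y) ^ 4 / 48" for y
  define v where "v = (r - 1) *\<^sub>R (y - y0)"
  have yv: "y + v = y0 + r *\<^sub>R (y - y0)" by (simp add: v_def algebra_simps)
  have "((\<lambda>t. G (y + t *\<^sub>R v) / (1 + t * (r - 1))) has_real_derivative 0) (at t)" if t: "0 \<le> t" "t \<le> 1" for t
  proof -
    define z where "z = y + t *\<^sub>R v"
    define \<rho> where "\<rho> = 1 + t * (r - 1)"
    have z: "z \<in> D" unfolding z_def using y(2) by (intro convex_line[OF convex_D y(1) _ t]) (simp add: yv)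
    have "\<rho> = (1 - t) * 1 + t * r" by (simp add: \<rho>_def algebra_simps)
    moreover have "(1 - t) * 1 + t * r > 0" using t r by (cases "t = 0") (auto intro: add_nonneg_pos)
    ultimately have \<rho>: "\<rho> > 0" by simp
    have z0: "z - y0 = \<rho> *\<^sub>R (y - y0)" by (simp add: z_def \<rho>_def v_def algebra_simps)
    let ?d = "\<lambda>u. \<partial> u F z - (q z)\<^sup>2 / 6 * hess F z (\<theta> z) u"
    have dG: "(G has_derivative ?d) (at z)" unfolding G_def[abs_def] by (rule has_derivative_G[OF z])
    have "hess F z (\<theta> z) (z - y0) = - (q z)\<^sup>2 / 2"
    proof -
      have "z - y0 = ((q z)\<^sup>2 / 2) *\<^sub>R \<theta> z" using y0[OF z] by (simp add: algebra_simps)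
      then show ?thesis by (simp add: hess_scale[OF z] hess_theta_theta[OF z])
    qed
    then have "?d (z - y0) = G z" using k[OF z] by (simp add: G_def power2_eq_square power4_eq_xxxx)
    then have 1: "\<rho> * ?d (y - y0) = G z"
      unfolding z0 linear_scale[OF has_derivative_linear[OF dG]] by simp
    have "?d v = (r - 1) * ?d (y - y0)"
      unfolding v_def linear_scale[OF has_derivative_linear[OF dG]] by simp
    then have e: "?d v * \<rho> = (r - 1) * G z" unfolding 1[symmetric] by simp
    have "((\<lambda>t. G (y + t *\<^sub>R v)) has_real_derivative ?d v) (at t)"
      by (rule has_real_derivative_along_line) (use dG z_def in simp)
    moreover have "((\<lambda>t. 1 + t * (r - 1)) has_real_derivative r - 1) (at t)" by (auto intro!: derivative_eq_intros)
    ultimately show ?thesis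
      by (rule DERIV_cong[OF DERIV_divide]) (use \<rho> e in \<open>simp_all add: \<rho>_def[symmetric] z_def[symmetric] mult.commute\<close>)
  qed
  then have "G (y + 1 *\<^sub>R v) / (1 + 1 * (r - 1)) = G (y + 0 *\<^sub>R v) / (1 + 0 * (r - 1))"
    by (rule constant_on_unit_interval[of "\<lambda>t. G (y + t *\<^sub>R v) / (1 + t * (r - 1))"])
  then have "G (y + v) = r * G y" using r by (simp add: field_simps)
  then show ?thesis unfolding yv G_def .
qed

text \<open>The lines of \<theta> are rays from \<open>y0\<close>, along which \<open>q\<close> and
  \<open>G\<close> have degree one. As \<open>P\<close> turns \<kappa> into the third coordinate,
  the points with \<open>q = t\<close> are \<open>y0 + P (t v, t w, t)\<close>, and \<open>G\<close>
  there is t times a function of (v, w), which is read off on the slice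
  \<open>q = t0\<close>.\<close>

lemma local_model:
  assumes y0: "\<And>y. y \<in> D \<Longrightarrow> y - ((q y)\<^sup>2 / 2) *\<^sub>R \<theta> y = y0"
    and k: "\<And>y. y \<in> D \<Longrightarrow> \<partial> (y - y0) F y - F y + (q y) ^ 4 / 16 = k"
    and \<kappa>: "\<And>y. y \<in> D \<Longrightarrow> q y = \<kappa> \<bullet> (y - y0)"
    and P: "linear P" "bij P" "\<And>x. \<kappa> \<bullet> P x = x $ 3"
    and det: "\<And>y. y \<in> D \<Longrightarrow> 4 * (det (matrix P))\<^sup>2 * \<bar>det (\<chi> i k. hess F y (axis i 1) (axis k 1))\<bar> = 1"
    and yp: "yp \<in> D"
  obtains I N f m m' where "open_positive_interval I" "improper_affine_graph N f"
    "(\<forall>y\<in>D. \<exists>e. e 0 = \<theta> y \<and> canonical_at F y e (\<alpha> y) 0) \<longrightarrow> on_elliptic_paraboloid N f"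
    "open (interval_times I N)" "m ` interval_times I N \<subseteq> D" "open (m ` interval_times I N)"
    "smooth_on (interval_times I N) m" "smooth_on (m ` interval_times I N) m'" "yp \<in> m ` interval_times I N"
    "\<And>u. u \<in> interval_times I N \<Longrightarrow> m' (m u) = u"
    "\<And>u. u \<in> interval_times I N \<Longrightarrow> m u = y0 + P (vector [u $ 1 * u $ 2, u $ 1 * u $ 3, u $ 1]) \<and>
      F (m u) + k = u $ 1 * f (u $ 2) (u $ 3) - u $ 1 ^ 4 / 48"
proof -
  define \<Lambda> where "\<Lambda> = inv P"
  have L\<Lambda>: "linear \<Lambda>" unfolding \<Lambda>_def by (metis P(1,2) bij_is_inj bij_is_surj inj_linear_imp_inv_linear)
  have \<Lambda>P [simp]: "\<Lambda> (P x) = x" and P\<Lambda> [simp]: "P (\<Lambda> y) = y" for x y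
    using P(2) by (auto simp: \<Lambda>_def bij_is_inj bij_is_surj surj_f_inv_f)
  have \<Lambda>3: "\<Lambda> (y - y0) $ 3 = q y" if "y \<in> D" for y
    using \<kappa>[OF that] P(3)[of "\<Lambda> (y - y0)"] by simp
  \<comment> \<open>Comparison of two formulas for the differential of \<open>q\<close>: the
    covector \<kappa> and \<open>dq\<close>. In particular \<theta> is orthogonal to the images of
    the first two axes.\<close>
  have h\<theta>: "hess F y (\<theta> y) (P x) = - (q y / 2) * x $ 3" if y: "y \<in> D" for y x
  proof -
    have "((\<lambda>y. \<kappa> \<bullet> (y - y0)) has_derivative (\<lambda>x. \<kappa> \<bullet> x)) (at y)" by (auto intro!: derivative_eq_intros)
    then have "(q has_derivative (\<lambda>x. \<kappa> \<bullet> x)) (at y)"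
      by (rule has_derivative_transform_within_open[OF _ open_D y]) (simp add: \<kappa>)
    from has_derivative_unique[OF this dq[OF y]] have "x $ 3 = - 2 / q y * hess F y (\<theta> y) (P x)"
      using P(3)[of x] by metis
    then show ?thesis using q_pos[OF y] by (simp add: field_simps)
  qed
  define t0 where "t0 = q yp"
  have t0: "t0 > 0" using q_pos[OF yp] by (simp add: t0_def)
  define x0 where "x0 = \<Lambda> (yp - y0)"
  have x03: "x0 $ 3 = t0" unfolding x0_def t0_def by (rule \<Lambda>3[OF yp])
  define z0 where "z0 = (vector [x0 $ 1 / t0, x0 $ 2 / t0] :: real ^ 2)"
  define b where "b = y0 + t0 *\<^sub>R P (axis 3 1)"
  define L where "L z = t0 *\<^sub>R P (emb z)" for z
  have linL: "linear L" unfolding L_def[abs_def] using linear_compose[OF linear_emb P(1)]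
    by (simp add: o_def linear_compose_scale_right)
  have Lb: "L z + b = y0 + t0 *\<^sub>R P (vector [z $ 1, z $ 2, 1])" for z
  proof -
    have "vector [z $ 1, z $ 2, 1] = emb z + axis 3 1"
      by (simp add: emb_def vec_eq_iff forall_3 axis_def)
    then show ?thesis by (simp add: L_def b_def linear_add[OF P(1)] scaleR_add_right)
  qed
  define N1 where "N1 = {z. L z + b \<in> D}"
  have qs: "q (L z + b) = t0" if "z \<in> N1" for z
    using \<kappa>[of "L z + b"] that unfolding N1_def Lb by (simp add: P(3))
  define G where "G y = F y + k + (q y) ^ 4 / 48" for y
  \<comment> \<open>Division by \<open>t0\<close> normalizes the value on the slice
    \<open>q = t0\<close>, so that degree one turns it into \<open>G = t * f\<close>.\<close>
  define Fs where "Fs y = inverse t0 * G y" for y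
  have sG: "smooth_on D G" unfolding G_def[abs_def]
    by (intro smooth_on_add smooth_on_divide smooth_on_power smooth_q smooth_F smooth_on_const open_D) auto
  have sFs: "smooth_on D Fs" unfolding Fs_def[abs_def]
    by (intro smooth_on_mult smooth_on_const open_D sG)
  have hFs: "hess Fs y u v = inverse t0 * tform y u v" if y: "y \<in> D" for y u v
  proof -
    have 1: "\<partial> v Fs z = inverse t0 * \<partial> v G z" if "z \<in> D" for z
      unfolding Fs_def[abs_def]
      by (rule dir_deriv_eq[where f'="\<lambda>v. inverse t0 * \<partial> v G z"])
        (intro has_derivative_mult_right smooth_on_has_derivative[OF sG that])
    have "((\<lambda>z. inverse t0 * \<partial> v G z) has_derivative (\<lambda>u. inverse t0 * \<partial> u (\<partial> v G) y)) (at y)"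
      by (intro has_derivative_mult_right smooth_on_has_derivative[OF smooth_on_dir_deriv[OF sG] y])
    then have "(\<partial> v Fs has_derivative (\<lambda>u. inverse t0 * \<partial> u (\<partial> v G) y)) (at y)"
      by (rule has_derivative_transform_within_open[OF _ open_D y]) (simp add: 1)
    then have "hess Fs y u v = inverse t0 * hess G y u v" unfolding hess_def by (rule dir_deriv_eq)
    then show ?thesis using hess_G[OF y, of k u v] by (simp add: G_def[abs_def])
  qed
  define fl where "fl z = Fs (L z + b)" for z
  define f where "f v w = fl (vector [v, w])" for v w
  have N1: "open N1" "smooth_on N1 fl"
    using smooth_comp_affine[OF open_D sFs linL, of b] by (auto simp: N1_def fl_def[abs_def])
  have hfl: "hess fl z u v = t0 * tform (L z + b) (P (emb u)) (P (emb v))" if "z \<in> N1" for z u v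
  proof -
    have y: "L z + b \<in> D" using that by (simp add: N1_def)
    have "hess fl z u v = inverse t0 * tform (L z + b) (L u) (L v)"
      using hess_comp_affine[OF open_D sFs linL y] hFs[OF y] by (simp add: fl_def[abs_def])
    also have "tform (L z + b) (L u) (L v) = t0 * (t0 * tform (L z + b) (P (emb u)) (P (emb v)))"
    proof -
      have 1: "L u = t0 *\<^sub>R P (emb u)" "L v = t0 *\<^sub>R P (emb v)" by (simp_all add: L_def)
      show ?thesis unfolding tform_def 1 hess_scale[OF y] by (simp add: algebra_simps)
    qed
    finally show ?thesis using t0 by simp
  qed
  have Lz0: "L z0 + b = yp"
  proof -
    have "t0 *\<^sub>R vector [z0 $ 1, z0 $ 2, 1] = x0" using t0 x03 by (simp add: z0_def vec_eq_iff forall_3)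
    then have "t0 *\<^sub>R P (vector [z0 $ 1, z0 $ 2, 1]) = P x0" by (simp flip: linear_scale[OF P(1)])
    then show ?thesis unfolding Lb by (simp add: x0_def)
  qed
  define m where "m u = y0 + P (vector [u $ 1 * u $ 2, u $ 1 * u $ 3, u $ 1])" for u :: "real ^ 3"
  define m' where "m' y = (vector [q y, \<Lambda> (y - y0) $ 1 / q y, \<Lambda> (y - y0) $ 2 / q y] :: real ^ 3)" for y
  have qm: "q (m u) = u $ 1" if "m u \<in> D" for u using \<kappa>[OF that] by (simp add: m_def P(3))
  have key: "G (m u) = u $ 1 * fl (vector [u $ 2, u $ 3])"
    if "u $ 1 > 0" "m u \<in> D" "vector [u $ 2, u $ 3] \<in> N1" for u
  proof -
    let ?s = "L (vector [u $ 2, u $ 3]) + b"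
    have s: "?s \<in> D" using that(3) by (simp add: N1_def)
    have "(vector [u $ 1 * u $ 2, u $ 1 * u $ 3, u $ 1] :: real ^ 3) = u $ 1 *\<^sub>R vector [u $ 2, u $ 3, 1]"
      by (simp add: vec_eq_iff forall_3)
    then have mu: "m u = y0 + (u $ 1 / t0) *\<^sub>R (?s - y0)"
      unfolding m_def Lb using t0 by (simp add: linear_scale[OF P(1)])
    have "G (y0 + (u $ 1 / t0) *\<^sub>R (?s - y0)) = u $ 1 / t0 * G ?s"
      unfolding G_def using that t0 s mu by (intro homogeneous_G[OF y0 k]) auto
    then show ?thesis unfolding mu[symmetric] by (simp add: fl_def Fs_def divide_inverse mult.assoc)
  qed
  let ?\<Omega> = "{u::real ^ 3. u $ 1 > 0 \<and> vector [u $ 2, u $ 3] \<in> N1}"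
  have o\<Omega>: "open ?\<Omega>"
  proof -
    have "continuous_on UNIV (\<lambda>u::real ^ 3. vector [u $ 2, u $ 3] :: real ^ 2)"
      by (intro smooth_on_continuous smooth_on_vector2 smooth_on_vec_nth smooth_on_id open_UNIV)
    from open_vimage[OF N1(1) this] have "open {u::real ^ 3. vector [u $ 2, u $ 3] \<in> N1}" by (simp add: vimage_def)
    moreover have "open {u::real ^ 3. u $ 1 > 0}" by (simp add: open_halfspace_component_gt_cart)
    ultimately have "open ({u::real ^ 3. u $ 1 > 0} \<inter> {u. vector [u $ 2, u $ 3] \<in> N1})" by (intro open_Int)
    then show ?thesis by (simp only: Collect_conj_eq)
  qed
  have sm: "smooth_on ?\<Omega> m" unfolding m_def[abs_def]
    by (intro smooth_on_add smooth_on_const smooth_on_linear[OF o\<Omega> P(1)] smooth_on_vector3 o\<Omega> smooth_on_vec_nth smooth_on_id smooth_on_mult)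
  have sm': "smooth_on D m'" unfolding m'_def[abs_def]
    by (intro smooth_on_vector3 open_D smooth_q smooth_on_divide smooth_on_vec_nth smooth_on_linear[OF open_D L\<Lambda>]
        smooth_on_diff smooth_on_const smooth_on_id) (auto dest: q_pos)
  have m0: "m (vector [t0, z0 $ 1, z0 $ 2]) = yp"
  proof -
    have "vector [t0 * z0 $ 1, t0 * z0 $ 2, t0] = x0" using t0 x03 by (simp add: z0_def vec_eq_iff forall_3)
    then show ?thesis by (simp add: m_def x0_def)
  qed
  obtain I N where IN: "open_positive_interval I" "open N" "convex N" "N \<subseteq> N1" "open (interval_times I N)"
    "m ` interval_times I N \<subseteq> D" "open (m ` interval_times I N)" "smooth_on (interval_times I N) m"
    "smooth_on (m ` interval_times I N) m'" "yp \<in> m ` interval_times I N"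
    "\<And>u. u \<in> interval_times I N \<Longrightarrow> u $ 1 > 0 \<and> vector [u $ 2, u $ 3] \<in> N1 \<and> m' (m u) = u"
  proof (rule product_neighbourhood[OF open_D yp N1(1) _ t0 sm m0 sm'])
    show "z0 \<in> N1" using Lz0 yp by (simp add: N1_def)
    show "m' (m u) = u" if u: "u $ 1 > 0" "vector [u $ 2, u $ 3] \<in> N1" "m u \<in> D" for u
    proof -
      have "\<Lambda> (m u - y0) = vector [u $ 1 * u $ 2, u $ 1 * u $ 3, u $ 1]" by (simp add: m_def)
      then show ?thesis using u(1) by (simp add: m'_def qm[OF u(3)] vector3_eta)
    qed
    show "m (m' y) = y" if y: "y \<in> D" "m' y $ 1 > 0" "vector [m' y $ 2, m' y $ 3] \<in> N1" for y
    proof -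
      have "vector [m' y $ 1 * m' y $ 2, m' y $ 1 * m' y $ 3, m' y $ 1] = \<Lambda> (y - y0)"
        using q_pos[OF y(1)] by (simp add: m'_def vec_eq_iff forall_3 \<Lambda>3[OF y(1)])
      then show ?thesis unfolding m_def by simp
    qed
  qed (rule that)
  have graph: "convex_graph N f fl"
  proof
    show "open N" "connected N" using IN convex_connected by auto
    show "fl y = f (y $ 1) (y $ 2)" for y by (simp add: f_def vector2_eta)
    show "smooth_on N fl" by (rule smooth_on_subset[OF N1(2) IN(4)])
    fix z assume "z \<in> N"
    then have z: "z \<in> N1" and y: "L z + b \<in> D" using IN(4) by (auto simp: N1_def)
    have c: "x = 0" if c: "\<exists>c. P (emb x) = c *\<^sub>R \<theta> (L z + b)" for x
    proof -
      obtain c where c: "P (emb x) = c *\<^sub>R \<theta> (L z + b)" using c by blast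
      have "hess F (L z + b) (\<theta> (L z + b)) (P (emb x)) = 0" unfolding h\<theta>[OF y] by (simp add: emb_def)
      then have "c = 0" unfolding c hess_scale[OF y] hess_theta_theta[OF y] by simp
      then have "emb x = 0" using c \<Lambda>P[of "emb x"] linear_0[OF L\<Lambda>] by simp
      then have "emb x $ 1 = 0" "emb x $ 2 = 0" by simp_all
      then show "x = 0" by (simp add: emb_def vec_eq_iff forall_2)
    qed
    show "hess fl z x x > 0" if "x \<noteq> 0" for x
      using tform_pos[OF y, of "P (emb x)"] c[of x] that t0 unfolding hfl[OF z] by fastforce
    have "t0\<^sup>2 * (tform (L z + b) (P (axis 1 1)) (P (axis 1 1)) * tform (L z + b) (P (axis 2 1)) (P (axis 2 1))
       - (tform (L z + b) (P (axis 1 1)) (P (axis 2 1)))\<^sup>2) = 1"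
    proof (rule det_tform_unit[OF y P(1,2) _ c det[OF y]])
      show "hess F (L z + b) (\<theta> (L z + b)) (P (axis 1 1)) = 0 \<and> hess F (L z + b) (\<theta> (L z + b)) (P (axis 2 1)) = 0 \<or>
        (\<exists>c. P (axis 3 1) = c *\<^sub>R \<theta> (L z + b))" by (simp add: h\<theta>[OF y] axis_def)
      show "t0\<^sup>2 = 4 * (hess F (L z + b) (\<theta> (L z + b)) (P (axis 3 1)))\<^sup>2"
        unfolding h\<theta>[OF y] qs[OF z] by (simp add: power2_eq_square)
    qed
    then show "hess fl z (axis 1 1) (axis 1 1) * hess fl z (axis 2 1) (axis 2 1) - (hess fl z (axis 1 1) (axis 2 1))\<^sup>2 = 1"
      unfolding hfl[OF z] emb_axis by (simp add: power2_eq_square algebra_simps)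
  qed
  interpret convex_graph N f fl by (rule graph)
  show thesis
  proof (rule that[of I N f m m'])
    show "improper_affine_graph N f" by (rule improper_affine)
    show "(\<forall>y\<in>D. \<exists>e. e 0 = \<theta> y \<and> canonical_at F y e (\<alpha> y) 0) \<longrightarrow> on_elliptic_paraboloid N f"
    proof (intro impI paraboloid[OF IN(3)])
      fix u v
      assume "\<forall>y\<in>D. \<exists>e. e 0 = \<theta> y \<and> canonical_at F y e (\<alpha> y) 0"
      then have flat: "\<exists>e. e 0 = \<theta> y \<and> canonical_at F y e (\<alpha> y) 0" if "y \<in> D" for y using that by blast
      have h0: "hess F y (\<theta> y) (P (emb u)) = 0" if "y \<in> D" for y u
        unfolding h\<theta>[OF that] by (simp add: emb_def)
      obtain c where c: "\<And>y. y \<in> D \<Longrightarrow> q y * tform y (P (emb u)) (P (emb v)) = c"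
        by (rule tform_constant[OF flat]) (assumption, erule h0, erule h0, rule that)
      have "hess fl z u v = c" if "z \<in> N" for z
        using that IN(4) hfl[of z u v] c[of "L z + b"] qs[of z] by (auto simp: N1_def)
      then show "\<exists>c. \<forall>y\<in>N. hess fl y u v = c" by blast
    qed
    show "m u = y0 + P (vector [u $ 1 * u $ 2, u $ 1 * u $ 3, u $ 1]) \<and>
      F (m u) + k = u $ 1 * f (u $ 2) (u $ 3) - u $ 1 ^ 4 / 48"
      if "u \<in> interval_times I N" for u
    proof -
      have u: "u $ 1 > 0" "vector [u $ 2, u $ 3] \<in> N1" "m u \<in> D" using IN(11)[OF that] IN(6) that by auto
      show ?thesis using key[OF u(1,3,2)] qm[OF u(3)] by (simp add: G_def f_def m_def)
    qed
    show "m' (m u) = u" if "u \<in> interval_times I N" for u using IN(11)[OF that] by simp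
  qed (use IN in auto)
qed

end

subsection \<open>Globalization\<close>

lemma affine_transformationI:
  fixes B :: "'a::euclidean_space \<Rightarrow> 'a"
  assumes "linear B" "inj B"
  shows "affine_transformation (\<lambda>x. B x + b)"
  using assms linear_injective_imp_surjective unfolding affine_transformation_def bij_def by blast

lemma linear_eq_on_open:
  fixes l l' :: "'a::euclidean_space"
  assumes "open S" "y \<in> S" "\<And>z. z \<in> S \<Longrightarrow> l \<bullet> z + c = l' \<bullet> z + c'"
  shows "l = l'" "c = c'"
proof -
  have "((\<lambda>z. (l - l') \<bullet> z + (c - c')) has_derivative (\<lambda>u. (l - l') \<bullet> u)) (at y)"
    by (auto intro!: derivative_eq_intros)
  moreover have "((\<lambda>z. (l - l') \<bullet> z + (c - c')) has_derivative (\<lambda>u. 0)) (at y)"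
    by (rule has_derivative_transform_within_open[OF has_derivative_const assms(1,2)])
      (use assms(3) in \<open>auto simp: inner_diff_left algebra_simps\<close>)
  ultimately have "(\<lambda>u. (l - l') \<bullet> u) = (\<lambda>u. 0)" by (rule has_derivative_unique)
  then have "(l - l') \<bullet> (l - l') = 0" by metis
  then show "l = l'" by simp
  then show "c = c'" using assms(2,3) by simp
qed

text \<open>A diagonal map with entries a/b, 1, b followed by a rotation that takes the third axis
  to \<open>w\<close>; the entry a/b adjusts the determinant. One case needs the image of the third
  axis, the other the covector that is pulled back to the third coordinate.\<close>

lemma linear_map_with_third_column:
  fixes w :: "real ^ 3"
  assumes w: "norm w = 1" and a: "a > 0" and b: "b > 0"
  obtains P :: "real ^ 3 \<Rightarrow> real ^ 3" where "linear P" "bij P" "P (axis 3 1) = b *\<^sub>R w"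
    "\<And>x. w \<bullet> P x = b * x $ 3" "\<bar>det (matrix P)\<bar> = a"
proof -
  obtain Q :: "real ^ 3 \<Rightarrow> real ^ 3" where Q: "orthogonal_transformation Q" "Q (axis 3 1) = w"
    by (rule orthogonal_transformation_exists[of "axis 3 1" w]) (use w in auto)
  define E where "E x = (vector [(a / b) * x $ 1, x $ 2, b * x $ 3] :: real ^ 3)" for x :: "real ^ 3"
  have lE: "linear E" by (auto simp: linear_iff E_def vec_eq_iff forall_3 algebra_simps)
  have lQ: "linear Q" using Q(1) by (simp add: orthogonal_transformation_linear)
  have lP: "linear (Q \<circ> E)" by (rule linear_compose[OF lE lQ])
  have "det (matrix E) = a" using b by (simp add: det_3 matrix_def E_def axis_def)
  then have d: "\<bar>det (matrix (Q \<circ> E))\<bar> = a"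
    using a orthogonal_transformation_det[OF Q(1)] by (simp add: matrix_compose[OF lE lQ] det_mul abs_mult)
  have "inj E" using a b by (auto simp: inj_def E_def vec_eq_iff forall_3)
  then have "inj (Q \<circ> E)" using orthogonal_transformation_inj[OF Q(1)] by (simp add: inj_compose)
  then have bij: "bij (Q \<circ> E)" using linear_injective_imp_surjective[OF lP] by (simp add: bij_def)
  show thesis
  proof (rule that[OF lP bij _ _ d])
    have "E (axis 3 1) = b *\<^sub>R axis 3 1" by (simp add: E_def vec_eq_iff forall_3 axis_def)
    then show "(Q \<circ> E) (axis 3 1) = b *\<^sub>R w" by (simp add: linear_scale[OF lQ] Q(2))
    have "w \<bullet> Q z = z $ 3" for z
    proof -
      have "Q (axis 3 1) \<bullet> Q z = axis 3 1 \<bullet> z"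
        using Q(1) by (simp add: orthogonal_transformation_def)
      then show ?thesis by (simp add: Q(2) inner_axis')
    qed
    then show "w \<bullet> (Q \<circ> E) x = b * x $ 3" for x by (simp add: E_def)
  qed
qed

context graph_sphere
begin

text \<open>The image under the immersion determines both the parameter and the height, so on the
  overlap the transition map is the identity and the graph functions are equal.\<close>

lemma charts_agree:
  assumes ad: "adapted D G F" "adapted D' G' F'" and y: "y \<in> D" and G: "G y \<in> G' ` D'"
  obtains U where "open U" "y \<in> U" "U \<subseteq> D" "U \<subseteq> D'" "\<And>z. z \<in> U \<Longrightarrow> G z = G' z" "\<And>z. z \<in> U \<Longrightarrow> F z = F' z"
proof -
  interpret c: adapted_chart M A \<phi> \<xi> nab h S B D G F using ad(1) by unfold_locales
  interpret c': adapted_chart M A \<phi> \<xi> nab h S B D' G' F' using ad(2) by unfold_locales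
  define U where "U = D \<inter> G -` (G' ` D')"
  have "open U" unfolding U_def
    using c.G diffeo_open(2)[OF c'.G] by (intro local_parametrization_open_vimage) (auto simp: diffeo_onto_open_def)
  have eq: "z \<in> D' \<and> G z = G' z \<and> F z = F' z" if z: "z \<in> U" for z
  proof -
    obtain z' where z': "z' \<in> D'" "G z = G' z'" "z \<in> D" using z unfolding U_def by blast
    then have "Binv (vec4 z (F z)) = Binv (vec4 z' (F' z'))" using c.phi_G c'.phi_G by metis
    then have "vec4 z (F z) = vec4 z' (F' z')" by (metis B_Binv)
    then have "z = z'" "F z = F' z'" by (metis proj3_vec4, metis vec4_nth_4)
    then show ?thesis using z' by simp
  qed
  have "y \<in> U" "U \<subseteq> D" unfolding U_def using y G by (blast, blast)
  moreover have "U \<subseteq> D'" "\<And>z. z \<in> U \<Longrightarrow> G z = G' z" "\<And>z. z \<in> U \<Longrightarrow> F z = F' z" using eq by blast+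
  ultimately show thesis using that[OF \<open>open U\<close>] by blast
qed

text \<open>Constants found in the charts agree on overlaps, hence, \<open>M\<close> being connected, everywhere.\<close>

lemma globalize:
  fixes P :: "(real ^ 3) set \<Rightarrow> (real ^ 3 \<Rightarrow> 'a) \<Rightarrow> (real ^ 3 \<Rightarrow> real) \<Rightarrow> 'c \<Rightarrow> bool"
  assumes ex: "\<And>D G F. adapted D G F \<Longrightarrow> convex D \<Longrightarrow> \<exists>c. P D G F c"
    and uniq: "\<And>D G F D' G' F' U y c c'. adapted D G F \<Longrightarrow> adapted D' G' F' \<Longrightarrow> P D G F c \<Longrightarrow> P D' G' F' c' \<Longrightarrow>
      open U \<Longrightarrow> y \<in> U \<Longrightarrow> U \<subseteq> D \<Longrightarrow> U \<subseteq> D' \<Longrightarrow> (\<And>z. z \<in> U \<Longrightarrow> G z = G' z) \<Longrightarrow> (\<And>z. z \<in> U \<Longrightarrow> F z = F' z) \<Longrightarrow> c = c'"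
  obtains c where "\<And>D G F. adapted D G F \<Longrightarrow> convex D \<Longrightarrow> D \<noteq> {} \<Longrightarrow> P D G F c"
proof -
  define Q where "Q p c \<longleftrightarrow> (\<exists>D G F. adapted D G F \<and> p \<in> G ` D \<and> P D G F c)" for p c
  \<comment> \<open>A constant is chosen at each point; \<open>uniq\<close> shows that any chart
    through the point would give the same one, which makes \<open>g\<close> locally
    constant.\<close>
  define g where "g p = (SOME c. Q p c)" for p
  have g: "g (G y) = c" if c: "adapted D G F" "P D G F c" "y \<in> D" for D G F c y
  proof -
    have "Q (G y) c" using c by (auto simp: Q_def)
    then have "Q (G y) (g (G y))" unfolding g_def by (rule someI)
    then obtain D' G' F' where 1: "adapted D' G' F'" "G y \<in> G' ` D'" "P D' G' F' (g (G y))" by (auto simp: Q_def)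
    obtain U where U: "open U" "y \<in> U" "U \<subseteq> D" "U \<subseteq> D'" "\<And>z. z \<in> U \<Longrightarrow> G z = G' z" "\<And>z. z \<in> U \<Longrightarrow> F z = F' z"
      by (rule charts_agree[OF c(1) 1(1) c(3) 1(2)]) (rule that)
    show ?thesis using uniq[OF c(1) 1(1) c(2) 1(3) U] by simp
  qed
  have const: "g p = g q" if "p \<in> topspace M" "q \<in> topspace M" for p q
  proof (rule locally_constant[OF _ that])
    fix p assume "p \<in> topspace M"
    then obtain D G F where c: "adapted D G F" "convex D" "p \<in> G ` D" by (rule adapted_exists)
    obtain k where k: "P D G F k" using ex[OF c(1,2)] by blast
    have "openin M (G ` D)" using c(1) diffeo_open(2) by (auto simp: adapted_def)
    then show "\<exists>Q. openin M Q \<and> p \<in> Q \<and> (\<forall>q\<in>Q. g q = g p)"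
      using c(3) g[OF c(1) k] by auto
  qed
  show thesis
  proof (rule that[of "g (SOME p. p \<in> topspace M)"])
    fix D G F assume c: "adapted D G F" "convex D" "D \<noteq> {}"
    obtain k where k: "P D G F k" using ex[OF c(1,2)] by blast
    obtain y where y: "y \<in> D" using c(3) by blast
    have t: "G y \<in> topspace M" using y diffeo_image_subset[of D G] c(1) by (auto simp: adapted_def)
    have "g (SOME p. p \<in> topspace M) = g (G y)" by (rule const[OF someI[of "\<lambda>p. p \<in> topspace M", OF t] t])
    then show "P D G F (g (SOME p. p \<in> topspace M))" using g[OF c(1) k y] k by simp
  qed
qed

end

section \<open>The dichotomy and the assembly of the affine equivalence\<close>

context symmetric_sphere
begin

lemma symmetric_chartI: "adapted D G F \<Longrightarrow> symmetric_chart M A \<phi> \<xi> nab h S B lc K T a4 D G F"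
  by unfold_locales

lemma a4_pos: "p \<in> topspace M \<Longrightarrow> a4 p > 0"
  using symmetry by (auto simp: pointwise_Z3_symmetry_def pointwise_SO2_symmetry_def)

definition qq :: "'a \<Rightarrow> real" where "qq p = inverse (sqrt (a4 p))"

text \<open>The hypothesis fixes the sign only at each point. In a chart a continuous ratio with
  values 1 and -1 on a convex set is constant; \<open>globalize\<close>, with the sign as the
  constant, extends this to \<open>M\<close>.\<close>

lemma dichotomy:
  assumes sq: "\<forall>p\<in>topspace M. (a22 A \<phi> h lc T p)\<^sup>2 = (a4 p)\<^sup>2"
  shows "(\<forall>p\<in>topspace M. a22 A \<phi> h lc T p = a4 p) \<or> (\<forall>p\<in>topspace M. - a22 A \<phi> h lc T p = a4 p)"
proof -
  define s where "s b = (if b then 1 else - 1 :: real)" for b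
  define P where "P D G F b \<longleftrightarrow> (\<forall>y\<in>D. a22 A \<phi> h lc T (G y) = s b * a4 (G y))"
    for D :: "(real ^ 3) set" and G :: "real ^ 3 \<Rightarrow> 'a" and F :: "real ^ 3 \<Rightarrow> real" and b
  obtain b where b: "\<And>D G F. adapted D G F \<Longrightarrow> convex D \<Longrightarrow> D \<noteq> {} \<Longrightarrow> P D G F b"
  proof (rule globalize[of P])
    fix D G F assume c: "adapted D G F" "convex D"
    interpret symmetric_chart M A \<phi> \<xi> nab h S B lc K T a4 D G F by (rule symmetric_chartI[OF c(1)])
    \<comment> \<open>The ratio of \<open>a22\<close> to \<open>a4\<close> in chart coordinates; it
      is continuous because \<beta> is.\<close>
    define r where "r y = (\<beta> y - \<alpha> y) / \<alpha> y" for y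
    have r: "r y = 1 \<or> r y = - 1" if y: "y \<in> D" for y
    proof -
      have "(\<beta> y - \<alpha> y)\<^sup>2 = (\<alpha> y)\<^sup>2" using sq[rule_format, OF G_top[OF y]] unfolding a22_eq[OF y] by (simp add: \<alpha>_def)
      then have "\<beta> y - \<alpha> y = \<alpha> y \<or> \<beta> y - \<alpha> y = - \<alpha> y" by (simp add: power2_eq_iff)
      then show ?thesis using \<alpha>_pos[OF y] by (auto simp: r_def)
    qed
    have "continuous_on D r" unfolding r_def[abs_def]
      using \<alpha>_pos by (intro continuous_intros continuous_beta smooth_on_continuous[OF smooth_alpha]) force
    then have conn: "connected (r ` D)" using c(2) by (intro connected_continuous_image convex_connected)
    have "\<not> (1 \<in> r ` D \<and> - 1 \<in> r ` D)"
    proof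
      assume "1 \<in> r ` D \<and> - 1 \<in> r ` D"
      then have "0 \<in> r ` D" using connected_contains_Icc[OF conn, of "-1" 1] by (auto simp: subset_iff)
      then show False using r by force
    qed
    then have "(\<forall>y\<in>D. r y = s True) \<or> (\<forall>y\<in>D. r y = s False)" using r by (force simp: s_def)
    then obtain b where "\<forall>y\<in>D. r y = s b" by blast
    then have "P D G F b" unfolding P_def
      using a22_eq \<alpha>_pos by (auto simp: r_def \<alpha>_def[symmetric] divide_eq_eq less_imp_neq[symmetric])
    then show "\<exists>b. P D G F b" by blast
  next
    fix D G F D' G' F' U y b b'
    assume c: "adapted D G F" "adapted D' G' F'" "P D G F b" "P D' G' F' b'" "open U" "y \<in> U" "U \<subseteq> D" "U \<subseteq> D'"
      "\<And>z. z \<in> U \<Longrightarrow> G z = G' z" "\<And>z. z \<in> U \<Longrightarrow> F z = F' z"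
    have "G y \<in> topspace M" using c(1,6,7) diffeo_image_subset[of D G] by (auto simp: adapted_def)
    then have "a4 (G y) > 0" by (rule a4_pos)
    moreover have "a22 A \<phi> h lc T (G y) = s b * a4 (G y)" "a22 A \<phi> h lc T (G y) = s b' * a4 (G y)"
      using c(3,4,6-8) unfolding P_def c(9)[OF c(6)] by (metis c(6,9) subsetD)+
    ultimately show "b = b'" by (auto simp: s_def split: if_splits)
  qed (rule that)
  have "a22 A \<phi> h lc T p = s b * a4 p" if "p \<in> topspace M" for p
    using that b by (elim adapted_exists) (auto simp: P_def)
  then show ?thesis by (cases b) (auto simp: s_def)
qed

end

lemma vector_4:
  "(vector [a, b, c, d] :: real ^ 4) $ 1 = a" "(vector [a, b, c, d] :: real ^ 4) $ 2 = b"
  "(vector [a, b, c, d] :: real ^ 4) $ 3 = c" "(vector [a, b, c, d] :: real ^ 4) $ 4 = d"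
  unfolding vector_def by simp_all

lemma vec4_vector: "vec4 y t = vector [y $ 1, y $ 2, y $ 3, t]"
  by (simp add: vec_eq_iff forall_4 vector_4 vec4_def)

lemma normalizing_scale: "4 * (1 / (2 * sqrt \<delta>))\<^sup>2 * \<delta> = 1" if "\<delta> > 0" for \<delta> :: real
  using that by (simp add: power_divide power_mult_distrib)

context symmetric_chart
begin

lemma q_qq: "q y = qq (G y)" by (simp add: q_def qq_def \<alpha>_def)

lemma minus_typeI:
  assumes "convex D" "\<forall>p\<in>topspace M. - a22 A \<phi> h lc T p = a4 p"
  shows "minus_type F D \<theta> \<alpha>"
proof (unfold_locales, rule assms(1))
  show "\<beta> y = 0" if "y \<in> D" for y
    using bspec[OF assms(2) G_top[OF that]] a22_eq[OF that] by (simp add: \<alpha>_def)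
qed

lemma plus_typeI:
  assumes "convex D" "\<forall>p\<in>topspace M. a22 A \<phi> h lc T p = a4 p"
  shows "plus_type F D \<theta> \<alpha>"
proof (unfold_locales, rule assms(1))
  show "\<beta> y = 2 * \<alpha> y" if "y \<in> D" for y
    using bspec[OF assms(2) G_top[OF that]] a22_eq[OF that] by (simp add: \<alpha>_def)
qed

end

context symmetric_sphere
begin

lemma B_eqI: "\<pi> x = \<pi> y \<Longrightarrow> B x $ 4 = B y $ 4 \<Longrightarrow> x = y"
  unfolding \<pi>_def by (metis Binv_B vec4_proj3)

lemma minus_equivalent:
  assumes ne: "topspace M \<noteq> {}" and minus: "\<forall>p\<in>topspace M. - a22 A \<phi> h lc T p = a4 p"
  shows "affine_equivalent_to_model model_minus
    (\<lambda>N f. pointwise_SO2_symmetry M A \<phi> h K T a4 \<longrightarrow> on_elliptic_paraboloid N f) M A \<phi>"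
proof -
  \<comment> \<open>The constants to be globalized are the direction e with
    \<open>\<theta> = q e\<close> and the affine function l . y + c that equals
    \<open>F + q ^ 4 / 16\<close>.\<close>
  define R where "R D G F c \<longleftrightarrow> (\<forall>y\<in>D. \<pi> (T (G y)) = qq (G y) *\<^sub>R fst c \<and>
      F y + qq (G y) ^ 4 / 16 = fst (snd c) \<bullet> y + snd (snd c))"
    for D :: "(real ^ 3) set" and G :: "real ^ 3 \<Rightarrow> 'a" and F :: "real ^ 3 \<Rightarrow> real"
      and c :: "(real ^ 3) \<times> (real ^ 3) \<times> real"
  obtain elc where elc: "\<And>D G F. adapted D G F \<Longrightarrow> convex D \<Longrightarrow> D \<noteq> {} \<Longrightarrow> R D G F elc"
  proof (rule globalize[of R])
    fix D G F assume c: "adapted D G F" "convex D"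
    interpret symmetric_chart M A \<phi> \<xi> nab h S B lc K T a4 D G F by (rule symmetric_chartI[OF c(1)])
    interpret mt: minus_type F D \<theta> \<alpha> by (rule minus_typeI[OF c(2) minus])
    obtain e where e: "\<And>y. y \<in> D \<Longrightarrow> \<theta> y = q y *\<^sub>R e" by (rule mt.theta_direction) (rule that)
    obtain l k where lk: "\<And>y. y \<in> D \<Longrightarrow> F y + (q y) ^ 4 / 16 = l \<bullet> y + k" by (rule mt.graph_function) (rule that)
    have "R D G F (e, l, k)" unfolding R_def using e lk by (simp add: q_qq \<theta>_def)
    then show "\<exists>c. R D G F c" by blast
  next
    fix D G F D' G' F' U y c c'
    assume c: "adapted D G F" "adapted D' G' F'" "R D G F c" "R D' G' F' c'" "open U" "y \<in> U" "U \<subseteq> D" "U \<subseteq> D'"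
      "\<And>z. z \<in> U \<Longrightarrow> G z = G' z" "\<And>z. z \<in> U \<Longrightarrow> F z = F' z"
    interpret symmetric_chart M A \<phi> \<xi> nab h S B lc K T a4 D G F by (rule symmetric_chartI[OF c(1)])
    have "qq (G y) *\<^sub>R fst c = qq (G y) *\<^sub>R fst c'"
      using c(3,4,6,7,8) c(9)[OF c(6)] unfolding R_def by (metis subsetD)
    then have 1: "fst c = fst c'" using q_pos[of y] c(6,7) by (auto simp: q_qq)
    have "fst (snd c) \<bullet> z + snd (snd c) = fst (snd c') \<bullet> z + snd (snd c')" if "z \<in> U" for z
      using c(3,4,7,8) c(9,10)[OF that] that unfolding R_def by (metis subsetD)
    from linear_eq_on_open[OF c(5,6) this] 1 show "c = c'" by (simp add: prod_eq_iff)
  qed (rule that)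
  define e l c where "e = fst elc" "l = fst (snd elc)" "c = snd (snd elc)"
  obtain p0 where p0: "p0 \<in> topspace M" using ne by blast
  have e: "e \<noteq> 0"
  proof -
    obtain D G F where ch: "adapted D G F" "convex D" "p0 \<in> G ` D" by (rule adapted_exists[OF p0])
    interpret symmetric_chart M A \<phi> \<xi> nab h S B lc K T a4 D G F by (rule symmetric_chartI[OF ch(1)])
    obtain y where y: "y \<in> D" using ch(3) by blast
    have "\<theta> y \<noteq> 0" using hess_theta_theta[OF y] linear_0[OF hess_linear(2)[OF y]] by force
    moreover have "\<theta> y = qq (G y) *\<^sub>R e" using elc[OF ch(1,2)] y by (auto simp: R_def \<theta>_def e_l_c_def)
    ultimately show ?thesis by auto
  qed
  obtain \<delta> where \<delta>: "\<delta> > 0" "\<And>D G F y. adapted D G F \<Longrightarrow> y \<in> D \<Longrightarrow> \<bar>det (\<chi> i k. hess F y (axis i 1) (axis k 1))\<bar> = \<delta>"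
    by (rule det_hess_constant) (rule that)
  \<comment> \<open>The unit vector and its length are arranged so that the third axis goes to
    \<open>- e\<close>; the determinant satisfies \<open>normalizing_scale\<close>.\<close>
  obtain P :: "real ^ 3 \<Rightarrow> real ^ 3" where P: "linear P" "bij P" "P (axis 3 1) = norm e *\<^sub>R (- inverse (norm e) *\<^sub>R e)"
    and dP: "\<bar>det (matrix P)\<bar> = 1 / (2 * sqrt \<delta>)"
  proof (rule linear_map_with_third_column[of "- inverse (norm e) *\<^sub>R e" "1 / (2 * sqrt \<delta>)" "norm e"])
    show "norm (- inverse (norm e) *\<^sub>R e) = 1" "norm e > 0" "1 / (2 * sqrt \<delta>) > 0" using e \<delta>(1) by simp_all
  qed (rule that)
  have P3: "P (axis 3 1) = - e" using P(3) e by simp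
  have d2: "4 * (det (matrix P))\<^sup>2 * \<delta> = 1"
    using normalizing_scale[OF \<delta>(1)] unfolding dP[symmetric] by simp
  define \<Lambda> where "\<Lambda> = inv P"
  have L\<Lambda>: "linear \<Lambda>" unfolding \<Lambda>_def by (metis P(1,2) bij_is_inj bij_is_surj inj_linear_imp_inv_linear)
  have \<Lambda>P [simp]: "\<Lambda> (P x) = x" and P\<Lambda> [simp]: "P (\<Lambda> y) = y" for x y
    using P(2) by (auto simp: \<Lambda>_def bij_is_inj bij_is_surj surj_f_inv_f)
  \<comment> \<open>By the globalized relation the last entry, 16 (l . y + c - F), equals
    \<open>q ^ 4\<close>, which is the fourth coordinate t^4 of the model.\<close>
  define L where "L z = vec4 (\<Lambda> (\<pi> z)) (16 * (l \<bullet> \<pi> z - B z $ 4)) + vec4 0 (16 * c)" for z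
  have "affine_transformation L" unfolding L_def[abs_def]
  proof (rule affine_transformationI)
    show "linear (\<lambda>z. vec4 (\<Lambda> (\<pi> z)) (16 * (l \<bullet> \<pi> z - B z $ 4)))"
      by (simp add: linear_iff linear_add[OF linear_pi] linear_add[OF L\<Lambda>] linear_scale[OF linear_pi] linear_scale[OF L\<Lambda>]
          linear_add[OF linear_B] linear_scale[OF linear_B] inner_add_right vec4_add[symmetric] vec4_scale[symmetric] algebra_simps)
    show "inj (\<lambda>z. vec4 (\<Lambda> (\<pi> z)) (16 * (l \<bullet> \<pi> z - B z $ 4)))"
    proof (rule injI)
      fix x y assume eq: "vec4 (\<Lambda> (\<pi> x)) (16 * (l \<bullet> \<pi> x - B x $ 4)) = vec4 (\<Lambda> (\<pi> y)) (16 * (l \<bullet> \<pi> y - B y $ 4))"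
      then have "\<Lambda> (\<pi> x) = \<Lambda> (\<pi> y)" by (metis proj3_vec4)
      then have 1: "\<pi> x = \<pi> y" by (metis P\<Lambda>)
      moreover have "16 * (l \<bullet> \<pi> x - B x $ 4) = 16 * (l \<bullet> \<pi> y - B y $ 4)" using eq by (metis vec4_nth_4)
      ultimately show "x = y" by (intro B_eqI) auto
    qed
  qed
  moreover have "\<exists>I N f E. open_positive_interval I \<and> improper_affine_graph N f \<and>
      (pointwise_SO2_symmetry M A \<phi> h K T a4 \<longrightarrow> on_elliptic_paraboloid N f) \<and>
      diffeo_onto_open M A (interval_times I N) E \<and> p \<in> E ` interval_times I N \<and>
      (\<forall>u\<in>interval_times I N. L (\<phi> (E u)) = model_minus (1 / 6) f u)" if p: "p \<in> topspace M" for p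
  proof -
    obtain D G F where ch: "adapted D G F" "convex D" "p \<in> G ` D" by (rule adapted_exists[OF p])
    interpret symmetric_chart M A \<phi> \<xi> nab h S B lc K T a4 D G F by (rule symmetric_chartI[OF ch(1)])
    interpret mt: minus_type F D \<theta> \<alpha> by (rule minus_typeI[OF ch(2) minus])
    obtain yp where yp: "yp \<in> D" "p = G yp" using ch(3) by blast
    have "R D G F elc" using elc[OF ch(1,2)] yp(1) by blast
    then have th: "\<And>y. y \<in> D \<Longrightarrow> \<theta> y = q y *\<^sub>R e" and Fq: "\<And>y. y \<in> D \<Longrightarrow> F y + q y ^ 4 / 16 = l \<bullet> y + c"
      by (simp_all add: R_def \<theta>_def q_qq e_l_c_def)
    have det: "4 * (det (matrix P))\<^sup>2 * \<bar>det (\<chi> i k. hess F y (axis i 1) (axis k 1))\<bar> = 1" if "y \<in> D" for y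
      using \<delta>(2)[OF ch(1) that] d2 by simp
    obtain I N f m m' where *: "open_positive_interval I" "improper_affine_graph N f"
      "(\<forall>y\<in>D. \<exists>e. e 0 = \<theta> y \<and> canonical_at F y e (\<alpha> y) 0) \<longrightarrow> on_elliptic_paraboloid N f"
      "open (interval_times I N)" "m ` interval_times I N \<subseteq> D" "open (m ` interval_times I N)"
      "smooth_on (interval_times I N) m" "smooth_on (m ` interval_times I N) m'" "yp \<in> m ` interval_times I N"
      "\<And>u. u \<in> interval_times I N \<Longrightarrow> m' (m u) = u"
      "\<And>u. u \<in> interval_times I N \<Longrightarrow> q (m u) = u $ 1 \<and> m u = P (vector [u $ 2, u $ 3, f (u $ 2) (u $ 3) + u $ 1 ^ 3 / 6])"
      by (rule mt.local_model[OF th P(1,2) P3 det yp(1)]) (assumption, assumption, rule that)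
    have "diffeo_onto_open M A (interval_times I N) (G \<circ> m)"
      by (rule diffeo_onto_open_comp[OF G *(4-8) *(10)])
    moreover have "L (\<phi> ((G \<circ> m) u)) = model_minus (1 / 6) f u" if u: "u \<in> interval_times I N" for u
    proof -
      have mu: "m u \<in> D" using *(5) u by blast
      have "\<Lambda> (m u) = vector [u $ 2, u $ 3, f (u $ 2) (u $ 3) + u $ 1 ^ 3 / 6]"
        using *(11)[OF u] \<Lambda>P by metis
      moreover have "16 * (l \<bullet> m u - F (m u)) + 16 * c = u $ 1 ^ 4"
        using Fq[OF mu] unfolding conjunct1[OF *(11)[OF u]] by simp
      moreover have "\<pi> (\<phi> (G (m u))) = m u" "B (\<phi> (G (m u))) $ 4 = F (m u)" by (simp_all add: phi_G[OF mu])
      ultimately have "L (\<phi> ((G \<circ> m) u)) = vec4 (vector [u $ 2, u $ 3, f (u $ 2) (u $ 3) + u $ 1 ^ 3 / 6]) (u $ 1 ^ 4)"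
        by (simp only: L_def o_apply vec4_add[symmetric] add_0_right)
      then show ?thesis by (simp add: vec4_vector model_minus_def Let_def)
    qed
    moreover have "p \<in> (G \<circ> m) ` interval_times I N" using *(9) yp(2) by auto
    ultimately show ?thesis
      using *(1,2,3) SO2_canonical_at by (intro exI[of _ I] exI[of _ N] exI[of _ f] exI[of _ "G \<circ> m"]) blast
  qed
  ultimately show ?thesis unfolding affine_equivalent_to_model_def by (intro exI[of _ L] exI[of _ "1 / 6"]) auto
qed

lemma plus_equivalent:
  assumes ne: "topspace M \<noteq> {}" and plus: "\<forall>p\<in>topspace M. a22 A \<phi> h lc T p = a4 p"
  shows "affine_equivalent_to_model model_plus
    (\<lambda>N f. pointwise_SO2_symmetry M A \<phi> h K T a4 \<longrightarrow> on_elliptic_paraboloid N f) M A \<phi>"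
proof -
  \<comment> \<open>The constants to be globalized are the center, the covector that gives
    \<open>q\<close> as a linear function about the center, and the additive constant in Euler's
    relation.\<close>
  define R where "R D G F c \<longleftrightarrow> (\<forall>y\<in>D. y - ((qq (G y))\<^sup>2 / 2) *\<^sub>R \<pi> (T (G y)) = fst c \<and>
      qq (G y) = fst (snd c) \<bullet> (y - fst c) \<and> \<partial> (y - fst c) F y - F y + qq (G y) ^ 4 / 16 = snd (snd c))"
    for D :: "(real ^ 3) set" and G :: "real ^ 3 \<Rightarrow> 'a" and F :: "real ^ 3 \<Rightarrow> real"
      and c :: "(real ^ 3) \<times> (real ^ 3) \<times> real"
  obtain C where C: "\<And>D G F. adapted D G F \<Longrightarrow> convex D \<Longrightarrow> D \<noteq> {} \<Longrightarrow> R D G F C"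
  proof (rule globalize[of R])
    fix D G F assume c: "adapted D G F" "convex D"
    interpret symmetric_chart M A \<phi> \<xi> nab h S B lc K T a4 D G F by (rule symmetric_chartI[OF c(1)])
    interpret pt: plus_type F D \<theta> \<alpha> by (rule plus_typeI[OF c(2) plus])
    obtain y0 where y0: "\<And>y. y \<in> D \<Longrightarrow> y - ((q y)\<^sup>2 / 2) *\<^sub>R \<theta> y = y0" by (rule pt.center) (rule that)
    obtain \<kappa> b where \<kappa>: "\<And>y. y \<in> D \<Longrightarrow> q y = \<kappa> \<bullet> y + b" by (rule pt.q_affine) (rule that)
    obtain k where k: "\<And>y. y \<in> D \<Longrightarrow> \<partial> (y - y0) F y - F y + (q y) ^ 4 / 16 = k"
      by (rule pt.euler_F[OF y0]) (assumption, rule that)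
    \<comment> \<open>The additive constant of the affine function \<open>q\<close> is absorbed by
      the center: \<open>y - y0\<close> is a multiple of \<open>\<theta> y\<close>, and
      \<open>dq\<close> evaluated on it returns \<open>q y\<close>.\<close>
    have "q y = \<kappa> \<bullet> (y - y0)" if y: "y \<in> D" for y
    proof -
      have "((\<lambda>y. \<kappa> \<bullet> y + b) has_derivative (\<lambda>x. \<kappa> \<bullet> x)) (at y)" by (auto intro!: derivative_eq_intros)
      then have "(q has_derivative (\<lambda>x. \<kappa> \<bullet> x)) (at y)"
        by (rule has_derivative_transform_within_open[OF _ open_D y]) (simp add: \<kappa>)
      from fun_cong[OF has_derivative_unique[OF this pt.dq[OF y]]]
      have "\<kappa> \<bullet> (y - y0) = - 2 / q y * hess F y (\<theta> y) (y - y0)" .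
      moreover have "y - y0 = ((q y)\<^sup>2 / 2) *\<^sub>R \<theta> y" using y0[OF y] by (simp add: algebra_simps)
      ultimately show ?thesis
        using q_pos[OF y] by (simp add: hess_scale[OF y] hess_theta_theta[OF y] power2_eq_square)
    qed
    then have "R D G F (y0, \<kappa>, k)" unfolding R_def using y0 k by (simp add: q_qq \<theta>_def)
    then show "\<exists>c. R D G F c" by blast
  next
    fix D G F D' G' F' U y c c'
    assume c: "adapted D G F" "adapted D' G' F'" "R D G F c" "R D' G' F' c'" "open U" "y \<in> U" "U \<subseteq> D" "U \<subseteq> D'"
      "\<And>z. z \<in> U \<Longrightarrow> G z = G' z" "\<And>z. z \<in> U \<Longrightarrow> F z = F' z"
    interpret symmetric_chart M A \<phi> \<xi> nab h S B lc K T a4 D G F by (rule symmetric_chartI[OF c(1)])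
    have r: "z - ((qq (G z))\<^sup>2 / 2) *\<^sub>R \<pi> (T (G z)) = fst c" "z - ((qq (G z))\<^sup>2 / 2) *\<^sub>R \<pi> (T (G z)) = fst c'"
      "qq (G z) = fst (snd c) \<bullet> (z - fst c)" "qq (G z) = fst (snd c') \<bullet> (z - fst c')"
      "\<partial> (z - fst c) F z - F z + qq (G z) ^ 4 / 16 = snd (snd c)"
      "\<partial> (z - fst c') F' z - F' z + qq (G z) ^ 4 / 16 = snd (snd c')" if z: "z \<in> U" for z
    proof -
      have "z \<in> D" "z \<in> D'" using z c(7,8) by auto
      from bspec[OF c(3)[unfolded R_def] this(1)] bspec[OF c(4)[unfolded R_def] this(2)]
      show "z - ((qq (G z))\<^sup>2 / 2) *\<^sub>R \<pi> (T (G z)) = fst c" "z - ((qq (G z))\<^sup>2 / 2) *\<^sub>R \<pi> (T (G z)) = fst c'"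
        "qq (G z) = fst (snd c) \<bullet> (z - fst c)" "qq (G z) = fst (snd c') \<bullet> (z - fst c')"
        "\<partial> (z - fst c) F z - F z + qq (G z) ^ 4 / 16 = snd (snd c)"
        "\<partial> (z - fst c') F' z - F' z + qq (G z) ^ 4 / 16 = snd (snd c')" unfolding c(9)[OF z] by blast+
    qed
    have y0: "fst c = fst c'" using r(1,2)[OF c(6)] by simp
    have "fst (snd c) \<bullet> z + - (fst (snd c) \<bullet> fst c) = fst (snd c') \<bullet> z + - (fst (snd c') \<bullet> fst c')" if "z \<in> U" for z
      using r(3,4)[OF that] by (simp add: inner_diff_right)
    note \<kappa> = linear_eq_on_open(1)[OF c(5,6) this]
    have yD: "y \<in> D" using c(6,7) by auto
    \<comment> \<open>The Euler constants involve first derivatives at one point; these agree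
      because the graph functions agree on a whole neighbourhood.\<close>
    have "\<partial> v F' y = \<partial> v F y" for v
      by (rule differentiable_cong_open(2)[OF c(5,6) c(10) smooth_on_differentiable[OF smooth_F yD]])
    then have "snd (snd c) = snd (snd c')" using r(5,6)[OF c(6)] y0 c(10)[OF c(6)] by simp
    then show "c = c'" using y0 \<kappa> by (simp add: prod_eq_iff)
  qed (rule that)
  define y0 \<kappa> k where "y0 = fst C" "\<kappa> = fst (snd C)" "k = snd (snd C)"
  obtain p0 where p0: "p0 \<in> topspace M" using ne by blast
  have \<kappa>: "\<kappa> \<noteq> 0"
  proof -
    obtain D G F where ch: "adapted D G F" "convex D" "p0 \<in> G ` D" by (rule adapted_exists[OF p0])
    interpret symmetric_chart M A \<phi> \<xi> nab h S B lc K T a4 D G F by (rule symmetric_chartI[OF ch(1)])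
    obtain y where y: "y \<in> D" using ch(3) by blast
    have "q y = \<kappa> \<bullet> (y - y0)" using C[OF ch(1,2)] y by (auto simp: R_def q_qq y0_\<kappa>_k_def)
    then show ?thesis using q_pos[OF y] by auto
  qed
  obtain \<delta> where \<delta>: "\<delta> > 0" "\<And>D G F y. adapted D G F \<Longrightarrow> y \<in> D \<Longrightarrow> \<bar>det (\<chi> i k. hess F y (axis i 1) (axis k 1))\<bar> = \<delta>"
    by (rule det_hess_constant) (rule that)
  \<comment> \<open>The unit vector is \<kappa> divided by its norm, and the factor is the inverse
    of that norm, so that \<kappa> itself is pulled back to the third coordinate.\<close>
  obtain P :: "real ^ 3 \<Rightarrow> real ^ 3" where P: "linear P" "bij P"
    "\<And>x. (inverse (norm \<kappa>) *\<^sub>R \<kappa>) \<bullet> P x = inverse (norm \<kappa>) * x $ 3"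
    and dP: "\<bar>det (matrix P)\<bar> = 1 / (2 * sqrt \<delta>)"
  proof (rule linear_map_with_third_column[of "inverse (norm \<kappa>) *\<^sub>R \<kappa>" "1 / (2 * sqrt \<delta>)" "inverse (norm \<kappa>)"])
    show "norm (inverse (norm \<kappa>) *\<^sub>R \<kappa>) = 1" "inverse (norm \<kappa>) > 0" "1 / (2 * sqrt \<delta>) > 0" using \<kappa> \<delta>(1) by simp_all
  qed (rule that)
  have P3: "\<kappa> \<bullet> P x = x $ 3" for x using P(3)[of x] \<kappa> by simp
  have d2: "4 * (det (matrix P))\<^sup>2 * \<delta> = 1"
    using normalizing_scale[OF \<delta>(1)] unfolding dP[symmetric] by simp
  define \<Lambda> where "\<Lambda> = inv P"
  have L\<Lambda>: "linear \<Lambda>" unfolding \<Lambda>_def by (metis P(1,2) bij_is_inj bij_is_surj inj_linear_imp_inv_linear)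
  have \<Lambda>P [simp]: "\<Lambda> (P x) = x" and P\<Lambda> [simp]: "P (\<Lambda> y) = y" for x y
    using P(2) by (auto simp: \<Lambda>_def bij_is_inj bij_is_surj surj_f_inv_f)
  \<comment> \<open>The model lists the height third and t last, so the third parameter and the
    height change places. The translation added below moves the center to the origin and adds the
    Euler constant to the height.\<close>
  define L0 where "L0 z = vec4 (vector [\<Lambda> (\<pi> z) $ 1, \<Lambda> (\<pi> z) $ 2, B z $ 4]) (\<Lambda> (\<pi> z) $ 3)" for z
  define L where "L z = L0 z + vec4 (vector [- (\<Lambda> y0 $ 1), - (\<Lambda> y0 $ 2), k]) (- (\<Lambda> y0 $ 3))" for z
  have "affine_transformation L" unfolding L_def[abs_def]
  proof (rule affine_transformationI)
    show "linear L0" unfolding L0_def[abs_def]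
      by (simp add: linear_iff linear_add[OF linear_pi] linear_add[OF L\<Lambda>] linear_scale[OF linear_pi] linear_scale[OF L\<Lambda>]
          linear_add[OF linear_B] linear_scale[OF linear_B] vector3_linear vec4_add vec4_scale)
    show "inj L0"
    proof (rule injI)
      fix x y assume "L0 x = L0 y"
      then have 1: "(vector [\<Lambda> (\<pi> x) $ 1, \<Lambda> (\<pi> x) $ 2, B x $ 4] :: real ^ 3) = vector [\<Lambda> (\<pi> y) $ 1, \<Lambda> (\<pi> y) $ 2, B y $ 4]"
        and 2: "\<Lambda> (\<pi> x) $ 3 = \<Lambda> (\<pi> y) $ 3" unfolding L0_def by (metis proj3_vec4, metis vec4_nth_4)
      have 3: "\<Lambda> (\<pi> x) $ 1 = \<Lambda> (\<pi> y) $ 1 \<and> \<Lambda> (\<pi> x) $ 2 = \<Lambda> (\<pi> y) $ 2 \<and> B x $ 4 = B y $ 4"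
        using 1 by (metis vector_3)
      then have "\<Lambda> (\<pi> x) = \<Lambda> (\<pi> y)" using 2 by (simp add: vec_eq_iff forall_3)
      then have "\<pi> x = \<pi> y" by (metis P\<Lambda>)
      then show "x = y" using 3 by (intro B_eqI) auto
    qed
  qed
  moreover have "\<exists>I N f E. open_positive_interval I \<and> improper_affine_graph N f \<and>
      (pointwise_SO2_symmetry M A \<phi> h K T a4 \<longrightarrow> on_elliptic_paraboloid N f) \<and>
      diffeo_onto_open M A (interval_times I N) E \<and> p \<in> E ` interval_times I N \<and>
      (\<forall>u\<in>interval_times I N. L (\<phi> (E u)) = model_plus (1 / 48) f u)" if p: "p \<in> topspace M" for p
  proof -
    obtain D G F where ch: "adapted D G F" "convex D" "p \<in> G ` D" by (rule adapted_exists[OF p])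
    interpret symmetric_chart M A \<phi> \<xi> nab h S B lc K T a4 D G F by (rule symmetric_chartI[OF ch(1)])
    interpret pt: plus_type F D \<theta> \<alpha> by (rule plus_typeI[OF ch(2) plus])
    obtain yp where yp: "yp \<in> D" "p = G yp" using ch(3) by blast
    have "R D G F C" using C[OF ch(1,2)] yp(1) by blast
    then have c: "\<And>y. y \<in> D \<Longrightarrow> y - ((q y)\<^sup>2 / 2) *\<^sub>R \<theta> y = y0" "\<And>y. y \<in> D \<Longrightarrow> \<partial> (y - y0) F y - F y + (q y) ^ 4 / 16 = k"
      "\<And>y. y \<in> D \<Longrightarrow> q y = \<kappa> \<bullet> (y - y0)"
      unfolding R_def y0_\<kappa>_k_def q_qq \<theta>_def by blast+
    have det: "4 * (det (matrix P))\<^sup>2 * \<bar>det (\<chi> i k. hess F y (axis i 1) (axis k 1))\<bar> = 1" if "y \<in> D" for y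
      using \<delta>(2)[OF ch(1) that] d2 by simp
    obtain I N f m m' where *: "open_positive_interval I" "improper_affine_graph N f"
      "(\<forall>y\<in>D. \<exists>e. e 0 = \<theta> y \<and> canonical_at F y e (\<alpha> y) 0) \<longrightarrow> on_elliptic_paraboloid N f"
      "open (interval_times I N)" "m ` interval_times I N \<subseteq> D" "open (m ` interval_times I N)"
      "smooth_on (interval_times I N) m" "smooth_on (m ` interval_times I N) m'" "yp \<in> m ` interval_times I N"
      "\<And>u. u \<in> interval_times I N \<Longrightarrow> m' (m u) = u"
      "\<And>u. u \<in> interval_times I N \<Longrightarrow> m u = y0 + P (vector [u $ 1 * u $ 2, u $ 1 * u $ 3, u $ 1]) \<and>
        F (m u) + k = u $ 1 * f (u $ 2) (u $ 3) - u $ 1 ^ 4 / 48"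
      by (rule pt.local_model[OF c P(1,2) P3 det yp(1)]) (assumption, assumption, assumption, assumption, rule that)
    have "diffeo_onto_open M A (interval_times I N) (G \<circ> m)"
      by (rule diffeo_onto_open_comp[OF G *(4-8) *(10)])
    moreover have "L (\<phi> ((G \<circ> m) u)) = model_plus (1 / 48) f u" if u: "u \<in> interval_times I N" for u
    proof -
      have mu: "m u \<in> D" using *(5) u by blast
      have "\<Lambda> (m u) = \<Lambda> y0 + vector [u $ 1 * u $ 2, u $ 1 * u $ 3, u $ 1]"
        using *(11)[OF u] \<Lambda>P linear_add[OF L\<Lambda>] by metis
      moreover have "\<pi> (\<phi> (G (m u))) = m u" "B (\<phi> (G (m u))) $ 4 = F (m u)" by (simp_all add: phi_G[OF mu])
      ultimately have "L (\<phi> ((G \<circ> m) u)) = vec4 (vector [u $ 1 * u $ 2, u $ 1 * u $ 3, F (m u) + k]) (u $ 1)"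
        by (simp only: L_def L0_def o_apply) (simp add: vec_eq_iff forall_4 vec4_def)
      then show ?thesis unfolding conjunct2[OF *(11)[OF u]]
        by (simp add: vec4_vector model_plus_def Let_def)
    qed
    moreover have "p \<in> (G \<circ> m) ` interval_times I N" using *(9) yp(2) by auto
    ultimately show ?thesis
      using *(1,2,3) SO2_canonical_at by (intro exI[of _ I] exI[of _ N] exI[of _ f] exI[of _ "G \<circ> m"]) blast
  qed
  ultimately show ?thesis unfolding affine_equivalent_to_model_def by (intro exI[of _ L] exI[of _ "1 / 48"]) auto
qed

end

theorem theorem7:
  fixes M :: "'a topology" and A :: "(3, 'a) chart set"
    and \<phi> \<xi> T :: "'a \<Rightarrow> real ^ 4"
    and nab lc :: "'a \<Rightarrow> real ^ 4 \<Rightarrow> ('a \<Rightarrow> real ^ 4) \<Rightarrow> real ^ 4"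
    and h :: "'a \<Rightarrow> real ^ 4 \<Rightarrow> real ^ 4 \<Rightarrow> real"
    and S :: "'a \<Rightarrow> real ^ 4 \<Rightarrow> real ^ 4"
    and K :: "'a \<Rightarrow> real ^ 4 \<Rightarrow> real ^ 4 \<Rightarrow> real ^ 4"
    and a4 :: "'a \<Rightarrow> real"
  assumes hypersurface: "blaschke_hypersurface M A \<phi> \<xi> nab h S"
    and indefinite: "indefinite M A \<phi> h" "one_negative_direction M A \<phi> h"
    and improper: "affine_sphere M A \<phi> S 0"
    and levi_civita: "levi_civita_connection M A \<phi> h lc"
    and difference: "difference_tensor M A \<phi> nab lc K"
    and symmetry: "pointwise_Z3_symmetry M A \<phi> h K T a4 \<or> pointwise_SO2_symmetry M A \<phi> h K T a4"
    and a22_a4: "\<forall>p\<in>topspace M. (a22 A \<phi> h lc T p)\<^sup>2 = (a4 p)\<^sup>2"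
  shows "(\<forall>p\<in>topspace M. a22 A \<phi> h lc T p = a4 p) \<and>
           affine_equivalent_to_model model_plus
             (\<lambda>N f. pointwise_SO2_symmetry M A \<phi> h K T a4 \<longrightarrow> on_elliptic_paraboloid N f) M A \<phi> \<or>
         (\<forall>p\<in>topspace M. - a22 A \<phi> h lc T p = a4 p) \<and>
           affine_equivalent_to_model model_minus
             (\<lambda>N f. pointwise_SO2_symmetry M A \<phi> h K T a4 \<longrightarrow> on_elliptic_paraboloid N f) M A \<phi>"
proof -
  have "oriented_manifold M A" using hypersurface by unfold_locales (simp add: blaschke_hypersurface_def)
  then interpret improper_sphere M A \<phi> \<xi> nab h S
    using hypersurface improper by (simp add: improper_sphere_def improper_sphere_axioms_def)
  obtain B :: "real ^ 4 \<Rightarrow> real ^ 4" where B: "linear B" "bij B" "\<And>p. p \<in> topspace M \<Longrightarrow> B (\<xi> p) = axis 4 1"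
    by (rule normalizing_map) (rule that)
  interpret graph_sphere M A \<phi> \<xi> nab h S B
    using B by (intro graph_sphere.intro improper_sphere_axioms graph_sphere_axioms.intro)
  interpret symmetric_sphere M A \<phi> \<xi> nab h S B lc K T a4
    by (intro symmetric_sphere.intro graph_sphere_axioms symmetric_sphere_axioms.intro levi_civita difference symmetry)
  show ?thesis
  proof (cases "topspace M = {}")
    case True
    \<comment> \<open>For empty \<open>M\<close> the conditions on points are vacuous, so the
      identity serves as the affine map.\<close>
    have "affine_transformation (\<lambda>x :: real ^ 4. x)"
      using affine_transformationI[of "\<lambda>x :: real ^ 4. x" 0] by (simp add: linear_iff)
    then show ?thesis using True unfolding affine_equivalent_to_model_def by (intro disjI1) (auto intro: exI[of _ 1])
  next
    case False
    then show ?thesis using dichotomy[OF a22_a4] plus_equivalent minus_equivalent by blast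
  qed
qed

end
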